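(* There exists a left determined model structure on the category $\mathbf{CTS}$ of cubical transition systems with respect to the class of cofibrations between cubical transition systems. The adjunction $\mathbf{CTS} \leftrightarrows \mathbf{WHDTS}$ (the left adjoint being the inclusion functor, the right adjoint being the coreflector, and $\mathbf{WHDTS}$ being equipped with its left determined model structure with respect to the class of cofibrations of weak HDTS) is a Quillen adjunction. All objects of $\mathbf{CTS}$ are cofibrant.
   Context: Fix a nonempty set $\Sigma$ (of labels). A weak higher dimensional transition system (weak HDTS) is a triple $(S,\mu:L\to\Sigma,T=\bigcup_{n\ge 1}T_n)$ where $S$ is a set (states), $L$ a set (actions), $\mu$ a set map (labelling map), $T_n\subset S\times L^n\times S$ (the $n$-transitions) such that: (Multiset axiom) if $(\alpha,u_1,\dots,u_n,\beta)\in T$, $n\ge 2$, then $(\alpha,u_{\sigma(1)},\dots,u_{\sigma(n)},\beta)\in T$ for every permutation $\sigma$ of $\{1,\dots,n\}$; (Coherence axiom) for $n\ge 3$, $p,q\ge 1$, $p+q<n$, if $(\alpha,u_1,\dots,u_n,\beta)$, $(\alpha,u_1,\dots,u_p,\nu_1)$, $(\nu_1,u_{p+1},\dots,u_n,\beta)$, $(\alpha,u_1,\dots,u_{p+q},\nu_2)$, $(\nu_2,u_{p+q+1},\dots,u_n,\beta)$ are all transitions, then $(\nu_1,u_{p+1},\dots,u_{p+q},\nu_2)$ is a transition. A map $f$ of weak HDTS consists of a map $f_0$ on states and a label-preserving map $\widetilde f$ on actions carrying transitions to transitions. The category is $\mathbf{WHDTS}$ (it is locally finitely presentable). For $n\ge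 0$ and $x_1,\dots,x_n\in\Sigma$, the $n$-cube $C_n[x_1,\dots,x_n]$ has states $\{0,1\}^n$, actions $\{(x_1,1),\dots,(x_n,n)\}$ with $\mu(x_i,i)=x_i$, and transitions all tuples $((\epsilon_1,\dots,\epsilon_n),(x_{i_1},i_1),\dots,(x_{i_d},i_d),(\epsilon'_1,\dots,\epsilon'_n))$ with $d\geq 1$, $i_1,\dots,i_d$ pairwise distinct, $\epsilon_i\le\epsilon'_i$ for all $i$, and $\epsilon_i\ne\epsilon'_i$ iff $i\in\{i_1,\dots,i_d\}$. A cube of $X$ is a map $C_n[x_1,\dots,x_n]\to X$; a subcube of $X$ is the image of a cube of $X$ (the smallest subobject of $X$ through which it factors). A weak HDTS is a cubical transition system if it equals the union (least upper bound in its poset of subobjects) of its subcubes. $\mathbf{CTS}\subset\mathbf{WHDTS}$ is the full subcategory of cubical transition systems; it is coreflective (the inclusion has a right adjoint, the coreflector) and locally presentable. A cofibration of weak HDTS is a map $f$ such that $\widetilde f$ is injective on actions (no condition on states). A cofibration of cubical transition systems is a map of $\mathbf{CTS}$ that is a cofibration of weak HDTS. For a class $\mathcal A$ of maps of a category $\mathcal K$, $\mathrm{inj}_{\mathcal K}(\mathcal A)$ is the class of maps with the right lifting property with respect to all maps of $\mathcal A$. An $\mathcal A$-localizer is a class $\mathcal W$ of maps satisfying two-out-of-three, with $\mathrm{inj}_{\mathcal K}(\mathcal A)\subset\mathcal W$, and such that $\mathcal A\cap\mathcal W$ is closed under pushout and transfinite composition. $\mathcal W_{\mathcal A}(\varnothing)$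 denotes the smallest $\mathcal A$-localizer. The left determined model structure with respect to $\mathcal A$ is the (at most one) model structure on $\mathcal K$ with class of cofibrations $\mathcal A$ and class of weak equivalences $\mathcal W_{\mathcal A}(\varnothing)$. *)

theory Defs
  imports
    "HOL-Library.Equipollence"
    "HOL-Library.FuncSet"
    "HOL-Combinatorics.Combinatorics"
begin

section \<open>Size\<close>

text \<open>
  Ordinary set theory is simulated inside a set \<open>U\<close> whose cardinal is uncountable and strongly
  inaccessible, i.e. inside a Grothendieck universe up to bijection: a set is small when it has
  strictly fewer elements than \<open>U\<close>.  Structured sets are carried by small subsets of \<open>U\<close>, which
  gives a category equivalent to that of all small structured sets, and classes of maps are
  arbitrary sets of arrows of such a category.
\<close>

definition inaccessible :: "'u set \<Rightarrow> bool" where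
  "inaccessible U \<longleftrightarrow>
     (UNIV :: nat set) \<prec> U \<and>
     (\<forall>A :: 'u set. A \<prec> U \<longrightarrow> Pow A \<prec> U) \<and>
     (\<forall>(A :: 'u set) (F :: 'u \<Rightarrow> 'u set).
        A \<prec> U \<and> (\<forall>a\<in>A. F a \<prec> U) \<longrightarrow> (\<Union>a\<in>A. F a) \<prec> U)"


section \<open>Categories, functors, limits and colimits\<close>

record ('o, 'm) category =
  Obj :: "'o set"
  Arr :: "'m set"
  Dom :: "'m \<Rightarrow> 'o"
  Cod :: "'m \<Rightarrow> 'o"
  Ident :: "'o \<Rightarrow> 'm"
  Comp :: "'m \<Rightarrow> 'm \<Rightarrow> 'm"   \<comment> \<open>\<open>Comp K g f\<close> is \<open>g\<close> after \<open>f\<close>\<close>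

definition Hom :: "('o, 'm) category \<Rightarrow> 'o \<Rightarrow> 'o \<Rightarrow> 'm set" where
  "Hom K X Y = {f \<in> Arr K. Dom K f = X \<and> Cod K f = Y}"

definition is_category :: "('o, 'm) category \<Rightarrow> bool" where
  "is_category K \<longleftrightarrow>
     (\<forall>f\<in>Arr K. Dom K f \<in> Obj K \<and> Cod K f \<in> Obj K) \<and>
     (\<forall>X\<in>Obj K. Ident K X \<in> Hom K X X) \<and>
     (\<forall>f\<in>Arr K. \<forall>g\<in>Arr K. Cod K f = Dom K g \<longrightarrow> Comp K g f \<in> Hom K (Dom K f) (Cod K g)) \<and>
     (\<forall>f\<in>Arr K. Comp K f (Ident K (Dom K f)) = f \<and> Comp K (Ident K (Cod K f)) f = f) \<and>
     (\<forall>f\<in>Arr K. \<forall>g\<in>Arr K. \<forall>h\<in>Arr K. Cod K f = Dom K g \<and> Cod K g = Dom K h \<longrightarrow>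
        Comp K h (Comp K g f) = Comp K (Comp K h g) f)"

definition full_subcategory :: "('o, 'm) category \<Rightarrow> ('o \<Rightarrow> bool) \<Rightarrow> ('o, 'm) category" where
  "full_subcategory K P =
     K\<lparr>Obj := {X \<in> Obj K. P X}, Arr := {f \<in> Arr K. P (Dom K f) \<and> P (Cod K f)}\<rparr>"

record ('o, 'm, 'p, 'n) cat_functor =
  fobj :: "'o \<Rightarrow> 'p"
  fmap :: "'m \<Rightarrow> 'n"

definition is_functor ::
    "('o, 'm) category \<Rightarrow> ('p, 'n) category \<Rightarrow> ('o, 'm, 'p, 'n) cat_functor \<Rightarrow> bool" where
  "is_functor J K D \<longleftrightarrow>
     (\<forall>X\<in>Obj J. fobj D X \<in> Obj K \<and> fmap D (Ident J X) = Ident K (fobj D X)) \<and>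
     (\<forall>f\<in>Arr J. fmap D f \<in> Hom K (fobj D (Dom J f)) (fobj D (Cod J f))) \<and>
     (\<forall>f\<in>Arr J. \<forall>g\<in>Arr J. Cod J f = Dom J g \<longrightarrow>
        fmap D (Comp J g f) = Comp K (fmap D g) (fmap D f))"

definition inclusion_functor :: "('o, 'm, 'o, 'm) cat_functor" where
  "inclusion_functor = \<lparr>fobj = (\<lambda>X. X), fmap = (\<lambda>f. f)\<rparr>"

definition is_cone ::
    "('i, 'a) category \<Rightarrow> ('o, 'm) category \<Rightarrow> ('i, 'a, 'o, 'm) cat_functor \<Rightarrow> 'o \<Rightarrow> ('i \<Rightarrow> 'm) \<Rightarrow> bool"
  where
  "is_cone J K D L \<pi> \<longleftrightarrow>
     L \<in> Obj K \<and> (\<forall>j\<in>Obj J. \<pi> j \<in> Hom K L (fobj D j)) \<and>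
     (\<forall>a\<in>Arr J. Comp K (fmap D a) (\<pi> (Dom J a)) = \<pi> (Cod J a))"

definition is_limit ::
    "('i, 'a) category \<Rightarrow> ('o, 'm) category \<Rightarrow> ('i, 'a, 'o, 'm) cat_functor \<Rightarrow> 'o \<Rightarrow> ('i \<Rightarrow> 'm) \<Rightarrow> bool"
  where
  "is_limit J K D L \<pi> \<longleftrightarrow>
     is_cone J K D L \<pi> \<and>
     (\<forall>M \<kappa>. is_cone J K D M \<kappa> \<longrightarrow>
        (\<exists>!h. h \<in> Hom K M L \<and> (\<forall>j\<in>Obj J. Comp K (\<pi> j) h = \<kappa> j)))"

definition is_cocone ::
    "('i, 'a) category \<Rightarrow> ('o, 'm) category \<Rightarrow> ('i, 'a, 'o, 'm) cat_functor \<Rightarrow> 'o \<Rightarrow> ('i \<Rightarrow> 'm) \<Rightarrow> bool"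
  where
  "is_cocone J K D L \<iota> \<longleftrightarrow>
     L \<in> Obj K \<and> (\<forall>j\<in>Obj J. \<iota> j \<in> Hom K (fobj D j) L) \<and>
     (\<forall>a\<in>Arr J. Comp K (\<iota> (Cod J a)) (fmap D a) = \<iota> (Dom J a))"

definition is_colimit ::
    "('i, 'a) category \<Rightarrow> ('o, 'm) category \<Rightarrow> ('i, 'a, 'o, 'm) cat_functor \<Rightarrow> 'o \<Rightarrow> ('i \<Rightarrow> 'm) \<Rightarrow> bool"
  where
  "is_colimit J K D L \<iota> \<longleftrightarrow>
     is_cocone J K D L \<iota> \<and>
     (\<forall>M \<kappa>. is_cocone J K D M \<kappa> \<longrightarrow>
        (\<exists>!h. h \<in> Hom K L M \<and> (\<forall>j\<in>Obj J. Comp K h (\<iota> j) = \<kappa> j)))"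

definition is_small_category :: "'u set \<Rightarrow> ('i, 'a) category \<Rightarrow> bool" where
  "is_small_category U J \<longleftrightarrow> is_category J \<and> Obj J \<prec> U \<and> Arr J \<prec> U"

text \<open>Every small category is isomorphic to one whose objects and arrows have type \<open>'u\<close>.\<close>

definition has_small_limits :: "'u set \<Rightarrow> ('o, 'm) category \<Rightarrow> bool" where
  "has_small_limits U K \<longleftrightarrow>
     (\<forall>(J :: ('u, 'u) category) D. is_small_category U J \<and> is_functor J K D \<longrightarrow>
        (\<exists>L \<pi>. is_limit J K D L \<pi>))"

definition has_small_colimits :: "'u set \<Rightarrow> ('o, 'm) category \<Rightarrow> bool" where
  "has_small_colimits U K \<longleftrightarrow>
     (\<forall>(J :: ('u, 'u) category) D. is_small_category U J \<and> is_functor J K D \<longrightarrow>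
        (\<exists>L \<iota>. is_colimit J K D L \<iota>))"

definition is_initial :: "('o, 'm) category \<Rightarrow> 'o \<Rightarrow> bool" where
  "is_initial K I \<longleftrightarrow> I \<in> Obj K \<and> (\<forall>X\<in>Obj K. \<exists>!f. f \<in> Hom K I X)"

text \<open>\<open>f'\<close> is a pushout of \<open>f\<close> along \<open>g\<close>, with \<open>g'\<close> the other leg.\<close>

definition is_pushout :: "('o, 'm) category \<Rightarrow> 'm \<Rightarrow> 'm \<Rightarrow> 'm \<Rightarrow> 'm \<Rightarrow> bool" where
  "is_pushout K f g f' g' \<longleftrightarrow>
     f \<in> Arr K \<and> g \<in> Arr K \<and> f' \<in> Arr K \<and> g' \<in> Arr K \<and>
     Dom K f = Dom K g \<and> Dom K f' = Cod K g \<and> Dom K g' = Cod K f \<and> Cod K f' = Cod K g' \<and>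
     Comp K f' g = Comp K g' f \<and>
     (\<forall>a\<in>Arr K. \<forall>b\<in>Arr K.
        Dom K a = Cod K g \<and> Dom K b = Cod K f \<and> Cod K a = Cod K b \<and> Comp K a g = Comp K b f \<longrightarrow>
        (\<exists>!h. h \<in> Hom K (Cod K f') (Cod K a) \<and> Comp K h f' = a \<and> Comp K h g' = b))"


section \<open>Subobjects\<close>

definition monic :: "('o, 'm) category \<Rightarrow> 'm \<Rightarrow> bool" where
  "monic K m \<longleftrightarrow>
     m \<in> Arr K \<and>
     (\<forall>f\<in>Arr K. \<forall>g\<in>Arr K.
        Dom K f = Dom K g \<and> Cod K f = Dom K m \<and> Cod K g = Dom K m \<and> Comp K m f = Comp K m g \<longrightarrow>
        f = g)"

definition factors_through :: "('o, 'm) category \<Rightarrow> 'm \<Rightarrow> 'm \<Rightarrow> bool" where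
  "factors_through K f m \<longleftrightarrow> (\<exists>h\<in>Hom K (Dom K f) (Dom K m). f = Comp K m h)"

text \<open>
  Subobjects of \<open>X\<close> are represented by monomorphisms into \<open>X\<close>, preordered by \<open>factors_through\<close>;
  images and unions are therefore determined up to isomorphism of representatives.
\<close>

definition subobjects :: "('o, 'm) category \<Rightarrow> 'o \<Rightarrow> 'm set" where
  "subobjects K X = {m. monic K m \<and> Cod K m = X}"

definition is_image :: "('o, 'm) category \<Rightarrow> 'm \<Rightarrow> 'm \<Rightarrow> bool" where
  "is_image K f m \<longleftrightarrow>
     m \<in> subobjects K (Cod K f) \<and> factors_through K f m \<and>
     (\<forall>m'\<in>subobjects K (Cod K f). factors_through K f m' \<longrightarrow> factors_through K m m')"

definition is_union :: "('o, 'm) category \<Rightarrow> 'o \<Rightarrow> 'm set \<Rightarrow> 'm \<Rightarrow> bool" where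
  "is_union K X M u \<longleftrightarrow>
     u \<in> subobjects K X \<and> (\<forall>m\<in>M. factors_through K m u) \<and>
     (\<forall>u'\<in>subobjects K X. (\<forall>m\<in>M. factors_through K m u') \<longrightarrow> factors_through K u u')"


section \<open>Transfinite composition\<close>

definition order_category :: "'i rel \<Rightarrow> ('i, 'i \<times> 'i) category" where
  "order_category r =
     \<lparr>Obj = Field r, Arr = r, Dom = fst, Cod = snd, Ident = (\<lambda>i. (i, i)),
      Comp = (\<lambda>g f. (fst f, snd g))\<rparr>"

definition is_succ :: "'i rel \<Rightarrow> 'i \<Rightarrow> 'i \<Rightarrow> bool" where
  "is_succ r i j \<longleftrightarrow> i \<in> underS r j \<and> (\<forall>k\<in>underS r j. (k, i) \<in> r)"

definition is_least :: "'i rel \<Rightarrow> 'i \<Rightarrow> bool" where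
  "is_least r i \<longleftrightarrow> i \<in> Field r \<and> underS r i = {}"

definition is_limit_element :: "'i rel \<Rightarrow> 'i \<Rightarrow> bool" where
  "is_limit_element r i \<longleftrightarrow> i \<in> Field r \<and> \<not> is_least r i \<and> (\<nexists>j. is_succ r j i)"

text \<open>
  A nonempty small ordinal is represented by a well-order \<open>r\<close>; the diagram \<open>D\<close> on it has to be
  continuous at limit elements, and the composition is the colimit injection at the least element.
\<close>

definition is_transfinite_composition :: "'u set \<Rightarrow> ('o, 'm) category \<Rightarrow> 'm set \<Rightarrow> 'm \<Rightarrow> bool" where
  "is_transfinite_composition U K A f \<longleftrightarrow>
     (\<exists>(r :: 'u rel) D L \<iota> i0.
        Well_order r \<and> Field r \<prec> U \<and> is_least r i0 \<and>
        is_functor (order_category r) K D \<and>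
        (\<forall>i j. is_succ r i j \<longrightarrow> fmap D (i, j) \<in> A) \<and>
        (\<forall>i. is_limit_element r i \<longrightarrow>
           is_colimit (order_category (Restr r (underS r i))) K D (fobj D i) (\<lambda>j. fmap D (j, i))) \<and>
        is_colimit (order_category r) K D L \<iota> \<and>
        f = \<iota> i0)"


section \<open>Model structures and localizers\<close>

definition has_lifting :: "('o, 'm) category \<Rightarrow> 'm \<Rightarrow> 'm \<Rightarrow> bool" where
  "has_lifting K i p \<longleftrightarrow>
     (\<forall>u\<in>Hom K (Dom K i) (Dom K p). \<forall>v\<in>Hom K (Cod K i) (Cod K p).
        Comp K p u = Comp K v i \<longrightarrow>
        (\<exists>h\<in>Hom K (Cod K i) (Dom K p). Comp K h i = u \<and> Comp K p h = v))"

definition inj_class :: "('o, 'm) category \<Rightarrow> 'm set \<Rightarrow> 'm set" where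
  "inj_class K A = {p \<in> Arr K. \<forall>i\<in>A. has_lifting K i p}"

definition two_out_of_three :: "('o, 'm) category \<Rightarrow> 'm set \<Rightarrow> bool" where
  "two_out_of_three K W \<longleftrightarrow>
     (\<forall>f\<in>Arr K. \<forall>g\<in>Arr K. Cod K f = Dom K g \<longrightarrow>
        (f \<in> W \<and> g \<in> W \<longrightarrow> Comp K g f \<in> W) \<and>
        (f \<in> W \<and> Comp K g f \<in> W \<longrightarrow> g \<in> W) \<and>
        (g \<in> W \<and> Comp K g f \<in> W \<longrightarrow> f \<in> W))"

definition is_retract :: "('o, 'm) category \<Rightarrow> 'm \<Rightarrow> 'm \<Rightarrow> bool" where
  "is_retract K f g \<longleftrightarrow>
     f \<in> Arr K \<and> g \<in> Arr K \<and>
     (\<exists>s\<in>Hom K (Dom K f) (Dom K g). \<exists>r\<in>Hom K (Dom K g) (Dom K f).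
      \<exists>s'\<in>Hom K (Cod K f) (Cod K g). \<exists>r'\<in>Hom K (Cod K g) (Cod K f).
        Comp K r s = Ident K (Dom K f) \<and> Comp K r' s' = Ident K (Cod K f) \<and>
        Comp K g s = Comp K s' f \<and> Comp K f r = Comp K r' g)"

definition closed_under_retracts :: "('o, 'm) category \<Rightarrow> 'm set \<Rightarrow> bool" where
  "closed_under_retracts K A \<longleftrightarrow> (\<forall>f g. g \<in> A \<and> is_retract K f g \<longrightarrow> f \<in> A)"

definition closed_under_pushout :: "('o, 'm) category \<Rightarrow> 'm set \<Rightarrow> bool" where
  "closed_under_pushout K A \<longleftrightarrow> (\<forall>f g f' g'. f \<in> A \<and> is_pushout K f g f' g' \<longrightarrow> f' \<in> A)"

definition closed_under_transfinite_composition ::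
    "'u set \<Rightarrow> ('o, 'm) category \<Rightarrow> 'm set \<Rightarrow> bool" where
  "closed_under_transfinite_composition U K A \<longleftrightarrow>
     (\<forall>f. is_transfinite_composition U K A f \<longrightarrow> f \<in> A)"

definition has_factorizations :: "('o, 'm) category \<Rightarrow> 'm set \<Rightarrow> 'm set \<Rightarrow> bool" where
  "has_factorizations K A B \<longleftrightarrow>
     (\<forall>f\<in>Arr K. \<exists>i\<in>A. \<exists>p\<in>B.
        Dom K i = Dom K f \<and> Cod K i = Dom K p \<and> Cod K p = Cod K f \<and> f = Comp K p i)"

definition model_structure ::
    "'u set \<Rightarrow> ('o, 'm) category \<Rightarrow> 'm set \<Rightarrow> 'm set \<Rightarrow> 'm set \<Rightarrow> bool" where
  "model_structure U K Cof We Fib \<longleftrightarrow>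
     is_category K \<and> has_small_limits U K \<and> has_small_colimits U K \<and>
     Cof \<subseteq> Arr K \<and> We \<subseteq> Arr K \<and> Fib \<subseteq> Arr K \<and>
     two_out_of_three K We \<and>
     closed_under_retracts K Cof \<and> closed_under_retracts K We \<and> closed_under_retracts K Fib \<and>
     (\<forall>i\<in>Cof \<inter> We. \<forall>p\<in>Fib. has_lifting K i p) \<and>
     (\<forall>i\<in>Cof. \<forall>p\<in>Fib \<inter> We. has_lifting K i p) \<and>
     has_factorizations K (Cof \<inter> We) Fib \<and>
     has_factorizations K Cof (Fib \<inter> We)"

definition localizer :: "'u set \<Rightarrow> ('o, 'm) category \<Rightarrow> 'm set \<Rightarrow> 'm set \<Rightarrow> bool" where
  "localizer U K A W \<longleftrightarrow>
     W \<subseteq> Arr K \<and> two_out_of_three K W \<and> inj_class K A \<subseteq> W \<and>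
     closed_under_pushout K (A \<inter> W) \<and>
     closed_under_transfinite_composition U K (A \<inter> W)"

definition smallest_localizer :: "'u set \<Rightarrow> ('o, 'm) category \<Rightarrow> 'm set \<Rightarrow> 'm set \<Rightarrow> bool" where
  "smallest_localizer U K A W \<longleftrightarrow>
     localizer U K A W \<and> (\<forall>W'. localizer U K A W' \<longrightarrow> W \<subseteq> W')"

definition left_determined_model_structure ::
    "'u set \<Rightarrow> ('o, 'm) category \<Rightarrow> 'm set \<Rightarrow> 'm set \<Rightarrow> 'm set \<Rightarrow> bool" where
  "left_determined_model_structure U K A We Fib \<longleftrightarrow>
     model_structure U K A We Fib \<and> smallest_localizer U K A We"

definition cofibrant :: "('o, 'm) category \<Rightarrow> 'm set \<Rightarrow> 'o \<Rightarrow> bool" where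
  "cofibrant K Cof X \<longleftrightarrow> (\<exists>I f. is_initial K I \<and> f \<in> Hom K I X \<and> f \<in> Cof)"

text \<open>\<open>\<phi> X Y : Hom(F X, Y) \<rightarrow> Hom(X, R Y)\<close> is the natural bijection of an adjunction with left
  adjoint \<open>F : K \<rightarrow> M\<close>.\<close>

definition is_adjunction ::
    "('o, 'm) category \<Rightarrow> ('p, 'n) category \<Rightarrow> ('o, 'm, 'p, 'n) cat_functor \<Rightarrow>
     ('p, 'n, 'o, 'm) cat_functor \<Rightarrow> ('o \<Rightarrow> 'p \<Rightarrow> 'n \<Rightarrow> 'm) \<Rightarrow> bool" where
  "is_adjunction K M F R \<phi> \<longleftrightarrow>
     is_functor K M F \<and> is_functor M K R \<and>
     (\<forall>X\<in>Obj K. \<forall>Y\<in>Obj M. bij_betw (\<phi> X Y) (Hom M (fobj F X) Y) (Hom K X (fobj R Y))) \<and>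
     (\<forall>h\<in>Arr K. \<forall>k\<in>Arr M. \<forall>f\<in>Hom M (fobj F (Cod K h)) (Dom M k).
        \<phi> (Dom K h) (Cod M k) (Comp M k (Comp M f (fmap F h))) =
        Comp K (fmap R k) (Comp K (\<phi> (Cod K h) (Dom M k) f) h))"

definition quillen_adjunction ::
    "('o, 'm) category \<Rightarrow> 'm set \<Rightarrow> 'm set \<Rightarrow> ('p, 'n) category \<Rightarrow> 'n set \<Rightarrow> 'n set \<Rightarrow>
     ('o, 'm, 'p, 'n) cat_functor \<Rightarrow> ('p, 'n, 'o, 'm) cat_functor \<Rightarrow>
     ('o \<Rightarrow> 'p \<Rightarrow> 'n \<Rightarrow> 'm) \<Rightarrow> bool" where
  "quillen_adjunction K CofK WeK M CofM WeM F R \<phi> \<longleftrightarrow>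
     is_adjunction K M F R \<phi> \<and>
     (\<forall>f\<in>CofK. fmap F f \<in> CofM) \<and>
     (\<forall>f\<in>CofK \<inter> WeK. fmap F f \<in> CofM \<inter> WeM)"


section \<open>Weak higher dimensional transition systems\<close>

record ('s, 'a, 'l) hdts =
  states :: "'s set"
  actions :: "'a set"
  label :: "'a \<Rightarrow> 'l"
  transitions :: "('s \<times> 'a list \<times> 's) set"

text \<open>
  An \<open>n\<close>-transition is a triple whose action list has length \<open>n\<close>.  In the coherence axiom the list
  \<open>u_1,\<dots>,u_n\<close> is split into \<open>us @ vs @ ws\<close> with \<open>us\<close> and \<open>vs\<close> of length \<open>p\<close> and \<open>q\<close>.
\<close>

definition weak_hdts :: "'l set \<Rightarrow> ('s, 'a, 'l) hdts \<Rightarrow> bool" where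
  "weak_hdts \<Sigma> X \<longleftrightarrow>
     label X \<in> actions X \<rightarrow>\<^sub>E \<Sigma> \<and>
     (\<forall>(\<alpha>, us, \<beta>)\<in>transitions X.
        \<alpha> \<in> states X \<and> \<beta> \<in> states X \<and> us \<noteq> [] \<and> set us \<subseteq> actions X) \<and>
     (\<forall>\<alpha> us \<beta> \<sigma>. (\<alpha>, us, \<beta>) \<in> transitions X \<and> 2 \<le> length us \<and> \<sigma> permutes {..<length us} \<longrightarrow>
        (\<alpha>, permute_list \<sigma> us, \<beta>) \<in> transitions X) \<and>
     (\<forall>\<alpha> us vs ws \<beta> \<nu>1 \<nu>2. us \<noteq> [] \<and> vs \<noteq> [] \<and> ws \<noteq> [] \<and>
        (\<alpha>, us @ vs @ ws, \<beta>) \<in> transitions X \<and>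
        (\<alpha>, us, \<nu>1) \<in> transitions X \<and> (\<nu>1, vs @ ws, \<beta>) \<in> transitions X \<and>
        (\<alpha>, us @ vs, \<nu>2) \<in> transitions X \<and> (\<nu>2, ws, \<beta>) \<in> transitions X \<longrightarrow>
        (\<nu>1, vs, \<nu>2) \<in> transitions X)"

text \<open>Maps are extensional, so that two maps are equal iff they agree on states and actions.\<close>

definition hdts_map ::
    "('s, 'a, 'l) hdts \<Rightarrow> ('t, 'b, 'l) hdts \<Rightarrow> ('s \<Rightarrow> 't) \<Rightarrow> ('a \<Rightarrow> 'b) \<Rightarrow> bool" where
  "hdts_map X Y f0 f1 \<longleftrightarrow>
     f0 \<in> states X \<rightarrow>\<^sub>E states Y \<and> f1 \<in> actions X \<rightarrow>\<^sub>E actions Y \<and>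
     (\<forall>u\<in>actions X. label Y (f1 u) = label X u) \<and>
     (\<forall>(\<alpha>, us, \<beta>)\<in>transitions X. (f0 \<alpha>, map f1 us, f0 \<beta>) \<in> transitions Y)"

definition hdts_isomorphic :: "('s, 'a, 'l) hdts \<Rightarrow> ('t, 'b, 'l) hdts \<Rightarrow> bool" where
  "hdts_isomorphic X Y \<longleftrightarrow>
     (\<exists>f0 f1 g0 g1. hdts_map X Y f0 f1 \<and> hdts_map Y X g0 g1 \<and>
        (\<forall>\<alpha>\<in>states X. g0 (f0 \<alpha>) = \<alpha>) \<and> (\<forall>u\<in>actions X. g1 (f1 u) = u) \<and>
        (\<forall>\<beta>\<in>states Y. f0 (g0 \<beta>) = \<beta>) \<and> (\<forall>v\<in>actions Y. f1 (g1 v) = v))"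

record ('s, 'a, 'l) hdts_arrow =
  source :: "('s, 'a, 'l) hdts"
  target :: "('s, 'a, 'l) hdts"
  on_states :: "'s \<Rightarrow> 's"
  on_actions :: "'a \<Rightarrow> 'a"

definition WHDTS ::
    "'u set \<Rightarrow> 'l set \<Rightarrow> (('u, 'u, 'l) hdts, ('u, 'u, 'l) hdts_arrow) category" where
  "WHDTS U \<Sigma> =
     (let objs = {X. weak_hdts \<Sigma> X \<and> states X \<subseteq> U \<and> states X \<prec> U \<and> actions X \<subseteq> U \<and> actions X \<prec> U}
      in \<lparr>Obj = objs,
          Arr = {f. source f \<in> objs \<and> target f \<in> objs \<and>
                    hdts_map (source f) (target f) (on_states f) (on_actions f)},
          Dom = source,
          Cod = target,
          Ident = (\<lambda>X. \<lparr>source = X, target = X,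
                        on_states = (\<lambda>\<alpha>\<in>states X. \<alpha>), on_actions = (\<lambda>u\<in>actions X. u)\<rparr>),
          Comp = (\<lambda>g f. \<lparr>source = source f, target = target g,
                         on_states = compose (states (source f)) (on_states g) (on_states f),
                         on_actions = compose (actions (source f)) (on_actions g) (on_actions f)\<rparr>)\<rparr>)"

definition WHDTS_cof :: "'u set \<Rightarrow> 'l set \<Rightarrow> ('u, 'u, 'l) hdts_arrow set" where
  "WHDTS_cof U \<Sigma> = {f \<in> Arr (WHDTS U \<Sigma>). inj_on (on_actions f) (actions (source f))}"


section \<open>Cubical transition systems\<close>

text \<open>
  In the cube on labels \<open>xs = [x_1,\<dots>,x_n]\<close>, indices run from \<open>0\<close> to \<open>n - 1\<close> and \<open>False < True\<close>
  play the roles of \<open>0 < 1\<close>.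
\<close>

definition cube :: "'l list \<Rightarrow> (bool list, 'l \<times> nat, 'l) hdts" where
  "cube xs =
     (let n = length xs; acts = {(xs ! i, i) | i. i < n}
      in \<lparr>states = {\<epsilon>. length \<epsilon> = n},
          actions = acts,
          label = (\<lambda>u\<in>acts. fst u),
          transitions = {(\<epsilon>, us, \<epsilon>').
            length \<epsilon> = n \<and> length \<epsilon>' = n \<and> us \<noteq> [] \<and> set us \<subseteq> acts \<and> distinct us \<and>
            (\<forall>i<n. \<epsilon> ! i \<le> \<epsilon>' ! i) \<and>
            (\<forall>i<n. \<epsilon> ! i \<noteq> \<epsilon>' ! i \<longleftrightarrow> (xs ! i, i) \<in> set us)}\<rparr>)"

text \<open>
  Cubes live on their own types; as objects of \<open>WHDTS U \<Sigma>\<close> they are the isomorphic copies of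
  \<open>cube xs\<close> carried by subsets of \<open>U\<close>.
\<close>

definition cubes_of :: "'u set \<Rightarrow> 'l set \<Rightarrow> ('u, 'u, 'l) hdts \<Rightarrow> ('u, 'u, 'l) hdts_arrow set" where
  "cubes_of U \<Sigma> X =
     {f \<in> Arr (WHDTS U \<Sigma>). target f = X \<and> (\<exists>xs\<in>lists \<Sigma>. hdts_isomorphic (cube xs) (source f))}"

definition subcubes :: "'u set \<Rightarrow> 'l set \<Rightarrow> ('u, 'u, 'l) hdts \<Rightarrow> ('u, 'u, 'l) hdts_arrow set" where
  "subcubes U \<Sigma> X = {m. \<exists>f\<in>cubes_of U \<Sigma> X. is_image (WHDTS U \<Sigma>) f m}"

definition cubical :: "'u set \<Rightarrow> 'l set \<Rightarrow> ('u, 'u, 'l) hdts \<Rightarrow> bool" where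
  "cubical U \<Sigma> X \<longleftrightarrow>
     is_union (WHDTS U \<Sigma>) X (subcubes U \<Sigma> X) (Ident (WHDTS U \<Sigma>) X)"

definition CTS ::
    "'u set \<Rightarrow> 'l set \<Rightarrow> (('u, 'u, 'l) hdts, ('u, 'u, 'l) hdts_arrow) category" where
  "CTS U \<Sigma> = full_subcategory (WHDTS U \<Sigma>) (cubical U \<Sigma>)"

definition CTS_cof :: "'u set \<Rightarrow> 'l set \<Rightarrow> ('u, 'u, 'l) hdts_arrow set" where
  "CTS_cof U \<Sigma> = Arr (CTS U \<Sigma>) \<inter> WHDTS_cof U \<Sigma>"

end

theory Submission
  imports Defs
begin

text \<open>
  Call two actions with the same label related if, in the cubical case, they moreover have a
  1-transition between the same two states, and call a system local if related actions are equal.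
  Take as weak equivalences the maps orthogonal to all local systems: the stability properties of a
  localizer are then formal.  Maps with the right lifting property against cofibrations are
  retracts of maps that are bijective on states, surjective on actions and reflect transitions, and
  these are orthogonal to local systems because two actions with the same image are related.

  Every system has a local reflection: saturate its transitions under interchange of related actions,
  then choose one action from each class.  The saturation is an \<open>\<omega>\<close>-composite of pushouts of maps
  built from sections of trivial maps, so the reflection map lies in every localizer; hence the
      weak equivalences form the
  smallest one.  A map \<open>f : X \<rightarrow> Y\<close> factors as a trivial cofibration followed by a fibration through the
  system with the states of \<open>X\<close> and transitions those visible both in \<open>Y\<close> and in the reflection of \<open>X\<close>,
  so no small object argument is needed.

  A weak HDTS is cubical iff all actions are used and every transition can be split in every way, which
  makes the coreflector explicit.  The coreflection of a local weak system is local, whence the inclusion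
  preserves weak equivalences.
\<close>

section \<open>Transition sets\<close>

text \<open>Weak and cubical systems are treated together, with \<open>b\<close> choosing between
  them. This works because \<open>splitting\<close> survives images, unions and closure under the
  axioms, so generated systems stay cubical. The notion of relatedness has to meet two demands.
  Actions identified by a trivial map must be related: in the cubical case each action lies on a
  1-transition, and trivial maps reflect it. Conversely, related actions must become identified by
  maps lying in every localizer. At the outset the maps available there are the trivial maps and
  hence their sections, which adjoin clones of existing actions. Merging \<open>u\<close> with a
  parallel \<open>v\<close> therefore passes through a clone of \<open>u\<close>, first seen only on
  the transitions shared with \<open>v\<close>, where it may be sent to \<open>v\<close>. In the
  cubical case relatedness is not transitive in general; saturation makes it so. Reflections leave
  states alone. A map into a local system is thus controlled by its values on states, on labels and
  on 1-transitions, which is what allows the second factorization to be written down with explicit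
  lifts.\<close>

definition mset_closed :: "('s \<times> 'a list \<times> 's) set \<Rightarrow> bool" where
  "mset_closed T \<longleftrightarrow> (\<forall>\<alpha> us vs \<beta>. (\<alpha>, us, \<beta>) \<in> T \<and> mset us = mset vs \<longrightarrow> (\<alpha>, vs, \<beta>) \<in> T)"

definition coherent :: "('s \<times> 'a list \<times> 's) set \<Rightarrow> bool" where
  "coherent T \<longleftrightarrow>
     (\<forall>\<alpha> us vs ws \<beta> \<nu>1 \<nu>2. us \<noteq> [] \<and> vs \<noteq> [] \<and> ws \<noteq> [] \<and>
        (\<alpha>, us @ vs @ ws, \<beta>) \<in> T \<and> (\<alpha>, us, \<nu>1) \<in> T \<and> (\<nu>1, vs @ ws, \<beta>) \<in> T \<and>
        (\<alpha>, us @ vs, \<nu>2) \<in> T \<and> (\<nu>2, ws, \<beta>) \<in> T \<longrightarrow> (\<nu>1, vs, \<nu>2) \<in> T)"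

text \<open>The intermediate state axiom for two factors, with no compatibility between different
  divisions. Together with the two axioms of weak systems it already yields whole cubes, see
  \<open>cube_of_transition\<close>.\<close>

definition splitting :: "('s \<times> 'a list \<times> 's) set \<Rightarrow> bool" where
  "splitting T \<longleftrightarrow>
     (\<forall>\<alpha> us vs ws \<beta>. (\<alpha>, us, \<beta>) \<in> T \<and> mset us = mset vs + mset ws \<and> vs \<noteq> [] \<and> ws \<noteq> [] \<longrightarrow>
        (\<exists>\<nu>. (\<alpha>, vs, \<nu>) \<in> T \<and> (\<nu>, ws, \<beta>) \<in> T))"

definition well_typed :: "'s set \<Rightarrow> 'a set \<Rightarrow> ('s \<times> 'a list \<times> 's) set" where
  "well_typed S L = {(\<alpha>, us, \<beta>). \<alpha> \<in> S \<and> \<beta> \<in> S \<and> us \<noteq> [] \<and> set us \<subseteq> L}"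

text \<open>An action on no transition lies in no subcube, because every action of a cube is used by
  a transition.\<close>

definition all_used :: "('s, 'a, 'l) hdts \<Rightarrow> bool" where
  "all_used X \<longleftrightarrow> (\<forall>u\<in>actions X. \<exists>\<alpha> us \<beta>. (\<alpha>, us, \<beta>) \<in> transitions X \<and> u \<in> set us)"

lemma mset_closedD: "mset_closed T \<Longrightarrow> (\<alpha>, us, \<beta>) \<in> T \<Longrightarrow> mset us = mset vs \<Longrightarrow> (\<alpha>, vs, \<beta>) \<in> T"
  unfolding mset_closed_def by blast

lemma coherentD:
  assumes "coherent T" "us \<noteq> []" "vs \<noteq> []" "ws \<noteq> []"
    "(\<alpha>, us @ vs @ ws, \<beta>) \<in> T" "(\<alpha>, us, \<nu>1) \<in> T" "(\<nu>1, vs @ ws, \<beta>) \<in> T"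
    "(\<alpha>, us @ vs, \<nu>2) \<in> T" "(\<nu>2, ws, \<beta>) \<in> T"
  shows "(\<nu>1, vs, \<nu>2) \<in> T"
  using assms unfolding coherent_def by blast

lemma splittingE:
  assumes "splitting T" "(\<alpha>, us, \<beta>) \<in> T" "mset us = mset vs + mset ws" "vs \<noteq> []" "ws \<noteq> []"
  obtains \<nu> where "(\<alpha>, vs, \<nu>) \<in> T" "(\<nu>, ws, \<beta>) \<in> T"
  using assms unfolding splitting_def by blast

lemma mset_closed_iff_permute_list:
  "mset_closed T \<longleftrightarrow>
     (\<forall>\<alpha> us \<beta> \<sigma>. (\<alpha>, us, \<beta>) \<in> T \<and> 2 \<le> length us \<and> \<sigma> permutes {..<length us} \<longrightarrow>
        (\<alpha>, permute_list \<sigma> us, \<beta>) \<in> T)"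
proof
  assume "mset_closed T"
  then show "\<forall>\<alpha> us \<beta> \<sigma>. (\<alpha>, us, \<beta>) \<in> T \<and> 2 \<le> length us \<and> \<sigma> permutes {..<length us} \<longrightarrow>
        (\<alpha>, permute_list \<sigma> us, \<beta>) \<in> T"
    unfolding mset_closed_def by (metis mset_permute_list)
next
  assume r: "\<forall>\<alpha> us \<beta> \<sigma>. (\<alpha>, us, \<beta>) \<in> T \<and> 2 \<le> length us \<and> \<sigma> permutes {..<length us} \<longrightarrow>
        (\<alpha>, permute_list \<sigma> us, \<beta>) \<in> T"
  show "mset_closed T"
    unfolding mset_closed_def
  proof (intro allI impI, elim conjE)
    fix \<alpha> us vs \<beta>
    assume a: "(\<alpha>, us, \<beta>) \<in> T" "mset us = mset vs"
    show "(\<alpha>, vs, \<beta>) \<in> T"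
    proof (cases "2 \<le> length us")
      case True
      from a(2) obtain \<sigma> where "\<sigma> permutes {..<length us}" "permute_list \<sigma> us = vs"
        by (metis mset_eq_permutation)
      with True a(1) r show ?thesis
        by blast
    next
      \<comment> \<open>Below length two a list is determined by its multiset, so there is nothing
        to permute.\<close>
      case False
      then have "us = vs"
        using a(2) by (cases us; cases "tl us") (auto dest!: mset_eq_length)
      with a(1) show ?thesis
        by simp
    qed
  qed
qed

lemma weak_hdts_iff:
  "weak_hdts \<Sigma> X \<longleftrightarrow>
     label X \<in> actions X \<rightarrow>\<^sub>E \<Sigma> \<and> transitions X \<subseteq> well_typed (states X) (actions X) \<and>
     mset_closed (transitions X) \<and> coherent (transitions X)"
proof -
  have "transitions X \<subseteq> well_typed (states X) (actions X) \<longleftrightarrow>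
      (\<forall>(\<alpha>, us, \<beta>)\<in>transitions X.
        \<alpha> \<in> states X \<and> \<beta> \<in> states X \<and> us \<noteq> [] \<and> set us \<subseteq> actions X)"
    by (auto simp: well_typed_def)
  then show ?thesis
    unfolding weak_hdts_def mset_closed_iff_permute_list coherent_def by simp
qed

text \<open>Direct images of transitions need not satisfy coherence, since identifying states or
  actions creates new instances of it. Colimits and images therefore carry generated
  transitions.\<close>

inductive_set coherent_closure :: "('s \<times> 'a list \<times> 's) set \<Rightarrow> ('s \<times> 'a list \<times> 's) set"
  for T where
  base: "t \<in> T \<Longrightarrow> t \<in> coherent_closure T"
| perm: "(\<alpha>, us, \<beta>) \<in> coherent_closure T \<Longrightarrow> mset us = mset vs \<Longrightarrow> (\<alpha>, vs, \<beta>) \<in> coherent_closure T"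
| coh: "us \<noteq> [] \<Longrightarrow> vs \<noteq> [] \<Longrightarrow> ws \<noteq> [] \<Longrightarrow>
    (\<alpha>, us @ vs @ ws, \<beta>) \<in> coherent_closure T \<Longrightarrow>
    (\<alpha>, us, \<nu>1) \<in> coherent_closure T \<Longrightarrow> (\<nu>1, vs @ ws, \<beta>) \<in> coherent_closure T \<Longrightarrow>
    (\<alpha>, us @ vs, \<nu>2) \<in> coherent_closure T \<Longrightarrow> (\<nu>2, ws, \<beta>) \<in> coherent_closure T \<Longrightarrow>
    (\<nu>1, vs, \<nu>2) \<in> coherent_closure T"

lemma coherent_closure_superset: "T \<subseteq> coherent_closure T"
  by (auto intro: coherent_closure.base)

lemma mset_closed_coherent_closure: "mset_closed (coherent_closure T)"
  unfolding mset_closed_def by (blast intro: coherent_closure.perm)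

lemma coherent_coherent_closure: "coherent (coherent_closure T)"
  unfolding coherent_def by (blast intro: coherent_closure.coh)

lemma coherent_closure_least:
  assumes "T \<subseteq> T'" "mset_closed T'" "coherent T'"
  shows "coherent_closure T \<subseteq> T'"
proof
  fix t assume "t \<in> coherent_closure T"
  then show "t \<in> T'"
    by induction (use assms(1) mset_closedD[OF assms(2)] coherentD[OF assms(3)] in blast)+
qed

lemma well_typed_closed: "mset_closed (well_typed S L)" "coherent (well_typed S L)"
  by (auto simp: well_typed_def mset_closed_def coherent_def dest: mset_eq_setD)

section \<open>Transport of transition sets along functions\<close>

definition tmap :: "('s \<Rightarrow> 't) \<Rightarrow> ('a \<Rightarrow> 'b) \<Rightarrow> 's \<times> 'a list \<times> 's \<Rightarrow> 't \<times> 'b list \<times> 't" where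
  "tmap f0 f1 = (\<lambda>(\<alpha>, us, \<beta>). (f0 \<alpha>, map f1 us, f0 \<beta>))"

lemma tmap_simp [simp]: "tmap f0 f1 (\<alpha>, us, \<beta>) = (f0 \<alpha>, map f1 us, f0 \<beta>)"
  by (simp add: tmap_def)

lemma mset_closed_vimage: "mset_closed T \<Longrightarrow> mset_closed (tmap f0 f1 -` T)"
  unfolding mset_closed_def by (simp, metis mset_map)

lemma coherent_vimage:
  assumes "coherent T"
  shows "coherent (tmap f0 f1 -` T)"
  unfolding coherent_def
proof (intro allI impI, elim conjE)
  fix \<alpha> us vs ws \<beta> \<nu>1 \<nu>2
  assume a: "us \<noteq> []" "vs \<noteq> []" "ws \<noteq> []"
    "(\<alpha>, us @ vs @ ws, \<beta>) \<in> tmap f0 f1 -` T" "(\<alpha>, us, \<nu>1) \<in> tmap f0 f1 -` T"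
    "(\<nu>1, vs @ ws, \<beta>) \<in> tmap f0 f1 -` T"
    "(\<alpha>, us @ vs, \<nu>2) \<in> tmap f0 f1 -` T" "(\<nu>2, ws, \<beta>) \<in> tmap f0 f1 -` T"
  have "(f0 \<nu>1, map f1 vs, f0 \<nu>2) \<in> T"
    by (rule coherentD[OF assms, of "map f1 us" _ "map f1 ws" "f0 \<alpha>" "f0 \<beta>"]) (use a in simp_all)
  then show "(\<nu>1, vs, \<nu>2) \<in> tmap f0 f1 -` T"
    by simp
qed

lemma mset_closed_Int: "mset_closed T \<Longrightarrow> mset_closed T' \<Longrightarrow> mset_closed (T \<inter> T')"
  unfolding mset_closed_def by blast

lemma coherent_Int:
  assumes "coherent T" "coherent T'"
  shows "coherent (T \<inter> T')"
  unfolding coherent_def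
proof (intro allI impI, elim conjE)
  fix \<alpha> us vs ws \<beta> \<nu>1 \<nu>2
  assume a: "us \<noteq> []" "vs \<noteq> []" "ws \<noteq> []"
    "(\<alpha>, us @ vs @ ws, \<beta>) \<in> T \<inter> T'" "(\<alpha>, us, \<nu>1) \<in> T \<inter> T'" "(\<nu>1, vs @ ws, \<beta>) \<in> T \<inter> T'"
    "(\<alpha>, us @ vs, \<nu>2) \<in> T \<inter> T'" "(\<nu>2, ws, \<beta>) \<in> T \<inter> T'"
  show "(\<nu>1, vs, \<nu>2) \<in> T \<inter> T'"
    by (rule IntI; rule coherentD[of _ us _ ws \<alpha> \<beta>]) (use a assms in simp_all)
qed

lemma mset_closed_Inter: "(\<And>T. T \<in> \<T> \<Longrightarrow> mset_closed T) \<Longrightarrow> mset_closed (\<Inter>\<T>)"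
  unfolding mset_closed_def by blast

lemma coherent_Inter:
  assumes "\<And>T. T \<in> \<T> \<Longrightarrow> coherent T"
  shows "coherent (\<Inter>\<T>)"
  unfolding coherent_def
proof (intro allI impI InterI, elim conjE)
  fix \<alpha> us vs ws \<beta> \<nu>1 \<nu>2 T
  assume T: "T \<in> \<T>" and a: "us \<noteq> []" "vs \<noteq> []" "ws \<noteq> []"
    "(\<alpha>, us @ vs @ ws, \<beta>) \<in> \<Inter>\<T>" "(\<alpha>, us, \<nu>1) \<in> \<Inter>\<T>" "(\<nu>1, vs @ ws, \<beta>) \<in> \<Inter>\<T>"
    "(\<alpha>, us @ vs, \<nu>2) \<in> \<Inter>\<T>" "(\<nu>2, ws, \<beta>) \<in> \<Inter>\<T>"
  show "(\<nu>1, vs, \<nu>2) \<in> T"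
    by (rule coherentD[OF assms[OF T], of us _ ws \<alpha> \<beta>]) (use a T in blast)+
qed

text \<open>A transition \<open>(\<nu>1, vs, \<nu>2)\<close> produced by coherence sits inside a
  long transition \<open>us @ vs @ ws\<close>. To divide \<open>vs\<close> into \<open>v1\<close>
  and \<open>v2\<close>, divide the long transition after \<open>us @ v1\<close>; two further uses
  of coherence cut the two halves out of it.\<close>

lemma splitting_coherent_closure:
  assumes "splitting T"
  shows "splitting (coherent_closure T)"
proof -
  let ?C = "coherent_closure T"
  note perm = mset_closedD[OF mset_closed_coherent_closure[of T]]
  note coherence = coherentD[OF coherent_coherent_closure[of T]]
  define Q where "Q t \<longleftrightarrow> (\<forall>vs ws. mset (fst (snd t)) = mset vs + mset ws \<and> vs \<noteq> [] \<and> ws \<noteq> [] \<longrightarrow>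
      (\<exists>\<nu>. (fst t, vs, \<nu>) \<in> ?C \<and> (\<nu>, ws, snd (snd t)) \<in> ?C))" for t
  have "Q t" if "t \<in> ?C" for t
    using that
  proof induction
    case (base t)
    then show ?case
      unfolding Q_def by (metis coherent_closure.base prod.collapse splittingE[OF assms])
  next
    case (perm \<alpha> us \<beta> vs)
    then show ?case
      by (simp add: Q_def)
  next
    case (coh us vs ws \<alpha> \<beta> \<nu>1 \<nu>2)
    show ?case
      unfolding Q_def
    proof (intro allI impI, elim conjE, simp only: fst_conv snd_conv)
      fix v1 v2 assume ms: "mset vs = mset v1 + mset v2" and ne: "v1 \<noteq> []" "v2 \<noteq> []"
      have "mset (us @ vs @ ws) = mset (us @ v1) + mset (v2 @ ws)"
        by (simp add: ms)
      \<comment> \<open>Only the induction hypothesis of the long transition enters; its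
        intermediate state serves for the short one.\<close>
      then obtain \<nu> where \<nu>: "(\<alpha>, us @ v1, \<nu>) \<in> ?C" "(\<nu>, v2 @ ws, \<beta>) \<in> ?C"
        using coh.IH(1) ne unfolding Q_def fst_conv snd_conv by (metis append_is_Nil_conv)
      have p1: "(\<alpha>, us @ v1 @ v2 @ ws, \<beta>) \<in> ?C"
        using coh.hyps(4) by (rule perm) (simp add: ms)
      have p2: "(\<nu>1, v1 @ v2 @ ws, \<beta>) \<in> ?C"
        using coh.hyps(6) by (rule perm) (simp add: ms)
      have p3: "(\<alpha>, (us @ v1) @ v2, \<nu>2) \<in> ?C"
        using coh.hyps(7) by (rule perm) (simp add: ms)
      have "(\<nu>1, v1, \<nu>) \<in> ?C"
        by (rule coherence[OF _ _ _ p1 coh.hyps(5) p2 \<nu>]) (use coh.hyps ne in auto)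
      moreover have "(\<nu>, v2, \<nu>2) \<in> ?C"
        by (rule coherence[OF _ _ _ _ \<nu> p3 coh.hyps(8)]) (use coh.hyps ne p1 in auto)
      ultimately show "\<exists>\<nu>. (\<nu>1, v1, \<nu>) \<in> ?C \<and> (\<nu>, v2, \<nu>2) \<in> ?C"
        by blast
    qed
  qed
  then show ?thesis
    unfolding splitting_def Q_def by fastforce
qed

text \<open>Splitting asks for the existence of two transitions for one transition at a time, so it
  passes to unions. Hence there is a largest splitting subset.\<close>

lemma splitting_Union:
  assumes "\<And>T. T \<in> \<T> \<Longrightarrow> splitting T"
  shows "splitting (\<Union>\<T>)"
  unfolding splitting_def
proof (intro allI impI, elim conjE)
  fix \<alpha> us vs ws \<beta>
  assume "(\<alpha>, us, \<beta>) \<in> \<Union>\<T>" and a: "mset us = mset vs + mset ws" "vs \<noteq> []" "ws \<noteq> []"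
  then obtain T where T: "T \<in> \<T>" "(\<alpha>, us, \<beta>) \<in> T"
    by blast
  show "\<exists>\<nu>. (\<alpha>, vs, \<nu>) \<in> \<Union>\<T> \<and> (\<nu>, ws, \<beta>) \<in> \<Union>\<T>"
    using splittingE[OF assms[OF T(1)] T(2) a] T(1) by (metis UnionI)
qed

text \<open>A greatest fixed point; it will be the set of transitions of the coreflection.\<close>

definition splitting_core :: "('s \<times> 'a list \<times> 's) set \<Rightarrow> ('s \<times> 'a list \<times> 's) set" where
  "splitting_core T = \<Union>{T'. T' \<subseteq> T \<and> mset_closed T' \<and> splitting T'}"

lemma splitting_core_subset: "splitting_core T \<subseteq> T"
  by (auto simp: splitting_core_def)

lemma splitting_core_greatest:
  "T' \<subseteq> T \<Longrightarrow> mset_closed T' \<Longrightarrow> splitting T' \<Longrightarrow> T' \<subseteq> splitting_core T"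
  by (auto simp: splitting_core_def)

lemma mset_closed_splitting_core: "mset_closed (splitting_core T)"
  unfolding splitting_core_def mset_closed_def by blast

lemma splitting_splitting_core: "splitting (splitting_core T)"
  unfolding splitting_core_def by (rule splitting_Union) blast

text \<open>Closing the core under the axioms stays inside \<open>T\<close> and keeps splitting, so
  by maximality it adds nothing.\<close>

lemma coherent_splitting_core:
  assumes "mset_closed T" "coherent T"
  shows "coherent (splitting_core T)"
proof -
  have "coherent_closure (splitting_core T) \<subseteq> T"
    using splitting_core_subset assms by (rule coherent_closure_least)
  then have "coherent_closure (splitting_core T) \<subseteq> splitting_core T"
    by (intro splitting_core_greatest mset_closed_coherent_closure splitting_coherent_closure
        splitting_splitting_core)
  then have "splitting_core T = coherent_closure (splitting_core T)"
    using coherent_closure_superset by blast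
  then show ?thesis
    by (metis coherent_coherent_closure)
qed

lemma mset_eq_map_mset:
  assumes "mset us = mset (map f ws)"
  obtains vs where "us = map f vs" "mset vs = mset ws"
proof -
  obtain \<sigma> where s: "\<sigma> permutes {..<length ws}" "permute_list \<sigma> (map f ws) = us"
    using assms by (metis length_map mset_eq_permutation)
  show ?thesis
    by (rule that[of "permute_list \<sigma> ws"]) (use s in \<open>auto simp: permute_list_map\<close>)
qed

lemma mset_map_add:
  assumes "mset (map f us) = mset vs + mset ws"
  obtains vs' ws' where "vs = map f vs'" "ws = map f ws'" "mset us = mset vs' + mset ws'"
proof -
  have "mset (vs @ ws) = mset (map f us)"
    using assms by simp
  then obtain xs where xs: "vs @ ws = map f xs" "mset xs = mset us"
    by (rule mset_eq_map_mset)
  then obtain xs1 xs2 where "xs = xs1 @ xs2" "vs = map f xs1" "ws = map f xs2"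
    by (metis append_eq_map_conv)
  with xs show ?thesis
    by (intro that) auto
qed

lemma mset_closed_image: "mset_closed T \<Longrightarrow> mset_closed (tmap f0 f1 ` T)"
  unfolding mset_closed_def
proof (intro allI impI, elim conjE)
  fix \<alpha> us vs \<beta>
  assume T: "\<forall>\<alpha> us vs \<beta>. (\<alpha>, us, \<beta>) \<in> T \<and> mset us = mset vs \<longrightarrow> (\<alpha>, vs, \<beta>) \<in> T"
    and "(\<alpha>, us, \<beta>) \<in> tmap f0 f1 ` T" and ms: "mset us = mset vs"
  then obtain a us' b where t: "(a, us', b) \<in> T" "\<alpha> = f0 a" "us = map f1 us'" "\<beta> = f0 b"
    by auto
  obtain vs' where "vs = map f1 vs'" "mset vs' = mset us'"
    by (rule mset_eq_map_mset[of vs f1 us']) (use ms t in auto)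
  moreover from this have "(a, vs', b) \<in> T"
    using T t(1) by metis
  ultimately show "(\<alpha>, vs, \<beta>) \<in> tmap f0 f1 ` T"
    using t by (auto intro!: rev_image_eqI[of "(a, vs', b)"])
qed

text \<open>A division of \<open>map f1 us'\<close> is the image of a division of
  \<open>us'\<close>, because the permutation involved acts on positions.\<close>

lemma splitting_image: "splitting T \<Longrightarrow> splitting (tmap f0 f1 ` T)"
  unfolding splitting_def
proof (intro allI impI, elim conjE)
  fix \<alpha> us vs ws \<beta>
  assume T: "\<forall>\<alpha> us vs ws \<beta>. (\<alpha>, us, \<beta>) \<in> T \<and> mset us = mset vs + mset ws \<and> vs \<noteq> [] \<and> ws \<noteq> [] \<longrightarrow>
      (\<exists>\<nu>. (\<alpha>, vs, \<nu>) \<in> T \<and> (\<nu>, ws, \<beta>) \<in> T)"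
    and "(\<alpha>, us, \<beta>) \<in> tmap f0 f1 ` T" and ms: "mset us = mset vs + mset ws"
    and ne: "vs \<noteq> []" "ws \<noteq> []"
  then obtain a us' b where t: "(a, us', b) \<in> T" "\<alpha> = f0 a" "us = map f1 us'" "\<beta> = f0 b"
    by auto
  obtain vs' ws' where s: "vs = map f1 vs'" "ws = map f1 ws'" "mset us' = mset vs' + mset ws'"
    by (rule mset_map_add[of f1 us' vs ws]) (use ms t in auto)
  then obtain \<nu> where "(a, vs', \<nu>) \<in> T" "(\<nu>, ws', b) \<in> T"
    using T t(1) ne by (metis list.map_disc_iff)
  then show "\<exists>\<nu>. (\<alpha>, vs, \<nu>) \<in> tmap f0 f1 ` T \<and> (\<nu>, ws, \<beta>) \<in> tmap f0 f1 ` T"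
    using t s by (intro exI[of _ "f0 \<nu>"]) (force simp: image_iff)
qed

text \<open>Splitting divides into two nonempty parts only, so the case where \<open>u\<close> is
  the whole list stands apart.\<close>

lemma singleton_transition:
  assumes "splitting T" "(\<alpha>, us, \<beta>) \<in> T" "u \<in> set us"
  obtains \<alpha>' \<beta>' where "(\<alpha>', [u], \<beta>') \<in> T"
proof -
  obtain ys zs where us: "us = ys @ u # zs"
    using assms(3) by (meson split_list)
  show ?thesis
  proof (cases "ys @ zs = []")
    case True
    then show ?thesis
      using that assms(2) us by auto
  next
    case False
    have "mset us = mset [u] + mset (ys @ zs)"
      by (simp add: us)
    then show ?thesis
      using splittingE[OF assms(1,2), of "[u]" "ys @ zs"] False that by blast
  qed
qed

text \<open>The flag \<open>b\<close> selects weak (\<open>True\<close>) or cubical (\<open>False\<close>) systems.\<close>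

definition regular :: "bool \<Rightarrow> ('s, 'a, 'l) hdts \<Rightarrow> bool" where
  "regular b X \<longleftrightarrow> b \<or> all_used X \<and> splitting (transitions X)"

lemma coherent_closure_well_typed:
  "T \<subseteq> well_typed S L \<Longrightarrow> coherent_closure T \<subseteq> well_typed S L"
  by (intro coherent_closure_least well_typed_closed)

lemma tmap_well_typed:
  assumes "T \<subseteq> well_typed S L" "f0 \<in> S \<rightarrow> S'" "f1 \<in> L \<rightarrow> L'"
  shows "tmap f0 f1 ` T \<subseteq> well_typed S' L'"
proof
  fix t assume "t \<in> tmap f0 f1 ` T"
  then obtain s where s: "s \<in> T" "t = tmap f0 f1 s"
    by blast
  moreover have "s \<in> well_typed S L"
    using s assms(1) by blast
  ultimately show "t \<in> well_typed S' L'"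
    using assms(2,3) by (cases s) (auto simp: well_typed_def)
qed

text \<open>A map of systems up to extensionality. Composites and identities can be plain functions
  here, and \<open>arrow_of\<close> restores extensionality at the end.\<close>

definition premap :: "('s, 'a, 'l) hdts \<Rightarrow> ('t, 'b, 'l) hdts \<Rightarrow> ('s \<Rightarrow> 't) \<Rightarrow> ('a \<Rightarrow> 'b) \<Rightarrow> bool" where
  "premap X Y f0 f1 \<longleftrightarrow>
     f0 \<in> states X \<rightarrow> states Y \<and> f1 \<in> actions X \<rightarrow> actions Y \<and>
     (\<forall>u\<in>actions X. label Y (f1 u) = label X u) \<and>
     (\<forall>(\<alpha>, us, \<beta>)\<in>transitions X. (f0 \<alpha>, map f1 us, f0 \<beta>) \<in> transitions Y)"

lemma hdts_map_iff:
  "hdts_map X Y f0 f1 \<longleftrightarrow>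
     premap X Y f0 f1 \<and> f0 \<in> extensional (states X) \<and> f1 \<in> extensional (actions X)"
  by (auto simp: hdts_map_def premap_def PiE_def)

lemma premapI:
  assumes "\<And>\<alpha>. \<alpha> \<in> states X \<Longrightarrow> f0 \<alpha> \<in> states Y" "\<And>u. u \<in> actions X \<Longrightarrow> f1 u \<in> actions Y"
    "\<And>u. u \<in> actions X \<Longrightarrow> label Y (f1 u) = label X u"
    "\<And>\<alpha> us \<beta>. (\<alpha>, us, \<beta>) \<in> transitions X \<Longrightarrow> (f0 \<alpha>, map f1 us, f0 \<beta>) \<in> transitions Y"
  shows "premap X Y f0 f1"
  using assms by (auto simp: premap_def)

lemma premapD:
  assumes "premap X Y f0 f1"
  shows "\<alpha> \<in> states X \<Longrightarrow> f0 \<alpha> \<in> states Y" "u \<in> actions X \<Longrightarrow> f1 u \<in> actions Y"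
    "u \<in> actions X \<Longrightarrow> label Y (f1 u) = label X u"
    "(\<alpha>, us, \<beta>) \<in> transitions X \<Longrightarrow> (f0 \<alpha>, map f1 us, f0 \<beta>) \<in> transitions Y"
  using assms by (auto simp: premap_def)

lemma premap_comp:
  assumes "premap X Y f0 f1" "premap Y Z g0 g1"
  shows "premap X Z (g0 \<circ> f0) (g1 \<circ> f1)"
  by (rule premapI)
    (simp_all add: premapD[OF assms(1)] premapD[OF assms(2)] flip: map_map)

lemma transition_typed:
  assumes "weak_hdts \<Sigma> X" "(\<alpha>, us, \<beta>) \<in> transitions X"
  shows "\<alpha> \<in> states X" "\<beta> \<in> states X" "us \<noteq> []" "set us \<subseteq> actions X"
  using assms by (auto simp: weak_hdts_iff well_typed_def)

lemma premap_cong: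
  assumes "weak_hdts \<Sigma> X" "premap X Y f0 f1"
    and "\<And>\<alpha>. \<alpha> \<in> states X \<Longrightarrow> g0 \<alpha> = f0 \<alpha>" "\<And>u. u \<in> actions X \<Longrightarrow> g1 u = f1 u"
  shows "premap X Y g0 g1"
proof (rule premapI)
  fix \<alpha> us \<beta> assume t: "(\<alpha>, us, \<beta>) \<in> transitions X"
  have eq: "map g1 us = map f1 us"
    using transition_typed(4)[OF assms(1) t] assms(4) by (auto intro!: map_cong)
  then show "(g0 \<alpha>, map g1 us, g0 \<beta>) \<in> transitions Y"
    unfolding eq using premapD(4)[OF assms(2) t] transition_typed(1,2)[OF assms(1) t] assms(3) by simp
qed (use assms premapD[OF assms(2)] in auto)

text \<open>The preimage of a closed set is closed, so a map out of a generated system has to be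
  checked on generators only.\<close>

lemma premap_coherent_closure:
  assumes "\<And>\<alpha> us \<beta>. (\<alpha>, us, \<beta>) \<in> T \<Longrightarrow> (f0 \<alpha>, map f1 us, f0 \<beta>) \<in> T'"
    and "mset_closed T'" "coherent T'" "(\<alpha>, us, \<beta>) \<in> coherent_closure T"
  shows "(f0 \<alpha>, map f1 us, f0 \<beta>) \<in> T'"
proof -
  have "coherent_closure T \<subseteq> tmap f0 f1 -` T'"
    using assms by (intro coherent_closure_least mset_closed_vimage coherent_vimage) auto
  then show ?thesis
    using assms(4) by auto
qed

lemma label_in: "weak_hdts \<Sigma> X \<Longrightarrow> u \<in> actions X \<Longrightarrow> label X u \<in> \<Sigma>"
  by (auto simp: weak_hdts_iff)

text \<open>\<open>sat\<close> replaces only the head of a list. Each replaced action is rotated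
  into the tail \<open>ts\<close>, which brings the next one to the front; the last permutation
  restores the order.\<close>

lemma list_all2_saturated:
  assumes "mset_closed T" and sat: "\<And>\<alpha> u v us \<beta>. (\<alpha>, u # us, \<beta>) \<in> T \<Longrightarrow> E u v \<Longrightarrow> (\<alpha>, v # us, \<beta>) \<in> T"
    and "list_all2 E us vs" "(\<alpha>, us, \<beta>) \<in> T"
  shows "(\<alpha>, vs, \<beta>) \<in> T"
proof -
  have "(\<alpha>, us @ ts, \<beta>) \<in> T \<Longrightarrow> (\<alpha>, vs @ ts, \<beta>) \<in> T" for ts
    using assms(3)
  proof (induction us vs arbitrary: ts rule: list_all2_induct)
    case (Cons u us v vs)
    have "(\<alpha>, v # us @ ts, \<beta>) \<in> T"
      using sat Cons.prems Cons.hyps(1) by simp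
    then have "(\<alpha>, us @ v # ts, \<beta>) \<in> T"
      by (rule mset_closedD[OF assms(1)]) simp
    then have "(\<alpha>, vs @ v # ts, \<beta>) \<in> T"
      by (rule Cons.IH)
    then show ?case
      by (rule mset_closedD[OF assms(1)]) simp
  qed simp
  from this[of "[]"] show ?thesis
    using assms(4) by simp
qed

text \<open>Splitting and coherence speak of lists with at least two entries, and a one-entry list
  has only one ordering. Systems of 1-transitions thus come for free; they are the gluing data of
  the saturation step.\<close>

lemma length_one_closed:
  assumes "\<And>\<alpha> us \<beta>. (\<alpha>, us, \<beta>) \<in> T \<Longrightarrow> length us = 1"
  shows "splitting T" "mset_closed T" "coherent T"
proof -
  show "splitting T"
    unfolding splitting_def
  proof (intro allI impI, elim conjE)
    fix \<alpha> us vs ws \<beta>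
    assume a: "(\<alpha>, us, \<beta>) \<in> T" "mset us = mset vs + mset ws" "vs \<noteq> []" "ws \<noteq> []"
    have "length us = length vs + length ws"
      using arg_cong[OF a(2), of size] by simp
    then show "\<exists>\<nu>. (\<alpha>, vs, \<nu>) \<in> T \<and> (\<nu>, ws, \<beta>) \<in> T"
      using assms[OF a(1)] a(3,4) by (cases vs; cases ws) auto
  qed
  show "mset_closed T"
    unfolding mset_closed_def
  proof (intro allI impI, elim conjE)
    fix \<alpha> us vs \<beta>
    assume a: "(\<alpha>, us, \<beta>) \<in> T" "mset us = mset vs"
    obtain x where "us = [x]"
      using assms[OF a(1)] by (auto simp: length_Suc_conv)
    then show "(\<alpha>, vs, \<beta>) \<in> T"
      using a by (metis mset_single_iff mset_single_iff_right)
  qed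
  show "coherent T"
    unfolding coherent_def
  proof (intro allI impI, elim conjE)
    fix \<alpha> us vs ws \<beta> \<nu>1 \<nu>2
    assume "(\<alpha>, us @ vs @ ws, \<beta>) \<in> T" "us \<noteq> []" "vs \<noteq> []"
    then show "(\<nu>1, vs, \<nu>2) \<in> T"
      using assms[of \<alpha> "us @ vs @ ws" \<beta>] by (cases us; cases vs) auto
  qed
qed

section \<open>Cubes\<close>

lemma states_cube [simp]: "states (cube xs) = {\<epsilon>. length \<epsilon> = length xs}"
  by (simp add: cube_def Let_def)

lemma actions_cube [simp]: "actions (cube xs) = (\<lambda>i. (xs ! i, i)) ` {..<length xs}"
  by (auto simp: cube_def Let_def)

lemma label_cube: "u \<in> actions (cube xs) \<Longrightarrow> label (cube xs) u = fst u"
  by (auto simp: cube_def Let_def)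

lemma transitions_cube:
  "(\<epsilon>, us, \<epsilon>') \<in> transitions (cube xs) \<longleftrightarrow>
     length \<epsilon> = length xs \<and> length \<epsilon>' = length xs \<and> us \<noteq> [] \<and> set us \<subseteq> actions (cube xs) \<and> distinct us \<and>
     (\<forall>i<length xs. \<epsilon> ! i \<le> \<epsilon>' ! i) \<and> (\<forall>i<length xs. \<epsilon> ! i \<noteq> \<epsilon>' ! i \<longleftrightarrow> (xs ! i, i) \<in> set us)"
  by (auto simp: cube_def Let_def)

lemma transitions_cubeI:
  assumes "length \<epsilon> = length xs" "length \<epsilon>' = length xs" "us \<noteq> []" "set us \<subseteq> actions (cube xs)"
    "distinct us"
    "\<And>i. i < length xs \<Longrightarrow> (\<epsilon> ! i \<longrightarrow> \<epsilon>' ! i) \<and> (\<epsilon> ! i \<noteq> \<epsilon>' ! i \<longleftrightarrow> (xs ! i, i) \<in> set us)"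
  shows "(\<epsilon>, us, \<epsilon>') \<in> transitions (cube xs)"
  using assms by (simp add: transitions_cube del: actions_cube)

lemma transitions_cubeD:
  assumes "(\<epsilon>, us, \<epsilon>') \<in> transitions (cube xs)"
  shows "length \<epsilon> = length xs" "length \<epsilon>' = length xs" "us \<noteq> []" "set us \<subseteq> actions (cube xs)"
    "distinct us"
    "i < length xs \<Longrightarrow> (\<epsilon> ! i \<longrightarrow> \<epsilon>' ! i) \<and> (\<epsilon> ! i \<noteq> \<epsilon>' ! i \<longleftrightarrow> (xs ! i, i) \<in> set us)"
  using assms by (simp_all add: transitions_cube del: actions_cube)

lemma weak_hdts_cube:
  assumes "xs \<in> lists \<Sigma>"
  shows "weak_hdts \<Sigma> (cube xs)"
  unfolding weak_hdts_iff
proof (intro conjI)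
  show "label (cube xs) \<in> actions (cube xs) \<rightarrow>\<^sub>E \<Sigma>"
    using assms by (auto simp: cube_def Let_def in_lists_conv_set)
  show "transitions (cube xs) \<subseteq> well_typed (states (cube xs)) (actions (cube xs))"
    by (auto simp: well_typed_def transitions_cube)
  show "mset_closed (transitions (cube xs))"
    unfolding mset_closed_def
  proof (intro allI impI, elim conjE)
    fix \<alpha> us vs \<beta>
    assume t: "(\<alpha>, us, \<beta>) \<in> transitions (cube xs)" and ms: "mset us = mset vs"
    from ms have "set us = set vs" "distinct us = distinct vs" "us = [] \<longleftrightarrow> vs = []"
      by (auto dest: mset_eq_setD mset_eq_imp_distinct_iff)
    then show "(\<alpha>, vs, \<beta>) \<in> transitions (cube xs)"
      using t by (simp add: transitions_cube)
  qed
  show "coherent (transitions (cube xs))"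
    unfolding coherent_def
  proof (intro allI impI, elim conjE)
    fix \<alpha> us vs ws \<beta> \<nu>1 \<nu>2
    assume "us \<noteq> []" "vs \<noteq> []" "ws \<noteq> []"
      and t: "(\<alpha>, us @ vs @ ws, \<beta>) \<in> transitions (cube xs)" "(\<alpha>, us, \<nu>1) \<in> transitions (cube xs)"
        "(\<nu>1, vs @ ws, \<beta>) \<in> transitions (cube xs)" "(\<alpha>, us @ vs, \<nu>2) \<in> transitions (cube xs)"
        "(\<nu>2, ws, \<beta>) \<in> transitions (cube xs)"
    note d = t[THEN transitions_cubeD(6)]
    show "(\<nu>1, vs, \<nu>2) \<in> transitions (cube xs)"
    proof (rule transitions_cubeI)
      show "length \<nu>1 = length xs" "length \<nu>2 = length xs" "vs \<noteq> []" "set vs \<subseteq> actions (cube xs)"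
        "distinct vs"
        using t[THEN transitions_cubeD(1)] t[THEN transitions_cubeD(2)] t(1)[THEN transitions_cubeD(4)]
          t(1)[THEN transitions_cubeD(5)] \<open>vs \<noteq> []\<close> by simp_all
      fix i assume i: "i < length xs"
      \<comment> \<open>The actions of the long transition are distinct, so the three parts are
        disjoint and each coordinate moves in at most one of them.\<close>
      have "set us \<inter> set vs = {}" "set us \<inter> set ws = {}" "set vs \<inter> set ws = {}"
        using t(1)[THEN transitions_cubeD(5)] by auto
      then show "(\<nu>1 ! i \<longrightarrow> \<nu>2 ! i) \<and> (\<nu>1 ! i \<noteq> \<nu>2 ! i \<longleftrightarrow> (xs ! i, i) \<in> set vs)"
        using d(1)[OF i] d(2)[OF i] d(3)[OF i] d(4)[OF i] d(5)[OF i] by auto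
    qed
  qed
qed

lemma splitting_cube: "splitting (transitions (cube xs))"
  unfolding splitting_def
proof (intro allI impI, elim conjE)
  fix \<alpha> us vs ws \<beta>
  assume t: "(\<alpha>, us, \<beta>) \<in> transitions (cube xs)" and ms: "mset us = mset vs + mset ws"
    and ne: "vs \<noteq> []" "ws \<noteq> []"
  have eq: "set us = set vs \<union> set ws"
    using ms by (metis set_mset_mset set_mset_union)
  have dist: "distinct (vs @ ws)"
    using transitions_cubeD(5)[OF t] ms by (metis mset_append mset_eq_imp_distinct_iff)
  \<comment> \<open>The intermediate vertex: the coordinates named by \<open>vs\<close> have moved
    to \<open>\<beta>\<close>, the others still agree with \<open>\<alpha>\<close>.\<close>
  define \<nu> where "\<nu> = map (\<lambda>i. if (xs ! i, i) \<in> set vs then \<beta> ! i else \<alpha> ! i) [0..<length xs]"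
  have \<nu>: "\<nu> ! i = (if (xs ! i, i) \<in> set vs then \<beta> ! i else \<alpha> ! i)" if "i < length xs" for i
    using that by (simp add: \<nu>_def)
  note d = transitions_cubeD[OF t]
  have "(\<alpha>, vs, \<nu>) \<in> transitions (cube xs)" "(\<nu>, ws, \<beta>) \<in> transitions (cube xs)"
    by (rule transitions_cubeI; use d ne dist eq \<nu> in \<open>auto simp: \<nu>_def\<close>)+
  then show "\<exists>\<nu>. (\<alpha>, vs, \<nu>) \<in> transitions (cube xs) \<and> (\<nu>, ws, \<beta>) \<in> transitions (cube xs)"
    by blast
qed

lemma all_used_cube: "all_used (cube xs)"
  unfolding all_used_def
proof
  fix u assume "u \<in> actions (cube xs)"
  then obtain i where i: "i < length xs" "u = (xs ! i, i)"
    by auto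
  \<comment> \<open>The edge at the origin in direction \<open>i\<close>.\<close>
  have "(replicate (length xs) False, [u], (replicate (length xs) False)[i := True]) \<in> transitions
      (cube xs)"
    by (rule transitions_cubeI) (use i in \<open>auto simp: nth_list_update\<close>)
  then show "\<exists>\<alpha> us \<beta>. (\<alpha>, us, \<beta>) \<in> transitions (cube xs) \<and> u \<in> set us"
    by fastforce
qed

text \<open>Indexed by positions and not by actions, since a transition of a general system may
  repeat an action.\<close>

definition sublist_at :: "'a list \<Rightarrow> nat set \<Rightarrow> 'a list" where
  "sublist_at us I = map (nth us) (sorted_list_of_set I)"

lemma mset_sublist_at: "finite I \<Longrightarrow> mset (sublist_at us I) = image_mset (nth us) (mset_set I)"
  using mset_set_set[of "sorted_list_of_set I"] by (simp add: sublist_at_def)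

lemma sublist_at_Nil_iff: "finite I \<Longrightarrow> sublist_at us I = [] \<longleftrightarrow> I = {}"
  by (simp add: sublist_at_def)

lemma mset_sublist_at_Un:
  "finite I \<Longrightarrow> finite J \<Longrightarrow> I \<inter> J = {} \<Longrightarrow>
     mset (sublist_at us (I \<union> J)) = mset (sublist_at us I) + mset (sublist_at us J)"
  by (simp add: mset_sublist_at mset_set_Union)

lemma mset_sublist_at_lessThan: "mset (sublist_at us {..<length us}) = mset us"
  by (simp add: sublist_at_def lessThan_atLeast0 map_nth)

text \<open>Intermediate states can be chosen for all subsets of the actions of a transition at once,
  without any compatibility between the choices: coherence supplies the missing faces.\<close>

lemma cube_of_transition:
  fixes X :: "('s, 'a, 'l) hdts"
  assumes X: "weak_hdts \<Sigma> X" "splitting (transitions X)" and t: "(\<alpha>, us, \<beta>) \<in> transitions X"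
  obtains f0 f1 \<epsilon> ks \<epsilon>' where "premap (cube (map (label X) us)) X f0 f1"
    "(\<epsilon>, ks, \<epsilon>') \<in> transitions (cube (map (label X) us))" "(f0 \<epsilon>, map f1 ks, f0 \<epsilon>') = (\<alpha>, us, \<beta>)"
proof -
  define T where "T = transitions X"
  define n where "n = length us"
  define xs where "xs = map (label X) us"
  have T: "mset_closed T" "coherent T" "splitting T"
    using X by (auto simp: T_def weak_hdts_iff)
  have n0: "0 < n"
    using transition_typed[OF X(1) t] by (simp add: n_def)
  have fin: "finite I" if "I \<subseteq> {..<n}" for I
    using that finite_subset by blast
  let ?s = "sublist_at us"
  \<comment> \<open>The two extreme vertices are pinned to the ends of the transition, where no
    intermediate state exists; all others are chosen independently of each other.\<close>
  define \<nu> where "\<nu> I = (if I = {} then \<alpha> else if I = {..<n} then \<beta> else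
      SOME \<nu>. (\<alpha>, ?s I, \<nu>) \<in> T \<and> (\<nu>, ?s ({..<n} - I), \<beta>) \<in> T)" for I
  have ends: "\<nu> {} = \<alpha>" "\<nu> {..<n} = \<beta>"
    using n0 by (simp_all add: \<nu>_def lessThan_empty_iff)
  have mid: "(\<alpha>, ?s I, \<nu> I) \<in> T \<and> (\<nu> I, ?s ({..<n} - I), \<beta>) \<in> T"
    if I: "I \<subseteq> {..<n}" "I \<noteq> {}" "I \<noteq> {..<n}" for I
  proof -
    have "mset us = mset (?s I) + mset (?s ({..<n} - I))"
      using mset_sublist_at_Un[of I "{..<n} - I" us] fin I(1)
      by (simp add: Un_absorb1 mset_sublist_at_lessThan n_def)
    moreover have "?s I \<noteq> []" "?s ({..<n} - I) \<noteq> []"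
      using I fin by (auto simp: sublist_at_Nil_iff)
    ultimately have "\<exists>\<nu>. (\<alpha>, ?s I, \<nu>) \<in> T \<and> (\<nu>, ?s ({..<n} - I), \<beta>) \<in> T"
      using splittingE[OF T(3) t[folded T_def]] by metis
    then show ?thesis
      using someI_ex[of "\<lambda>\<nu>. (\<alpha>, ?s I, \<nu>) \<in> T \<and> (\<nu>, ?s ({..<n} - I), \<beta>) \<in> T"] I
      by (simp add: \<nu>_def)
  qed
  have full: "(\<alpha>, ?s {..<n}, \<beta>) \<in> T"
    using mset_closedD[OF T(1) t[folded T_def]] by (simp add: n_def mset_sublist_at_lessThan)
  have A: "(\<alpha>, ?s I, \<nu> I) \<in> T" if "I \<subseteq> {..<n}" "I \<noteq> {}" for I
    using mid[OF that] full ends by (cases "I = {..<n}") auto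
  have B: "(\<nu> I, ?s ({..<n} - I), \<beta>) \<in> T" if "I \<subseteq> {..<n}" "I \<noteq> {..<n}" for I
    using mid[OF that(1)] full ends that(2) by (cases "I = {}") auto
  \<comment> \<open>The faces of the cube. If \<open>I\<close> is empty or \<open>J\<close> is
    everything, the face is one of the chosen halves; otherwise coherence applied to
    \<open>I\<close>, \<open>J - I\<close> and the complement of \<open>J\<close> produces
    it.\<close>
  have C: "(\<nu> I, ?s (J - I), \<nu> J) \<in> T" if IJ: "I \<subset> J" "J \<subseteq> {..<n}" for I J
  proof (cases "I = {} \<or> J = {..<n}")
    case True
    then show ?thesis
    proof
      assume "I = {}"
      then show ?thesis
        using A[of J] IJ ends(1) by auto
    next
      assume "J = {..<n}"
      then show ?thesis
        using B[of I] IJ ends(2) by auto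
    qed
  next
    case False
    have I: "I \<subseteq> {..<n}" "I \<noteq> {..<n}"
      using IJ by auto
    have dis: "I \<inter> (J - I) = {}" "I \<inter> ({..<n} - I) = {}" "(J - I) \<inter> ({..<n} - J) = {}"
      by auto
    have un: "I \<union> (J - I) = J" "I \<union> ({..<n} - I) = {..<n}" "(J - I) \<union> ({..<n} - J) = {..<n} - I"
      using IJ by auto
    have fins: "finite I" "finite J" "finite (J - I)" "finite ({..<n} - I)" "finite ({..<n} - J)"
      using IJ I fin by auto
    note ms = mset_sublist_at_Un[OF fins(1,3) dis(1), of us] mset_sublist_at_Un[OF fins(1,4)
        dis(2), of us]
      mset_sublist_at_Un[OF fins(3,5) dis(3), of us]
    show ?thesis
    proof (rule coherentD[OF T(2), of "?s I" _ "?s ({..<n} - J)" \<alpha> \<beta>])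
      show "?s I \<noteq> []" "?s (J - I) \<noteq> []" "?s ({..<n} - J) \<noteq> []"
        using False IJ fins by (auto simp: sublist_at_Nil_iff)
      show "(\<alpha>, ?s I, \<nu> I) \<in> T" "(\<nu> J, ?s ({..<n} - J), \<beta>) \<in> T"
        using A[of I] B[of J] False IJ I by auto
      show "(\<alpha>, ?s I @ ?s (J - I) @ ?s ({..<n} - J), \<beta>) \<in> T"
        using full by (rule mset_closedD[OF T(1)]) (use ms un in \<open>simp add: add.assoc\<close>)
      show "(\<nu> I, ?s (J - I) @ ?s ({..<n} - J), \<beta>) \<in> T"
        using B[OF I] by (rule mset_closedD[OF T(1)]) (use ms un in simp)
      have "J \<noteq> {}"
        using IJ by auto
      from A[OF IJ(2) this] show "(\<alpha>, ?s I @ ?s (J - I), \<nu> J) \<in> T"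
        by (rule mset_closedD[OF T(1)]) (simp add: ms(1)[unfolded un])
    qed
  qed
  \<comment> \<open>A vertex is identified with the set of its coordinates equal to
    \<open>True\<close>, and the action in direction \<open>i\<close> is sent to
    \<open>us ! i\<close>.\<close>
  define on where "on \<epsilon> = {i. i < n \<and> \<epsilon> ! i}" for \<epsilon>
  define f1 where "f1 u = us ! snd u" for u :: "'l \<times> nat"
  have lx: "length xs = n"
    by (simp add: xs_def n_def)
  show ?thesis
  proof (rule that[unfolded xs_def[symmetric]])
    show "premap (cube xs) X (\<nu> \<circ> on) f1"
    proof (rule premapI)
      fix \<epsilon> assume "\<epsilon> \<in> states (cube xs)"
      show "(\<nu> \<circ> on) \<epsilon> \<in> states X"
      proof (cases "on \<epsilon> = {}")
        case True
        then show ?thesis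
          using transition_typed[OF X(1) t] by (simp add: \<nu>_def)
      next
        case False
        then show ?thesis
          using A[of "on \<epsilon>"] transition_typed(2)[OF X(1)] unfolding T_def on_def by auto
      qed
    next
      fix u assume u: "u \<in> actions (cube xs)"
      then show "f1 u \<in> actions X"
        using transition_typed[OF X(1) t] by (auto simp: f1_def lx n_def)
      show "label X (f1 u) = label (cube xs) u"
        using u by (auto simp: label_cube f1_def lx n_def xs_def)
    next
      fix \<epsilon> ks \<epsilon>' assume k: "(\<epsilon>, ks, \<epsilon>') \<in> transitions (cube xs)"
      note d = transitions_cubeD[OF k]
      \<comment> \<open>\<open>D\<close> consists of the coordinates that are switched on. The list
        \<open>ks\<close> enumerates them in some order, so the multiset axiom reduces the claim to
        \<open>C\<close>.\<close>
      define D where "D = on \<epsilon>' - on \<epsilon>"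
      have ks: "set ks = (\<lambda>i. (xs ! i, i)) ` D"
        using d(4) d(6) by (auto simp: D_def on_def lx)
      have "D \<noteq> {}"
        using d(3) ks by auto
      then have sub: "on \<epsilon> \<subset> on \<epsilon>'" "on \<epsilon>' \<subseteq> {..<n}"
        using d(6) by (auto simp: D_def on_def lx)
      have finD: "finite D"
        using fin[of D] sub by (auto simp: D_def)
      have "mset (map f1 ks) = image_mset f1 (mset_set ((\<lambda>i. (xs ! i, i)) ` D))"
        using mset_set_set[OF d(5)] by (simp flip: ks)
      also have "\<dots> = image_mset f1 (image_mset (\<lambda>i. (xs ! i, i)) (mset_set D))"
        by (subst image_mset_mset_set) (auto simp: inj_on_def)
      also have "\<dots> = mset (?s D)"
        by (simp add: mset_sublist_at[OF finD] multiset.map_comp f1_def comp_def)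
      finally have "mset (?s D) = mset (map f1 ks)" ..
      then have "(\<nu> (on \<epsilon>), map f1 ks, \<nu> (on \<epsilon>')) \<in> T"
        using C[OF sub, folded D_def] mset_closedD[OF T(1)] by blast
      then show "((\<nu> \<circ> on) \<epsilon>, map f1 ks, (\<nu> \<circ> on) \<epsilon>') \<in> transitions X"
        by (simp add: T_def)
    qed
    \<comment> \<open>The main diagonal of the cube realises the given transition.\<close>
    let ?ks = "map (\<lambda>i. (xs ! i, i)) [0..<n]"
    show "(replicate n False, ?ks, replicate n True) \<in> transitions (cube xs)"
      by (rule transitions_cubeI) (use n0 in \<open>auto simp: lx distinct_map inj_on_def\<close>)
    have "on (replicate n False) = {}" "on (replicate n True) = {..<n}"
      by (auto simp: on_def)
    moreover have "map f1 ?ks = us"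
      by (simp add: f1_def comp_def n_def map_nth)
    ultimately show "((\<nu> \<circ> on) (replicate n False), map f1 ?ks, (\<nu> \<circ> on) (replicate n True)) = (\<alpha>,
        us, \<beta>)"
      by (simp add: ends)
  qed
qed

section \<open>Copies of a system on other carriers\<close>

definition copy_hdts :: "('s \<Rightarrow> 't) \<Rightarrow> ('a \<Rightarrow> 'b) \<Rightarrow> ('s, 'a, 'l) hdts \<Rightarrow> ('t, 'b, 'l) hdts" where
  "copy_hdts e0 e1 X =
     \<lparr>states = e0 ` states X, actions = e1 ` actions X,
      label = (\<lambda>v\<in>e1 ` actions X. label X (inv_into (actions X) e1 v)),
      transitions = tmap e0 e1 ` transitions X\<rparr>"

lemma copy_hdts_isomorphism:
  assumes X: "weak_hdts \<Sigma> X" and e: "inj_on e0 (states X)" "inj_on e1 (actions X)"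
  shows "weak_hdts \<Sigma> (copy_hdts e0 e1 X)" (is ?w)
    and "premap X (copy_hdts e0 e1 X) e0 e1" (is ?p)
    and "premap (copy_hdts e0 e1 X) X (inv_into (states X) e0) (inv_into (actions X) e1)" (is ?q)
proof -
  let ?Y = "copy_hdts e0 e1 X" and ?g0 = "inv_into (states X) e0" and ?g1 = "inv_into (actions X) e1"
  have inv_map: "map ?g1 (map e1 us) = us" if "set us \<subseteq> actions X" for us
    using that e(2) by (auto intro!: map_idI simp: subset_iff)
  have inv: "tmap ?g0 ?g1 (tmap e0 e1 t) = t" if "t \<in> transitions X" for t
  proof -
    obtain \<alpha> us \<beta> where t: "t = (\<alpha>, us, \<beta>)"
      by (cases t)
    note tt = transition_typed[OF X that[unfolded t]]
    show ?thesis
      using inv_map[OF tt(4)] tt(1,2) e by (simp add: t del: map_map)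
  qed
  \<comment> \<open>Once the image is rewritten as a preimage under the inverse functions, both
    axioms follow from their stability under preimages.\<close>
  have T: "tmap e0 e1 ` transitions X =
      tmap ?g0 ?g1 -` transitions X \<inter> well_typed (states ?Y) (actions ?Y)" (is "?L = ?R")
  proof (intro set_eqI iffI)
    fix t assume "t \<in> ?L"
    then obtain s where s: "s \<in> transitions X" "t = tmap e0 e1 s"
      by blast
    obtain \<alpha> us \<beta> where s': "s = (\<alpha>, us, \<beta>)"
      by (cases s)
    have "t \<in> well_typed (states ?Y) (actions ?Y)"
      using transition_typed[OF X s(1)[unfolded s']] s(2)
      by (auto simp: well_typed_def copy_hdts_def s')
    then show "t \<in> ?R"
      using s inv by simp
  next
    fix t assume t: "t \<in> ?R"
    obtain \<alpha> us \<beta> where t': "t = (\<alpha>, us, \<beta>)"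
      by (cases t)
    have "map e1 (map ?g1 us) = us"
      unfolding map_map by (rule map_idI) (use t t' in \<open>auto simp: well_typed_def copy_hdts_def
          f_inv_into_f subset_iff\<close>)
    then have "t = tmap e0 e1 (tmap ?g0 ?g1 t)"
      using t t' by (simp add: well_typed_def copy_hdts_def f_inv_into_f del: map_map)
    then show "t \<in> ?L"
      using t by blast
  qed
  show ?w
    unfolding weak_hdts_iff
  proof (intro conjI)
    show "label ?Y \<in> actions ?Y \<rightarrow>\<^sub>E \<Sigma>"
      using X e by (auto simp: copy_hdts_def weak_hdts_iff)
    have tr: "transitions ?Y = ?R"
      using T by (simp add: copy_hdts_def)
    show "transitions ?Y \<subseteq> well_typed (states ?Y) (actions ?Y)"
      unfolding tr by blast
    show "mset_closed (transitions ?Y)" "coherent (transitions ?Y)"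
      unfolding tr using X
      by (auto simp: weak_hdts_iff intro!: mset_closed_Int coherent_Int mset_closed_vimage
          coherent_vimage well_typed_closed)
  qed
  show ?p
    by (rule premapI) (use e in \<open>auto simp: copy_hdts_def intro!: rev_image_eqI\<close>)
  show ?q
  proof (rule premapI)
    fix \<alpha> us \<beta> assume "(\<alpha>, us, \<beta>) \<in> transitions ?Y"
    then obtain t where "t \<in> transitions X" "(\<alpha>, us, \<beta>) = tmap e0 e1 t"
      by (auto simp: copy_hdts_def)
    then show "(?g0 \<alpha>, map ?g1 us, ?g0 \<beta>) \<in> transitions X"
      using inv[of t] by (metis tmap_simp)
  qed (use e in \<open>auto simp: copy_hdts_def inv_into_into\<close>)
qed

lemma hdts_isomorphic_copy:
  assumes X: "weak_hdts \<Sigma> X" and e: "inj_on e0 (states X)" "inj_on e1 (actions X)"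
  shows "hdts_isomorphic X (copy_hdts e0 e1 X)"
proof -
  let ?Y = "copy_hdts e0 e1 X"
  let ?g0 = "inv_into (states X) e0" and ?g1 = "inv_into (actions X) e1"
  note iso = copy_hdts_isomorphism[OF assms]
  have "hdts_map X ?Y (restrict e0 (states X)) (restrict e1 (actions X))"
    using premap_cong[OF X iso(2)] by (simp add: hdts_map_iff)
  moreover have "hdts_map ?Y X (restrict ?g0 (states ?Y)) (restrict ?g1 (actions ?Y))"
    using premap_cong[OF iso(1,3)] by (simp add: hdts_map_iff)
  ultimately show ?thesis
    unfolding hdts_isomorphic_def using e
    by (intro exI conjI) (assumption+, auto simp: copy_hdts_def)
qed

text \<open>An isomorphism exhibits the transitions of \<open>Y\<close> as an image of those of
  \<open>X\<close>, and splitting passes to images.\<close>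

lemma isomorphic_splitting:
  assumes "hdts_isomorphic X Y" "weak_hdts \<Sigma> Y" "splitting (transitions X)" "all_used X"
  shows "splitting (transitions Y) \<and> all_used Y"
proof -
  obtain f0 f1 g0 g1 where f: "premap X Y f0 f1" and g: "premap Y X g0 g1"
    and inv: "\<And>\<beta>. \<beta> \<in> states Y \<Longrightarrow> f0 (g0 \<beta>) = \<beta>" "\<And>v. v \<in> actions Y \<Longrightarrow> f1 (g1 v) = v"
    using assms(1) by (auto simp: hdts_isomorphic_def hdts_map_iff)
  have "transitions Y = tmap f0 f1 ` transitions X"
  proof (intro set_eqI iffI)
    fix t assume "t \<in> tmap f0 f1 ` transitions X"
    then show "t \<in> transitions Y"
      using premapD(4)[OF f] by auto
  next
    fix t assume t: "t \<in> transitions Y"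
    obtain \<alpha> us \<beta> where t': "t = (\<alpha>, us, \<beta>)"
      by (cases t)
    note tt = transition_typed[OF assms(2) t[unfolded t']]
    have "map f1 (map g1 us) = us"
      unfolding map_map by (rule map_idI) (use tt(4) inv in auto)
    then have "t = tmap f0 f1 (g0 \<alpha>, map g1 us, g0 \<beta>)"
      using inv(1) tt by (simp add: t' del: map_map)
    then show "t \<in> tmap f0 f1 ` transitions X"
      using premapD(4)[OF g t[unfolded t']] by (rule image_eqI)
  qed
  then have "splitting (transitions Y)"
    using splitting_image assms(3) by metis
  moreover have "all_used Y"
    unfolding all_used_def
  proof
    fix v assume v: "v \<in> actions Y"
    then obtain \<alpha> us \<beta> where "(\<alpha>, us, \<beta>) \<in> transitions X" "g1 v \<in> set us"
      using assms(4) premapD(2)[OF g] by (meson all_used_def)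
    then have "(f0 \<alpha>, map f1 us, f0 \<beta>) \<in> transitions Y" "v \<in> set (map f1 us)"
      using premapD(4)[OF f] inv(2)[OF v] by (auto intro!: rev_image_eqI)
    then show "\<exists>\<alpha> us \<beta>. (\<alpha>, us, \<beta>) \<in> transitions Y \<and> v \<in> set us"
      by blast
  qed
  ultimately show ?thesis ..
qed

text \<open>The structure induced on \<open>L\<close> by pulling transitions back along
  \<open>q\<close>. Actions over the same action of \<open>Y\<close> become clones of each other,
  and if \<open>q\<close> is onto \<open>actions Y\<close>, the projection to \<open>Y\<close> is a
  trivial map.\<close>

definition reindex :: "('s, 'a, 'l) hdts \<Rightarrow> 'a set \<Rightarrow> ('a \<Rightarrow> 'a) \<Rightarrow> ('s, 'a, 'l) hdts" where
  "reindex Y L q = \<lparr>states = states Y, actions = L, label = (\<lambda>u\<in>L. label Y (q u)),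
     transitions = tmap (\<lambda>\<alpha>. \<alpha>) q -` transitions Y \<inter> well_typed (states Y) L\<rparr>"

lemma reindex_simps [simp]:
  "states (reindex Y L q) = states Y" "actions (reindex Y L q) = L"
  "u \<in> L \<Longrightarrow> label (reindex Y L q) u = label Y (q u)"
  "(\<alpha>, us, \<beta>) \<in> transitions (reindex Y L q) \<longleftrightarrow>
     (\<alpha>, map q us, \<beta>) \<in> transitions Y \<and> \<alpha> \<in> states Y \<and> \<beta> \<in> states Y \<and> us \<noteq> [] \<and> set us \<subseteq> L"
  by (auto simp: reindex_def well_typed_def)

lemma weak_hdts_reindex:
  assumes "weak_hdts \<Sigma> Y" "q \<in> L \<rightarrow> actions Y"
  shows "weak_hdts \<Sigma> (reindex Y L q)"
  using assms label_in[OF assms(1)] unfolding weak_hdts_iff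
  by (auto simp: reindex_def intro!: mset_closed_Int coherent_Int mset_closed_vimage coherent_vimage
      well_typed_closed)

lemma regular_singleton:
  assumes "regular False X" "u \<in> actions X"
  obtains \<alpha> \<beta> where "(\<alpha>, [u], \<beta>) \<in> transitions X"
proof -
  obtain \<alpha> us \<beta> where "(\<alpha>, us, \<beta>) \<in> transitions X" "u \<in> set us"
    using assms unfolding regular_def all_used_def by blast
  then show ?thesis
    using assms(1) singleton_transition that unfolding regular_def by metis
qed

lemma regular_reindex:
  assumes "weak_hdts \<Sigma> Y" "regular b Y" "q \<in> L \<rightarrow> actions Y"
  shows "regular b (reindex Y L q)"
proof (cases b)
  case False
  have reg: "regular False Y"
    using assms(2) False by simp
  have "splitting (transitions (reindex Y L q))"
    unfolding splitting_def
  proof (intro allI impI, elim conjE)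
    fix \<alpha> us vs ws \<beta>
    assume t: "(\<alpha>, us, \<beta>) \<in> transitions (reindex Y L q)" and ms: "mset us = mset vs + mset ws"
      and ne: "vs \<noteq> []" "ws \<noteq> []"
    have "set us = set vs \<union> set ws"
      using ms by (metis set_mset_mset set_mset_union)
    have "mset (map q us) = mset (map q vs) + mset (map q ws)"
      using ms by simp
    moreover have "(\<alpha>, map q us, \<beta>) \<in> transitions Y"
      using t by simp
    ultimately obtain \<nu> where \<nu>: "(\<alpha>, map q vs, \<nu>) \<in> transitions Y" "(\<nu>, map q ws, \<beta>) \<in> transitions Y"
      using splittingE reg ne unfolding regular_def by (metis list.map_disc_iff)
    then have "\<nu> \<in> states Y"
      using transition_typed[OF assms(1)] by blast
    then show "\<exists>\<nu>. (\<alpha>, vs, \<nu>) \<in> transitions (reindex Y L q) \<and> (\<nu>, ws, \<beta>) \<in> transitions (reindex Y L q)"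
      using \<nu> t ne \<open>set us = set vs \<union> set ws\<close> by (intro exI[of _ \<nu>]) simp
  qed
  moreover have "all_used (reindex Y L q)"
    unfolding all_used_def
  proof
    fix u assume "u \<in> actions (reindex Y L q)"
    then have u: "u \<in> L" "q u \<in> actions Y"
      using assms(3) by auto
    \<comment> \<open>A 1-transition is chosen because a longer one through \<open>q u\<close> could
      involve actions outside the image of \<open>q\<close>.\<close>
    obtain \<alpha> \<beta> where "(\<alpha>, [q u], \<beta>) \<in> transitions Y"
      using regular_singleton[OF reg u(2)] .
    then have "(\<alpha>, [u], \<beta>) \<in> transitions (reindex Y L q)"
      using u(1) transition_typed[OF assms(1)] by simp
    then show "\<exists>\<alpha> us \<beta>. (\<alpha>, us, \<beta>) \<in> transitions (reindex Y L q) \<and> u \<in> set us"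
      by (meson list.set_intros(1))
  qed
  ultimately show ?thesis
    by (simp add: regular_def)
qed (simp add: regular_def)

definition rel :: "bool \<Rightarrow> ('s, 'a, 'l) hdts \<Rightarrow> 'a \<Rightarrow> 'a \<Rightarrow> bool" where
  "rel b X u v \<longleftrightarrow> u \<in> actions X \<and> v \<in> actions X \<and> label X u = label X v \<and>
     (b \<or> (\<exists>\<alpha> \<beta>. (\<alpha>, [u], \<beta>) \<in> transitions X \<and> (\<alpha>, [v], \<beta>) \<in> transitions X))"

lemma rel_premap: "premap X Y f0 f1 \<Longrightarrow> rel b X u v \<Longrightarrow> rel b Y (f1 u) (f1 v)"
  unfolding rel_def by (auto dest: premapD(4)[of X Y f0 f1] simp: premapD(2,3)) (force dest:
      premapD(4)[of X Y f0 f1])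

section \<open>Orthogonality and model structures\<close>

locale cat =
  fixes K :: "('o, 'm) category"
  assumes category: "is_category K"
begin

lemma ident_Hom: "X \<in> Obj K \<Longrightarrow> Ident K X \<in> Hom K X X"
  using category by (simp add: is_category_def)

lemma comp_Hom: "f \<in> Hom K X Y \<Longrightarrow> g \<in> Hom K Y Z \<Longrightarrow> Comp K g f \<in> Hom K X Z"
  using category unfolding is_category_def Hom_def by fastforce

lemma comp_assoc:
  "f \<in> Hom K X Y \<Longrightarrow> g \<in> Hom K Y Z \<Longrightarrow> h \<in> Hom K Z V \<Longrightarrow>
     Comp K h (Comp K g f) = Comp K (Comp K h g) f"
  using category unfolding is_category_def Hom_def by auto

lemma comp_ident: "f \<in> Hom K X Y \<Longrightarrow> Comp K f (Ident K X) = f"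
  and ident_comp: "f \<in> Hom K X Y \<Longrightarrow> Comp K (Ident K Y) f = f"
  using category unfolding is_category_def Hom_def by auto

lemma Hom_Obj: "f \<in> Hom K X Y \<Longrightarrow> X \<in> Obj K" "f \<in> Hom K X Y \<Longrightarrow> Y \<in> Obj K"
  using category unfolding is_category_def Hom_def by auto

lemma Hom_Arr: "f \<in> Hom K X Y \<Longrightarrow> f \<in> Arr K"
  and Hom_Dom: "f \<in> Hom K X Y \<Longrightarrow> Dom K f = X"
  and Hom_Cod: "f \<in> Hom K X Y \<Longrightarrow> Cod K f = Y"
  and Arr_Hom: "f \<in> Arr K \<Longrightarrow> f \<in> Hom K (Dom K f) (Cod K f)"
  by (auto simp: Hom_def)

section \<open>Orthogonality and its stability properties\<close>

definition orthogonal :: "'m \<Rightarrow> 'o \<Rightarrow> bool" where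
  "orthogonal f Z \<longleftrightarrow> (\<forall>k\<in>Hom K (Dom K f) Z. \<exists>!h. h \<in> Hom K (Cod K f) Z \<and> Comp K h f = k)"

definition local_equivalences :: "'o set \<Rightarrow> 'm set" where
  "local_equivalences \<Z> = {f \<in> Arr K. \<forall>Z\<in>\<Z>. orthogonal f Z}"

lemma orthogonalI:
  assumes f: "f \<in> Hom K X Y"
    and ex: "\<And>k. k \<in> Hom K X Z \<Longrightarrow> \<exists>h\<in>Hom K Y Z. Comp K h f = k"
    and un: "\<And>h h'. h \<in> Hom K Y Z \<Longrightarrow> h' \<in> Hom K Y Z \<Longrightarrow> Comp K h f = Comp K h' f \<Longrightarrow> h = h'"
  shows "orthogonal f Z"
  unfolding orthogonal_def Hom_Dom[OF f] Hom_Cod[OF f] using ex un by metis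

lemma orthogonalE:
  assumes "orthogonal f Z" "f \<in> Hom K X Y" "k \<in> Hom K X Z"
  obtains h where "h \<in> Hom K Y Z" "Comp K h f = k"
  using assms unfolding orthogonal_def by (metis Hom_Dom Hom_Cod)

lemma orthogonal_unique:
  assumes "orthogonal f Z" "f \<in> Hom K X Y" "h \<in> Hom K Y Z" "h' \<in> Hom K Y Z"
    "Comp K h f = Comp K h' f"
  shows "h = h'"
  using assms comp_Hom[OF assms(2,3)] unfolding orthogonal_def by (metis Hom_Dom Hom_Cod)

lemma orthogonal_comp:
  assumes f: "f \<in> Hom K X Y" and g: "g \<in> Hom K Y V" and o: "orthogonal f Z" "orthogonal g Z"
  shows "orthogonal (Comp K g f) Z"
proof (rule orthogonalI[OF comp_Hom[OF f g]])
  fix k assume k: "k \<in> Hom K X Z"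
  obtain h where h: "h \<in> Hom K Y Z" "Comp K h f = k"
    using orthogonalE[OF o(1) f k] .
  obtain h' where h': "h' \<in> Hom K V Z" "Comp K h' g = h"
    using orthogonalE[OF o(2) g h(1)] .
  show "\<exists>h\<in>Hom K V Z. Comp K h (Comp K g f) = k"
    using h h' comp_assoc[OF f g h'(1)] by auto
next
  fix h h' assume h: "h \<in> Hom K V Z" "h' \<in> Hom K V Z" "Comp K h (Comp K g f) = Comp K h' (Comp K g f)"
  then have "Comp K h g = Comp K h' g"
    using orthogonal_unique[OF o(1) f comp_Hom[OF g h(1)] comp_Hom[OF g h(2)]] comp_assoc[OF f g] by auto
  then show "h = h'"
    using orthogonal_unique[OF o(2) g h(1,2)] by blast
qed

lemma orthogonal_cancel_left:
  assumes f: "f \<in> Hom K X Y" and g: "g \<in> Hom K Y V" and o: "orthogonal f Z" "orthogonal (Comp K g f) Z"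
  shows "orthogonal g Z"
proof (rule orthogonalI[OF g])
  fix k assume k: "k \<in> Hom K Y Z"
  obtain h where h: "h \<in> Hom K V Z" "Comp K h (Comp K g f) = Comp K k f"
    using orthogonalE[OF o(2) comp_Hom[OF f g] comp_Hom[OF f k]] .
  then have "Comp K h g = k"
    using orthogonal_unique[OF o(1) f comp_Hom[OF g h(1)] k] comp_assoc[OF f g h(1)] by auto
  with h show "\<exists>h\<in>Hom K V Z. Comp K h g = k"
    by blast
next
  fix h h' assume h: "h \<in> Hom K V Z" "h' \<in> Hom K V Z" "Comp K h g = Comp K h' g"
  then show "h = h'"
    using orthogonal_unique[OF o(2) comp_Hom[OF f g] h(1,2)] comp_assoc[OF f g] by metis
qed

text \<open>For uniqueness, two competing extensions are themselves extended along \<open>g\<close>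
  and then compared on the composite.\<close>

lemma orthogonal_cancel_right:
  assumes f: "f \<in> Hom K X Y" and g: "g \<in> Hom K Y V" and o: "orthogonal g Z" "orthogonal (Comp K g f) Z"
  shows "orthogonal f Z"
proof (rule orthogonalI[OF f])
  fix k assume k: "k \<in> Hom K X Z"
  obtain h where h: "h \<in> Hom K V Z" "Comp K h (Comp K g f) = k"
    using orthogonalE[OF o(2) comp_Hom[OF f g] k] .
  then show "\<exists>h\<in>Hom K Y Z. Comp K h f = k"
    using comp_assoc[OF f g h(1)] comp_Hom[OF g h(1)] by metis
next
  fix h h' assume h: "h \<in> Hom K Y Z" "h' \<in> Hom K Y Z" and eq: "Comp K h f = Comp K h' f"
  obtain l where l: "l \<in> Hom K V Z" "Comp K l g = h"
    using orthogonalE[OF o(1) g h(1)] .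
  obtain l' where l': "l' \<in> Hom K V Z" "Comp K l' g = h'"
    using orthogonalE[OF o(1) g h(2)] .
  have "Comp K l (Comp K g f) = Comp K l' (Comp K g f)"
    using comp_assoc[OF f g l(1)] comp_assoc[OF f g l'(1)] l l' eq by simp
  then show "h = h'"
    using orthogonal_unique[OF o(2) comp_Hom[OF f g] l(1) l'(1)] l l' by auto
qed

lemma two_out_of_three_local_equivalences: "two_out_of_three K (local_equivalences \<Z>)"
  unfolding two_out_of_three_def
proof (intro ballI impI)
  fix f g assume fg: "f \<in> Arr K" "g \<in> Arr K" "Cod K f = Dom K g"
  have f: "f \<in> Hom K (Dom K f) (Cod K f)" and g: "g \<in> Hom K (Cod K f) (Cod K g)"
    using fg by (auto simp: Hom_def)
  have "Comp K g f \<in> Arr K"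
    using comp_Hom[OF f g] by (rule Hom_Arr)
  then show "(f \<in> local_equivalences \<Z> \<and> g \<in> local_equivalences \<Z> \<longrightarrow> Comp K g f \<in> local_equivalences \<Z>) \<and>
      (f \<in> local_equivalences \<Z> \<and> Comp K g f \<in> local_equivalences \<Z> \<longrightarrow> g \<in> local_equivalences \<Z>) \<and>
      (g \<in> local_equivalences \<Z> \<and> Comp K g f \<in> local_equivalences \<Z> \<longrightarrow> f \<in> local_equivalences \<Z>)"
    unfolding local_equivalences_def mem_Collect_eq
    using fg(1,2) orthogonal_comp[OF f g] orthogonal_cancel_left[OF f g] orthogonal_cancel_right[OF f g]
    by meson
qed

text \<open>An extension problem for \<open>f\<close> is carried to \<open>g\<close> by the
  retraction \<open>r\<close>, solved there, and brought back by \<open>s'\<close>.\<close>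

lemma orthogonal_retract:
  assumes "is_retract K f g" "orthogonal g Z"
  shows "orthogonal f Z"
proof -
  obtain s r s' r' where fA: "f \<in> Arr K" "g \<in> Arr K"
    and s: "s \<in> Hom K (Dom K f) (Dom K g)" and r: "r \<in> Hom K (Dom K g) (Dom K f)"
    and s': "s' \<in> Hom K (Cod K f) (Cod K g)" and r': "r' \<in> Hom K (Cod K g) (Cod K f)"
    and eq: "Comp K r s = Ident K (Dom K f)" "Comp K r' s' = Ident K (Cod K f)"
      "Comp K g s = Comp K s' f" "Comp K f r = Comp K r' g"
    using assms(1) unfolding is_retract_def by blast
  note f = Arr_Hom[OF fA(1)] and g = Arr_Hom[OF fA(2)]
  show ?thesis
  proof (rule orthogonalI[OF f])
    fix k assume k: "k \<in> Hom K (Dom K f) Z"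
    obtain h where h: "h \<in> Hom K (Cod K g) Z" "Comp K h g = Comp K k r"
      using orthogonalE[OF assms(2) g comp_Hom[OF r k]] .
    have "Comp K (Comp K h s') f = Comp K h (Comp K g s)"
      by (simp add: eq comp_assoc[OF f s' h(1)])
    also have "\<dots> = Comp K (Comp K k r) s"
      by (simp add: comp_assoc[OF s g h(1)] h)
    also have "\<dots> = Comp K k (Comp K r s)"
      by (simp add: comp_assoc[OF s r k])
    also have "\<dots> = k"
      by (simp add: eq comp_ident[OF k])
    finally show "\<exists>h\<in>Hom K (Cod K f) Z. Comp K h f = k"
      using comp_Hom[OF s' h(1)] by blast
  next
    fix h h' assume h: "h \<in> Hom K (Cod K f) Z" "h' \<in> Hom K (Cod K f) Z" "Comp K h f = Comp K h' f"
    have "Comp K (Comp K h r') g = Comp K (Comp K h' r') g"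
      using h comp_assoc[OF g r' h(1)] comp_assoc[OF g r' h(2)] comp_assoc[OF r f h(1)]
        comp_assoc[OF r f h(2)] eq(4) by simp
    then have "Comp K h r' = Comp K h' r'"
      using orthogonal_unique[OF assms(2) g] comp_Hom[OF r'] h by blast
    then have "Comp K h (Comp K r' s') = Comp K h' (Comp K r' s')"
      using comp_assoc[OF s' r' h(1)] comp_assoc[OF s' r' h(2)] by simp
    then show "h = h'"
      by (simp add: eq comp_ident[OF h(1)] comp_ident[OF h(2)])
  qed
qed

lemma closed_under_retracts_local_equivalences: "closed_under_retracts K (local_equivalences \<Z>)"
proof -
  have "f \<in> Arr K" if "is_retract K f g" for f g
    using that by (simp add: is_retract_def)
  then show ?thesis
    unfolding closed_under_retracts_def local_equivalences_def using orthogonal_retract by blast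
qed

text \<open>To extend \<open>k\<close> along \<open>f'\<close>, extend its restriction
  \<open>k g\<close> along \<open>f\<close> and glue the result to \<open>k\<close>; uniqueness is
  inherited from \<open>f\<close> and the universal property.\<close>

lemma orthogonal_pushout:
  assumes po: "is_pushout K f g f' g'" and o: "orthogonal f Z"
  shows "orthogonal f' Z"
proof -
  have f: "f \<in> Hom K (Dom K f) (Cod K f)" and g: "g \<in> Hom K (Dom K f) (Cod K g)"
    and f': "f' \<in> Hom K (Cod K g) (Cod K f')" and g': "g' \<in> Hom K (Cod K f) (Cod K f')"
    and sq: "Comp K f' g = Comp K g' f"
    using po unfolding is_pushout_def Hom_def by auto
  have univ: "\<exists>!h. h \<in> Hom K (Cod K f') Z \<and> Comp K h f' = a \<and> Comp K h g' = b"
    if a: "a \<in> Hom K (Cod K g) Z" and b: "b \<in> Hom K (Cod K f) Z" and "Comp K a g = Comp K b f" for a b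
  proof -
    have "\<forall>a\<in>Arr K. \<forall>b\<in>Arr K.
        Dom K a = Cod K g \<and> Dom K b = Cod K f \<and> Cod K a = Cod K b \<and> Comp K a g = Comp K b f \<longrightarrow>
        (\<exists>!h. h \<in> Hom K (Cod K f') (Cod K a) \<and> Comp K h f' = a \<and> Comp K h g' = b)"
      using po unfolding is_pushout_def by (elim conjE)
    from this[rule_format, OF Hom_Arr[OF a] Hom_Arr[OF b]] that show ?thesis
      by (simp add: Hom_Dom[OF a] Hom_Dom[OF b] Hom_Cod[OF a] Hom_Cod[OF b])
  qed
  show ?thesis
  proof (rule orthogonalI[OF f'])
    fix k assume k: "k \<in> Hom K (Cod K g) Z"
    obtain b where "b \<in> Hom K (Cod K f) Z" "Comp K b f = Comp K k g"
      using orthogonalE[OF o f comp_Hom[OF g k]] .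
    then show "\<exists>h\<in>Hom K (Cod K f') Z. Comp K h f' = k"
      using univ[OF k] by metis
  next
    fix h h' assume h: "h \<in> Hom K (Cod K f') Z" "h' \<in> Hom K (Cod K f') Z" "Comp K h f' = Comp K h' f'"
    have "Comp K (Comp K h g') f = Comp K (Comp K h' g') f"
      using comp_assoc[OF f g' h(1)] comp_assoc[OF f g' h(2)] comp_assoc[OF g f' h(1)]
        comp_assoc[OF g f' h(2)] sq h(3) by simp
    then have "Comp K h g' = Comp K h' g'"
      using orthogonal_unique[OF o f] comp_Hom[OF g'] h by blast
    moreover have "Comp K (Comp K h f') g = Comp K (Comp K h g') f"
      using comp_assoc[OF f g' h(1)] comp_assoc[OF g f' h(1)] sq by simp
    ultimately show "h = h'"
      using univ[OF comp_Hom[OF f' h(1)] comp_Hom[OF g' h(1)]] h by metis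
  qed
qed

lemma closed_under_pushout_local_equivalences:
  assumes "closed_under_pushout K A"
  shows "closed_under_pushout K (A \<inter> local_equivalences \<Z>)"
proof -
  have "f' \<in> Arr K" if "is_pushout K f g f' g'" for f g f' g'
    using that by (simp add: is_pushout_def)
  then show ?thesis
    using assms unfolding closed_under_pushout_def local_equivalences_def using orthogonal_pushout
    by blast
qed

lemma functor_order_category:
  assumes "is_functor (order_category r) K D"
  shows "i \<in> Field r \<Longrightarrow> fobj D i \<in> Obj K" "i \<in> Field r \<Longrightarrow> fmap D (i, i) = Ident K (fobj D i)"
    "(i, j) \<in> r \<Longrightarrow> fmap D (i, j) \<in> Hom K (fobj D i) (fobj D j)"
    "(i, j) \<in> r \<Longrightarrow> (j, k) \<in> r \<Longrightarrow> fmap D (i, k) = Comp K (fmap D (j, k)) (fmap D (i, j))"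
  using assms unfolding is_functor_def order_category_def by force+

lemma cocone_order_category:
  "is_cocone (order_category r) K D L \<iota> \<longleftrightarrow>
     L \<in> Obj K \<and> (\<forall>j\<in>Field r. \<iota> j \<in> Hom K (fobj D j) L) \<and>
     (\<forall>(i, j)\<in>r. Comp K (\<iota> j) (fmap D (i, j)) = \<iota> i)"
  by (auto simp: is_cocone_def order_category_def)

text \<open>A map on the first stage extends uniquely to every stage, and uniqueness makes these
  extensions a cocone. The subrelation \<open>s\<close> is either the whole chain or the part below
  a limit element.\<close>

lemma orthogonal_chain_colimit:
  assumes D: "is_functor (order_category r) K D" and col: "is_colimit (order_category s) K D L \<iota>"
    and s: "s \<subseteq> r" "i0 \<in> Field s" "\<And>j. j \<in> Field s \<Longrightarrow> (i0, j) \<in> s"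
    and o: "\<And>j. j \<in> Field s \<Longrightarrow> orthogonal (fmap D (i0, j)) Z" and Z: "Z \<in> Obj K"
  shows "orthogonal (\<iota> i0) Z"
proof -
  note func = functor_order_category[OF D]
  have co: "\<And>j. j \<in> Field s \<Longrightarrow> \<iota> j \<in> Hom K (fobj D j) L"
    "\<And>i j. (i, j) \<in> s \<Longrightarrow> Comp K (\<iota> j) (fmap D (i, j)) = \<iota> i"
    using col unfolding is_colimit_def cocone_order_category by auto
  have Ds: "fmap D (i0, j) \<in> Hom K (fobj D i0) (fobj D j)" if "j \<in> Field s" for j
    using func(3) s that by blast
  have fld: "i \<in> Field s" "j \<in> Field s" if "(i, j) \<in> s" for i j
    using that by (auto simp: Field_def)
  have univ: "\<exists>!h. h \<in> Hom K L Z \<and> (\<forall>j\<in>Field s. Comp K h (\<iota> j) = \<kappa> j)"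
    if "\<And>j. j \<in> Field s \<Longrightarrow> \<kappa> j \<in> Hom K (fobj D j) Z"
      "\<And>i j. (i, j) \<in> s \<Longrightarrow> Comp K (\<kappa> j) (fmap D (i, j)) = \<kappa> i" for \<kappa>
  proof -
    have "is_cocone (order_category s) K D Z \<kappa>"
      unfolding cocone_order_category using that Z by auto
    then have "\<exists>!h. h \<in> Hom K L Z \<and> (\<forall>j\<in>Obj (order_category s). Comp K h (\<iota> j) = \<kappa> j)"
      using col unfolding is_colimit_def by blast
    then show ?thesis
      by (simp add: order_category_def)
  qed
  show ?thesis
  proof (rule orthogonalI[OF co(1)[OF s(2)]])
    fix k assume k: "k \<in> Hom K (fobj D i0) Z"
    have "\<forall>j\<in>Field s. \<exists>h\<in>Hom K (fobj D j) Z. Comp K h (fmap D (i0, j)) = k"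
      using orthogonalE[OF o Ds k] by metis
    then obtain \<kappa> where \<kappa>: "\<And>j. j \<in> Field s \<Longrightarrow> \<kappa> j \<in> Hom K (fobj D j) Z"
      "\<And>j. j \<in> Field s \<Longrightarrow> Comp K (\<kappa> j) (fmap D (i0, j)) = k"
      by metis
    \<comment> \<open>Both sides extend \<open>k\<close> along the map from \<open>i0\<close> to
      stage \<open>i\<close>.\<close>
    have "Comp K (\<kappa> j) (fmap D (i, j)) = \<kappa> i" if ij: "(i, j) \<in> s" for i j
    proof (rule orthogonal_unique[OF o Ds])
      note fl = fld[OF ij]
      show "i \<in> Field s" "i \<in> Field s" "\<kappa> i \<in> Hom K (fobj D i) Z"
        "Comp K (\<kappa> j) (fmap D (i, j)) \<in> Hom K (fobj D i) Z"
        using fl \<kappa>(1) comp_Hom func(3) ij s(1) by blast+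
      show "Comp K (Comp K (\<kappa> j) (fmap D (i, j))) (fmap D (i0, i)) = Comp K (\<kappa> i) (fmap D (i0, i))"
        using comp_assoc[OF Ds[OF fl(1)] func(3) \<kappa>(1)[OF fl(2)]] func(4)[of i0 i j] ij s fl \<kappa>(2)
        by (metis subsetD)
    qed
    then obtain h where "h \<in> Hom K L Z" "\<forall>j\<in>Field s. Comp K h (\<iota> j) = \<kappa> j"
      using univ[of \<kappa>] \<kappa>(1) by metis
    moreover have "\<kappa> i0 = k"
    proof -
      have "i0 \<in> Field r"
        using s by (auto simp: Field_def)
      then show ?thesis
        using \<kappa>[OF s(2)] func(2) comp_ident by metis
    qed
    ultimately show "\<exists>h\<in>Hom K L Z. Comp K h (\<iota> i0) = k"
      using s(2) by blast
  next
    fix h h' assume h: "h \<in> Hom K L Z" "h' \<in> Hom K L Z" "Comp K h (\<iota> i0) = Comp K h' (\<iota> i0)"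
    have eq: "Comp K h (\<iota> j) = Comp K h' (\<iota> j)" if j: "j \<in> Field s" for j
    proof (rule orthogonal_unique[OF o Ds])
      show "Comp K (Comp K h (\<iota> j)) (fmap D (i0, j)) = Comp K (Comp K h' (\<iota> j)) (fmap D (i0, j))"
        using comp_assoc[OF Ds[OF j] co(1)[OF j] h(1)] comp_assoc[OF Ds[OF j] co(1)[OF j] h(2)]
          co(2)[OF s(3)[OF j]] h(3) by simp
    qed (use j h co comp_Hom in blast)+
    have "\<exists>!l. l \<in> Hom K L Z \<and> (\<forall>j\<in>Field s. Comp K l (\<iota> j) = Comp K h (\<iota> j))"
    proof (rule univ)
      fix i j assume ij: "(i, j) \<in> s"
      then have "fmap D (i, j) \<in> Hom K (fobj D i) (fobj D j)"
        using func(3) s(1) by blast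
      then show "Comp K (Comp K h (\<iota> j)) (fmap D (i, j)) = Comp K h (\<iota> i)"
        using comp_assoc[OF _ co(1)[OF fld(2)[OF ij]] h(1)] co(2)[OF ij] by metis
    qed (use co(1) h(1) comp_Hom in blast)
    then show "h = h'"
      using h(1,2) eq by metis
  qed
qed

end

section \<open>Induction along transfinite compositions\<close>

lemma Well_order_cases:
  assumes "Well_order r" "i \<in> Field r"
  obtains "is_least r i" | j where "is_succ r j i" | "is_limit_element r i"
  using assms unfolding is_limit_element_def by blast

lemma linear_order_least:
  assumes "linear_order_on (Field s) s" "is_least s i0" "j \<in> Field s"
  shows "(i0, j) \<in> s"
proof -
  have "refl_on (Field s) s" "total_on (Field s) s"
    using assms(1) by (auto simp: linear_order_on_def partial_order_on_def preorder_on_def)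
  moreover have "i0 \<in> Field s" "i0 \<noteq> j \<Longrightarrow> (j, i0) \<notin> s"
    using assms(2) by (auto simp: is_least_def underS_def)
  ultimately show ?thesis
    using assms(3) by (cases "i0 = j") (auto simp: refl_on_def total_on_def)
qed

lemma Field_Restr_underS:
  assumes "Well_order r"
  shows "Field (Restr r (underS r i)) = underS r i"
proof -
  have "(j, j) \<in> r" if "j \<in> underS r i" for j
    using assms that unfolding well_order_on_def linear_order_on_def partial_order_on_def
      preorder_on_def refl_on_def by (auto simp: underS_def Field_def)
  then show ?thesis
    by (auto simp: Field_def)
qed

lemma Well_order_induct [consumes 2, case_names less]:
  assumes "Well_order r" "i \<in> Field r"
    and step: "\<And>i. i \<in> Field r \<Longrightarrow> (\<And>j. j \<in> underS r i \<Longrightarrow> P j) \<Longrightarrow> P i"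
  shows "P i"
proof -
  have wf: "wf (r - Id)"
    using assms(1) by (simp add: well_order_on_def)
  show ?thesis
    using wf assms(2)
  proof (induction i rule: wf_induct_rule)
    case (less i)
    show ?case
      by (rule step[OF less.prems]) (auto intro!: less.IH simp: underS_def Field_def)
  qed
qed

text \<open>\<open>P\<close> is proved for the maps between all pairs of stages and not only for
  those leaving the least one. The limit rule then knows every map of the chain and concludes for
  every injection, which is the strength needed to show that colimit injections are injective on
  actions.\<close>

lemma (in cat) transfinite_composition_induct:
  fixes U :: "'u set"
  assumes tc: "is_transfinite_composition U K A f"
    and ident: "\<And>X. X \<in> Obj K \<Longrightarrow> P (Ident K X)"
    and step: "\<And>X Y Z g h. g \<in> Hom K X Y \<Longrightarrow> P g \<Longrightarrow> h \<in> Hom K Y Z \<Longrightarrow> h \<in> A \<Longrightarrow> P (Comp K h g)"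
    and lim: "\<And>(r :: 'u rel) s D L \<iota> i0 j. Well_order r \<Longrightarrow> is_functor (order_category r) K D \<Longrightarrow> s \<subseteq> r \<Longrightarrow>
        linear_order_on (Field s) s \<Longrightarrow>
        is_colimit (order_category s) K D L \<iota> \<Longrightarrow> (\<And>i k. (i, k) \<in> s \<Longrightarrow> P (fmap D (i, k))) \<Longrightarrow>
        is_least s i0 \<Longrightarrow> j \<in> Field s \<Longrightarrow> P (\<iota> j)"
  shows "P f"
proof -
  from tc obtain r :: "'u rel" and D L \<iota> i0 where r: "Well_order r" and i0: "is_least r i0"
    and D: "is_functor (order_category r) K D" and suc: "\<And>i j. is_succ r i j \<Longrightarrow> fmap D (i, j) \<in> A"
    and limit: "\<And>i. is_limit_element r i \<Longrightarrow>
      is_colimit (order_category (Restr r (underS r i))) K D (fobj D i) (\<lambda>j. fmap D (j, i))"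
    and L: "is_colimit (order_category r) K D L \<iota>" and f: "f = \<iota> i0"
    unfolding is_transfinite_composition_def by blast
  note func = functor_order_category[OF D]
  have lin_r: "linear_order_on (Field r) r"
    using r by (simp add: well_order_on_def)
  have "\<forall>j. (j, i) \<in> r \<longrightarrow> P (fmap D (j, i))" if "i \<in> Field r" for i
    using r that
  proof (induction i rule: Well_order_induct)
    case (less i)
    have refl: "P (fmap D (i, i))"
      using func(1,2) ident less(1) by simp
    have IH: "P (fmap D (j, k))" if "(j, k) \<in> r" "k \<in> underS r i" for j k
      using less(2) that by blast
    from r less(1) show ?case
    proof (cases rule: Well_order_cases)
      case 1
      then show ?thesis
        using refl by (auto simp: is_least_def underS_def)
    next
      case (2 k)
      then have k: "(k, i) \<in> r" "k \<in> underS r i" "fmap D (k, i) \<in> A"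
        using suc by (auto simp: is_succ_def underS_def)
      show ?thesis
      proof (intro allI impI)
        fix j assume ji: "(j, i) \<in> r"
        show "P (fmap D (j, i))"
        proof (cases "j = i")
          case False
          then have jk: "(j, k) \<in> r"
            using 2 ji by (auto simp: is_succ_def underS_def)
          then show ?thesis
            using func(4)[OF jk k(1)] step[OF func(3)[OF jk] IH[OF jk k(2)] func(3)[OF k(1)] k(3)]
                by simp
        qed (use refl in simp)
      qed
    next
      case 3
      let ?s = "Restr r (underS r i)"
      note F = Field_Restr_underS[OF r, of i]
      have "(i0, i) \<in> r" "i0 \<noteq> i"
        using linear_order_least[OF lin_r i0 less(1)] i0 3 by (auto simp: is_limit_element_def)
      then have least: "is_least ?s i0"
        using i0 unfolding is_least_def F by (auto simp: underS_def)
      have lin: "linear_order_on (Field ?s) ?s"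
        using r Linear_order_Restr unfolding well_order_on_def by blast
      show ?thesis
      proof (intro allI impI)
        fix j assume ji: "(j, i) \<in> r"
        show "P (fmap D (j, i))"
        proof (cases "j = i")
          case False
          show ?thesis
          proof (rule lim[OF r D _ lin limit[OF 3] _ least])
            show "j \<in> Field ?s"
              using False ji unfolding F by (auto simp: underS_def)
          qed (use IH in auto)
        qed (use refl in simp)
      qed
    qed
  qed
  then have "P (fmap D (i, k))" if "(i, k) \<in> r" for i k
    using that by (auto simp: Field_def)
  \<comment> \<open>The colimit of the whole chain obeys the same rule as a limit stage, with
    \<open>s = r\<close>.\<close>
  then show ?thesis
    unfolding f using r i0
    by (intro lim[OF r D _ _ L _ i0]) (auto simp: is_least_def well_order_on_def)
qed

context cat
begin

lemma orthogonal_ident: "X \<in> Obj K \<Longrightarrow> orthogonal (Ident K X) Z"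
  by (rule orthogonalI[OF ident_Hom]) (auto simp: comp_ident)

text \<open>The colimit argument yields the injection at the least stage; the injection at stage
  \<open>j\<close> follows by cancelling the map from the least stage to \<open>j\<close>.\<close>

lemma orthogonal_transfinite_composition:
  fixes U :: "'u set"
  assumes tc: "is_transfinite_composition U K A f" and A: "\<And>g. g \<in> A \<Longrightarrow> orthogonal g Z"
    and Z: "Z \<in> Obj K"
  shows "orthogonal f Z"
  using tc
proof (rule transfinite_composition_induct)
  fix r :: "'u rel" and s D L \<iota> i0 j
  assume D: "is_functor (order_category r) K D" and s: "s \<subseteq> r" "linear_order_on (Field s) s"
    and L: "is_colimit (order_category s) K D L \<iota>" and o: "\<And>i k. (i, k) \<in> s \<Longrightarrow> orthogonal (fmap D
        (i, k)) Z"
    and i0: "is_least s i0" and j: "j \<in> Field s"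
  note least = linear_order_least[OF s(2) i0]
  have i0': "i0 \<in> Field s"
    using i0 by (simp add: is_least_def)
  have "orthogonal (\<iota> i0) Z"
    by (rule orthogonal_chain_colimit[OF D L s(1) i0' least o[OF least] Z])
  moreover have "\<iota> i0 = Comp K (\<iota> j) (fmap D (i0, j))" "\<iota> j \<in> Hom K (fobj D j) L"
    using L j least[OF j] unfolding is_colimit_def cocone_order_category by auto
  moreover have "fmap D (i0, j) \<in> Hom K (fobj D i0) (fobj D j)"
    using functor_order_category(3)[OF D] least[OF j] s(1) by blast
  ultimately show "orthogonal (\<iota> j) Z"
    using orthogonal_cancel_left o least[OF j] by metis
qed (use A orthogonal_ident orthogonal_comp in blast)+

lemma closed_under_transfinite_composition_local_equivalences:
  assumes "closed_under_transfinite_composition U K A" "\<Z> \<subseteq> Obj K" "A \<subseteq> Arr K"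
  shows "closed_under_transfinite_composition U K (A \<inter> local_equivalences \<Z>)"
  unfolding closed_under_transfinite_composition_def
proof (intro allI impI)
  fix f assume f: "is_transfinite_composition U K (A \<inter> local_equivalences \<Z>) f"
  then have "is_transfinite_composition U K A f"
    unfolding is_transfinite_composition_def by blast
  then have "f \<in> A"
    using assms(1) by (simp add: closed_under_transfinite_composition_def)
  moreover have "orthogonal f Z" if "Z \<in> \<Z>" for Z
    using f by (rule orthogonal_transfinite_composition) (use that assms(2) in \<open>auto simp:
        local_equivalences_def\<close>)
  ultimately show "f \<in> A \<inter> local_equivalences \<Z>"
    using assms(3) by (auto simp: local_equivalences_def)
qed

section \<open>Lifting properties and the retract argument\<close>

lemma has_liftingE:
  assumes "has_lifting K i p" "i \<in> Hom K A B" "p \<in> Hom K X Y" "u \<in> Hom K A X" "v \<in> Hom K B Y"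
    "Comp K p u = Comp K v i"
  obtains h where "h \<in> Hom K B X" "Comp K h i = u" "Comp K p h = v"
  using assms unfolding has_lifting_def by (auto simp: Hom_def)

lemma has_liftingI:
  assumes "i \<in> Hom K A B" "p \<in> Hom K X Y"
    and "\<And>u v. u \<in> Hom K A X \<Longrightarrow> v \<in> Hom K B Y \<Longrightarrow> Comp K p u = Comp K v i \<Longrightarrow>
      \<exists>h\<in>Hom K B X. Comp K h i = u \<and> Comp K p h = v"
  shows "has_lifting K i p"
  using assms unfolding has_lifting_def by (auto simp: Hom_def)

text \<open>The retract argument: a lift in the square with edges \<open>Ident K X\<close> and
  \<open>p\<close> splits \<open>i\<close> over \<open>Y\<close>.\<close>

lemma retract_of_factorization:
  assumes i: "i \<in> Hom K X Z" and p: "p \<in> Hom K Z Y" and l: "has_lifting K i (Comp K p i)"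
  shows "is_retract K (Comp K p i) p"
proof -
  note f = comp_Hom[OF i p]
  note X = Hom_Obj(1)[OF i] and Y = Hom_Obj(2)[OF p]
  obtain h where "h \<in> Hom K Z X" "Comp K h i = Ident K X" "Comp K (Comp K p i) h = p"
    by (rule has_liftingE[OF l i f ident_Hom[OF X] p comp_ident[OF f]])
  then show ?thesis
    unfolding is_retract_def Hom_Dom[OF f] Hom_Cod[OF f] Hom_Dom[OF p] Hom_Cod[OF p]
    using i p f ident_Hom[OF Y] comp_ident[OF ident_Hom[OF Y]] ident_comp[OF f] ident_comp[OF p]
    by (metis Hom_Arr)
qed

lemma closed_under_retracts_inj_class:
  assumes A: "A \<subseteq> Arr K"
  shows "closed_under_retracts K (inj_class K A)"
  unfolding closed_under_retracts_def
proof (intro allI impI, elim conjE)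
  fix f g assume g: "g \<in> inj_class K A" and "is_retract K f g"
  then obtain s r s' r' where fA: "f \<in> Arr K" "g \<in> Arr K"
    and s: "s \<in> Hom K (Dom K f) (Dom K g)" and r: "r \<in> Hom K (Dom K g) (Dom K f)"
    and s': "s' \<in> Hom K (Cod K f) (Cod K g)" and r': "r' \<in> Hom K (Cod K g) (Cod K f)"
    and eq: "Comp K r s = Ident K (Dom K f)" "Comp K r' s' = Ident K (Cod K f)"
      "Comp K g s = Comp K s' f" "Comp K f r = Comp K r' g"
    unfolding is_retract_def by blast
  note fH = Arr_Hom[OF fA(1)] and gH = Arr_Hom[OF fA(2)]
  show "f \<in> inj_class K A"
    unfolding inj_class_def mem_Collect_eq
  proof (intro conjI ballI fA(1))
    fix i assume i: "i \<in> A"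
    have l: "has_lifting K i g"
      using g i by (simp add: inj_class_def)
    show "has_lifting K i f"
      unfolding has_lifting_def
    proof (intro ballI impI)
      fix u v assume u: "u \<in> Hom K (Dom K i) (Dom K f)" and v: "v \<in> Hom K (Cod K i) (Cod K f)"
        and sq: "Comp K f u = Comp K v i"
      show "\<exists>h\<in>Hom K (Cod K i) (Dom K f). Comp K h i = u \<and> Comp K f h = v"
      proof -
        have iH: "i \<in> Hom K (Dom K i) (Cod K i)"
          using A i by (intro Arr_Hom) blast
        have "Comp K g (Comp K s u) = Comp K (Comp K s' v) i"
          using comp_assoc[OF u s gH] comp_assoc[OF u fH s'] comp_assoc[OF iH v s'] eq sq by simp
        then obtain h where h: "h \<in> Hom K (Cod K i) (Dom K g)" "Comp K h i = Comp K s u"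
          "Comp K g h = Comp K s' v"
          using has_liftingE[OF l iH gH comp_Hom[OF u s] comp_Hom[OF v s']] by blast
        have "Comp K (Comp K r h) i = u"
          using comp_assoc[OF iH h(1) r] comp_assoc[OF u s r] h(2) eq(1) ident_comp[OF u] by simp
        moreover have "Comp K f (Comp K r h) = v"
          using comp_assoc[OF h(1) r fH] comp_assoc[OF h(1) gH r'] comp_assoc[OF v s' r'] h(3) eq(2,4)
            ident_comp[OF v] by simp
        ultimately show ?thesis
          using comp_Hom[OF h(1) r] by blast
      qed
    qed
  qed
qed

text \<open>By the retract argument each map of \<open>inj_class K A\<close> is a retract of the
  right factor of any of its factorizations, hence it is enough to understand one convenient class
  \<open>T\<close> of right factors.\<close>

lemma inj_class_subset:
  assumes "has_factorizations K A T" "T \<subseteq> W" "closed_under_retracts K W"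
    and "A \<subseteq> Arr K" "T \<subseteq> Arr K"
  shows "inj_class K A \<subseteq> W"
proof
  fix f assume f: "f \<in> inj_class K A"
  then have "f \<in> Arr K"
    by (simp add: inj_class_def)
  then obtain i p where ip: "i \<in> A" "p \<in> T" "f = Comp K p i" "Dom K i = Dom K f" "Cod K i = Dom K p"
      "Cod K p = Cod K f"
    using assms(1) unfolding has_factorizations_def by blast
  then have H: "i \<in> Hom K (Dom K f) (Dom K p)" "p \<in> Hom K (Dom K p) (Cod K f)"
    using assms(4,5) by (auto simp: Hom_def)
  have "is_retract K f p"
    using retract_of_factorization[OF H] f ip(1,3) by (simp add: inj_class_def)
  then show "f \<in> W"
    using assms(2,3) ip(2) unfolding closed_under_retracts_def by blast
qed

text \<open>With fibrations defined by lifting, the remaining point is that a fibration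
  \<open>f\<close> in \<open>W\<close> lifts against all of \<open>C\<close>. Factor
  \<open>f = p j\<close> with \<open>p\<close> in \<open>inj_class K C\<close>. Two-out-of-three
  puts \<open>j\<close> in \<open>W\<close>, so \<open>f\<close> lifts against \<open>j\<close> and
  is a retract of \<open>p\<close>.\<close>

lemma model_structureI:
  assumes lim: "has_small_limits U K" "has_small_colimits U K"
    and C: "C \<subseteq> Arr K" "closed_under_retracts K C"
    and W: "W \<subseteq> Arr K" "two_out_of_three K W" "closed_under_retracts K W"
    and triv: "inj_class K C \<subseteq> W" "has_factorizations K C (inj_class K C)"
    and fact: "has_factorizations K (C \<inter> W) (inj_class K (C \<inter> W))"
  shows "model_structure U K C W (inj_class K (C \<inter> W))"
  unfolding model_structure_def
proof (intro conjI)
  let ?F = "inj_class K (C \<inter> W)"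
  show "\<forall>i\<in>C. \<forall>p\<in>?F \<inter> W. has_lifting K i p"
  proof (intro ballI)
    fix i f assume i: "i \<in> C" and f: "f \<in> ?F \<inter> W"
    then have "f \<in> Arr K"
      using W by blast
    then obtain j p where jp: "j \<in> C" "p \<in> inj_class K C" "f = Comp K p j"
      "Dom K j = Dom K f" "Cod K j = Dom K p" "Cod K p = Cod K f"
      using triv(2) unfolding has_factorizations_def by blast
    have jp': "j \<in> Arr K" "p \<in> Arr K" "j \<in> Hom K (Dom K f) (Dom K p)" "p \<in> Hom K (Dom K p) (Cod K f)"
      using jp C by (auto simp: Hom_def inj_class_def)
    have "j \<in> W"
      using W(2) jp jp' triv(1) f unfolding two_out_of_three_def by blast
    then have "has_lifting K j f"
      using f jp(1) by (simp add: inj_class_def)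
    then have "is_retract K f p"
      using retract_of_factorization[OF jp'(3,4)] jp(3) by simp
    then have "f \<in> inj_class K C"
      using closed_under_retracts_inj_class[OF C(1)] jp(2) unfolding closed_under_retracts_def by blast
    then show "has_lifting K i f"
      using i by (simp add: inj_class_def)
  qed
  show "has_factorizations K C (?F \<inter> W)"
  proof -
    have "inj_class K C \<subseteq> ?F \<inter> W"
      using triv(1) by (auto simp: inj_class_def)
    then show ?thesis
      using triv(2) unfolding has_factorizations_def by blast
  qed
  show "closed_under_retracts K ?F"
    using C(1) by (intro closed_under_retracts_inj_class) blast
qed (use assms category in \<open>auto simp: inj_class_def\<close>)

end

section \<open>Full subcategories and coreflections\<close>

lemma full_subcategory_simps [simp]:
  "Obj (full_subcategory K Q) = {X \<in> Obj K. Q X}"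
  "Dom (full_subcategory K Q) = Dom K" "Cod (full_subcategory K Q) = Cod K"
  "Ident (full_subcategory K Q) = Ident K" "Comp (full_subcategory K Q) = Comp K"
  "f \<in> Arr (full_subcategory K Q) \<longleftrightarrow> f \<in> Arr K \<and> Q (Dom K f) \<and> Q (Cod K f)"
  by (auto simp: full_subcategory_def)

lemma Hom_full_subcategory:
  "f \<in> Hom (full_subcategory K Q) X Y \<longleftrightarrow> f \<in> Hom K X Y \<and> Q X \<and> Q Y"
  by (auto simp: Hom_def)

lemma is_category_full_subcategory: "is_category K \<Longrightarrow> is_category (full_subcategory K Q)"
  unfolding is_category_def by (simp add: Hom_full_subcategory)

lemma full_subcategory_cong:
  assumes "is_category K" "\<And>X. X \<in> Obj K \<Longrightarrow> P X = Q X"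
  shows "full_subcategory K P = full_subcategory K Q"
proof -
  have "{X \<in> Obj K. P X} = {X \<in> Obj K. Q X}"
    "{f \<in> Arr K. P (Dom K f) \<and> P (Cod K f)} = {f \<in> Arr K. Q (Dom K f) \<and> Q (Cod K f)}"
    using assms unfolding is_category_def by auto
  then show ?thesis
    by (simp add: full_subcategory_def)
qed

lemma is_functor_full_subcategory:
  "is_functor J (full_subcategory K Q) D \<longleftrightarrow>
     is_functor J K D \<and> (\<forall>j\<in>Obj J. Q (fobj D j)) \<and>
     (\<forall>a\<in>Arr J. Q (fobj D (Dom J a)) \<and> Q (fobj D (Cod J a)))"
  by (auto simp: is_functor_def Hom_full_subcategory)

lemma is_cone_full_subcategory:
  assumes "\<forall>j\<in>Obj J. Q (fobj D j)"
  shows "is_cone J (full_subcategory K Q) D L \<pi> \<longleftrightarrow> is_cone J K D L \<pi> \<and> Q L"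
  using assms by (auto simp: is_cone_def Hom_full_subcategory)

text \<open>Stated through universal arrows, which is the form in which the core of a system
  presents itself; the functor, the adjunction and limits are derived from them.\<close>

locale coreflection = cat K for K :: "('o, 'm) category" +
  fixes Q :: "'o \<Rightarrow> bool" and R :: "'o \<Rightarrow> 'o" and \<epsilon> :: "'o \<Rightarrow> 'm"
  assumes coreflector_Obj: "Y \<in> Obj K \<Longrightarrow> R Y \<in> Obj K \<and> Q (R Y)"
    and counit_Hom: "Y \<in> Obj K \<Longrightarrow> \<epsilon> Y \<in> Hom K (R Y) Y"
    and coreflection_univ: "f \<in> Hom K X Y \<Longrightarrow> Q X \<Longrightarrow> \<exists>!g. g \<in> Hom K X (R Y) \<and> Comp K (\<epsilon> Y) g = f"
begin

definition adjunct :: "'m \<Rightarrow> 'm" where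
  "adjunct f = (THE g. g \<in> Hom K (Dom K f) (R (Cod K f)) \<and> Comp K (\<epsilon> (Cod K f)) g = f)"

lemma adjunct:
  assumes "f \<in> Hom K X Y" "Q X"
  shows "adjunct f \<in> Hom K X (R Y)" "Comp K (\<epsilon> Y) (adjunct f) = f"
  using theI'[OF coreflection_univ[OF assms]]
  by (simp_all add: adjunct_def Hom_Dom[OF assms(1)] Hom_Cod[OF assms(1)])

lemma counit_cancel:
  assumes "Q X" "g \<in> Hom K X (R Y)" "h \<in> Hom K X (R Y)" "Comp K (\<epsilon> Y) g = Comp K (\<epsilon> Y) h" "Y \<in> Obj K"
  shows "g = h"
  using coreflection_univ[OF comp_Hom[OF assms(2) counit_Hom[OF assms(5)]] assms(1)] assms by metis

definition coreflector :: "('o, 'm, 'o, 'm) cat_functor" where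
  "coreflector = \<lparr>fobj = R, fmap = (\<lambda>k. adjunct (Comp K k (\<epsilon> (Dom K k))))\<rparr>"

lemma fmap_coreflector:
  assumes k: "k \<in> Hom K Y Y'"
  shows "fmap coreflector k \<in> Hom K (R Y) (R Y')"
    "Comp K (\<epsilon> Y') (fmap coreflector k) = Comp K k (\<epsilon> Y)"
proof -
  have Y: "Y \<in> Obj K"
    using Hom_Obj k by blast
  show "fmap coreflector k \<in> Hom K (R Y) (R Y')"
    "Comp K (\<epsilon> Y') (fmap coreflector k) = Comp K k (\<epsilon> Y)"
    using adjunct[OF comp_Hom[OF counit_Hom[OF Y] k]] coreflector_Obj[OF Y]
    by (simp_all add: coreflector_def Hom_Dom[OF k])
qed

text \<open>Each functor law is checked after composing with the counit, which may then be
  cancelled.\<close>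

lemma is_functor_coreflector: "is_functor K (full_subcategory K Q) coreflector"
  unfolding is_functor_def
proof (intro conjI ballI impI)
  fix Y assume Y: "Y \<in> Obj K"
  show "fobj coreflector Y \<in> Obj (full_subcategory K Q)"
    using coreflector_Obj[OF Y] by (simp add: coreflector_def)
  have "fmap coreflector (Ident K Y) = Ident K (R Y)"
  proof (rule counit_cancel[OF _ fmap_coreflector(1) _ _ Y])
    show "Ident K (R Y) \<in> Hom K (R Y) (R Y)" "Ident K Y \<in> Hom K Y Y" "Q (R Y)"
      using coreflector_Obj[OF Y] Y ident_Hom by auto
    show "Comp K (\<epsilon> Y) (fmap coreflector (Ident K Y)) = Comp K (\<epsilon> Y) (Ident K (R Y))"
      using fmap_coreflector(2)[OF ident_Hom[OF Y]] counit_Hom[OF Y] by (simp add: comp_ident ident_comp)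
  qed
  then show "fmap coreflector (Ident K Y) = Ident (full_subcategory K Q) (fobj coreflector Y)"
    by (simp add: coreflector_def)
next
  fix k assume "k \<in> Arr K"
  note k = Arr_Hom[OF this]
  show "fmap coreflector k \<in> Hom (full_subcategory K Q) (fobj coreflector (Dom K k)) (fobj
      coreflector (Cod K k))"
    using fmap_coreflector(1)[OF k] coreflector_Obj Hom_Obj[OF k]
    by (simp add: Hom_full_subcategory coreflector_def)
next
  fix f g assume fg: "f \<in> Arr K" "g \<in> Arr K" "Cod K f = Dom K g"
  then have f: "f \<in> Hom K (Dom K f) (Dom K g)" and g: "g \<in> Hom K (Dom K g) (Cod K g)"
    by (auto simp: Hom_def)
  note X = Hom_Obj(1)[OF f] and Y = Hom_Obj(2)[OF f] and Z = Hom_Obj(2)[OF g]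
  note e = counit_Hom[OF X] counit_Hom[OF Y] counit_Hom[OF Z]
  have "fmap coreflector (Comp K g f) = Comp K (fmap coreflector g) (fmap coreflector f)"
  proof (rule counit_cancel[OF _ fmap_coreflector(1)[OF comp_Hom[OF f g]] _ _ Z])
    have "Comp K (\<epsilon> (Cod K g)) (Comp K (fmap coreflector g) (fmap coreflector f)) =
        Comp K (Comp K g (\<epsilon> (Dom K g))) (fmap coreflector f)"
      using comp_assoc[OF fmap_coreflector(1)[OF f] fmap_coreflector(1)[OF g] e(3)]
        fmap_coreflector(2)[OF g] by simp
    also have "\<dots> = Comp K g (Comp K f (\<epsilon> (Dom K f)))"
      using comp_assoc[OF fmap_coreflector(1)[OF f] e(2) g] fmap_coreflector(2)[OF f] by simp
    finally show "Comp K (\<epsilon> (Cod K g)) (fmap coreflector (Comp K g f)) =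
        Comp K (\<epsilon> (Cod K g)) (Comp K (fmap coreflector g) (fmap coreflector f))"
      using fmap_coreflector(2)[OF comp_Hom[OF f g]] comp_assoc[OF e(1) f g] by simp
  qed (use comp_Hom[OF fmap_coreflector(1)[OF f] fmap_coreflector(1)[OF g]] coreflector_Obj[OF X]
      in auto)
  then show "fmap coreflector (Comp K g f) = Comp (full_subcategory K Q) (fmap coreflector g)
      (fmap coreflector f)"
    by simp
qed

lemma is_adjunction_coreflector:
  "is_adjunction (full_subcategory K Q) K inclusion_functor coreflector (\<lambda>X Y. adjunct)"
  unfolding is_adjunction_def
proof (intro conjI ballI)
  show "is_functor (full_subcategory K Q) K inclusion_functor"
    by (auto simp: is_functor_def inclusion_functor_def Hom_def)
  show "is_functor K (full_subcategory K Q) coreflector"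
    by (rule is_functor_coreflector)
next
  fix X Y assume X: "X \<in> Obj (full_subcategory K Q)" and Y: "Y \<in> Obj K"
  have "bij_betw adjunct (Hom K X Y) (Hom K X (R Y))"
  proof (rule bij_betwI[where g = "\<lambda>g. Comp K (\<epsilon> Y) g"])
    show "adjunct \<in> Hom K X Y \<rightarrow> Hom K X (R Y)"
      using X adjunct(1) by auto
    show "(\<lambda>g. Comp K (\<epsilon> Y) g) \<in> Hom K X (R Y) \<rightarrow> Hom K X Y"
      using comp_Hom counit_Hom[OF Y] by blast
    show "Comp K (\<epsilon> Y) (adjunct f) = f" if "f \<in> Hom K X Y" for f
      using adjunct(2)[OF that] X by simp
    show "adjunct (Comp K (\<epsilon> Y) g) = g" if g: "g \<in> Hom K X (R Y)" for g
    proof (rule counit_cancel[OF _ _ g _ Y])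
      show "Q X"
        using X by simp
      from adjunct[OF comp_Hom[OF g counit_Hom[OF Y]] this]
      show "adjunct (Comp K (\<epsilon> Y) g) \<in> Hom K X (R Y)"
        "Comp K (\<epsilon> Y) (adjunct (Comp K (\<epsilon> Y) g)) = Comp K (\<epsilon> Y) g" .
    qed
  qed
  then show "bij_betw adjunct (Hom K (fobj inclusion_functor X) Y)
      (Hom (full_subcategory K Q) X (fobj coreflector Y))"
    using X coreflector_Obj[OF Y]
    by (simp add: inclusion_functor_def coreflector_def Hom_full_subcategory bij_betw_def set_eq_iff)
next
  fix h k f assume h: "h \<in> Arr (full_subcategory K Q)" and k: "k \<in> Arr K"
    and "f \<in> Hom K (fobj inclusion_functor (Cod (full_subcategory K Q) h)) (Dom K k)"
  then have f: "f \<in> Hom K (Cod K h) (Dom K k)"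
    by (simp add: inclusion_functor_def)
  have hH: "h \<in> Hom K (Dom K h) (Cod K h)" and Q: "Q (Dom K h)" "Q (Cod K h)"
    using h Arr_Hom by auto
  note kH = Arr_Hom[OF k]
  note Y = Hom_Obj(1)[OF kH] and Y' = Hom_Obj(2)[OF kH]
  note t = adjunct[OF f Q(2)] and kfh = comp_Hom[OF comp_Hom[OF hH f] kH]
  note r = fmap_coreflector[OF kH]
  have "adjunct (Comp K k (Comp K f h)) = Comp K (fmap coreflector k) (Comp K (adjunct f) h)"
  proof (rule counit_cancel[OF Q(1) adjunct(1)[OF kfh Q(1)] _ _ Y'])
    show "Comp K (fmap coreflector k) (Comp K (adjunct f) h) \<in> Hom K (Dom K h) (R (Cod K k))"
      by (rule comp_Hom[OF comp_Hom[OF hH t(1)] r(1)])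
    have "Comp K (\<epsilon> (Cod K k)) (Comp K (fmap coreflector k) (Comp K (adjunct f) h)) =
        Comp K (Comp K k (\<epsilon> (Dom K k))) (Comp K (adjunct f) h)"
      using comp_assoc[OF comp_Hom[OF hH t(1)] r(1) counit_Hom[OF Y']] r(2) by simp
    also have "\<dots> = Comp K k (Comp K (\<epsilon> (Dom K k)) (Comp K (adjunct f) h))"
      using comp_assoc[OF comp_Hom[OF hH t(1)] counit_Hom[OF Y] kH] by simp
    also have "\<dots> = Comp K k (Comp K f h)"
      using comp_assoc[OF hH t(1) counit_Hom[OF Y]] t(2) by simp
    finally show "Comp K (\<epsilon> (Cod K k)) (adjunct (Comp K k (Comp K f h))) =
        Comp K (\<epsilon> (Cod K k)) (Comp K (fmap coreflector k) (Comp K (adjunct f) h))"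
      using adjunct(2)[OF kfh Q(1)] by simp
  qed
  then show "adjunct (Comp K k (Comp K f (fmap inclusion_functor h))) =
      Comp (full_subcategory K Q) (fmap coreflector k) (Comp (full_subcategory K Q) (adjunct f) h)"
    by (simp add: inclusion_functor_def)
qed

text \<open>A cone whose vertex satisfies \<open>Q\<close> factors through the ambient limit and
  hence uniquely through its coreflection.\<close>

lemma is_limit_coreflection:
  assumes Q: "\<forall>j\<in>Obj J. Q (fobj D j)" and L: "is_limit J K D L \<pi>"
    and J: "\<And>a. a \<in> Arr J \<Longrightarrow> Dom J a \<in> Obj J \<and> Cod J a \<in> Obj J" and D: "is_functor J K D"
  shows "is_limit J (full_subcategory K Q) D (R L) (\<lambda>j. Comp K (\<pi> j) (\<epsilon> L))"
  unfolding is_limit_def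
proof (intro conjI allI impI)
  have cone: "L \<in> Obj K" "\<And>j. j \<in> Obj J \<Longrightarrow> \<pi> j \<in> Hom K L (fobj D j)"
    "\<And>a. a \<in> Arr J \<Longrightarrow> Comp K (fmap D a) (\<pi> (Dom J a)) = \<pi> (Cod J a)"
    using L by (auto simp: is_limit_def is_cone_def)
  note e = counit_Hom[OF cone(1)]
  show "is_cone J (full_subcategory K Q) D (R L) (\<lambda>j. Comp K (\<pi> j) (\<epsilon> L))"
    unfolding is_cone_full_subcategory[OF Q] unfolding is_cone_def
  proof (intro conjI ballI)
    fix a assume a: "a \<in> Arr J"
    have "fmap D a \<in> Hom K (fobj D (Dom J a)) (fobj D (Cod J a))"
      using D a by (simp add: is_functor_def)
    then show "Comp K (fmap D a) (Comp K (\<pi> (Dom J a)) (\<epsilon> L)) = Comp K (\<pi> (Cod J a)) (\<epsilon> L)"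
      using comp_assoc[OF e cone(2)] J[OF a] cone(3)[OF a] by simp
  qed (use coreflector_Obj[OF cone(1)] comp_Hom[OF e cone(2)] in auto)
  fix M \<kappa> assume "is_cone J (full_subcategory K Q) D M \<kappa>"
  then have M: "is_cone J K D M \<kappa>" "Q M"
    by (auto simp: is_cone_full_subcategory[OF Q])
  then obtain h where h: "h \<in> Hom K M L" "\<And>j. j \<in> Obj J \<Longrightarrow> Comp K (\<pi> j) h = \<kappa> j"
    and un: "\<And>h'. h' \<in> Hom K M L \<Longrightarrow> (\<And>j. j \<in> Obj J \<Longrightarrow> Comp K (\<pi> j) h' = \<kappa> j) \<Longrightarrow> h' = h"
    using L unfolding is_limit_def by metis
  note t = adjunct[OF h(1) M(2)]
  have eq: "Comp K (Comp K (\<pi> j) (\<epsilon> L)) g = Comp K (\<pi> j) (Comp K (\<epsilon> L) g)"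
    if "g \<in> Hom K M (R L)" "j \<in> Obj J" for g j
    using comp_assoc[OF that(1) e cone(2)[OF that(2)]] by simp
  show "\<exists>!h. h \<in> Hom (full_subcategory K Q) M (R L) \<and>
      (\<forall>j\<in>Obj J. Comp (full_subcategory K Q) (Comp K (\<pi> j) (\<epsilon> L)) h = \<kappa> j)"
  proof (rule ex1I[of _ "adjunct h"])
    show "adjunct h \<in> Hom (full_subcategory K Q) M (R L) \<and>
      (\<forall>j\<in>Obj J. Comp (full_subcategory K Q) (Comp K (\<pi> j) (\<epsilon> L)) (adjunct h) = \<kappa> j)"
      using t M(2) coreflector_Obj[OF cone(1)] eq h(2) by (simp add: Hom_full_subcategory)
    fix g assume g: "g \<in> Hom (full_subcategory K Q) M (R L) \<and>
      (\<forall>j\<in>Obj J. Comp (full_subcategory K Q) (Comp K (\<pi> j) (\<epsilon> L)) g = \<kappa> j)"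
    then have g': "g \<in> Hom K M (R L)"
      by (simp add: Hom_full_subcategory)
    have "Comp K (\<epsilon> L) g = h"
      using g eq[OF g'] by (intro un comp_Hom[OF g' e]) simp
    then show "g = adjunct h"
      using t by (intro counit_cancel[OF M(2) g' t(1) _ cone(1)]) simp
  qed
qed

lemma has_small_limits_coreflection:
  assumes "has_small_limits U K"
  shows "has_small_limits U (full_subcategory K Q)"
  unfolding has_small_limits_def
proof (intro allI impI, elim conjE)
  fix J :: "('a, 'a) category" and D
  assume J: "is_small_category U J" and D: "is_functor J (full_subcategory K Q) D"
  have DK: "is_functor J K D" and Q: "\<forall>j\<in>Obj J. Q (fobj D j)"
    using D by (auto simp: is_functor_full_subcategory)
  obtain L \<pi> where "is_limit J K D L \<pi>"
    using assms(1) J DK unfolding has_small_limits_def by blast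
  moreover have "\<And>a. a \<in> Arr J \<Longrightarrow> Dom J a \<in> Obj J \<and> Cod J a \<in> Obj J"
    using J by (simp add: is_small_category_def is_category_def)
  ultimately show "\<exists>L \<pi>. is_limit J (full_subcategory K Q) D L \<pi>"
    using is_limit_coreflection[OF Q _ _ DK] by blast
qed

text \<open>For \<open>X\<close> and \<open>Y\<close> in the subcategory, maps to \<open>Z\<close>
  and maps to \<open>R Z\<close> correspond, so the extension problems for \<open>f\<close> are the
  same.\<close>

lemma orthogonal_coreflection:
  assumes f: "f \<in> Hom K X Y" and Q: "Q X" "Q Y" and Z: "Z \<in> Obj K"
    and o: "cat.orthogonal (full_subcategory K Q) f (R Z)"
  shows "orthogonal f Z"
proof -
  interpret S: cat "full_subcategory K Q"
    by unfold_locales (rule is_category_full_subcategory[OF category])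
  have fS: "f \<in> Hom (full_subcategory K Q) X Y"
    using f Q by (simp add: Hom_full_subcategory)
  note QR = coreflector_Obj[OF Z, THEN conjunct2]
  note e = counit_Hom[OF Z]
  show ?thesis
  proof (rule orthogonalI[OF f])
    fix k assume k: "k \<in> Hom K X Z"
    note t = adjunct[OF k Q(1)]
    have "adjunct k \<in> Hom (full_subcategory K Q) X (R Z)"
      using t Q QR by (simp add: Hom_full_subcategory)
    then obtain h where h: "h \<in> Hom (full_subcategory K Q) Y (R Z)"
      "Comp (full_subcategory K Q) h f = adjunct k"
      using S.orthogonalE[OF o fS] by blast
    then have h': "h \<in> Hom K Y (R Z)" "Comp K h f = adjunct k"
      by (auto simp: Hom_full_subcategory)
    then show "\<exists>h\<in>Hom K Y Z. Comp K h f = k"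
      using comp_assoc[OF f h'(1) e] t comp_Hom[OF h'(1) e] by (intro bexI[of _ "Comp K (\<epsilon> Z) h"]) auto
  next
    fix h h' assume h: "h \<in> Hom K Y Z" "h' \<in> Hom K Y Z" "Comp K h f = Comp K h' f"
    note t = adjunct[OF h(1) Q(2)] and t' = adjunct[OF h(2) Q(2)]
    have "Comp K (adjunct h) f = Comp K (adjunct h') f"
      by (rule counit_cancel[OF Q(1) comp_Hom[OF f t(1)] comp_Hom[OF f t'(1)] _ Z])
        (simp add: comp_assoc[OF f t(1) e] comp_assoc[OF f t'(1) e] t t' h)
    then have "adjunct h = adjunct h'"
      using S.orthogonal_unique[OF o fS] t(1) t'(1) Q QR by (simp add: Hom_full_subcategory)
    then show "h = h'"
      using t(2) t'(2) by metis
  qed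
qed

end

section \<open>Smallness\<close>

locale universe =
  fixes U :: "'u set"
  assumes inaccessible: "inaccessible U"
begin

abbreviation small :: "'a set \<Rightarrow> bool" where
  "small A \<equiv> A \<prec> U"

lemma small_lepoll: "small B \<Longrightarrow> A \<lesssim> B \<Longrightarrow> small A"
  by (rule lesspoll_trans1)

lemma small_subset: "small B \<Longrightarrow> A \<subseteq> B \<Longrightarrow> small A"
  by (rule small_lepoll) (auto intro: subset_imp_lepoll)

lemma small_image: "small A \<Longrightarrow> small (f ` A)"
  using image_lepoll by (rule lesspoll_trans1)

lemma small_nat: "small (UNIV :: nat set)"
  using inaccessible by (simp add: inaccessible_def)

lemma infinite_U: "infinite U"
  using small_nat infinite_le_lepoll lesspoll_imp_lepoll by blast

lemma small_finite: "finite A \<Longrightarrow> small A"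
  using infinite_U by (rule finite_lesspoll_infinite)

lemma small_copy:
  assumes "small (A :: 'a set)"
  obtains i :: "'a \<Rightarrow> 'u" where "inj_on i A" "i ` A \<subseteq> U" "small (i ` A)"
proof -
  obtain i :: "'a \<Rightarrow> 'u" where "inj_on i A" "i ` A \<subseteq> U"
    using assms by (auto simp: lesspoll_def lepoll_def)
  then show ?thesis
    using that small_image[OF assms] by blast
qed

lemma small_Pow:
  assumes "small A"
  shows "small (Pow A)"
proof -
  obtain i :: "'a \<Rightarrow> 'u" where i: "inj_on i A" "small (i ` A)"
    using small_copy[OF assms] by blast
  have "small (Pow (i ` A))"
    using inaccessible i(2) by (simp add: inaccessible_def)
  moreover have "Pow A \<lesssim> Pow (i ` A)"
    unfolding lepoll_def by (rule exI[of _ "image i"]) (use i in \<open>auto intro: inj_on_image_Pow\<close>)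
  ultimately show ?thesis
    by (rule small_lepoll)
qed

lemma small_UN_universe:
  fixes A :: "'u set" and F :: "'u \<Rightarrow> 'u set"
  shows "small A \<Longrightarrow> (\<And>a. a \<in> A \<Longrightarrow> small (F a)) \<Longrightarrow> small (\<Union>a\<in>A. F a)"
  using inaccessible by (simp add: inaccessible_def)

text \<open>The axiom bounds unions indexed by sets of elements of \<open>'u\<close>, so two points
  of \<open>U\<close> serve as indices.\<close>

lemma small_Un_universe:
  fixes A B :: "'u set"
  assumes "small A" "small B"
  shows "small (A \<union> B)"
proof -
  obtain x y where "x \<in> U" "y \<in> U" "x \<noteq> y"
    using infinite_U by (metis finite.simps insert_iff not_finite_existsD rev_finite_subset subsetI)
  then have "A \<union> B = (\<Union>a\<in>{x, y}. if a = x then A else B)"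
    by auto
  then show ?thesis
    using small_UN_universe[of "{x, y}" "\<lambda>a. if a = x then A else B"] assms
    by (simp add: small_finite)
qed

lemma small_Times:
  assumes "small (A :: 'a set)" "small (B :: 'b set)"
  shows "small (A \<times> B)"
proof -
  obtain i :: "'a \<Rightarrow> 'u" where i: "inj_on i A" "small (i ` A)"
    using small_copy[OF assms(1)] by blast
  obtain j :: "'b \<Rightarrow> 'u" where j: "inj_on j B" "small (j ` B)"
    using small_copy[OF assms(2)] by blast
  define C where "C = i ` A \<union> j ` B"
  have "small (Pow (Pow C))"
    unfolding C_def using i j by (intro small_Pow small_Un_universe)
  moreover have "A \<times> B \<lesssim> Pow (Pow C)"
    unfolding lepoll_def
  proof (intro exI conjI)
    \<comment> \<open>Kuratowski pairs embed the product into a double power set.\<close>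
    show "inj_on (\<lambda>(a, b). {{i a}, {i a, j b}}) (A \<times> B)"
    proof (rule inj_onI, clarify)
      fix a b a' b' assume "a \<in> A" "a' \<in> A" "b \<in> B" "b' \<in> B"
        and eq: "{{i a}, {i a, j b}} = {{i a'}, {i a', j b'}}"
      have "i a = i a' \<and> j b = j b'"
        using eq by (metis doubleton_eq_iff insert_absorb2)
      then show "a = a' \<and> b = b'"
        using i(1) j(1) \<open>a \<in> A\<close> \<open>a' \<in> A\<close> \<open>b \<in> B\<close> \<open>b' \<in> B\<close> by (simp add: inj_on_eq_iff)
    qed
    show "(\<lambda>(a, b). {{i a}, {i a, j b}}) ` (A \<times> B) \<subseteq> Pow (Pow C)"
      by (auto simp: C_def)
  qed
  ultimately show ?thesis
    by (rule small_lepoll)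
qed

text \<open>Base and fibres may have arbitrary types. Coding the fibres in \<open>'u\<close> places
  all of them in one small union \<open>H\<close>, and the sum embeds into
  \<open>A \<times> H\<close>.\<close>

lemma small_Sigma:
  assumes "small (A :: 'a set)" "\<And>a. a \<in> A \<Longrightarrow> small (F a :: 'b set)"
  shows "small (Sigma A F)"
proof -
  obtain i :: "'a \<Rightarrow> 'u" where i: "inj_on i A" "small (i ` A)"
    using small_copy[OF assms(1)] by blast
  have "\<forall>a\<in>A. \<exists>j :: 'b \<Rightarrow> 'u. inj_on j (F a) \<and> small (j ` F a)"
    using small_copy[OF assms(2)] by metis
  then obtain j :: "'a \<Rightarrow> 'b \<Rightarrow> 'u" where j: "\<And>a. a \<in> A \<Longrightarrow> inj_on (j a) (F a) \<and> small (j a ` F a)"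
    by metis
  define H where "H = (\<Union>c\<in>i ` A. j (inv_into A i c) ` F (inv_into A i c))"
  have "small H"
    unfolding H_def using i(2)
    by (rule small_UN_universe) (metis (no_types, lifting) f_inv_into_f i(1) image_eqI imageE
        inv_into_f_f j)
  then have "small (A \<times> H)"
    using assms(1) by (rule small_Times[rotated])
  moreover have "Sigma A F \<lesssim> A \<times> H"
    unfolding lepoll_def
  proof (intro exI conjI)
    show "inj_on (\<lambda>(a, x). (a, j a x)) (Sigma A F)"
      using j by (auto simp: inj_on_def)
    show "(\<lambda>(a, x). (a, j a x)) ` Sigma A F \<subseteq> A \<times> H"
      using i by (auto simp: H_def)
  qed
  ultimately show ?thesis
    by (rule small_lepoll)
qed

lemma small_Un:
  assumes "small (A :: 'a set)" "small B"
  shows "small (A \<union> B)"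
proof -
  have "small (Sigma (UNIV :: bool set) (\<lambda>c. if c then A else B))"
    using assms by (intro small_Sigma) (auto intro: small_finite)
  then have "small (snd ` Sigma (UNIV :: bool set) (\<lambda>c. if c then A else B))"
    by (rule small_image)
  then show ?thesis
    by (rule small_subset) (force simp: image_iff)
qed

lemma small_PiE:
  assumes "small A" "\<And>a. a \<in> A \<Longrightarrow> small (F a)"
  shows "small (Pi\<^sub>E A F)"
proof -
  have "small (Pow (Sigma A F))"
    using assms by (intro small_Pow small_Sigma)
  moreover have "Pi\<^sub>E A F \<lesssim> Pow (Sigma A F)"
    unfolding lepoll_def
  proof (intro exI conjI)
    show "inj_on (\<lambda>f. (\<lambda>a. (a, f a)) ` A) (Pi\<^sub>E A F)"
    proof (rule inj_onI)
      fix f g assume fg: "f \<in> Pi\<^sub>E A F" "g \<in> Pi\<^sub>E A F" "(\<lambda>a. (a, f a)) ` A = (\<lambda>a. (a, g a)) ` A"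
      have "f a = g a" if "a \<in> A" for a
        using that fg(3) by (auto simp: set_eq_iff image_iff)
      then show "f = g"
        using fg(1,2) by (meson PiE_ext)
    qed
  qed auto
  ultimately show ?thesis
    by (rule small_lepoll)
qed

text \<open>Since \<open>U\<close> is not a union of two small sets, \<open>U - B\<close> is not
  small, and comparability of cardinals embeds \<open>A\<close> into it. This supplies names for new
  actions disjoint from the old ones.\<close>

lemma fresh_copy:
  assumes "small (A :: 'a set)" "small (B :: 'u set)"
  obtains c :: "'a \<Rightarrow> 'u" where "inj_on c A" "c ` A \<subseteq> U" "c ` A \<inter> B = {}" "small (c ` A)"
proof -
  have "\<not> small (U - B)"
  proof
    assume "small (U - B)"
    then have "small (U - B \<union> B)"
      using assms(2) by (rule small_Un)
    then have "small U"
      by (rule small_subset) blast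
    then show False
      by simp
  qed
  moreover have "U - B \<lesssim> A \<or> A \<lesssim> U - B"
    unfolding lepoll_def
    by (metis card_of_ordLeq ordLeq_total[OF card_of_Well_order card_of_Well_order])
  ultimately have "A \<lesssim> U - B"
    using assms(1) small_lepoll by blast
  then obtain c :: "'a \<Rightarrow> 'u" where c: "inj_on c A" "c ` A \<subseteq> U - B"
    by (auto simp: lepoll_def)
  show ?thesis
    by (rule that[of c, OF c(1) _ _ small_image[OF assms(1)]]) (use c in auto)
qed

end

section \<open>Well-orders and colimits of sets\<close>

text \<open>The order type of the natural numbers, carried by elements of \<open>'u\<close> as
  \<open>is_transfinite_composition\<close> demands of its indexing order.\<close>

definition omega_order :: "(nat \<Rightarrow> 'u) \<Rightarrow> 'u rel" where
  "omega_order e = {(e m, e n) | m n. m \<le> n}"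

lemma omega_order_iff: "inj e \<Longrightarrow> (e m, e n) \<in> omega_order e \<longleftrightarrow> m \<le> n"
  by (auto simp: omega_order_def dest: injD)

lemma Field_omega_order: "Field (omega_order e) = range e"
  by (auto simp: omega_order_def Field_def)

lemma Well_order_omega_order:
  assumes e: "inj e"
  shows "Well_order (omega_order e)"
proof -
  have "omega_order e - Id \<subseteq> inv_image less_than (inv e)"
    using e by (auto simp: omega_order_def)
  then have "wf (omega_order e - Id)"
    by (rule wf_subset[rotated]) simp
  moreover have "omega_order e \<subseteq> range e \<times> range e"
    by (auto simp: omega_order_def)
  moreover have "refl_on (range e) (omega_order e)"
    using e by (auto simp: refl_on_def omega_order_iff)
  moreover have "trans (omega_order e)"
    using e by (auto simp: trans_def omega_order_def inj_eq)
  moreover have "antisym (omega_order e)"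
    using e by (auto simp: antisym_def omega_order_def inj_eq)
  moreover have "total_on (range e) (omega_order e)"
    using e by (auto simp: total_on_def omega_order_iff)
  ultimately show ?thesis
    unfolding well_order_on_def linear_order_on_def partial_order_on_def preorder_on_def
        Field_omega_order
    by simp
qed

lemma underS_omega_order:
  assumes e: "inj e"
  shows "underS (omega_order e) (e n) = e ` {..<n}"
proof (intro set_eqI iffI)
  fix x assume x: "x \<in> underS (omega_order e) (e n)"
  then obtain m where m: "x = e m"
    by (auto simp: underS_def omega_order_def)
  then show "x \<in> e ` {..<n}"
    using x e by (auto simp: underS_def omega_order_iff inj_eq)
next
  fix x assume "x \<in> e ` {..<n}"
  then show "x \<in> underS (omega_order e) (e n)"
    using e by (auto simp: underS_def omega_order_iff inj_eq)
qed

lemma is_succ_omega_order: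
  assumes e: "inj e" and "is_succ (omega_order e) i j"
  obtains n where "i = e n" "j = e (Suc n)"
proof -
  have "i \<in> underS (omega_order e) j"
    using assms(2) by (simp add: is_succ_def)
  then obtain m n where i: "i = e m" and j: "j = e n"
    by (auto simp: underS_def omega_order_def)
  have mn: "m < n" and le: "\<And>k. k < n \<Longrightarrow> k \<le> m"
    using assms(2) e unfolding is_succ_def i j by (auto simp: underS_omega_order omega_order_iff inj_eq)
  have "n = Suc m"
    using mn le[of "n - 1"] by linarith
  then show ?thesis
    using that i j by blast
qed

lemma not_is_limit_element_omega_order:
  assumes e: "inj e"
  shows "\<not> is_limit_element (omega_order e) i"
proof
  assume l: "is_limit_element (omega_order e) i"
  then obtain n where i: "i = e n"
    by (auto simp: is_limit_element_def Field_omega_order)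
  show False
  proof (cases n)
    case 0
    then show False
      using l e by (simp add: is_limit_element_def is_least_def i Field_omega_order underS_omega_order)
  next
    case (Suc m)
    then have "is_succ (omega_order e) (e m) i"
      using e unfolding is_succ_def i by (auto simp: underS_omega_order omega_order_iff)
    then show False
      using l by (auto simp: is_limit_element_def)
  qed
qed

section \<open>Colimits of sets as quotients of disjoint unions\<close>

definition colim_rel ::
    "('i, 'a) category \<Rightarrow> ('i \<Rightarrow> 'x set) \<Rightarrow> ('a \<Rightarrow> 'x \<Rightarrow> 'x) \<Rightarrow> 'i \<times> 'x \<Rightarrow> 'i \<times> 'x \<Rightarrow> bool" where
  "colim_rel J S F = equivclp (\<lambda>(j, x) (k, y). \<exists>a\<in>Arr J. Dom J a = j \<and> Cod J a = k \<and> x \<in> S j \<and> y =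
      F a x)"

lemma colim_rel_invariant:
  assumes "colim_rel J S F p p'"
    and g: "\<And>a x. a \<in> Arr J \<Longrightarrow> x \<in> S (Dom J a) \<Longrightarrow> g (Cod J a) (F a x) = g (Dom J a) x"
  shows "g (fst p) (snd p) = g (fst p') (snd p')"
  using assms(1) unfolding colim_rel_def
  by (induction rule: equivclp_induct) (auto simp: g)

lemma colim_rel_arrow:
  "a \<in> Arr J \<Longrightarrow> x \<in> S (Dom J a) \<Longrightarrow> colim_rel J S F (Dom J a, x) (Cod J a, F a x)"
  unfolding colim_rel_def by (rule r_into_equivclp) auto

text \<open>If \<open>q\<close> identifies only what the diagram forces, then a compatible family
  can be evaluated on any chosen preimage.\<close>

lemma colim_factor:
  assumes q: "\<And>j k x y. j \<in> Obj J \<Longrightarrow> k \<in> Obj J \<Longrightarrow> x \<in> S j \<Longrightarrow> y \<in> S k \<Longrightarrow> q j x = q k y \<Longrightarrow>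
      colim_rel J S F (j, x) (k, y)"
    and g: "\<And>a x. a \<in> Arr J \<Longrightarrow> x \<in> S (Dom J a) \<Longrightarrow> g (Cod J a) (F a x) = g (Dom J a) x"
  shows "\<exists>h. \<forall>j\<in>Obj J. \<forall>x\<in>S j. h (q j x) = g j x"
proof -
  define p where "p c = (SOME p. fst p \<in> Obj J \<and> snd p \<in> S (fst p) \<and> q (fst p) (snd p) = c)" for c
  have "g (fst (p (q j x))) (snd (p (q j x))) = g j x" if "j \<in> Obj J" "x \<in> S j" for j x
  proof -
    have "fst (p (q j x)) \<in> Obj J \<and> snd (p (q j x)) \<in> S (fst (p (q j x))) \<and>
        q (fst (p (q j x))) (snd (p (q j x))) = q j x"
      unfolding p_def by (rule someI[of _ "(j, x)"]) (use that in simp)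
    then have "colim_rel J S F (fst (p (q j x)), snd (p (q j x))) (j, x)"
      using q that by blast
    from colim_rel_invariant[of J S F _ _ g, OF this g] show ?thesis
      by simp
  qed
  then show ?thesis
    by (intro exI[of _ "\<lambda>c. g (fst (p c)) (snd (p c))"]) blast
qed

lemma (in universe) set_colimit:
  fixes J :: "('u, 'u) category" and S :: "'u \<Rightarrow> 'u set"
  assumes "small (Obj J)" "\<And>j. j \<in> Obj J \<Longrightarrow> small (S j)"
  obtains C :: "'u set" and q where "C \<subseteq> U" "small C" "C = (\<Union>j\<in>Obj J. q j ` S j)"
    "\<And>j k x y. j \<in> Obj J \<Longrightarrow> k \<in> Obj J \<Longrightarrow> x \<in> S j \<Longrightarrow> y \<in> S k \<Longrightarrow>
      q j x = q k y \<longleftrightarrow> colim_rel J S F (j, x) (k, y)"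
proof -
  let ?E = "colim_rel J S F"
  \<comment> \<open>The choice is made from the predicate \<open>?E p\<close>, which depends on the
    class only, so equivalent elements get the same representative.\<close>
  define rep where "rep p = (SOME p'. ?E p p')" for p
  have E: "?E p p" "?E p p' \<Longrightarrow> ?E p' p" "?E p p' \<Longrightarrow> ?E p' p'' \<Longrightarrow> ?E p p''" for p p' p''
    unfolding colim_rel_def by (auto intro: equivclp_sym equivclp_trans)
  have rep: "?E p (rep p)" for p
    unfolding rep_def by (rule someI[of _ p]) (rule E(1))
  have rep_eq: "rep p = rep p' \<longleftrightarrow> ?E p p'" for p p'
  proof
    assume "rep p = rep p'"
    then show "?E p p'"
      using rep[of p] rep[of p'] E by metis
  next
    assume "?E p p'"
    then have "?E p = ?E p'"
      using E by blast
    then show "rep p = rep p'"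
      by (simp add: rep_def)
  qed
  let ?C = "rep ` Sigma (Obj J) S"
  have "small ?C"
    using assms by (intro small_image small_Sigma)
  then obtain e :: "'u \<times> 'u \<Rightarrow> 'u" where e: "inj_on e ?C" "e ` ?C \<subseteq> U" "small (e ` ?C)"
    using small_copy by blast
  show ?thesis
  proof (rule that[of "e ` ?C" "\<lambda>j x. e (rep (j, x))"])
    show "e (rep (j, x)) = e (rep (k, y)) \<longleftrightarrow> ?E (j, x) (k, y)"
      if "j \<in> Obj J" "k \<in> Obj J" "x \<in> S j" "y \<in> S k" for j k x y
    proof -
      have "rep (j, x) \<in> ?C" "rep (k, y) \<in> ?C"
        using that by auto
      then show ?thesis
        using e(1) rep_eq by (metis inj_on_eq_iff)
    qed
  qed (use e in auto)
qed

section \<open>The categories of weak and of cubical systems\<close>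

definition arrow_ident :: "('s, 'a, 'l) hdts \<Rightarrow> ('s, 'a, 'l) hdts_arrow" where
  "arrow_ident X = \<lparr>source = X, target = X,
     on_states = (\<lambda>\<alpha>\<in>states X. \<alpha>), on_actions = (\<lambda>u\<in>actions X. u)\<rparr>"

definition arrow_comp ::
    "('s, 'a, 'l) hdts_arrow \<Rightarrow> ('s, 'a, 'l) hdts_arrow \<Rightarrow> ('s, 'a, 'l) hdts_arrow" where
  "arrow_comp g f = \<lparr>source = source f, target = target g,
     on_states = compose (states (source f)) (on_states g) (on_states f),
     on_actions = compose (actions (source f)) (on_actions g) (on_actions f)\<rparr>"

definition arrow_of ::
    "('s, 'a, 'l) hdts \<Rightarrow> ('s, 'a, 'l) hdts \<Rightarrow> ('s \<Rightarrow> 's) \<Rightarrow> ('a \<Rightarrow> 'a) \<Rightarrow> ('s, 'a, 'l) hdts_arrow" where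
  "arrow_of X Y f0 f1 = \<lparr>source = X, target = Y,
     on_states = restrict f0 (states X), on_actions = restrict f1 (actions X)\<rparr>"

lemma arrow_ident_simps [simp]:
  "source (arrow_ident X) = X" "target (arrow_ident X) = X"
  "\<alpha> \<in> states X \<Longrightarrow> on_states (arrow_ident X) \<alpha> = \<alpha>" "u \<in> actions X \<Longrightarrow> on_actions (arrow_ident X) u = u"
  by (simp_all add: arrow_ident_def)

lemma arrow_comp_simps [simp]:
  "source (arrow_comp g f) = source f" "target (arrow_comp g f) = target g"
  "\<alpha> \<in> states (source f) \<Longrightarrow> on_states (arrow_comp g f) \<alpha> = on_states g (on_states f \<alpha>)"
  "u \<in> actions (source f) \<Longrightarrow> on_actions (arrow_comp g f) u = on_actions g (on_actions f u)"
  by (simp_all add: arrow_comp_def compose_def)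

lemma arrow_of_simps [simp]:
  "source (arrow_of X Y f0 f1) = X" "target (arrow_of X Y f0 f1) = Y"
  "\<alpha> \<in> states X \<Longrightarrow> on_states (arrow_of X Y f0 f1) \<alpha> = f0 \<alpha>"
  "u \<in> actions X \<Longrightarrow> on_actions (arrow_of X Y f0 f1) u = f1 u"
  by (simp_all add: arrow_of_def)

text \<open>The object part of the coreflector. All states survive, each being the image of a
  0-cube; an action survives only if a transition of the core uses it.\<close>

definition core_hdts :: "('s, 'a, 'l) hdts \<Rightarrow> ('s, 'a, 'l) hdts" where
  "core_hdts X = (let T = splitting_core (transitions X); L = {u. \<exists>(\<alpha>, us, \<beta>)\<in>T. u \<in> set us}
     in \<lparr>states = states X, actions = L, label = restrict (label X) L, transitions = T\<rparr>)"

locale hdts_universe = universe U for U :: "'u set" +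
  fixes \<Sigma> :: "'l set"
  assumes label_set: "\<Sigma> \<noteq> {}" "small \<Sigma>"
begin

definition systems :: "bool \<Rightarrow> (('u, 'u, 'l) hdts, ('u, 'u, 'l) hdts_arrow) category" where
  "systems b = full_subcategory (WHDTS U \<Sigma>) (regular b)"

lemma WHDTS_simps:
  "Dom (WHDTS U \<Sigma>) = source" "Cod (WHDTS U \<Sigma>) = target"
  "Ident (WHDTS U \<Sigma>) = arrow_ident" "Comp (WHDTS U \<Sigma>) = arrow_comp"
  by (auto simp: WHDTS_def Let_def arrow_ident_def arrow_comp_def fun_eq_iff)

lemma systems_simps [simp]:
  "Dom (systems b) = source" "Cod (systems b) = target"
  "Ident (systems b) = arrow_ident" "Comp (systems b) = arrow_comp"
  by (simp_all add: systems_def WHDTS_simps)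

lemma Obj_systems:
  "X \<in> Obj (systems b) \<longleftrightarrow> weak_hdts \<Sigma> X \<and> states X \<subseteq> U \<and> small (states X) \<and>
     actions X \<subseteq> U \<and> small (actions X) \<and> regular b X"
  by (auto simp: systems_def WHDTS_def Let_def)

lemma Hom_systems:
  "f \<in> Hom (systems b) X Y \<longleftrightarrow> X \<in> Obj (systems b) \<and> Y \<in> Obj (systems b) \<and> source f = X \<and>
     target f = Y \<and> hdts_map X Y (on_states f) (on_actions f)"
  by (auto simp: Hom_def systems_def WHDTS_def Let_def)

lemma Arr_systems: "f \<in> Arr (systems b) \<longleftrightarrow> f \<in> Hom (systems b) (source f) (target f)"
  by (auto simp: Hom_def)

lemma systems_True: "systems True = WHDTS U \<Sigma>"
  by (simp add: systems_def full_subcategory_def regular_def)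

lemma Hom_D:
  assumes "f \<in> Hom (systems b) X Y"
  shows "X \<in> Obj (systems b)" "Y \<in> Obj (systems b)" "source f = X" "target f = Y"
    "premap X Y (on_states f) (on_actions f)" "weak_hdts \<Sigma> X" "weak_hdts \<Sigma> Y"
  using assms by (auto simp: Hom_systems hdts_map_iff Obj_systems)

lemma arrow_of_Hom:
  assumes "X \<in> Obj (systems b)" "Y \<in> Obj (systems b)" "premap X Y f0 f1"
  shows "arrow_of X Y f0 f1 \<in> Hom (systems b) X Y"
proof -
  have "weak_hdts \<Sigma> X"
    using assms(1) by (simp add: Obj_systems)
  then show ?thesis
    using assms premap_cong[OF _ assms(3), of \<Sigma> "restrict f0 (states X)" "restrict f1 (actions X)"]
    by (simp add: Hom_systems hdts_map_iff arrow_of_def)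
qed

lemma arrow_eqI:
  assumes "f \<in> Hom (systems b) X Y" "g \<in> Hom (systems b) X Y"
    and "\<And>\<alpha>. \<alpha> \<in> states X \<Longrightarrow> on_states f \<alpha> = on_states g \<alpha>"
    and "\<And>u. u \<in> actions X \<Longrightarrow> on_actions f u = on_actions g u"
  shows "f = g"
proof -
  have "on_states f = on_states g" "on_actions f = on_actions g"
    using assms by (auto simp: Hom_systems hdts_map_iff intro: extensionalityI)
  then show ?thesis
    using assms(1,2) by (intro hdts_arrow.equality) (auto simp: Hom_systems)
qed

lemma arrow_comp_Hom:
  assumes f: "f \<in> Hom (systems b) X Y" and g: "g \<in> Hom (systems b) Y Z"
  shows "arrow_comp g f \<in> Hom (systems b) X Z"
proof -
  have "arrow_comp g f = arrow_of X Z (on_states g \<circ> on_states f) (on_actions g \<circ> on_actions f)"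
    using Hom_D[OF f] Hom_D[OF g] by (simp add: arrow_comp_def arrow_of_def compose_def
        restrict_def o_def)
  then show ?thesis
    using Hom_D[OF f] Hom_D[OF g] by (auto intro!: arrow_of_Hom premap_comp)
qed

lemma arrow_ident_Hom: "X \<in> Obj (systems b) \<Longrightarrow> arrow_ident X \<in> Hom (systems b) X X"
  using arrow_of_Hom[of X b X "\<lambda>\<alpha>. \<alpha>" "\<lambda>u. u"]
  by (simp add: arrow_of_def arrow_ident_def restrict_def premap_def)

lemma is_category_systems: "is_category (systems b)"
proof -
  have H: "f \<in> Hom (systems b) (source f) (target f)" if "f \<in> Arr (systems b)" for f
    using that by (simp add: Arr_systems)
  show ?thesis
    unfolding is_category_def
  proof (intro conjI ballI impI, unfold systems_simps)
    fix f assume "f \<in> Arr (systems b)"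
    note f = H[OF this] and D = Hom_D[OF H[OF this]]
    show "source f \<in> Obj (systems b)" "target f \<in> Obj (systems b)"
      using D by auto
    show "arrow_comp f (arrow_ident (source f)) = f"
      by (rule arrow_eqI[OF arrow_comp_Hom[OF arrow_ident_Hom[OF D(1)] f] f]) simp_all
    show "arrow_comp (arrow_ident (target f)) f = f"
      by (rule arrow_eqI[OF arrow_comp_Hom[OF f arrow_ident_Hom[OF D(2)]] f])
        (simp_all add: premapD[OF D(5)])
  next
    fix X assume "X \<in> Obj (systems b)"
    then show "arrow_ident X \<in> Hom (systems b) X X"
      by (rule arrow_ident_Hom)
  next
    fix f g assume fg: "f \<in> Arr (systems b)" "g \<in> Arr (systems b)" "target f = source g"
    then show "arrow_comp g f \<in> Hom (systems b) (source f) (target g)"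
      using H arrow_comp_Hom by metis
  next
    fix f g h assume fgh: "f \<in> Arr (systems b)" "g \<in> Arr (systems b)" "h \<in> Arr (systems b)"
      "target f = source g \<and> target g = source h"
    note f = H[OF fgh(1)] and g = H[OF fgh(2), folded fgh(4)[THEN conjunct1]]
      and h = H[OF fgh(3), folded fgh(4)[THEN conjunct2]]
    show "arrow_comp h (arrow_comp g f) = arrow_comp (arrow_comp h g) f"
      by (rule arrow_eqI[OF arrow_comp_Hom[OF arrow_comp_Hom[OF f g] h]
            arrow_comp_Hom[OF f arrow_comp_Hom[OF g h]]])
        (use premapD[OF Hom_D(5)[OF f]] fgh(4) in simp_all)
  qed
qed

end

sublocale hdts_universe \<subseteq> systems: cat "systems b" for b
  by unfold_locales (rule is_category_systems)

context hdts_universe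
begin

lemma Obj_systems_mono: "X \<in> Obj (systems b) \<Longrightarrow> X \<in> Obj (systems True)"
  by (auto simp: Obj_systems regular_def)

lemma Hom_systems_mono: "f \<in> Hom (systems b) X Y \<Longrightarrow> f \<in> Hom (systems True) X Y"
  by (auto simp: Hom_systems intro: Obj_systems_mono)

section \<open>The coreflector\<close>

lemma core_hdts_simps [simp]:
  "states (core_hdts X) = states X"
  "transitions (core_hdts X) = splitting_core (transitions X)"
  "u \<in> actions (core_hdts X) \<longleftrightarrow> (\<exists>\<alpha> us \<beta>. (\<alpha>, us, \<beta>) \<in> splitting_core (transitions X) \<and> u \<in> set us)"
  "u \<in> actions (core_hdts X) \<Longrightarrow> label (core_hdts X) u = label X u"
  by (auto simp: core_hdts_def Let_def)

lemma core_hdts_Obj: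
  assumes X: "X \<in> Obj (systems True)"
  shows "core_hdts X \<in> Obj (systems False)" "actions (core_hdts X) \<subseteq> actions X"
proof -
  have w: "weak_hdts \<Sigma> X"
    using X by (simp add: Obj_systems)
  let ?T = "splitting_core (transitions X)"
  have sub: "?T \<subseteq> transitions X"
    by (rule splitting_core_subset)
  show acts: "actions (core_hdts X) \<subseteq> actions X"
    using sub transition_typed(4)[OF w] by fastforce
  have "?T \<subseteq> well_typed (states X) (actions (core_hdts X))"
  proof
    fix t assume t: "t \<in> ?T"
    obtain \<alpha> us \<beta> where t': "t = (\<alpha>, us, \<beta>)"
      by (cases t)
    have "set us \<subseteq> actions (core_hdts X)"
      using t unfolding t' by (intro subsetI) (simp only: core_hdts_simps(3), blast)
    then show "t \<in> well_typed (states X) (actions (core_hdts X))"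
      using transition_typed[OF w subsetD[OF sub t[unfolded t']]]
      by (simp add: t' well_typed_def del: core_hdts_simps(3))
  qed
  moreover have "label (core_hdts X) \<in> actions (core_hdts X) \<rightarrow>\<^sub>E \<Sigma>"
    using w acts by (auto simp: weak_hdts_iff core_hdts_def Let_def)
  ultimately have "weak_hdts \<Sigma> (core_hdts X)"
    using w coherent_splitting_core[of "transitions X"]
    by (simp add: weak_hdts_iff mset_closed_splitting_core)
  moreover have "regular False (core_hdts X)"
    by (auto simp: regular_def all_used_def splitting_splitting_core)
  ultimately show "core_hdts X \<in> Obj (systems False)"
    using X acts by (auto simp: Obj_systems intro: small_subset)
qed

text \<open>The direct image of the transitions of \<open>Y\<close> is splitting and closed under
  permutations, so it lies in the largest such subset; the actions follow because each is
  used.\<close>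

lemma premap_core_hdts:
  assumes "premap Y X f0 f1" "weak_hdts \<Sigma> Y" "regular False Y"
  shows "premap Y (core_hdts X) f0 f1"
proof -
  have Y: "mset_closed (transitions Y)" "splitting (transitions Y)" "all_used Y"
    using assms(2,3) by (auto simp: weak_hdts_iff regular_def)
  have "tmap f0 f1 ` transitions Y \<subseteq> splitting_core (transitions X)"
    using premapD(4)[OF assms(1)]
    by (intro splitting_core_greatest mset_closed_image splitting_image Y) auto
  then have T: "(f0 \<alpha>, map f1 us, f0 \<beta>) \<in> splitting_core (transitions X)"
    if "(\<alpha>, us, \<beta>) \<in> transitions Y" for \<alpha> us \<beta>
    using that by force
  have act: "f1 u \<in> actions (core_hdts X)" if u: "u \<in> actions Y" for u
  proof -
    obtain \<alpha> us \<beta> where "(\<alpha>, us, \<beta>) \<in> transitions Y" "u \<in> set us"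
      using Y(3) u by (auto simp: all_used_def)
    with T show ?thesis
      by fastforce
  qed
  show ?thesis
    by (rule premapI) (use premapD[OF assms(1)] T act in \<open>auto simp del: core_hdts_simps(3)\<close>)
qed

definition counit :: "('u, 'u, 'l) hdts \<Rightarrow> ('u, 'u, 'l) hdts_arrow" where
  "counit X = arrow_of (core_hdts X) X (\<lambda>\<alpha>. \<alpha>) (\<lambda>u. u)"

lemma premap_counit:
  assumes "X \<in> Obj (systems True)"
  shows "premap (core_hdts X) X (\<lambda>\<alpha>. \<alpha>) (\<lambda>u. u)"
proof (rule premapI)
  show "u \<in> actions X" if "u \<in> actions (core_hdts X)" for u
    using that core_hdts_Obj(2)[OF assms] by blast
qed (use splitting_core_subset in auto)

lemma counit_Hom: "X \<in> Obj (systems True) \<Longrightarrow> counit X \<in> Hom (systems True) (core_hdts X) X"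
  unfolding counit_def
  by (rule arrow_of_Hom) (auto intro: core_hdts_Obj Obj_systems_mono premap_counit)

text \<open>The adjunct of \<open>f\<close> has the same underlying functions as \<open>f\<close>
  and only a smaller target.\<close>

lemma coreflection_systems: "coreflection (systems True) (regular False) core_hdts counit"
proof unfold_locales
  fix Y assume Y: "Y \<in> Obj (systems True)"
  show "core_hdts Y \<in> Obj (systems True) \<and> regular False (core_hdts Y)"
    using core_hdts_Obj(1)[OF Y] Obj_systems_mono by (auto simp: Obj_systems)
  show "counit Y \<in> Hom (systems True) (core_hdts Y) Y"
    using Y by (rule counit_Hom)
next
  fix f X Y assume f: "f \<in> Hom (systems True) X Y" and X: "regular False X"
  note D = Hom_D[OF f]
  have Y: "core_hdts Y \<in> Obj (systems True)"
    using D(2) core_hdts_Obj Obj_systems_mono by blast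
  let ?g = "arrow_of X (core_hdts Y) (on_states f) (on_actions f)"
  have p: "premap X (core_hdts Y) (on_states f) (on_actions f)"
    by (rule premap_core_hdts[OF D(5,6) X])
  have g: "?g \<in> Hom (systems True) X (core_hdts Y)"
    by (rule arrow_of_Hom[OF D(1) Y p])
  show "\<exists>!g. g \<in> Hom (systems True) X (core_hdts Y) \<and> Comp (systems True) (counit Y) g = f"
  proof (rule ex1I[of _ ?g])
    have "arrow_comp (counit Y) ?g = f"
      by (rule arrow_eqI[OF arrow_comp_Hom[OF g counit_Hom[OF D(2)]] f])
        (use premapD[OF p] in \<open>auto simp: counit_def simp del: core_hdts_simps(3)\<close>)
    with g show "?g \<in> Hom (systems True) X (core_hdts Y) \<and> Comp (systems True) (counit Y) ?g = f"
      by simp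
  next
    fix h assume "h \<in> Hom (systems True) X (core_hdts Y) \<and> Comp (systems True) (counit Y) h = f"
    then have h: "h \<in> Hom (systems True) X (core_hdts Y)" "arrow_comp (counit Y) h = f"
      by auto
    note Dh = Hom_D[OF h(1)]
    show "h = ?g"
      by (rule arrow_eqI[OF h(1) g], unfold h(2)[symmetric])
        (use Dh(3) premapD[OF Dh(5)] in \<open>auto simp: counit_def simp del: core_hdts_simps(3)\<close>)
  qed
qed

text \<open>Two test objects suffice: a single state without actions, and a single action without
  states. The second is a weak system but not a cubical one, which is harmless since subobjects are
  taken among weak systems.\<close>

lemma monic_inj:
  assumes "monic (WHDTS U \<Sigma>) m"
  shows "inj_on (on_states m) (states (source m))" "inj_on (on_actions m) (actions (source m))"
proof -
  have mA: "m \<in> Arr (systems True)" and mon: "\<And>f g. f \<in> Hom (systems True) Z (source m) \<Longrightarrow>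
      g \<in> Hom (systems True) Z (source m) \<Longrightarrow> arrow_comp m f = arrow_comp m g \<Longrightarrow> f = g" for Z
    using assms unfolding systems_True[symmetric] monic_def by (auto simp: Hom_def)
  then have m: "m \<in> Hom (systems True) (source m) (target m)"
    by (simp add: Arr_systems)
  note D = Hom_D[OF m]
  obtain x where x: "x \<in> U"
    using infinite_U by (metis finite.emptyI ex_in_conv)
  show "inj_on (on_states m) (states (source m))"
  proof (rule inj_onI)
    fix \<alpha> \<beta> assume ab: "\<alpha> \<in> states (source m)" "\<beta> \<in> states (source m)" "on_states m \<alpha> = on_states m \<beta>"
    define P :: "('u, 'u, 'l) hdts" where
      "P = \<lparr>states = {x}, actions = {}, label = (\<lambda>u\<in>{}. undefined), transitions = {}\<rparr>"
    have P: "P \<in> Obj (systems True)"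
      using x by (auto simp: Obj_systems P_def weak_hdts_iff regular_def mset_closed_def coherent_def
          intro: small_finite)
    have h: "arrow_of P (source m) (\<lambda>_. \<gamma>) id \<in> Hom (systems True) P (source m)"
      if "\<gamma> \<in> states (source m)" for \<gamma>
      by (rule arrow_of_Hom[OF P D(1)]) (use that in \<open>auto simp: premap_def P_def\<close>)
    have "arrow_of P (source m) (\<lambda>_. \<alpha>) id = arrow_of P (source m) (\<lambda>_. \<beta>) id"
      by (rule mon[OF h h], use ab in simp_all, rule arrow_eqI[OF arrow_comp_Hom[OF h m]
          arrow_comp_Hom[OF h m]])
        (use ab in \<open>auto simp: P_def\<close>)
    then have "on_states (arrow_of P (source m) (\<lambda>_. \<alpha>) id) x = on_states (arrow_of P (source m)
        (\<lambda>_. \<beta>) id) x"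
      by simp
    then show "\<alpha> = \<beta>"
      by (simp add: P_def arrow_of_def)
  qed
  show "inj_on (on_actions m) (actions (source m))"
  proof (rule inj_onI)
    fix u v assume uv: "u \<in> actions (source m)" "v \<in> actions (source m)" "on_actions m u =
        on_actions m v"
    define P :: "('u, 'u, 'l) hdts" where
      "P = \<lparr>states = {}, actions = {x}, label = (\<lambda>_\<in>{x}. label (source m) u), transitions = {}\<rparr>"
    have l: "label (source m) v = label (source m) u"
      using premapD(3)[OF D(5)] uv by metis
    have "label (source m) u \<in> \<Sigma>"
      using D(6) uv by (auto simp: weak_hdts_iff)
    then have P: "P \<in> Obj (systems True)"
      using x by (auto simp: Obj_systems P_def weak_hdts_iff regular_def mset_closed_def coherent_def
          intro: small_finite)
    have h: "arrow_of P (source m) id (\<lambda>_. w) \<in> Hom (systems True) P (source m)"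
      if "w \<in> {u, v}" for w
      by (rule arrow_of_Hom[OF P D(1)]) (use that uv l in \<open>auto simp: premap_def P_def\<close>)
    have "arrow_of P (source m) id (\<lambda>_. u) = arrow_of P (source m) id (\<lambda>_. v)"
      by (rule mon[OF h h], simp_all, rule arrow_eqI[OF arrow_comp_Hom[OF h m] arrow_comp_Hom[OF h m]])
        (use uv in \<open>auto simp: P_def\<close>)
    then have "on_actions (arrow_of P (source m) id (\<lambda>_. u)) x = on_actions (arrow_of P (source m)
        id (\<lambda>_. v)) x"
      by simp
    then show "u = v"
      by (simp add: P_def arrow_of_def)
  qed
qed

lemma inj_monic:
  assumes m: "m \<in> Hom (systems True) X Y"
    and "inj_on (on_states m) (states X)" "inj_on (on_actions m) (actions X)"
  shows "monic (WHDTS U \<Sigma>) m"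
  unfolding systems_True[symmetric] monic_def
proof (intro conjI ballI impI)
  show "m \<in> Arr (systems True)"
    using m by (rule systems.Hom_Arr)
  fix f g assume fg: "f \<in> Arr (systems True)" "g \<in> Arr (systems True)"
    "Dom (systems True) f = Dom (systems True) g \<and> Cod (systems True) f = Dom (systems True) m \<and>
      Cod (systems True) g = Dom (systems True) m \<and> Comp (systems True) m f = Comp (systems True) m g"
  then have f: "f \<in> Hom (systems True) (source f) X" and g: "g \<in> Hom (systems True) (source f) X"
    and eq: "arrow_comp m f = arrow_comp m g"
    using Hom_D(3)[OF m] by (auto simp: Hom_def)
  note Df = Hom_D[OF f] and Dg = Hom_D[OF g]
  show "f = g"
  proof (rule arrow_eqI[OF f g])
    fix \<alpha> assume a: "\<alpha> \<in> states (source f)"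
    then have "on_states m (on_states f \<alpha>) = on_states m (on_states g \<alpha>)"
      using arg_cong[OF eq, of "\<lambda>h. on_states h \<alpha>"] Dg(3) by simp
    then show "on_states f \<alpha> = on_states g \<alpha>"
      using assms(2) premapD(1)[OF Df(5) a] premapD(1)[OF Dg(5) a] by (simp add: inj_on_eq_iff)
  next
    fix u assume a: "u \<in> actions (source f)"
    then have "on_actions m (on_actions f u) = on_actions m (on_actions g u)"
      using arg_cong[OF eq, of "\<lambda>h. on_actions h u"] Dg(3) by simp
    then show "on_actions f u = on_actions g u"
      using assms(3) premapD(2)[OF Df(5) a] premapD(2)[OF Dg(5) a] by (simp add: inj_on_eq_iff)
  qed
qed

section \<open>Images and subcubes\<close>

definition image_hdts :: "('u, 'u, 'l) hdts_arrow \<Rightarrow> ('u, 'u, 'l) hdts" where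
  "image_hdts f = \<lparr>states = on_states f ` states (source f), actions = on_actions f ` actions (source f),
     label = restrict (label (target f)) (on_actions f ` actions (source f)),
     transitions = coherent_closure (tmap (on_states f) (on_actions f) ` transitions (source f))\<rparr>"

text \<open>The direct image closed under the axioms is the least subobject: any monomorphism
  through which \<open>f\<close> factors contains the generators, and its own axioms supply the
  closure.\<close>

lemma image_exists:
  assumes f: "f \<in> Arr (WHDTS U \<Sigma>)"
  shows "\<exists>m. is_image (WHDTS U \<Sigma>) f m"
proof -
  define X Y where "X = source f" and "Y = target f"
  have f': "f \<in> Hom (systems True) X Y"
    using f by (simp add: X_def Y_def systems_True[symmetric] Arr_systems)
  note D = Hom_D[OF f']
  let ?I = "image_hdts f"
  let ?m = "arrow_of ?I Y (\<lambda>\<alpha>. \<alpha>) (\<lambda>u. u)"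
  have sub: "states ?I \<subseteq> states Y" "actions ?I \<subseteq> actions Y"
    using premapD[OF D(5)] by (auto simp: image_hdts_def X_def)
  have typed: "transitions ?I \<subseteq> well_typed (states ?I) (actions ?I)"
  proof -
    have "transitions X \<subseteq> well_typed (states X) (actions X)"
      using D(6) by (simp add: weak_hdts_iff)
    then have "tmap (on_states f) (on_actions f) ` transitions X \<subseteq>
        well_typed (on_states f ` states X) (on_actions f ` actions X)"
      by (rule tmap_well_typed) auto
    then show ?thesis
      by (simp add: image_hdts_def X_def coherent_closure_well_typed)
  qed
  have "weak_hdts \<Sigma> ?I"
    unfolding weak_hdts_iff
  proof (intro conjI typed)
    show "label ?I \<in> actions ?I \<rightarrow>\<^sub>E \<Sigma>"
      using sub(2) D(4,7) by (auto simp: image_hdts_def weak_hdts_iff)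
  qed (simp_all add: image_hdts_def mset_closed_coherent_closure coherent_coherent_closure)
  then have I: "?I \<in> Obj (systems True)"
    using D(1,2) sub small_subset by (auto simp: Obj_systems regular_def)
  have p: "premap ?I Y (\<lambda>\<alpha>. \<alpha>) (\<lambda>u. u)"
  proof (rule premapI)
    show "label Y u = label ?I u" if "u \<in> actions ?I" for u
      using that D(4) by (simp add: image_hdts_def)
    fix \<alpha> us \<beta> assume "(\<alpha>, us, \<beta>) \<in> transitions ?I"
    moreover have "coherent_closure (tmap (on_states f) (on_actions f) ` transitions (source f)) \<subseteq>
        transitions Y"
      using D(7) premapD(4)[OF D(5)] by (intro coherent_closure_least) (auto simp: weak_hdts_iff X_def)
    ultimately show "(\<alpha>, map (\<lambda>u. u) us, \<beta>) \<in> transitions Y"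
      by (auto simp: image_hdts_def)
  qed (use sub in auto)
  note m = arrow_of_Hom[OF I D(2) p]
  have q: "premap X ?I (on_states f) (on_actions f)"
    by (rule premapI)
      (use premapD[OF D(5)] D(4) in \<open>auto simp: image_hdts_def X_def intro!: coherent_closure.base
          rev_image_eqI\<close>)
  have "is_image (WHDTS U \<Sigma>) f ?m"
    unfolding is_image_def systems_True[symmetric]
  proof (intro conjI ballI impI)
    show "?m \<in> subobjects (systems True) (Cod (systems True) f)"
      using inj_monic[OF m] by (simp add: subobjects_def systems_True[symmetric] Y_def inj_on_def)
    have "arrow_comp ?m (arrow_of X ?I (on_states f) (on_actions f)) = f"
      by (rule arrow_eqI[OF arrow_comp_Hom[OF arrow_of_Hom[OF D(1) I q] m] f'])
        (auto simp: image_hdts_def X_def)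
    then show "factors_through (systems True) f ?m"
      using arrow_of_Hom[OF D(1) I q] unfolding factors_through_def
      by (intro bexI[of _ "arrow_of X ?I (on_states f) (on_actions f)"]) (simp_all add: X_def)
    fix m' assume "m' \<in> subobjects (systems True) (Cod (systems True) f)" "factors_through
        (systems True) f m'"
    then obtain h where m': "monic (WHDTS U \<Sigma>) m'" "target m' = Y" and h: "h \<in> Hom (systems True)
        X (source m')"
      and fh: "f = arrow_comp m' h"
      by (auto simp: subobjects_def factors_through_def systems_True[symmetric] X_def Y_def)
    have m'H: "m' \<in> Hom (systems True) (source m') Y"
      using m' by (auto simp: monic_def systems_True[symmetric] Hom_def)
    note Dh = Hom_D[OF h] and Dm = Hom_D[OF m'H] and inj = monic_inj[OF m'(1)]
    have f0: "on_states f \<alpha> = on_states m' (on_states h \<alpha>)" if "\<alpha> \<in> states X" for \<alpha>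
      using that Dh(3) by (simp add: fh)
    have f1: "on_actions f u = on_actions m' (on_actions h u)" if "u \<in> actions X" for u
      using that Dh(3) by (simp add: fh)
    \<comment> \<open>The factorization is read backwards: on values of \<open>f\<close>, inverting
      the injective \<open>m'\<close> returns the values of \<open>h\<close>.\<close>
    define k0 where "k0 = inv_into (states (source m')) (on_states m')"
    define k1 where "k1 = inv_into (actions (source m')) (on_actions m')"
    have k0: "k0 (on_states f \<alpha>) = on_states h \<alpha>" if "\<alpha> \<in> states X" for \<alpha>
      using inj(1) premapD(1)[OF Dh(5)] that by (simp add: k0_def f0)
    have k1: "k1 (on_actions f u) = on_actions h u" if "u \<in> actions X" for u
      using inj(2) premapD(2)[OF Dh(5)] that by (simp add: k1_def f1)
    have pk: "premap ?I (source m') k0 k1"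
    proof (rule premapI)
      fix \<alpha> assume "\<alpha> \<in> states ?I"
      then show "k0 \<alpha> \<in> states (source m')"
        using k0 premapD(1)[OF Dh(5)] by (auto simp: image_hdts_def X_def)
    next
      fix v assume "v \<in> actions ?I"
      then obtain u where u: "u \<in> actions X" "v = on_actions f u"
        by (auto simp: image_hdts_def X_def)
      then show "k1 v \<in> actions (source m')"
        using k1 premapD(2)[OF Dh(5)] by simp
      show "label (source m') (k1 v) = label ?I v"
        using u k1 premapD(3)[OF Dh(5)] premapD(3)[OF D(5)] D(4) by (auto simp: image_hdts_def X_def)
    next
      fix \<alpha> us \<beta> assume "(\<alpha>, us, \<beta>) \<in> transitions ?I"
      then have t: "(\<alpha>, us, \<beta>) \<in> coherent_closure (tmap (on_states f) (on_actions f) ` transitions X)"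
        by (simp add: image_hdts_def X_def)
      show "(k0 \<alpha>, map k1 us, k0 \<beta>) \<in> transitions (source m')"
      proof (rule premap_coherent_closure[OF _ _ _ t])
        fix a vs b assume "(a, vs, b) \<in> tmap (on_states f) (on_actions f) ` transitions X"
        then obtain \<alpha>' us' \<beta>' where t': "(\<alpha>', us', \<beta>') \<in> transitions X" "a = on_states f \<alpha>'"
          "vs = map (on_actions f) us'" "b = on_states f \<beta>'"
          by auto
        note tt = transition_typed[OF D(6) t'(1)]
        have "map k1 vs = map (on_actions h) us'"
          using tt(4) k1 by (auto simp: t')
        then show "(k0 a, map k1 vs, k0 b) \<in> transitions (source m')"
          using premapD(4)[OF Dh(5) t'(1)] k0 tt(1,2) by (simp add: t'(2,4))
      qed (use Dm(6) in \<open>auto simp: weak_hdts_iff\<close>)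
    qed
    note kH = arrow_of_Hom[OF I Dm(1) pk]
    have c0: "on_states m' (k0 (on_states f \<alpha>)) = on_states f \<alpha>" if "\<alpha> \<in> states X" for \<alpha>
      using k0[OF that] f0[OF that] by simp
    have c1: "on_actions m' (k1 (on_actions f u)) = on_actions f u" if "u \<in> actions X" for u
      using k1[OF that] f1[OF that] by simp
    have "arrow_comp m' (arrow_of ?I (source m') k0 k1) = ?m"
      by (rule arrow_eqI[OF arrow_comp_Hom[OF kH m'H] m])
        (auto simp: image_hdts_def X_def[symmetric] c0 c1)
    then show "factors_through (systems True) ?m m'"
      using kH unfolding factors_through_def
      by (intro bexI[of _ "arrow_of ?I (source m') k0 k1"]) simp_all
  qed
  then show ?thesis
    by blast
qed

text \<open>Hides images and copies of cubes: a subobject that contains all subcubes receives every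
  map out of an abstract cube, through the copy of the cube in \<open>U\<close> and then through its
  image.\<close>

lemma subcube_factorization:
  assumes X: "X \<in> Obj (systems True)" and xs: "xs \<in> lists \<Sigma>" and g: "premap (cube xs) X g0 g1"
    and m: "m \<in> subobjects (WHDTS U \<Sigma>) X"
      "\<And>c. c \<in> subcubes U \<Sigma> X \<Longrightarrow> factors_through (WHDTS U \<Sigma>) c m"
  shows "\<exists>k0 k1. premap (cube xs) (source m) k0 k1 \<and>
    (\<forall>\<epsilon>\<in>states (cube xs). on_states m (k0 \<epsilon>) = g0 \<epsilon>) \<and>
    (\<forall>u\<in>actions (cube xs). on_actions m (k1 u) = g1 u)"
proof -
  let ?C = "cube xs"
  have "finite (states ?C)" "finite (actions ?C)"
    using finite_lists_length_eq[of "UNIV :: bool set" "length xs"] by (auto simp: cube_def Let_def)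
  then have small: "small (states ?C)" "small (actions ?C)"
    by (auto intro: small_finite)
  obtain e0 :: "bool list \<Rightarrow> 'u" where e0: "inj_on e0 (states ?C)" "e0 ` states ?C \<subseteq> U" "small (e0
      ` states ?C)"
    using small_copy[OF small(1)] .
  obtain e1 :: "'l \<times> nat \<Rightarrow> 'u" where e1: "inj_on e1 (actions ?C)" "e1 ` actions ?C \<subseteq> U" "small (e1
      ` actions ?C)"
    using small_copy[OF small(2)] .
  define C where "C = copy_hdts e0 e1 ?C"
  note iso = copy_hdts_isomorphism[OF weak_hdts_cube[OF xs] e0(1) e1(1), folded C_def]
  have C: "C \<in> Obj (systems True)"
    using iso(1) e0(2,3) e1(2,3) by (simp add: Obj_systems regular_def C_def copy_hdts_def)
  note p = premap_comp[OF iso(3) g]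
  define f where "f = arrow_of C X (g0 \<circ> inv_into (states ?C) e0) (g1 \<circ> inv_into (actions ?C) e1)"
  have f: "f \<in> Hom (systems True) C X"
    unfolding f_def by (rule arrow_of_Hom[OF C X p])
  have fA: "f \<in> Arr (WHDTS U \<Sigma>)"
    using f by (simp add: Hom_def systems_True)
  have "hdts_isomorphic ?C C"
    unfolding C_def by (rule hdts_isomorphic_copy[OF weak_hdts_cube[OF xs] e0(1) e1(1)])
  then have "f \<in> cubes_of U \<Sigma> X"
    using fA xs Hom_D(3,4)[OF f] by (auto simp: cubes_of_def)
  moreover obtain c where c: "is_image (WHDTS U \<Sigma>) f c"
    using image_exists[OF fA] by blast
  ultimately have "factors_through (WHDTS U \<Sigma>) c m"
    by (intro m(2)) (auto simp: subcubes_def)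
  then obtain h where h: "h \<in> Hom (systems True) (source c) (source m)" "c = arrow_comp m h"
    by (auto simp: factors_through_def WHDTS_simps systems_True)
  obtain l where l: "l \<in> Hom (systems True) C (source c)" "f = arrow_comp c l"
    using c Hom_D(3)[OF f] by (auto simp: is_image_def factors_through_def WHDTS_simps systems_True)
  note Dh = Hom_D[OF h(1)] and Dl = Hom_D[OF l(1)]
  have c0: "on_states c \<alpha> = on_states m (on_states h \<alpha>)" if "\<alpha> \<in> states (source c)" for \<alpha>
    by (subst h(2)) (use that Dh(3) in simp)
  have c1: "on_actions c u = on_actions m (on_actions h u)" if "u \<in> actions (source c)" for u
    by (subst h(2)) (use that Dh(3) in simp)
  have f0: "on_states f \<alpha> = on_states m (on_states h (on_states l \<alpha>))" if "\<alpha> \<in> states C" for \<alpha>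
    using that Dl(3) c0[OF premapD(1)[OF Dl(5) that]] by (simp add: l(2))
  have f1: "on_actions f u = on_actions m (on_actions h (on_actions l u))" if "u \<in> actions C" for u
    using that Dl(3) c1[OF premapD(2)[OF Dl(5) that]] by (simp add: l(2))
  show ?thesis
  proof (intro exI conjI ballI)
    show "premap ?C (source m) (on_states h \<circ> on_states l \<circ> e0) (on_actions h \<circ> on_actions l \<circ> e1)"
      using premap_comp[OF premap_comp[OF iso(2) Dl(5)] Dh(5)] by (simp only: o_assoc)
    show "on_states m ((on_states h \<circ> on_states l \<circ> e0) \<epsilon>) = g0 \<epsilon>" if "\<epsilon> \<in> states ?C" for \<epsilon>
    proof -
      have eC: "e0 \<epsilon> \<in> states C"
        using premapD(1)[OF iso(2)] that by blast
      have "on_states f (e0 \<epsilon>) = g0 \<epsilon>"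
        using eC that e0(1) by (simp add: f_def)
      then show ?thesis
        using f0[OF eC] by simp
    qed
    show "on_actions m ((on_actions h \<circ> on_actions l \<circ> e1) u) = g1 u" if "u \<in> actions ?C" for u
    proof -
      have eC: "e1 u \<in> actions C"
        using premapD(2)[OF iso(2)] that by blast
      have "on_actions f (e1 u) = g1 u"
        using eC inv_into_f_f[OF e1(1) that] by (simp add: f_def)
      then show ?thesis
        using f1[OF eC] by simp
    qed
  qed
qed

text \<open>The counit is a subobject of \<open>X\<close>, and every cube factors through it because
  cubes are regular. Being above all subcubes it is above their union, so the identity of
  \<open>X\<close> factors through the core and \<open>X\<close> equals its core.\<close>

lemma cubical_imp_regular:
  assumes X: "X \<in> Obj (systems True)" and "cubical U \<Sigma> X"
  shows "regular False X"
proof -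
  let ?W = "WHDTS U \<Sigma>"
  have e: "counit X \<in> Hom (systems True) (core_hdts X) X"
    by (rule counit_Hom[OF X])
  note D = Hom_D[OF e]
  have mono: "counit X \<in> subobjects ?W X"
    using inj_monic[OF e] D(4) by (simp add: subobjects_def WHDTS_simps counit_def inj_on_def del:
        core_hdts_simps(3))
  interpret coreflection "systems True" "regular False" core_hdts counit
    by (rule coreflection_systems)
  have "factors_through ?W c (counit X)" if "c \<in> subcubes U \<Sigma> X" for c
  proof -
    obtain f xs where f: "f \<in> Arr ?W" "target f = X" and xs: "xs \<in> lists \<Sigma>" "hdts_isomorphic (cube
        xs) (source f)"
      and c: "is_image ?W f c"
      using \<open>c \<in> subcubes U \<Sigma> X\<close> by (auto simp: subcubes_def cubes_of_def)
    have fH: "f \<in> Hom (systems True) (source f) X"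
      using f by (auto simp: systems_True[symmetric] Arr_systems)
    have "regular False (source f)"
      using isomorphic_splitting[OF xs(2) Hom_D(6)[OF fH] splitting_cube all_used_cube]
      by (simp add: regular_def)
    from adjunct[OF fH this] have "factors_through ?W f (counit X)"
      unfolding factors_through_def systems_True[symmetric]
      by (intro bexI[of _ "adjunct f"]) (simp_all add: D(3))
    then show ?thesis
      using c mono f(2) by (simp add: is_image_def WHDTS_simps)
  qed
  then have "factors_through ?W (arrow_ident X) (counit X)"
    using assms(2) mono by (simp add: cubical_def is_union_def WHDTS_simps)
  then obtain h where h: "h \<in> Hom (systems True) X (core_hdts X)" "arrow_ident X = arrow_comp
      (counit X) h"
    by (auto simp: factors_through_def systems_True[symmetric] D(3))
  note Dh = Hom_D[OF h(1)]
  have h0: "on_states h \<alpha> = \<alpha>" if "\<alpha> \<in> states X" for \<alpha>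
    using arg_cong[OF h(2), of "\<lambda>k. on_states k \<alpha>"] that Dh(3) premapD(1)[OF Dh(5) that]
    by (simp add: counit_def)
  have h1: "on_actions h u = u" if "u \<in> actions X" for u
    using arg_cong[OF h(2), of "\<lambda>k. on_actions k u"] that Dh(3) premapD(2)[OF Dh(5) that]
    by (simp add: counit_def del: core_hdts_simps(3))
  have T: "transitions X = splitting_core (transitions X)"
  proof
    show "splitting_core (transitions X) \<subseteq> transitions X"
      by (rule splitting_core_subset)
    show "transitions X \<subseteq> splitting_core (transitions X)"
    proof
      fix t assume t: "t \<in> transitions X"
      obtain \<alpha> us \<beta> where t': "t = (\<alpha>, us, \<beta>)"
        by (cases t)
      note tt = transition_typed[OF Dh(6) t[unfolded t']]
      have "map (on_actions h) us = us"
        using tt(4) h1 by (intro map_idI) auto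
      then show "t \<in> splitting_core (transitions X)"
        using premapD(4)[OF Dh(5) t[unfolded t']] tt h0 by (simp add: t')
    qed
  qed
  have "all_used X"
    unfolding all_used_def
  proof
    fix u assume u: "u \<in> actions X"
    then have "u \<in> actions (core_hdts X)"
      using premapD(2)[OF Dh(5) u] h1[OF u] by simp
    then show "\<exists>\<alpha> us \<beta>. (\<alpha>, us, \<beta>) \<in> transitions X \<and> u \<in> set us"
      using T by simp
  qed
  then show ?thesis
    using splitting_splitting_core[of "transitions X"] T by (simp add: regular_def)
qed

text \<open>Let \<open>m\<close> contain all subcubes. States are 0-cubes and every transition
  extends to a cube, so \<open>m\<close> reaches all states and transitions, and all actions since
  these are used. Being injective, it can be inverted.\<close>

lemma regular_imp_cubical:
  assumes X: "X \<in> Obj (systems True)" and reg: "regular False X"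
  shows "cubical U \<Sigma> X"
  unfolding cubical_def is_union_def WHDTS_simps
proof (intro conjI ballI impI)
  let ?W = "WHDTS U \<Sigma>"
  note idH = arrow_ident_Hom[OF X]
  have w: "weak_hdts \<Sigma> X"
    using X by (simp add: Obj_systems)
  show "arrow_ident X \<in> subobjects ?W X"
    using inj_monic[OF idH] by (simp add: subobjects_def WHDTS_simps inj_on_def)
  show "factors_through ?W c (arrow_ident X)" if "c \<in> subcubes U \<Sigma> X" for c
  proof -
    have "c \<in> subobjects ?W X"
      using that by (auto simp: subcubes_def cubes_of_def is_image_def WHDTS_simps)
    then have "c \<in> Hom (systems True) (source c) X"
      by (auto simp: subobjects_def monic_def systems_True[symmetric] Hom_def)
    then show ?thesis
      unfolding factors_through_def systems_True[symmetric]
      by (intro bexI[of _ c]) (use systems.ident_comp in auto)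
  qed
  fix m assume m: "m \<in> subobjects ?W X" and sub: "\<forall>c\<in>subcubes U \<Sigma> X. factors_through ?W c m"
  have mH: "m \<in> Hom (systems True) (source m) X"
    using m by (auto simp: subobjects_def monic_def systems_True[symmetric] Hom_def)
  note D = Hom_D[OF mH]
  have inj: "inj_on (on_states m) (states (source m))" "inj_on (on_actions m) (actions (source m))"
    using monic_inj m by (auto simp: subobjects_def)
  note fact = subcube_factorization[OF X _ _ m sub[rule_format]]
  have st: "\<alpha> \<in> on_states m ` states (source m)" if a: "\<alpha> \<in> states X" for \<alpha>
  proof -
    \<comment> \<open>The 0-cube has one state and no actions, so it picks out
      \<open>\<alpha>\<close>; its function on actions is arbitrary.\<close>
    have p: "premap (cube ([] :: 'l list)) X (\<lambda>_. \<alpha>) (\<lambda>_. undefined)"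
      using a by (auto simp: premap_def cube_def)
    obtain k0 k1 where k: "premap (cube ([] :: 'l list)) (source m) k0 k1"
      "\<forall>\<epsilon>\<in>states (cube ([] :: 'l list)). on_states m (k0 \<epsilon>) = \<alpha>"
      using fact[OF lists.Nil p] by blast
    show ?thesis
      using premapD(1)[OF k(1), of "[]"] bspec[OF k(2), of "[]"] by (intro image_eqI[of _ _ "k0
          []"]) auto
  qed
  have tr: "\<exists>us'. us = map (on_actions m) us' \<and> set us' \<subseteq> actions (source m) \<and>
      (\<exists>a b. \<alpha> = on_states m a \<and> \<beta> = on_states m b \<and> (a, us', b) \<in> transitions (source m))"
    if t: "(\<alpha>, us, \<beta>) \<in> transitions X" for \<alpha> us \<beta>
  proof -
    obtain f0 f1 \<epsilon> ks \<epsilon>'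
      where f: "premap (cube (map (label X) us)) X f0 f1"
        "(\<epsilon>, ks, \<epsilon>') \<in> transitions (cube (map (label X) us))" "(f0 \<epsilon>, map f1 ks, f0 \<epsilon>') = (\<alpha>, us, \<beta>)"
      by (rule cube_of_transition[OF w _ t]) (use reg in \<open>simp add: regular_def\<close>)
    have xs: "map (label X) us \<in> lists \<Sigma>"
      using transition_typed(4)[OF w t] w by (auto simp: weak_hdts_iff in_lists_conv_set)
    obtain k0 k1 where k: "premap (cube (map (label X) us)) (source m) k0 k1"
      "\<forall>\<epsilon>\<in>states (cube (map (label X) us)). on_states m (k0 \<epsilon>) = f0 \<epsilon>"
      "\<forall>u\<in>actions (cube (map (label X) us)). on_actions m (k1 u) = f1 u"
      using fact[OF xs f(1)] by blast
    note tt = transition_typed[OF weak_hdts_cube[OF xs] f(2)]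
    have "map f1 ks = map (on_actions m) (map k1 ks)"
      using k(3) tt(4) by auto
    moreover have "(k0 \<epsilon>, map k1 ks, k0 \<epsilon>') \<in> transitions (source m)"
      by (rule premapD(4)[OF k(1) f(2)])
    moreover have "set (map k1 ks) \<subseteq> actions (source m)"
      using transition_typed(4)[OF D(6)] calculation(2) by blast
    moreover have "on_states m (k0 \<epsilon>) = \<alpha>" "on_states m (k0 \<epsilon>') = \<beta>"
      using f(3) bspec[OF k(2) tt(1)] bspec[OF k(2) tt(2)] by simp_all
    moreover have "us = map f1 ks"
      using f(3) by simp
    ultimately show ?thesis
      by metis
  qed
  have ac: "u \<in> on_actions m ` actions (source m)" if u: "u \<in> actions X" for u
  proof -
    obtain \<alpha> us \<beta> where "(\<alpha>, us, \<beta>) \<in> transitions X" "u \<in> set us"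
      using reg u unfolding regular_def all_used_def by blast
    then show ?thesis
      using tr by fastforce
  qed
  \<comment> \<open>By now \<open>m\<close> is bijective on states and actions, and
    \<open>tr\<close> says that transitions lift along it, so the inverse functions form a
    map.\<close>
  define k0 where "k0 = inv_into (states (source m)) (on_states m)"
  define k1 where "k1 = inv_into (actions (source m)) (on_actions m)"
  have k0: "k0 \<alpha> \<in> states (source m)" "on_states m (k0 \<alpha>) = \<alpha>" if "\<alpha> \<in> states X" for \<alpha>
    using st[OF that] by (auto simp: k0_def inv_into_into f_inv_into_f)
  have k1: "k1 u \<in> actions (source m)" "on_actions m (k1 u) = u" if "u \<in> actions X" for u
    using ac[OF that] by (auto simp: k1_def inv_into_into f_inv_into_f)
  have "premap X (source m) k0 k1"
  proof (rule premapI)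
    show "label (source m) (k1 u) = label X u" if "u \<in> actions X" for u
      using premapD(3)[OF D(5) k1(1)[OF that]] k1(2)[OF that] by simp
    fix \<alpha> us \<beta> assume "(\<alpha>, us, \<beta>) \<in> transitions X"
    then obtain us' a b where t: "us = map (on_actions m) us'" "set us' \<subseteq> actions (source m)"
      "\<alpha> = on_states m a" "\<beta> = on_states m b" "(a, us', b) \<in> transitions (source m)"
      using tr by blast
    have "k0 \<alpha> = a" "k0 \<beta> = b"
      using transition_typed(1,2)[OF D(6) t(5)] inj(1) by (simp_all add: k0_def t(3,4))
    moreover have "map k1 us = us'"
      unfolding t(1) map_map using t(2) inj(2) by (intro map_idI) (auto simp: k1_def)
    ultimately show "(k0 \<alpha>, map k1 us, k0 \<beta>) \<in> transitions (source m)"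
      using t(5) by simp
  qed (use k0 k1 in auto)
  note k = arrow_of_Hom[OF X D(1) this]
  have "arrow_comp m (arrow_of X (source m) k0 k1) = arrow_ident X"
    by (rule arrow_eqI[OF arrow_comp_Hom[OF k mH] idH]) (simp_all add: k0 k1)
  then show "factors_through ?W (arrow_ident X) m"
    using k unfolding factors_through_def systems_True[symmetric]
    by (intro bexI[of _ "arrow_of X (source m) k0 k1"]) simp_all
qed

lemma CTS_eq: "CTS U \<Sigma> = systems False"
  unfolding CTS_def systems_def
proof (rule full_subcategory_cong)
  show "is_category (WHDTS U \<Sigma>)"
    using is_category_systems[of True] by (simp add: systems_True)
  show "cubical U \<Sigma> X = regular False X" if "X \<in> Obj (WHDTS U \<Sigma>)" for X
    using that cubical_imp_regular regular_imp_cubical by (auto simp: systems_True)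
qed

section \<open>Limits and colimits\<close>

text \<open>States and actions are colimits of sets, and transitions are generated by the pushed
  forward ones. As splitting passes through images, unions and closure, one construction serves both
  values of \<open>b\<close>.\<close>

lemma colimit_exists:
  fixes J :: "('u, 'u) category"
  assumes J: "is_small_category U J" and D: "is_functor J (systems b) D"
  shows "\<exists>L \<iota>. is_colimit J (systems b) D L \<iota>"
proof -
  have Dobj: "fobj D j \<in> Obj (systems b)" if "j \<in> Obj J" for j
    using D that by (simp add: is_functor_def)
  have Dmap: "fmap D a \<in> Hom (systems b) (fobj D (Dom J a)) (fobj D (Cod J a))" if "a \<in> Arr J" for a
    using D that by (simp add: is_functor_def)
  have JD: "Dom J a \<in> Obj J" "Cod J a \<in> Obj J" if "a \<in> Arr J" for a
    using J that by (auto simp: is_small_category_def is_category_def)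
  have w: "weak_hdts \<Sigma> (fobj D j)" and small: "small (states (fobj D j))" "small (actions (fobj D j))"
    if "j \<in> Obj J" for j
    using Dobj[OF that] by (auto simp: Obj_systems)
  have smallJ: "small (Obj J)"
    using J by (simp add: is_small_category_def)
  let ?S = "\<lambda>j. states (fobj D j)" and ?A = "\<lambda>j. actions (fobj D j)"
  let ?F = "\<lambda>a. on_states (fmap D a)" and ?G = "\<lambda>a. on_actions (fmap D a)"
  obtain C p where C: "C \<subseteq> U" "small C" "C = (\<Union>j\<in>Obj J. p j ` ?S j)"
    and p: "\<And>j k x y. j \<in> Obj J \<Longrightarrow> k \<in> Obj J \<Longrightarrow> x \<in> ?S j \<Longrightarrow> y \<in> ?S k \<Longrightarrow>
      p j x = p k y \<longleftrightarrow> colim_rel J ?S ?F (j, x) (k, y)"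
    using set_colimit[of J ?S ?F] smallJ small(1) by blast
  obtain B q where B: "B \<subseteq> U" "small B" "B = (\<Union>j\<in>Obj J. q j ` ?A j)"
    and q: "\<And>j k x y. j \<in> Obj J \<Longrightarrow> k \<in> Obj J \<Longrightarrow> x \<in> ?A j \<Longrightarrow> y \<in> ?A k \<Longrightarrow>
      q j x = q k y \<longleftrightarrow> colim_rel J ?A ?G (j, x) (k, y)"
    using set_colimit[of J ?A ?G] smallJ small(2) by blast
  note DP = premapD[OF Hom_D(5)[OF Dmap]]
  \<comment> \<open>Arrows of the diagram preserve labels, so the labels descend to the
    quotient.\<close>
  have "\<exists>lab. \<forall>j\<in>Obj J. \<forall>u\<in>?A j. lab (q j u) = label (fobj D j) u"
    by (rule colim_factor[where F = ?G]) (use q DP(3) in auto)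
  then obtain lab where lab: "\<And>j u. j \<in> Obj J \<Longrightarrow> u \<in> ?A j \<Longrightarrow> lab (q j u) = label (fobj D j) u"
    by blast
  define T where "T = \<Union>((\<lambda>j. tmap (p j) (q j) ` transitions (fobj D j)) ` Obj J)"
  define L where "L = \<lparr>states = C, actions = B, label = restrict lab B, transitions =
      coherent_closure T\<rparr>"
  have "T \<subseteq> well_typed C B"
    unfolding T_def
  proof (intro UN_least tmap_well_typed)
    fix j assume j: "j \<in> Obj J"
    show "transitions (fobj D j) \<subseteq> well_typed (?S j) (?A j)"
      using w[OF j] by (simp add: weak_hdts_iff)
    show "p j \<in> ?S j \<rightarrow> C" "q j \<in> ?A j \<rightarrow> B"
      using j by (auto simp: C(3) B(3))
  qed
  then have "coherent_closure T \<subseteq> well_typed C B"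
    by (rule coherent_closure_well_typed)
  moreover have "restrict lab B \<in> B \<rightarrow>\<^sub>E \<Sigma>"
    using lab label_in[OF w] by (auto simp: B(3))
  ultimately have wL: "weak_hdts \<Sigma> L"
    by (simp add: weak_hdts_iff L_def mset_closed_coherent_closure coherent_coherent_closure)
  have "regular b L"
  proof (cases b)
    case False
    have reg: "regular False (fobj D j)" if "j \<in> Obj J" for j
      using Dobj[OF that] False by (simp add: Obj_systems)
    \<comment> \<open>\<open>T\<close> is a union of images of splitting sets, taken before closing
      under the axioms.\<close>
    have "splitting T"
      unfolding T_def using reg
      by (intro splitting_Union) (auto intro!: splitting_image simp: regular_def)
    then have "splitting (transitions L)"
      by (simp add: L_def splitting_coherent_closure)
    moreover have "all_used L"
      unfolding all_used_def
    proof
      fix v assume "v \<in> actions L"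
      then obtain j u where j: "j \<in> Obj J" and u: "u \<in> ?A j" "v = q j u"
        by (auto simp: L_def B(3))
      then obtain \<alpha> us \<beta> where t: "(\<alpha>, us, \<beta>) \<in> transitions (fobj D j)" "u \<in> set us"
        using reg[OF j] unfolding regular_def all_used_def by blast
      then have "tmap (p j) (q j) (\<alpha>, us, \<beta>) \<in> T"
        using j by (auto simp: T_def simp del: tmap_simp)
      then have "(p j \<alpha>, map (q j) us, p j \<beta>) \<in> transitions L"
        by (simp add: L_def coherent_closure.base)
      moreover have "v \<in> set (map (q j) us)"
        using t(2) u(2) by simp
      ultimately show "\<exists>\<alpha> us \<beta>. (\<alpha>, us, \<beta>) \<in> transitions L \<and> v \<in> set us"
        by blast
    qed
    ultimately show ?thesis
      by (simp add: regular_def)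
  qed (simp add: regular_def)
  with wL have L: "L \<in> Obj (systems b)"
    using C B by (simp add: Obj_systems L_def)
  have pL: "p j x \<in> states L" if "j \<in> Obj J" "x \<in> ?S j" for j x
    using that by (auto simp: L_def C(3))
  have qL: "q j x \<in> actions L" if "j \<in> Obj J" "x \<in> ?A j" for j x
    using that by (auto simp: L_def B(3))
  define \<iota> where "\<iota> j = arrow_of (fobj D j) L (p j) (q j)" for j
  have \<iota>: "\<iota> j \<in> Hom (systems b) (fobj D j) L" if j: "j \<in> Obj J" for j
    unfolding \<iota>_def
  proof (rule arrow_of_Hom[OF Dobj[OF j] L], rule premapI)
    fix \<alpha> us \<beta> assume "(\<alpha>, us, \<beta>) \<in> transitions (fobj D j)"
    then have "tmap (p j) (q j) (\<alpha>, us, \<beta>) \<in> T"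
      using j by (auto simp: T_def simp del: tmap_simp)
    then show "(p j \<alpha>, map (q j) us, p j \<beta>) \<in> transitions L"
      by (simp add: L_def coherent_closure.base)
  qed (use j lab in \<open>auto simp: L_def C(3) B(3)\<close>)
  have Dsrc: "source (fmap D a) = fobj D (Dom J a)" if "a \<in> Arr J" for a
    using Hom_D(3)[OF Dmap[OF that]] .
  have "is_colimit J (systems b) D L \<iota>"
    unfolding is_colimit_def
  proof (intro conjI allI impI)
    show "is_cocone J (systems b) D L \<iota>"
      unfolding is_cocone_def
    proof (intro conjI ballI L \<iota>)
      fix a assume a: "a \<in> Arr J"
      show "Comp (systems b) (\<iota> (Cod J a)) (fmap D a) = \<iota> (Dom J a)"
        unfolding systems_simps
      proof (rule arrow_eqI[OF arrow_comp_Hom[OF Dmap[OF a] \<iota>[OF JD(2)[OF a]]] \<iota>[OF JD(1)[OF a]]])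
        fix \<alpha> assume x: "\<alpha> \<in> states (fobj D (Dom J a))"
        have "p (Dom J a) \<alpha> = p (Cod J a) (?F a \<alpha>)"
          using p[OF JD[OF a] x DP(1)[OF a x]] colim_rel_arrow[of a J \<alpha> ?S ?F] a x by simp
        then show "on_states (arrow_comp (\<iota> (Cod J a)) (fmap D a)) \<alpha> = on_states (\<iota> (Dom J a)) \<alpha>"
          using x DP(1)[OF a x] Dsrc[OF a] by (simp add: \<iota>_def)
      next
        fix u assume x: "u \<in> actions (fobj D (Dom J a))"
        have "q (Dom J a) u = q (Cod J a) (?G a u)"
          using q[OF JD[OF a] x DP(2)[OF a x]] colim_rel_arrow[of a J u ?A ?G] a x by simp
        then show "on_actions (arrow_comp (\<iota> (Cod J a)) (fmap D a)) u = on_actions (\<iota> (Dom J a)) u"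
          using x DP(2)[OF a x] Dsrc[OF a] by (simp add: \<iota>_def)
      qed
    qed
    fix M \<kappa> assume "is_cocone J (systems b) D M \<kappa>"
    then have M: "M \<in> Obj (systems b)" and \<kappa>: "\<And>j. j \<in> Obj J \<Longrightarrow> \<kappa> j \<in> Hom (systems b) (fobj D j) M"
      and \<kappa>c: "\<And>a. a \<in> Arr J \<Longrightarrow> arrow_comp (\<kappa> (Cod J a)) (fmap D a) = \<kappa> (Dom J a)"
      by (auto simp: is_cocone_def)
    have "\<exists>h. \<forall>j\<in>Obj J. \<forall>x\<in>?S j. h (p j x) = on_states (\<kappa> j) x"
    proof (rule colim_factor[where F = ?F])
      show "on_states (\<kappa> (Cod J a)) (?F a x) = on_states (\<kappa> (Dom J a)) x"
        if "a \<in> Arr J" "x \<in> ?S (Dom J a)" for a x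
        using arg_cong[OF \<kappa>c[OF that(1)], of "\<lambda>f. on_states f x"] that Dsrc[OF that(1)] by simp
    qed (use p in blast)
    then obtain h0 where h0: "\<And>j x. j \<in> Obj J \<Longrightarrow> x \<in> ?S j \<Longrightarrow> h0 (p j x) = on_states (\<kappa> j) x"
      by blast
    have "\<exists>h. \<forall>j\<in>Obj J. \<forall>x\<in>?A j. h (q j x) = on_actions (\<kappa> j) x"
    proof (rule colim_factor[where F = ?G])
      show "on_actions (\<kappa> (Cod J a)) (?G a x) = on_actions (\<kappa> (Dom J a)) x"
        if "a \<in> Arr J" "x \<in> ?A (Dom J a)" for a x
        using arg_cong[OF \<kappa>c[OF that(1)], of "\<lambda>f. on_actions f x"] that Dsrc[OF that(1)] by simp
    qed (use q in blast)
    then obtain h1 where h1: "\<And>j x. j \<in> Obj J \<Longrightarrow> x \<in> ?A j \<Longrightarrow> h1 (q j x) = on_actions (\<kappa> j) x"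
      by blast
    note \<kappa>P = premapD[OF Hom_D(5)[OF \<kappa>]]
    have "premap L M h0 h1"
    proof (rule premapI)
      show "h0 c \<in> states M" if "c \<in> states L" for c
        using that h0 \<kappa>P(1) by (auto simp: L_def C(3))
      show "h1 v \<in> actions M" if "v \<in> actions L" for v
        using that h1 \<kappa>P(2) by (auto simp: L_def B(3))
      show "label M (h1 v) = label L v" if v: "v \<in> actions L" for v
      proof -
        obtain j u where "j \<in> Obj J" "u \<in> ?A j" "v = q j u"
          using v by (auto simp: L_def B(3))
        then show ?thesis
          using h1 \<kappa>P(3) lab v by (simp add: L_def)
      qed
      fix \<alpha> us \<beta> assume "(\<alpha>, us, \<beta>) \<in> transitions L"
      then have t: "(\<alpha>, us, \<beta>) \<in> coherent_closure T"
        by (simp add: L_def)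
      show "(h0 \<alpha>, map h1 us, h0 \<beta>) \<in> transitions M"
      proof (rule premap_coherent_closure[OF _ _ _ t])
        fix a vs c assume "(a, vs, c) \<in> T"
        then obtain j \<alpha>' us' \<beta>' where j: "j \<in> Obj J" and t': "(\<alpha>', us', \<beta>') \<in> transitions (fobj D j)"
          and eq: "a = p j \<alpha>'" "vs = map (q j) us'" "c = p j \<beta>'"
          by (auto simp: T_def)
        note tt = transition_typed[OF w[OF j] t']
        have "map h1 vs = map (on_actions (\<kappa> j)) us'"
          using tt(4) h1[OF j] by (auto simp: eq)
        then show "(h0 a, map h1 vs, h0 c) \<in> transitions M"
          using \<kappa>P(4)[OF j t'] h0[OF j] tt(1,2) by (simp add: eq(1,3))
      qed (use M in \<open>auto simp: Obj_systems weak_hdts_iff\<close>)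
    qed
    note h = arrow_of_Hom[OF L M this]
    show "\<exists>!h. h \<in> Hom (systems b) L M \<and> (\<forall>j\<in>Obj J. Comp (systems b) h (\<iota> j) = \<kappa> j)"
    proof (rule ex1I[of _ "arrow_of L M h0 h1"], intro conjI ballI h)
      fix j assume j: "j \<in> Obj J"
      have "arrow_comp (arrow_of L M h0 h1) (\<iota> j) = \<kappa> j"
        by (rule arrow_eqI[OF arrow_comp_Hom[OF \<iota>[OF j] h] \<kappa>[OF j]])
          (use j h0 h1 pL qL in \<open>simp_all add: \<iota>_def\<close>)
      then show "Comp (systems b) (arrow_of L M h0 h1) (\<iota> j) = \<kappa> j"
        by simp
    next
      fix g assume g: "g \<in> Hom (systems b) L M \<and> (\<forall>j\<in>Obj J. Comp (systems b) g (\<iota> j) = \<kappa> j)"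
      then have gH: "g \<in> Hom (systems b) L M" and gc: "\<And>j. j \<in> Obj J \<Longrightarrow> arrow_comp g (\<iota> j) = \<kappa> j"
        by auto
      show "g = arrow_of L M h0 h1"
      proof (rule arrow_eqI[OF gH h])
        fix c assume c: "c \<in> states L"
        then obtain j x where j: "j \<in> Obj J" "x \<in> ?S j" "c = p j x"
          by (auto simp: L_def C(3))
        then have "on_states g c = on_states (\<kappa> j) x"
          using arg_cong[OF gc[OF j(1)], of "\<lambda>f. on_states f x"] by (simp add: \<iota>_def)
        then show "on_states g c = on_states (arrow_of L M h0 h1) c"
          using c j h0 by simp
      next
        fix c assume c: "c \<in> actions L"
        then obtain j x where j: "j \<in> Obj J" "x \<in> ?A j" "c = q j x"
          by (auto simp: L_def B(3))
        then have "on_actions g c = on_actions (\<kappa> j) x"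
          using arg_cong[OF gc[OF j(1)], of "\<lambda>f. on_actions f x"] by (simp add: \<iota>_def)
        then show "on_actions g c = on_actions (arrow_of L M h0 h1) c"
          using c j h1 by simp
      qed
    qed
  qed
  then show ?thesis
    by blast
qed

lemma has_small_colimits_systems: "has_small_colimits U (systems b)"
  unfolding has_small_colimits_def using colimit_exists by blast

lemma limit_exists:
  fixes J :: "('u, 'u) category"
  assumes J: "is_small_category U J" and D: "is_functor J (systems True) D"
  shows "\<exists>L \<pi>. is_limit J (systems True) D L \<pi>"
proof -
  have Dobj: "fobj D j \<in> Obj (systems True)" if "j \<in> Obj J" for j
    using D that by (simp add: is_functor_def)
  have Dmap: "fmap D a \<in> Hom (systems True) (fobj D (Dom J a)) (fobj D (Cod J a))" if "a \<in> Arr J" for a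
    using D that by (simp add: is_functor_def)
  have JD: "Dom J a \<in> Obj J" "Cod J a \<in> Obj J" if "a \<in> Arr J" for a
    using J that by (auto simp: is_small_category_def is_category_def)
  have w: "weak_hdts \<Sigma> (fobj D j)" and small: "small (states (fobj D j))" "small (actions (fobj D j))"
    if "j \<in> Obj J" for j
    using Dobj[OF that] by (auto simp: Obj_systems)
  have smallJ: "small (Obj J)"
    using J by (simp add: is_small_category_def)
  define S where "S = {s \<in> (\<Pi>\<^sub>E j\<in>Obj J. states (fobj D j)).
    \<forall>a\<in>Arr J. on_states (fmap D a) (s (Dom J a)) = s (Cod J a)}"
  \<comment> \<open>The label is recorded as a separate component because for the empty diagram the
    family \<open>u\<close> determines none: the terminal system has one action for each
    label.\<close>
  define A where "A = {(l, u). l \<in> \<Sigma> \<and> u \<in> (\<Pi>\<^sub>E j\<in>Obj J. actions (fobj D j)) \<and>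
    (\<forall>j\<in>Obj J. label (fobj D j) (u j) = l) \<and>
    (\<forall>a\<in>Arr J. on_actions (fmap D a) (u (Dom J a)) = u (Cod J a))}"
  have "small S"
    by (rule small_subset[OF small_PiE[OF smallJ small(1)]]) (auto simp: S_def)
  then obtain e0 :: "('u \<Rightarrow> 'u) \<Rightarrow> 'u" where e0: "inj_on e0 S" "e0 ` S \<subseteq> U" "small (e0 ` S)"
    by (rule small_copy)
  have "small A"
    by (rule small_subset[OF small_Times[OF label_set(2) small_PiE[OF smallJ small(2)]]]) (auto
        simp: A_def)
  then obtain e1 :: "'l \<times> ('u \<Rightarrow> 'u) \<Rightarrow> 'u" where e1: "inj_on e1 A" "e1 ` A \<subseteq> U" "small (e1 ` A)"
    by (rule small_copy)
  define p where "p j c = inv_into S e0 c j" for j c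
  define q where "q j v = snd (inv_into A e1 v) j" for j v
  have p: "p j (e0 s) = s j" if "s \<in> S" for j s
    using that e0(1) by (simp add: p_def)
  have q: "q j (e1 v) = snd v j" if "v \<in> A" for j v
    using that e1(1) by (simp add: q_def)
  \<comment> \<open>Including the typing set keeps transitions typed and makes the empty diagram
    yield all typed transitions.\<close>
  define T where "T = \<Inter>(insert (well_typed (e0 ` S) (e1 ` A))
    ((\<lambda>j. tmap (p j) (q j) -` transitions (fobj D j)) ` Obj J))"
  define L where "L = \<lparr>states = e0 ` S, actions = e1 ` A, label = (\<lambda>v\<in>e1 ` A. fst (inv_into A e1
      v)), transitions = T\<rparr>"
  have "mset_closed T"
    unfolding T_def using w well_typed_closed(1)
    by (intro mset_closed_Inter) (auto intro!: mset_closed_vimage simp: weak_hdts_iff)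
  moreover have "coherent T"
    unfolding T_def using w well_typed_closed(2)
    by (intro coherent_Inter) (auto intro!: coherent_vimage simp: weak_hdts_iff)
  moreover have "label L \<in> actions L \<rightarrow>\<^sub>E \<Sigma>"
    using e1(1) by (auto simp: L_def A_def)
  ultimately have wL: "weak_hdts \<Sigma> L"
    by (simp add: weak_hdts_iff L_def) (simp add: T_def)
  then have L: "L \<in> Obj (systems True)"
    using e0 e1 by (simp add: Obj_systems L_def regular_def)
  define \<pi> where "\<pi> j = arrow_of L (fobj D j) (p j) (q j)" for j
  have \<pi>: "\<pi> j \<in> Hom (systems True) L (fobj D j)" if j: "j \<in> Obj J" for j
    unfolding \<pi>_def
  proof (rule arrow_of_Hom[OF L Dobj[OF j]], rule premapI)
    show "p j c \<in> states (fobj D j)" if "c \<in> states L" for c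
      using that p j by (auto simp: L_def S_def)
    show "q j v \<in> actions (fobj D j)" "label (fobj D j) (q j v) = label L v" if "v \<in> actions L" for v
      using that q j e1(1) by (auto simp: L_def A_def)
    show "(p j \<alpha>, map (q j) us, p j \<beta>) \<in> transitions (fobj D j)" if "(\<alpha>, us, \<beta>) \<in> transitions L"
        for \<alpha> us \<beta>
      using that j by (auto simp: L_def T_def)
  qed
  have "is_limit J (systems True) D L \<pi>"
    unfolding is_limit_def
  proof (intro conjI allI impI)
    show "is_cone J (systems True) D L \<pi>"
      unfolding is_cone_def
    proof (intro conjI ballI L \<pi>)
      fix a assume a: "a \<in> Arr J"
      show "Comp (systems True) (fmap D a) (\<pi> (Dom J a)) = \<pi> (Cod J a)"
        unfolding systems_simps
      proof (rule arrow_eqI[OF arrow_comp_Hom[OF \<pi>[OF JD(1)[OF a]] Dmap[OF a]] \<pi>[OF JD(2)[OF a]]])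
        show "on_states (arrow_comp (fmap D a) (\<pi> (Dom J a))) c = on_states (\<pi> (Cod J a)) c"
          if "c \<in> states L" for c
          using that p a by (auto simp: \<pi>_def L_def S_def)
        show "on_actions (arrow_comp (fmap D a) (\<pi> (Dom J a))) v = on_actions (\<pi> (Cod J a)) v"
          if "v \<in> actions L" for v
          using that q a by (auto simp: \<pi>_def L_def A_def)
      qed
    qed
    fix M \<kappa> assume "is_cone J (systems True) D M \<kappa>"
    then have M: "M \<in> Obj (systems True)" and \<kappa>: "\<And>j. j \<in> Obj J \<Longrightarrow> \<kappa> j \<in> Hom (systems True) M (fobj D j)"
      and \<kappa>c: "\<And>a. a \<in> Arr J \<Longrightarrow> arrow_comp (fmap D a) (\<kappa> (Dom J a)) = \<kappa> (Cod J a)"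
      by (auto simp: is_cone_def)
    note \<kappa>P = premapD[OF Hom_D(5)[OF \<kappa>]]
    have wM: "weak_hdts \<Sigma> M"
      using M by (simp add: Obj_systems)
    define s where "s m = (\<lambda>j\<in>Obj J. on_states (\<kappa> j) m)" for m
    define v where "v u = (label M u, \<lambda>j\<in>Obj J. on_actions (\<kappa> j) u)" for u
    have s: "s m \<in> S" if m: "m \<in> states M" for m
    proof -
      have "on_states (fmap D a) (on_states (\<kappa> (Dom J a)) m) = on_states (\<kappa> (Cod J a)) m" if "a \<in>
          Arr J" for a
        using arg_cong[OF \<kappa>c[OF that], of "\<lambda>f. on_states f m"] m Hom_D(3)[OF \<kappa>[OF JD(1)[OF that]]]
            by simp
      then show ?thesis
        using JD \<kappa>P(1) m by (auto simp: S_def s_def)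
    qed
    have v: "v u \<in> A" if u: "u \<in> actions M" for u
    proof -
      have "on_actions (fmap D a) (on_actions (\<kappa> (Dom J a)) u) = on_actions (\<kappa> (Cod J a)) u" if "a
          \<in> Arr J" for a
        using arg_cong[OF \<kappa>c[OF that], of "\<lambda>f. on_actions f u"] u Hom_D(3)[OF \<kappa>[OF JD(1)[OF
            that]]] by simp
      moreover have "label M u \<in> \<Sigma>"
        using wM u by (auto simp: weak_hdts_iff)
      ultimately show ?thesis
        using JD \<kappa>P(2,3) u by (auto simp: A_def v_def)
    qed
    have "premap M L (e0 \<circ> s) (e1 \<circ> v)"
    proof (rule premapI)
      show "label L ((e1 \<circ> v) u) = label M u" if "u \<in> actions M" for u
        using v[OF that] e1(1) by (simp add: L_def) (simp add: v_def)
      fix \<alpha> us \<beta> assume t: "(\<alpha>, us, \<beta>) \<in> transitions M"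
      note tt = transition_typed[OF wM t]
      have "(p j (e0 (s \<alpha>)), map (q j) (map (e1 \<circ> v) us), p j (e0 (s \<beta>))) \<in> transitions (fobj D j)"
        if j: "j \<in> Obj J" for j
      proof -
        have eq: "map (q j) (map (e1 \<circ> v) us) = map (on_actions (\<kappa> j)) us"
          using tt(4) q v j by (auto simp: v_def)
        show ?thesis
          unfolding eq using \<kappa>P(4)[OF j t] p[OF s[OF tt(1)], of j] p[OF s[OF tt(2)], of j] j
          by (simp add: s_def)
      qed
      then show "((e0 \<circ> s) \<alpha>, map (e1 \<circ> v) us, (e0 \<circ> s) \<beta>) \<in> transitions L"
        using tt s v by (auto simp: L_def T_def well_typed_def)
    qed (use s v in \<open>auto simp: L_def\<close>)
    note h = arrow_of_Hom[OF M L this]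
    let ?h = "arrow_of M L (e0 \<circ> s) (e1 \<circ> v)"
    show "\<exists>!h. h \<in> Hom (systems True) M L \<and> (\<forall>j\<in>Obj J. Comp (systems True) (\<pi> j) h = \<kappa> j)"
    proof (rule ex1I[of _ ?h], intro conjI ballI h)
      fix j assume j: "j \<in> Obj J"
      have "arrow_comp (\<pi> j) ?h = \<kappa> j"
        by (rule arrow_eqI[OF arrow_comp_Hom[OF h \<pi>[OF j]] \<kappa>[OF j]])
          (use j p q s v in \<open>simp_all add: \<pi>_def L_def s_def v_def\<close>)
      then show "Comp (systems True) (\<pi> j) ?h = \<kappa> j"
        by simp
    next
      fix g assume g: "g \<in> Hom (systems True) M L \<and> (\<forall>j\<in>Obj J. Comp (systems True) (\<pi> j) g = \<kappa> j)"
      then have gH: "g \<in> Hom (systems True) M L" and gc: "\<And>j. j \<in> Obj J \<Longrightarrow> arrow_comp (\<pi> j) g = \<kappa> j"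
        by auto
      note gP = premapD[OF Hom_D(5)[OF gH]] and gs = Hom_D(3)[OF gH]
      show "g = ?h"
      proof (rule arrow_eqI[OF gH h])
        fix m assume m: "m \<in> states M"
        obtain c where c: "c \<in> S" "on_states g m = e0 c"
          using gP(1)[OF m] by (auto simp: L_def)
        have "c j = s m j" if "j \<in> Obj J" for j
          using arg_cong[OF gc[OF that], of "\<lambda>f. on_states f m"] m gs c p[OF c(1)] that gP(1)[OF m]
          by (simp add: \<pi>_def s_def)
        moreover have "c \<in> extensional (Obj J)" "s m \<in> extensional (Obj J)"
          using c(1) s[OF m] by (auto simp: S_def PiE_def)
        ultimately have "c = s m"
          by (auto intro: extensionalityI)
        then show "on_states g m = on_states ?h m"
          using c m by simp
      next
        fix u assume u: "u \<in> actions M"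
        obtain c where c: "c \<in> A" "on_actions g u = e1 c"
          using gP(2)[OF u] by (auto simp: L_def)
        have "snd c j = snd (v u) j" if "j \<in> Obj J" for j
          using arg_cong[OF gc[OF that], of "\<lambda>f. on_actions f u"] u gs c q[OF c(1)] that gP(2)[OF u]
          by (simp add: \<pi>_def v_def)
        moreover have "snd c \<in> extensional (Obj J)" "snd (v u) \<in> extensional (Obj J)"
          using c(1) v[OF u] by (auto simp: A_def PiE_def)
        ultimately have "snd c = snd (v u)"
          by (auto intro: extensionalityI)
        moreover have "fst c = fst (v u)"
          using gP(3)[OF u] c e1(1) by (simp add: L_def) (simp add: v_def)
        ultimately have "c = v u"
          by (simp add: prod_eq_iff)
        then show "on_actions g u = on_actions ?h u"
          using c u by simp
      qed
    qed
  qed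
  then show ?thesis
    by blast
qed

lemma systems_False: "systems False = full_subcategory (systems True) (regular False)"
  by (simp add: systems_True) (simp add: systems_def)

text \<open>A limit of cubical systems formed among weak systems may fail to be cubical; its
  coreflection is the limit among cubical ones.\<close>

lemma has_small_limits_systems: "has_small_limits U (systems b)"
proof -
  have "has_small_limits U (systems True)"
    unfolding has_small_limits_def using limit_exists by blast
  moreover have "has_small_limits U (systems False)"
    unfolding systems_False
    using calculation by (rule coreflection.has_small_limits_coreflection[OF coreflection_systems])
  ultimately show ?thesis
    by (cases b) simp_all
qed

section \<open>Cofibrations, trivial maps and weak equivalences\<close>

definition cofibrations :: "bool \<Rightarrow> ('u, 'u, 'l) hdts_arrow set" where
  "cofibrations b = {f \<in> Arr (systems b). inj_on (on_actions f) (actions (source f))}"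

definition trivial_maps :: "bool \<Rightarrow> ('u, 'u, 'l) hdts_arrow set" where
  "trivial_maps b = {f \<in> Arr (systems b).
     bij_betw (on_states f) (states (source f)) (states (target f)) \<and>
     on_actions f ` actions (source f) = actions (target f) \<and>
     (\<forall>\<alpha>\<in>states (source f). \<forall>\<beta>\<in>states (source f). \<forall>us\<in>lists (actions (source f)).
        (on_states f \<alpha>, map (on_actions f) us, on_states f \<beta>) \<in> transitions (target f) \<longrightarrow>
        (\<alpha>, us, \<beta>) \<in> transitions (source f))}"

lemma cofibrations_CTS: "CTS_cof U \<Sigma> = cofibrations False"
proof -
  have "f \<in> Arr (systems False) \<Longrightarrow> f \<in> Arr (systems True)" for f
    using Hom_systems_mono by (simp add: Arr_systems)
  then show ?thesis
    unfolding CTS_cof_def WHDTS_cof_def cofibrations_def CTS_eq systems_True[symmetric] by blast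
qed

lemma cofibrations_WHDTS: "WHDTS_cof U \<Sigma> = cofibrations True"
  by (simp add: WHDTS_cof_def cofibrations_def systems_True)

lemma cofibrations_Arr: "cofibrations b \<subseteq> Arr (systems b)"
  and trivial_maps_Arr: "trivial_maps b \<subseteq> Arr (systems b)"
  by (auto simp: cofibrations_def trivial_maps_def)

lemma cofibrationI:
  "f \<in> Hom (systems b) X Y \<Longrightarrow> inj_on (on_actions f) (actions X) \<Longrightarrow> f \<in> cofibrations b"
  by (auto simp: cofibrations_def Hom_def)

lemma cofibrationD:
  assumes "f \<in> cofibrations b"
  shows "f \<in> Hom (systems b) (source f) (target f)" "inj_on (on_actions f) (actions (source f))"
  using assms by (auto simp: cofibrations_def Arr_systems)

lemma trivial_mapD:
  assumes "f \<in> trivial_maps b" "f \<in> Hom (systems b) X Y"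
  shows "bij_betw (on_states f) (states X) (states Y)" "on_actions f ` actions X = actions Y"
    "\<alpha> \<in> states X \<Longrightarrow> \<beta> \<in> states X \<Longrightarrow> set us \<subseteq> actions X \<Longrightarrow>
      (on_states f \<alpha>, map (on_actions f) us, on_states f \<beta>) \<in> transitions Y \<Longrightarrow> (\<alpha>, us, \<beta>) \<in> transitions X"
  using assms(1) Hom_D(3,4)[OF assms(2)] by (auto simp: trivial_maps_def in_lists_conv_set subset_iff)

lemma trivial_mapI:
  assumes "f \<in> Hom (systems b) X Y" "bij_betw (on_states f) (states X) (states Y)"
    "on_actions f ` actions X = actions Y"
    "\<And>\<alpha> \<beta> us. \<alpha> \<in> states X \<Longrightarrow> \<beta> \<in> states X \<Longrightarrow> set us \<subseteq> actions X \<Longrightarrow>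
      (on_states f \<alpha>, map (on_actions f) us, on_states f \<beta>) \<in> transitions Y \<Longrightarrow> (\<alpha>, us, \<beta>) \<in> transitions X"
  shows "f \<in> trivial_maps b"
  using assms Hom_D(3,4)[OF assms(1)]
  by (auto simp: trivial_maps_def in_lists_conv_set subset_iff Arr_systems)

text \<open>States lift in exactly one way. Actions lift by surjectivity, with the freedom that
  injectivity of the cofibration grants, and any such choice respects transitions because
  \<open>p\<close> reflects them.\<close>

lemma trivial_maps_lifting: "trivial_maps b \<subseteq> inj_class (systems b) (cofibrations b)"
  unfolding inj_class_def
proof (intro subsetI CollectI conjI ballI)
  fix p i assume p: "p \<in> trivial_maps b" and i: "i \<in> cofibrations b"
  define A B X Y where "A = source i" and "B = target i" and "X = source p" and "Y = target p"
  have iH: "i \<in> Hom (systems b) A B" and pH: "p \<in> Hom (systems b) X Y"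
    using i p cofibrations_Arr trivial_maps_Arr by (auto simp: A_def B_def X_def Y_def Hom_def)
  note P = trivial_mapD[OF p pH] and DP = Hom_D[OF pH] and DI = Hom_D[OF iH]
  have inj: "inj_on (on_actions i) (actions A)"
    using cofibrationD(2)[OF i] by (simp add: A_def)
  show "has_lifting (systems b) i p"
  proof (rule systems.has_liftingI[OF iH pH], unfold systems_simps)
    fix u v assume u: "u \<in> Hom (systems b) A X" and v: "v \<in> Hom (systems b) B Y"
      and sq: "arrow_comp p u = arrow_comp v i"
    note DU = Hom_D[OF u] and DV = Hom_D[OF v]
    have sq0: "on_states p (on_states u \<alpha>) = on_states v (on_states i \<alpha>)" if "\<alpha> \<in> states A" for \<alpha>
      using arg_cong[OF sq, of "\<lambda>f. on_states f \<alpha>"] that DU(3) DI(3) by simp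
    have sq1: "on_actions p (on_actions u x) = on_actions v (on_actions i x)" if "x \<in> actions A" for x
      using arg_cong[OF sq, of "\<lambda>f. on_actions f x"] that DU(3) DI(3) by simp
    define h0 where "h0 \<beta> = inv_into (states X) (on_states p) (on_states v \<beta>)" for \<beta>
    \<comment> \<open>On the image of \<open>i\<close> the value is dictated by \<open>u\<close>,
      consistently since \<open>i\<close> is injective; elsewhere a preimage of \<open>v y\<close>
      is chosen.\<close>
    define h1 where "h1 y = (if y \<in> on_actions i ` actions A
      then on_actions u (inv_into (actions A) (on_actions i) y)
      else inv_into (actions X) (on_actions p) (on_actions v y))" for y
    have h0: "h0 \<beta> \<in> states X" "on_states p (h0 \<beta>) = on_states v \<beta>" if "\<beta> \<in> states B" for \<beta>
      using premapD(1)[OF DV(5) that] P(1) unfolding h0_def bij_betw_def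
      by (auto simp: inv_into_into f_inv_into_f)
    have h0i: "h0 (on_states i \<alpha>) = on_states u \<alpha>" if "\<alpha> \<in> states A" for \<alpha>
      using P(1) premapD(1)[OF DU(5) that] sq0[OF that, symmetric]
      by (simp add: h0_def bij_betw_def)
    have h1i: "h1 (on_actions i x) = on_actions u x" if "x \<in> actions A" for x
      using that inj by (simp add: h1_def)
    have h1: "h1 y \<in> actions X \<and> on_actions p (h1 y) = on_actions v y" if y: "y \<in> actions B" for y
    proof (cases "y \<in> on_actions i ` actions A")
      case True
      then show ?thesis
        using h1i premapD(2)[OF DU(5)] sq1 by auto
    next
      case False
      then show ?thesis
        using premapD(2)[OF DV(5) y] P(2)[symmetric] by (simp add: h1_def inv_into_into f_inv_into_f)
    qed
    have "premap B X h0 h1"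
    proof (rule premapI)
      show "label X (h1 y) = label B y" if "y \<in> actions B" for y
        using premapD(3)[OF DP(5)] premapD(3)[OF DV(5) that] h1[OF that] by metis
      fix \<alpha> us \<beta> assume t: "(\<alpha>, us, \<beta>) \<in> transitions B"
      note tt = transition_typed[OF DV(6) t]
      have eq: "map (on_actions p) (map h1 us) = map (on_actions v) us"
        using tt(4) h1 by auto
      show "(h0 \<alpha>, map h1 us, h0 \<beta>) \<in> transitions X"
        by (rule P(3), unfold eq) (use h0 h1 tt premapD(4)[OF DV(5) t] in auto)
    qed (use h0 h1 in auto)
    note h = arrow_of_Hom[OF DV(1) DP(1) this]
    have "arrow_comp (arrow_of B X h0 h1) i = u"
      by (rule arrow_eqI[OF arrow_comp_Hom[OF iH h] u])
        (use DI(3) premapD(1,2)[OF DI(5)] h0i h1i in simp_all)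
    moreover have "arrow_comp p (arrow_of B X h0 h1) = v"
      by (rule arrow_eqI[OF arrow_comp_Hom[OF h pH] v]) (use h0 h1 in simp_all)
    ultimately show "\<exists>h\<in>Hom (systems b) B X. arrow_comp h i = u \<and> arrow_comp p h = v"
      using h by blast
  qed
qed (use trivial_maps_Arr in blast)

lemma reindex_Obj:
  assumes "Y \<in> Obj (systems b)" "q \<in> L \<rightarrow> actions Y" "L \<subseteq> U" "small L"
  shows "reindex Y L q \<in> Obj (systems b)"
  using assms weak_hdts_reindex regular_reindex by (auto simp: Obj_systems)

lemma reindex_trivial:
  assumes "Y \<in> Obj (systems b)" "q ` L = actions Y" "L \<subseteq> U" "small L"
  shows "arrow_of (reindex Y L q) Y (\<lambda>\<alpha>. \<alpha>) q \<in> trivial_maps b"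
    and "arrow_of (reindex Y L q) Y (\<lambda>\<alpha>. \<alpha>) q \<in> Hom (systems b) (reindex Y L q) Y"
proof -
  have wY: "weak_hdts \<Sigma> Y"
    using assms(1) by (simp add: Obj_systems)
  have p: "premap (reindex Y L q) Y (\<lambda>\<alpha>. \<alpha>) q"
    by (rule premapI) (use assms(2) in auto)
  show H: "arrow_of (reindex Y L q) Y (\<lambda>\<alpha>. \<alpha>) q \<in> Hom (systems b) (reindex Y L q) Y"
    using assms by (intro arrow_of_Hom reindex_Obj p) auto
  show "arrow_of (reindex Y L q) Y (\<lambda>\<alpha>. \<alpha>) q \<in> trivial_maps b"
  proof (rule trivial_mapI[OF H])
    fix \<alpha> \<beta> us assume a: "\<alpha> \<in> states (reindex Y L q)" "\<beta> \<in> states (reindex Y L q)"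
      "set us \<subseteq> actions (reindex Y L q)"
      and t: "(on_states (arrow_of (reindex Y L q) Y (\<lambda>\<alpha>. \<alpha>) q) \<alpha>,
        map (on_actions (arrow_of (reindex Y L q) Y (\<lambda>\<alpha>. \<alpha>) q)) us,
        on_states (arrow_of (reindex Y L q) Y (\<lambda>\<alpha>. \<alpha>) q) \<beta>) \<in> transitions Y"
    have "map (on_actions (arrow_of (reindex Y L q) Y (\<lambda>\<alpha>. \<alpha>) q)) us = map q us"
      using a(3) by (intro map_cong) auto
    with t a have "(\<alpha>, map q us, \<beta>) \<in> transitions Y"
      by simp
    moreover from this have "us \<noteq> []"
      using transition_typed(3)[OF wY] by blast
    ultimately show "(\<alpha>, us, \<beta>) \<in> transitions (reindex Y L q)"
      using a by simp
  qed (use assms(2) in \<open>auto simp: bij_betw_def inj_on_def arrow_of_def\<close>)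
qed

text \<open>A mapping cylinder on actions alone. Its states are those of \<open>Y\<close>, which is
  permitted because cofibrations put no condition on states.\<close>

lemma has_factorizations_trivial: "has_factorizations (systems b) (cofibrations b) (trivial_maps b)"
  unfolding has_factorizations_def systems_simps
proof
  fix f assume "f \<in> Arr (systems b)"
  then have f: "f \<in> Hom (systems b) (source f) (target f)"
    by (simp add: Arr_systems)
  define X Y where "X = source f" and "Y = target f"
  have f: "f \<in> Hom (systems b) X Y"
    using f by (simp add: X_def Y_def)
  note D = Hom_D[OF f]
  have small: "small (actions X)" "small (actions Y)" and sub: "actions X \<subseteq> U"
    using D(1,2) by (auto simp: Obj_systems)
  obtain c :: "'u \<Rightarrow> 'u" where c: "inj_on c (actions Y)" "c ` actions Y \<subseteq> U" "c ` actions Y \<inter>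
      actions X = {}"
      "small (c ` actions Y)"
    using fresh_copy[OF small(2,1)] .
  \<comment> \<open>The actions of \<open>X\<close> make the first factor injective; the disjoint
    copy of \<open>actions Y\<close> makes \<open>q\<close> surjective.\<close>
  define L where "L = actions X \<union> c ` actions Y"
  define q where "q u = (if u \<in> actions X then on_actions f u else inv_into (actions Y) c u)" for u
  have q: "q u = on_actions f u" if "u \<in> actions X" for u
    using that by (simp add: q_def)
  have qc: "q (c v) = v" if "v \<in> actions Y" for v
    using that c(1,3) by (auto simp: q_def)
  have qL: "q ` L = actions Y"
    using q qc premapD(2)[OF D(5)] by (auto simp: L_def image_Un image_iff)
  have L: "L \<subseteq> U" "small L"
    using c small sub by (auto simp: L_def intro: small_Un)
  let ?Z = "reindex Y L q"
  let ?i = "arrow_of X ?Z (on_states f) (\<lambda>u. u)" and ?p = "arrow_of ?Z Y (\<lambda>\<alpha>. \<alpha>) q"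
  have Z: "?Z \<in> Obj (systems b)"
    using reindex_Obj[OF D(2) _ L] qL by blast
  have "premap X ?Z (on_states f) (\<lambda>u. u)"
  proof (rule premapI)
    fix \<alpha> us \<beta> assume t: "(\<alpha>, us, \<beta>) \<in> transitions X"
    note tt = transition_typed[OF D(6) t]
    have eq: "map q us = map (on_actions f) us"
      using tt(4) q by auto
    show "(on_states f \<alpha>, map (\<lambda>u. u) us, on_states f \<beta>) \<in> transitions ?Z"
      using tt premapD[OF D(5)] t by (auto simp: L_def eq)
  qed (use premapD[OF D(5)] q in \<open>auto simp: L_def\<close>)
  note i = arrow_of_Hom[OF D(1) Z this]
  note p = reindex_trivial[OF D(2) qL L]
  have "arrow_comp ?p ?i = f"
    by (rule arrow_eqI[OF arrow_comp_Hom[OF i p(2)] f])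
      (use premapD(1,2)[OF D(5)] q in \<open>simp_all add: L_def\<close>)
  moreover have "?i \<in> cofibrations b"
    by (rule cofibrationI[OF i]) (simp add: inj_on_def)
  ultimately show "\<exists>i\<in>cofibrations b. \<exists>p\<in>trivial_maps b. source i = source f \<and> target i = source p \<and>
      target p = target f \<and> f = arrow_comp p i"
    using p(1) by (intro bexI[of _ ?i] bexI[of _ ?p]) (auto simp: X_def Y_def)
qed

section \<open>Stability of cofibrations\<close>

lemma closed_under_retracts_cofibrations: "closed_under_retracts (systems b) (cofibrations b)"
  unfolding closed_under_retracts_def
proof (intro allI impI, elim conjE)
  fix f g assume g: "g \<in> cofibrations b" and "is_retract (systems b) f g"
  then obtain s r s' where f: "f \<in> Arr (systems b)"
    and s: "s \<in> Hom (systems b) (source f) (source g)" and r: "r \<in> Hom (systems b) (source g) (source f)"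
    and eq: "arrow_comp r s = arrow_ident (source f)" "arrow_comp g s = arrow_comp s' f"
    unfolding is_retract_def systems_simps by blast
  note Ds = Hom_D[OF s]
  have "inj_on (on_actions f) (actions (source f))"
  proof (rule inj_onI)
    fix u v assume uv: "u \<in> actions (source f)" "v \<in> actions (source f)" "on_actions f u =
        on_actions f v"
    have "on_actions g (on_actions s w) = on_actions s' (on_actions f w)" if "w \<in> actions (source
        f)" for w
      using arg_cong[OF eq(2), of "\<lambda>h. on_actions h w"] that Ds(3) by simp
    then have "on_actions s u = on_actions s v"
      using uv cofibrationD(2)[OF g] premapD(2)[OF Ds(5)] by (metis inj_on_eq_iff)
    moreover have "on_actions r (on_actions s w) = w" if "w \<in> actions (source f)" for w
      using arg_cong[OF eq(1), of "\<lambda>h. on_actions h w"] that Ds(3) by simp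
    ultimately show "u = v"
      using uv by metis
  qed
  then show "f \<in> cofibrations b"
    using f by (simp add: cofibrations_def)
qed

text \<open>Maps into the system \<open>\<Omega>\<close> below classify sets of actions, so that injectivity on actions can be
  tested by maps out of a colimit.\<close>

lemma action_classifier:
  "\<exists>\<Omega> x (e :: bool \<times> 'l \<Rightarrow> 'u). inj_on e (UNIV \<times> \<Sigma>) \<and> (\<forall>b. \<Omega> \<in> Obj (systems b)) \<and>
    (\<forall>b X \<chi>. X \<in> Obj (systems b) \<longrightarrow>
      arrow_of X \<Omega> (\<lambda>_. x) (\<lambda>u. e (\<chi> u, label X u)) \<in> Hom (systems b) X \<Omega>)"
proof -
  obtain x where x: "x \<in> U"
    using infinite_U by (metis finite.emptyI ex_in_conv)
  have "small ((UNIV :: bool set) \<times> \<Sigma>)"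
    using label_set(2) by (intro small_Times) (auto intro: small_finite)
  then obtain e :: "bool \<times> 'l \<Rightarrow> 'u" where e: "inj_on e (UNIV \<times> \<Sigma>)" "e ` (UNIV \<times> \<Sigma>) \<subseteq> U"
      "small (e ` (UNIV \<times> \<Sigma>))"
    by (rule small_copy)
  let ?L = "e ` (UNIV \<times> \<Sigma>)"
  \<comment> \<open>One state, two actions for each label and every typed transition: a map into
    \<open>\<Omega>\<close> amounts to a free choice of truth values on actions.\<close>
  define \<Omega> :: "('u, 'u, 'l) hdts" where "\<Omega> = \<lparr>states = {x}, actions = ?L,
    label = (\<lambda>v\<in>?L. snd (inv_into (UNIV \<times> \<Sigma>) e v)), transitions = well_typed {x} ?L\<rparr>"
  have w: "weak_hdts \<Sigma> \<Omega>"
    using e(1) by (auto simp: weak_hdts_iff \<Omega>_def well_typed_closed)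
  have "splitting (well_typed {x} ?L)"
    unfolding splitting_def
  proof (intro allI impI, elim conjE)
    fix \<alpha> us vs ws \<beta>
    assume t: "(\<alpha>, us, \<beta>) \<in> well_typed {x} ?L" and ms: "mset us = mset vs + mset ws"
      and ne: "vs \<noteq> []" "ws \<noteq> []"
    have "set us = set vs \<union> set ws"
      using ms by (metis set_mset_mset set_mset_union)
    then show "\<exists>\<nu>. (\<alpha>, vs, \<nu>) \<in> well_typed {x} ?L \<and> (\<nu>, ws, \<beta>) \<in> well_typed {x} ?L"
      using t ne by (auto simp: well_typed_def)
  qed
  moreover have "all_used \<Omega>"
    unfolding all_used_def
  proof
    fix u assume "u \<in> actions \<Omega>"
    then have "(x, [u], x) \<in> transitions \<Omega>"
      by (auto simp: \<Omega>_def well_typed_def)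
    then show "\<exists>\<alpha> us \<beta>. (\<alpha>, us, \<beta>) \<in> transitions \<Omega> \<and> u \<in> set us"
      by (meson list.set_intros(1))
  qed
  ultimately have "regular b \<Omega>" for b
    by (simp add: regular_def \<Omega>_def)
  then have \<Omega>: "\<Omega> \<in> Obj (systems b)" for b
    using w x e by (auto simp: Obj_systems \<Omega>_def intro: small_finite)
  show ?thesis
  proof (rule exI[of _ \<Omega>], rule exI[of _ x], rule exI[of _ e], intro conjI allI impI e(1) \<Omega>)
    fix b X \<chi> assume X: "X \<in> Obj (systems b)"
    then have wX: "weak_hdts \<Sigma> X"
      by (simp add: Obj_systems)
    show "arrow_of X \<Omega> (\<lambda>_. x) (\<lambda>u. e (\<chi> u, label X u)) \<in> Hom (systems b) X \<Omega>"
    proof (rule arrow_of_Hom[OF X \<Omega>], rule premapI)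
      fix \<alpha> us \<beta> assume t: "(\<alpha>, us, \<beta>) \<in> transitions X"
      show "(x, map (\<lambda>u. e (\<chi> u, label X u)) us, x) \<in> transitions \<Omega>"
        using transition_typed[OF wX t] label_in[OF wX] by (auto simp: \<Omega>_def well_typed_def)
    qed (use label_in[OF wX] e(1) in \<open>auto simp: \<Omega>_def\<close>)
  qed
qed

lemma closed_under_pushout_cofibrations: "closed_under_pushout (systems b) (cofibrations b)"
  unfolding closed_under_pushout_def
proof (intro allI impI, elim conjE)
  fix f g f' g' assume f: "f \<in> cofibrations b" and po: "is_pushout (systems b) f g f' g'"
  define A B C D where "A = source f" and "B = target f" and "C = target g" and "D = target f'"
  have H: "f \<in> Hom (systems b) A B" "g \<in> Hom (systems b) A C" "f' \<in> Hom (systems b) C D" "g' \<in> Hom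
      (systems b) B D"
    using po unfolding is_pushout_def Hom_def by (auto simp: A_def B_def C_def D_def)
  note Df = Hom_D[OF H(1)] and Dg = Hom_D[OF H(2)] and Df' = Hom_D[OF H(3)]
  have univ: "\<exists>h. h \<in> Hom (systems b) D Z \<and> arrow_comp h f' = a \<and> arrow_comp h g' = c"
    if "a \<in> Hom (systems b) C Z" "c \<in> Hom (systems b) B Z" "arrow_comp a g = arrow_comp c f" for Z a c
  proof -
    have "\<forall>a\<in>Arr (systems b). \<forall>c\<in>Arr (systems b).
        source a = C \<and> source c = B \<and> target a = target c \<and> arrow_comp a g = arrow_comp c f \<longrightarrow>
        (\<exists>!h. h \<in> Hom (systems b) D (target a) \<and> arrow_comp h f' = a \<and> arrow_comp h g' = c)"
      using po unfolding is_pushout_def systems_simps B_def C_def D_def by (elim conjE)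
    from this[rule_format, OF systems.Hom_Arr[OF that(1)] systems.Hom_Arr[OF that(2)]] show ?thesis
      using that(3) Hom_D(3,4)[OF that(1)] Hom_D(3,4)[OF that(2)] by auto
  qed
  obtain \<Omega> x and e :: "bool \<times> 'l \<Rightarrow> 'u" where e: "inj_on e (UNIV \<times> \<Sigma>)" and \<Omega>: "\<forall>b. \<Omega> \<in> Obj (systems b)"
    and cl': "\<forall>b X \<chi>. X \<in> Obj (systems b) \<longrightarrow>
      arrow_of X \<Omega> (\<lambda>_. x) (\<lambda>u. e (\<chi> u, label X u)) \<in> Hom (systems b) X \<Omega>"
    using action_classifier by blast
    note cl = cl'[rule_format]
  have inj: "inj_on (on_actions f) (actions A)"
    using cofibrationD(2)[OF f] by (simp add: A_def)
  show "f' \<in> cofibrations b"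
  proof (rule cofibrationI[OF H(3)], rule inj_onI)
    fix u v assume uv: "u \<in> actions C" "v \<in> actions C" "on_actions f' u = on_actions f' v"
    \<comment> \<open>On \<open>C\<close> classify the single action \<open>u\<close>, on
      \<open>B\<close> the image under \<open>f\<close> of its preimage under \<open>g\<close>.
      Injectivity of \<open>f\<close> makes the two agree on \<open>A\<close>, so they glue to a map
      out of the pushout that separates \<open>u\<close> from every other action.\<close>
    let ?\<chi> = "\<lambda>y. \<exists>w\<in>actions A. on_actions f w = y \<and> on_actions g w = u"
    let ?a = "arrow_of C \<Omega> (\<lambda>_. x) (\<lambda>w. e (w = u, label C w))"
    let ?c = "arrow_of B \<Omega> (\<lambda>_. x) (\<lambda>y. e (?\<chi> y, label B y))"
    note a = cl[OF Dg(2), of "\<lambda>w. w = u"] and c = cl[OF Df(2), of ?\<chi>]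
    have "arrow_comp ?a g = arrow_comp ?c f"
    proof (rule arrow_eqI[OF arrow_comp_Hom[OF H(2) a] arrow_comp_Hom[OF H(1) c]])
      fix w assume w: "w \<in> actions A"
      have "?\<chi> (on_actions f w) = (on_actions g w = u)"
        using inj w by (auto simp: inj_on_eq_iff)
      then show "on_actions (arrow_comp ?a g) w = on_actions (arrow_comp ?c f) w"
        using w Df(3) Dg(3) premapD(2,3)[OF Df(5) w] premapD(2,3)[OF Dg(5) w] by simp
    qed (use Df(3) Dg(3) premapD(1)[OF Df(5)] premapD(1)[OF Dg(5)] in simp)
    then obtain h where h: "h \<in> Hom (systems b) D \<Omega>" "arrow_comp h f' = ?a"
      using univ[OF a c] by blast
    have hf: "on_actions h (on_actions f' w) = e (w = u, label C w)" if "w \<in> actions C" for w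
      using arg_cong[OF h(2), of "\<lambda>k. on_actions k w"] that Df'(3) by simp
    have "e (u = u, label C u) = e (v = u, label C v)"
      unfolding hf[OF uv(1), symmetric] hf[OF uv(2), symmetric] uv(3) ..
    then show "u = v"
      using e uv label_in[OF Df'(6)] by (auto simp: inj_on_eq_iff)
  qed
qed

lemma closed_under_transfinite_composition_cofibrations:
  "closed_under_transfinite_composition U (systems b) (cofibrations b)"
  unfolding closed_under_transfinite_composition_def
proof (intro allI impI)
  fix f assume tc: "is_transfinite_composition U (systems b) (cofibrations b) f"
  from tc show "f \<in> cofibrations b"
  proof (rule systems.transfinite_composition_induct)
    fix X assume "X \<in> Obj (systems b)"
    then show "Ident (systems b) X \<in> cofibrations b"
      by (intro cofibrationI[of _ b X X]) (auto simp: inj_on_def arrow_ident_Hom)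
  next
    fix X Y Z g h assume g: "g \<in> Hom (systems b) X Y" "g \<in> cofibrations b"
      and h: "h \<in> Hom (systems b) Y Z" "h \<in> cofibrations b"
    have "inj_on (on_actions g) (actions X)" "inj_on (on_actions h) (actions Y)"
      using cofibrationD(2) g h Hom_D(3) by metis+
    then show "Comp (systems b) h g \<in> cofibrations b"
      using arrow_comp_Hom[OF g(1) h(1)] Hom_D(3)[OF g(1)] premapD(2)[OF Hom_D(5)[OF g(1)]]
      by (intro cofibrationI[of _ b X Z]) (auto simp: inj_on_def)
  next
    fix r :: "'u rel" and s D L \<iota> i0 j
    assume D: "is_functor (order_category r) (systems b) D" and s: "s \<subseteq> r" "linear_order_on (Field s) s"
      and L: "is_colimit (order_category s) (systems b) D L \<iota>"
      and c: "\<And>i k. (i, k) \<in> s \<Longrightarrow> fmap D (i, k) \<in> cofibrations b" and j: "j \<in> Field s"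
    note func = systems.functor_order_category[OF D]
    have ord: "\<And>i. i \<in> Field s \<Longrightarrow> (i, i) \<in> s" "\<And>i k l. (i, k) \<in> s \<Longrightarrow> (k, l) \<in> s \<Longrightarrow> (i, l) \<in> s"
      "\<And>i k. i \<in> Field s \<Longrightarrow> k \<in> Field s \<Longrightarrow> (i, k) \<in> s \<or> (k, i) \<in> s"
      using s(2) unfolding linear_order_on_def partial_order_on_def preorder_on_def
      by (auto simp: refl_on_def elim: transE) (metis refl_onD refl_on_def total_on_def)
    have H: "fmap D (i, k) \<in> Hom (systems b) (fobj D i) (fobj D k)" if "(i, k) \<in> s" for i k
      using func(3) s(1) that by blast
    have comp: "on_actions (fmap D (k, l)) (on_actions (fmap D (i, k)) x) = on_actions (fmap D (i, l)) x"
      if "(i, k) \<in> s" "(k, l) \<in> s" "x \<in> actions (fobj D i)" for i k l x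
      using func(4)[OF subsetD[OF s(1) that(1)] subsetD[OF s(1) that(2)]] that(3)
        Hom_D(3)[OF H[OF that(1)]] by simp
    have fld: "i \<in> Field s" "k \<in> Field s" if "(i, k) \<in> s" for i k
      using that by (auto simp: Field_def)
    have \<iota>: "\<iota> i \<in> Hom (systems b) (fobj D i) L" if "i \<in> Field s" for i
      using L that unfolding is_colimit_def systems.cocone_order_category by blast
    obtain \<Omega> x and e :: "bool \<times> 'l \<Rightarrow> 'u" where e: "inj_on e (UNIV \<times> \<Sigma>)" and \<Omega>: "\<forall>b. \<Omega> \<in> Obj (systems b)"
      and cl': "\<forall>b X \<chi>. X \<in> Obj (systems b) \<longrightarrow>
        arrow_of X \<Omega> (\<lambda>_. x) (\<lambda>u. e (\<chi> u, label X u)) \<in> Hom (systems b) X \<Omega>"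
      using action_classifier by blast
    note cl = cl'[rule_format]
    show "\<iota> j \<in> cofibrations b"
    proof (rule cofibrationI[OF \<iota>[OF j]], rule inj_onI)
      fix u v assume uv: "u \<in> actions (fobj D j)" "v \<in> actions (fobj D j)" "on_actions (\<iota> j) u =
          on_actions (\<iota> j) v"
      \<comment> \<open>At stage \<open>i\<close> this classifies the actions that agree with
        \<open>u\<close> at some later stage.\<close>
      define \<chi> where "\<chi> i y \<longleftrightarrow> (\<exists>m. (i, m) \<in> s \<and> (j, m) \<in> s \<and>
        on_actions (fmap D (i, m)) y = on_actions (fmap D (j, m)) u)" for i y
      define \<kappa> where "\<kappa> i = arrow_of (fobj D i) \<Omega> (\<lambda>_. x) (\<lambda>y. e (\<chi> i y, label (fobj D i) y))" for i
      have Dobj: "fobj D i \<in> Obj (systems b)" if "i \<in> Field s" for i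
        using Hom_D(1)[OF \<iota>[OF that]] .
      have \<kappa>: "\<kappa> i \<in> Hom (systems b) (fobj D i) \<Omega>" if "i \<in> Field s" for i
        unfolding \<kappa>_def by (rule cl[OF Dobj[OF that]])
      have \<chi>: "\<chi> k (on_actions (fmap D (i, k)) y) = \<chi> i y" if ik: "(i, k) \<in> s" and y: "y \<in> actions
          (fobj D i)" for i k y
      proof
        assume "\<chi> k (on_actions (fmap D (i, k)) y)"
        then obtain m where "(k, m) \<in> s" "(j, m) \<in> s"
          "on_actions (fmap D (k, m)) (on_actions (fmap D (i, k)) y) = on_actions (fmap D (j, m)) u"
          unfolding \<chi>_def by blast
        then show "\<chi> i y"
          using comp[OF ik _ y] ord(2)[OF ik] unfolding \<chi>_def by auto
      next
        assume "\<chi> i y"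
        then obtain m where m: "(i, m) \<in> s" "(j, m) \<in> s"
          "on_actions (fmap D (i, m)) y = on_actions (fmap D (j, m)) u"
          unfolding \<chi>_def by blast
        \<comment> \<open>By linearity \<open>m\<close> and \<open>k\<close> have a common upper
          bound, where the agreement with \<open>u\<close> can be tested.\<close>
        obtain n where n: "(m, n) \<in> s" "(k, n) \<in> s"
          using ord(1,3) fld m(1) ik by metis
        have "on_actions (fmap D (k, n)) (on_actions (fmap D (i, k)) y) = on_actions (fmap D (i, n)) y"
          using comp[OF ik n(2) y] .
        also have "\<dots> = on_actions (fmap D (m, n)) (on_actions (fmap D (j, m)) u)"
          using comp[OF m(1) n(1) y] m(3) by simp
        also have "\<dots> = on_actions (fmap D (j, n)) u"
          using comp[OF m(2) n(1) uv(1)] .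
        finally show "\<chi> k (on_actions (fmap D (i, k)) y)"
          unfolding \<chi>_def using n ord(2)[OF m(2) n(1)] by blast
      qed
      have "is_cocone (order_category s) (systems b) D \<Omega> \<kappa>"
        unfolding systems.cocone_order_category
      proof (intro conjI ballI \<Omega>[rule_format])
        show "\<kappa> i \<in> Hom (systems b) (fobj D i) \<Omega>" if "i \<in> Field s" for i
          by (rule \<kappa>[OF that])
        fix p assume "p \<in> s"
        then obtain i k where p: "p = (i, k)" and ik: "(i, k) \<in> s"
          by (cases p) blast
        note DH = Hom_D[OF H[OF ik]]
        have "arrow_comp (\<kappa> k) (fmap D (i, k)) = \<kappa> i"
        proof (rule arrow_eqI[OF arrow_comp_Hom[OF H[OF ik] \<kappa>[OF fld(2)[OF ik]]] \<kappa>[OF fld(1)[OF ik]]])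
          fix y assume y: "y \<in> actions (fobj D i)"
          show "on_actions (arrow_comp (\<kappa> k) (fmap D (i, k))) y = on_actions (\<kappa> i) y"
            using y DH(3) premapD(2,3)[OF DH(5) y] \<chi>[OF ik y] by (simp add: \<kappa>_def)
        qed (use DH(3) premapD(1)[OF DH(5)] in \<open>simp add: \<kappa>_def\<close>)
        then show "case p of (i, k) \<Rightarrow> Comp (systems b) (\<kappa> k) (fmap D (i, k)) = \<kappa> i"
          by (simp add: p)
      qed
      then obtain h where "h \<in> Hom (systems b) L \<Omega>" "\<forall>i\<in>Obj (order_category s). Comp (systems b) h
          (\<iota> i) = \<kappa> i"
        using L unfolding is_colimit_def by metis
      then have h: "arrow_comp h (\<iota> j) = \<kappa> j"
        using j by (simp add: order_category_def)
      have hj: "on_actions h (on_actions (\<iota> j) w) = e (\<chi> j w, label (fobj D j) w)" if "w \<in> actions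
          (fobj D j)" for w
        using arg_cong[OF h, of "\<lambda>k. on_actions k w"] that Hom_D(3)[OF \<iota>[OF j]] by (simp add: \<kappa>_def)
      have "e (\<chi> j u, label (fobj D j) u) = e (\<chi> j v, label (fobj D j) v)"
        using hj[OF uv(1)] hj[OF uv(2)] uv(3) by simp
      then have "\<chi> j u = \<chi> j v"
        using e uv label_in[OF Hom_D(6)[OF \<iota>[OF j]]] by (auto simp: inj_on_eq_iff)
      moreover have "\<chi> j u"
        unfolding \<chi>_def using ord(1)[OF j] by blast
      ultimately obtain m where m: "(j, m) \<in> s" "on_actions (fmap D (j, m)) v = on_actions (fmap D
          (j, m)) u"
        unfolding \<chi>_def by blast
      \<comment> \<open>The classifier shows that \<open>u\<close> and \<open>v\<close> agree at a
        later stage \<open>m\<close>; since the map from \<open>j\<close> to \<open>m\<close> is a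
        cofibration, they agree already at \<open>j\<close>.\<close>
      have "inj_on (on_actions (fmap D (j, m))) (actions (fobj D j))"
        using cofibrationD(2)[OF c[OF m(1)]] Hom_D(3)[OF H[OF m(1)]] by simp
      then show "u = v"
        using m(2) uv by (simp add: inj_on_eq_iff)
    qed
  qed
qed

section \<open>Local systems and weak equivalences\<close>

definition local_systems :: "bool \<Rightarrow> ('u, 'u, 'l) hdts set" where
  "local_systems b = {Z \<in> Obj (systems b). \<forall>u v. rel b Z u v \<longrightarrow> u = v}"

definition weak_equivalences :: "bool \<Rightarrow> ('u, 'u, 'l) hdts_arrow set" where
  "weak_equivalences b = systems.local_equivalences b (local_systems b)"

lemma trivial_maps_weak_equivalences: "trivial_maps b \<subseteq> weak_equivalences b"
  unfolding weak_equivalences_def systems.local_equivalences_def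
proof (intro subsetI CollectI conjI ballI)
  fix f Z assume f: "f \<in> trivial_maps b" and Z: "Z \<in> local_systems b"
  define X Y where "X = source f" and "Y = target f"
  have fH: "f \<in> Hom (systems b) X Y"
    using subsetD[OF trivial_maps_Arr f] by (simp add: X_def Y_def Arr_systems)
  note P = trivial_mapD[OF f fH] and D = Hom_D[OF fH]
  have ZO: "Z \<in> Obj (systems b)" and disc: "\<And>u v. rel b Z u v \<Longrightarrow> u = v"
    using Z by (auto simp: local_systems_def)
  show "systems.orthogonal b f Z"
  proof (rule systems.orthogonalI[OF fH], unfold systems_simps)
    fix k assume k: "k \<in> Hom (systems b) X Z"
    note Dk = Hom_D[OF k]
    have ident: "on_actions k u = on_actions k v"
      if uv: "u \<in> actions X" "v \<in> actions X" "on_actions f u = on_actions f v" for u v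
    proof -
      have "label X u = label X v"
        using premapD(3)[OF D(5)] uv by metis
      moreover have "b \<or> (\<exists>\<alpha> \<beta>. (\<alpha>, [u], \<beta>) \<in> transitions X \<and> (\<alpha>, [v], \<beta>) \<in> transitions X)"
      proof (cases b)
        case False
        then have "regular False X"
          using D(1) by (simp add: Obj_systems)
        then obtain \<alpha> \<beta> where t: "(\<alpha>, [u], \<beta>) \<in> transitions X"
          using regular_singleton uv(1) by metis
        \<comment> \<open>As \<open>u\<close> and \<open>v\<close> have the same image, the image of
          the 1-transition of \<open>u\<close> is also that of one along \<open>v\<close>, and
          \<open>f\<close> reflects it.\<close>
        have "(\<alpha>, [v], \<beta>) \<in> transitions X"
          using premapD(4)[OF D(5) t] transition_typed[OF D(6) t] uv by (intro P(3)) auto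
        then show ?thesis
          using t by blast
      qed simp
      ultimately have "rel b X u v"
        using uv by (simp add: rel_def)
      then show ?thesis
        using rel_premap[OF Dk(5)] disc by blast
    qed
    define h0 where "h0 \<beta> = on_states k (inv_into (states X) (on_states f) \<beta>)" for \<beta>
    define h1 where "h1 y = on_actions k (inv_into (actions X) (on_actions f) y)" for y
    have h0: "h0 (on_states f \<alpha>) = on_states k \<alpha>" if "\<alpha> \<in> states X" for \<alpha>
      using P(1) that by (simp add: h0_def bij_betw_def)
    have h1: "h1 (on_actions f u) = on_actions k u" if u: "u \<in> actions X" for u
      unfolding h1_def by (rule ident) (use u in \<open>auto simp: inv_into_into f_inv_into_f\<close>)
    have st: "\<exists>\<alpha>\<in>states X. \<beta> = on_states f \<alpha>" if "\<beta> \<in> states Y" for \<beta>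
      using P(1) that by (auto simp: bij_betw_def)
    have ac: "\<exists>u\<in>actions X. y = on_actions f u" if "y \<in> actions Y" for y
      using P(2) that by auto
    have "premap Y Z h0 h1"
    proof (rule premapI)
      show "h0 \<beta> \<in> states Z" if "\<beta> \<in> states Y" for \<beta>
        using st[OF that] h0 premapD(1)[OF Dk(5)] by auto
      show "h1 y \<in> actions Z" "label Z (h1 y) = label Y y" if "y \<in> actions Y" for y
        using ac[OF that] h1 premapD(2,3)[OF Dk(5)] premapD(3)[OF D(5)] by auto
      fix \<alpha> us \<beta> assume t: "(\<alpha>, us, \<beta>) \<in> transitions Y"
      note tt = transition_typed[OF D(7) t]
      obtain \<alpha>' \<beta>' where ab: "\<alpha>' \<in> states X" "\<alpha> = on_states f \<alpha>'" "\<beta>' \<in> states X" "\<beta> = on_states f \<beta>'"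
        using st tt by metis
      define us' where "us' = map (inv_into (actions X) (on_actions f)) us"
      have us': "set us' \<subseteq> actions X" "map (on_actions f) us' = us"
        using tt(4) unfolding P(2)[symmetric] us'_def
        by (auto simp: inv_into_into f_inv_into_f subset_iff intro!: map_idI)
      have "(\<alpha>', us', \<beta>') \<in> transitions X"
        using t us' ab by (intro P(3)) auto
      moreover have "map h1 us = map (on_actions k) us'"
        unfolding us'(2)[symmetric] using us'(1) h1 by auto
      ultimately show "(h0 \<alpha>, map h1 us, h0 \<beta>) \<in> transitions Z"
        using premapD(4)[OF Dk(5)] ab h0 by metis
    qed
    note h = arrow_of_Hom[OF D(2) ZO this]
    have "arrow_comp (arrow_of Y Z h0 h1) f = k"
      by (rule arrow_eqI[OF arrow_comp_Hom[OF fH h] k])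
        (use D(3) premapD(1,2)[OF D(5)] h0 h1 in simp_all)
    then show "\<exists>h\<in>Hom (systems b) Y Z. arrow_comp h f = k"
      using h by blast
  next
    fix h h' assume h: "h \<in> Hom (systems b) Y Z" "h' \<in> Hom (systems b) Y Z" "arrow_comp h f =
        arrow_comp h' f"
    show "h = h'"
    proof (rule arrow_eqI[OF h(1,2)])
      fix \<beta> assume "\<beta> \<in> states Y"
      then obtain \<alpha> where "\<alpha> \<in> states X" "\<beta> = on_states f \<alpha>"
        using P(1) by (auto simp: bij_betw_def)
      then show "on_states h \<beta> = on_states h' \<beta>"
        using arg_cong[OF h(3), of "\<lambda>k. on_states k \<alpha>"] D(3) by simp
    next
      fix y assume "y \<in> actions Y"
      then obtain u where "u \<in> actions X" "y = on_actions f u"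
        using P(2) by auto
      then show "on_actions h y = on_actions h' y"
        using arg_cong[OF h(3), of "\<lambda>k. on_actions k u"] D(3) by simp
    qed
  qed
qed (use trivial_maps_Arr in blast)

lemma localizer_weak_equivalences: "localizer U (systems b) (cofibrations b) (weak_equivalences b)"
  unfolding localizer_def
proof (intro conjI)
  show "weak_equivalences b \<subseteq> Arr (systems b)"
    by (auto simp: weak_equivalences_def systems.local_equivalences_def)
  show "two_out_of_three (systems b) (weak_equivalences b)"
    unfolding weak_equivalences_def by (rule systems.two_out_of_three_local_equivalences)
  show "inj_class (systems b) (cofibrations b) \<subseteq> weak_equivalences b"
    by (rule systems.inj_class_subset[OF has_factorizations_trivial trivial_maps_weak_equivalences _
          cofibrations_Arr trivial_maps_Arr])
      (simp add: weak_equivalences_def systems.closed_under_retracts_local_equivalences)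
  show "closed_under_pushout (systems b) (cofibrations b \<inter> weak_equivalences b)"
    unfolding weak_equivalences_def
    by (rule systems.closed_under_pushout_local_equivalences[OF closed_under_pushout_cofibrations])
  show "closed_under_transfinite_composition U (systems b) (cofibrations b \<inter> weak_equivalences b)"
    unfolding weak_equivalences_def
    by (rule systems.closed_under_transfinite_composition_local_equivalences[OF
          closed_under_transfinite_composition_cofibrations _ cofibrations_Arr])
      (auto simp: local_systems_def)
qed

section \<open>Local reflections\<close>

abbreviation inclusion :: "('u, 'u, 'l) hdts \<Rightarrow> ('u, 'u, 'l) hdts \<Rightarrow> ('u, 'u, 'l) hdts_arrow" where
  "inclusion X Y \<equiv> arrow_of X Y (\<lambda>\<alpha>. \<alpha>) (\<lambda>u. u)"

lemma inclusion_cofibration: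
  "inclusion X Y \<in> Hom (systems b) X Y \<Longrightarrow> inclusion X Y \<in> cofibrations b"
  by (rule cofibrationI) (auto simp: inj_on_def)

lemma inclusion_Hom:
  assumes "X \<in> Obj (systems b)" "Y \<in> Obj (systems b)" "states X \<subseteq> states Y" "actions X \<subseteq> actions Y"
    "\<And>u. u \<in> actions X \<Longrightarrow> label Y u = label X u" "transitions X \<subseteq> transitions Y"
  shows "inclusion X Y \<in> Hom (systems b) X Y"
  using assms by (intro arrow_of_Hom premapI) auto

lemma two_out_of_threeD:
  assumes "two_out_of_three (systems b) W" "f \<in> Hom (systems b) X Y" "g \<in> Hom (systems b) Y Z"
  shows "f \<in> W \<Longrightarrow> g \<in> W \<Longrightarrow> arrow_comp g f \<in> W"
    "f \<in> W \<Longrightarrow> arrow_comp g f \<in> W \<Longrightarrow> g \<in> W"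
    "g \<in> W \<Longrightarrow> arrow_comp g f \<in> W \<Longrightarrow> f \<in> W"
proof -
  have "f \<in> Arr (systems b)" "g \<in> Arr (systems b)" "target f = source g"
    using assms(2,3) by (auto simp: Hom_def)
  then have "(f \<in> W \<and> g \<in> W \<longrightarrow> arrow_comp g f \<in> W) \<and> (f \<in> W \<and> arrow_comp g f \<in> W \<longrightarrow> g \<in> W) \<and>
      (g \<in> W \<and> arrow_comp g f \<in> W \<longrightarrow> f \<in> W)"
    using assms(1) unfolding two_out_of_three_def systems_simps by blast
  then show "f \<in> W \<Longrightarrow> g \<in> W \<Longrightarrow> arrow_comp g f \<in> W"
    "f \<in> W \<Longrightarrow> arrow_comp g f \<in> W \<Longrightarrow> g \<in> W"
    "g \<in> W \<Longrightarrow> arrow_comp g f \<in> W \<Longrightarrow> f \<in> W"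
    by blast+
qed

context
  fixes b :: bool and W :: "('u, 'u, 'l) hdts_arrow set"
  assumes W: "localizer U (systems b) (cofibrations b) W"
begin

lemma localizer_two_out_of_three: "two_out_of_three (systems b) W"
  using W by (simp add: localizer_def)

lemma localizer_trivial_maps: "trivial_maps b \<subseteq> W"
  using W trivial_maps_lifting[of b] unfolding localizer_def by blast

lemma localizer_ident:
  assumes "X \<in> Obj (systems b)"
  shows "arrow_ident X \<in> W"
proof -
  have "arrow_ident X \<in> trivial_maps b"
  proof (rule trivial_mapI[OF arrow_ident_Hom[OF assms]])
    fix \<alpha> \<beta> us assume a: "\<alpha> \<in> states X" "\<beta> \<in> states X" "set us \<subseteq> actions X"
      "(on_states (arrow_ident X) \<alpha>, map (on_actions (arrow_ident X)) us, on_states (arrow_ident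
          X) \<beta>) \<in> transitions X"
    have "map (on_actions (arrow_ident X)) us = us"
      using a(3) by (intro map_idI) auto
    then show "(\<alpha>, us, \<beta>) \<in> transitions X"
      using a by simp
  qed (auto simp: bij_betw_def inj_on_def image_iff)
  then show ?thesis
    using localizer_trivial_maps by blast
qed

text \<open>Two-out-of-three for \<open>p s = id\<close>. Sections are the source of weak
  equivalences which are cofibrations but need not be trivial maps.\<close>

lemma localizer_section:
  assumes "p \<in> trivial_maps b" "p \<in> Hom (systems b) Y X" "s \<in> Hom (systems b) X Y" "arrow_comp p s
      = arrow_ident X"
  shows "s \<in> W"
  using two_out_of_threeD(3)[OF localizer_two_out_of_three assms(3,2)] assms(1,4)
    localizer_trivial_maps localizer_ident[OF Hom_D(1)[OF assms(3)]] by auto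

text \<open>\<open>q\<close> retracts \<open>L\<close> onto \<open>actions X\<close>, so each new
  action is a clone of an old one and the inclusion is a section of a trivial map.\<close>

lemma localizer_reindex_inclusion:
  assumes X: "X \<in> Obj (systems b)" and q: "q \<in> L \<rightarrow> actions X" "L \<subseteq> U" "small L" "actions X \<subseteq> L"
    "\<And>u. u \<in> actions X \<Longrightarrow> q u = u"
  shows "inclusion X (reindex X L q) \<in> W" "inclusion X (reindex X L q) \<in> Hom (systems b) X
      (reindex X L q)"
proof -
  have w: "weak_hdts \<Sigma> X"
    using X by (simp add: Obj_systems)
  have sub: "transitions X \<subseteq> transitions (reindex X L q)"
  proof
    fix t assume t: "t \<in> transitions X"
    obtain \<alpha> us \<beta> where t': "t = (\<alpha>, us, \<beta>)"
      by (cases t)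
    note tt = transition_typed[OF w t[unfolded t']]
    have "map q us = us"
      using tt(4) q(5) by (intro map_idI) auto
    then show "t \<in> transitions (reindex X L q)"
      using t tt q(4) by (auto simp: t')
  qed
  show H: "inclusion X (reindex X L q) \<in> Hom (systems b) X (reindex X L q)"
    using q by (intro inclusion_Hom X reindex_Obj sub) auto
  have "q ` L = actions X"
    using q(1,4,5) by (auto simp: image_iff subset_iff) metis
  note p = reindex_trivial[OF X this q(2,3)]
  show "inclusion X (reindex X L q) \<in> W"
  proof (rule localizer_section[OF p H])
    show "arrow_comp (arrow_of (reindex X L q) X (\<lambda>\<alpha>. \<alpha>) q) (inclusion X (reindex X L q)) =
        arrow_ident X"
      by (rule arrow_eqI[OF arrow_comp_Hom[OF H p(2)] arrow_ident_Hom[OF X]])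
        (use q(4,5) in \<open>auto simp: subset_iff\<close>)
  qed
qed

end

lemma is_pushoutI:
  assumes f: "f \<in> Hom (systems b) A B" and g: "g \<in> Hom (systems b) A C"
    and f': "f' \<in> Hom (systems b) C D" and g': "g' \<in> Hom (systems b) B D"
    and sq: "arrow_comp f' g = arrow_comp g' f"
    and ex: "\<And>Z a c. a \<in> Hom (systems b) C Z \<Longrightarrow> c \<in> Hom (systems b) B Z \<Longrightarrow> arrow_comp a g =
        arrow_comp c f \<Longrightarrow>
      \<exists>h\<in>Hom (systems b) D Z. arrow_comp h f' = a \<and> arrow_comp h g' = c"
    and un: "\<And>Z h h'. h \<in> Hom (systems b) D Z \<Longrightarrow> h' \<in> Hom (systems b) D Z \<Longrightarrow>
      arrow_comp h f' = arrow_comp h' f' \<Longrightarrow> arrow_comp h g' = arrow_comp h' g' \<Longrightarrow> h = h'"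
  shows "is_pushout (systems b) f g f' g'"
  unfolding is_pushout_def systems_simps
proof (intro conjI ballI impI)
  fix a c assume ac: "a \<in> Arr (systems b)" "c \<in> Arr (systems b)"
    and eq: "source a = target g \<and> source c = target f \<and> target a = target c \<and> arrow_comp a g =
        arrow_comp c f"
  have "a \<in> Hom (systems b) C (target a)" "c \<in> Hom (systems b) B (target a)"
    using ac eq Hom_D(3,4)[OF f] Hom_D(3,4)[OF g] by (auto simp: Hom_def)
  from ex[OF this] obtain h where "h \<in> Hom (systems b) D (target a)" "arrow_comp h f' = a"
      "arrow_comp h g' = c"
    using eq by blast
  then show "\<exists>!h. h \<in> Hom (systems b) (target f') (target a) \<and> arrow_comp h f' = a \<and> arrow_comp h g' = c"
    using un unfolding Hom_D(4)[OF f'] by (intro ex1I[of _ h]) auto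
qed (use assms(1-5) in \<open>auto simp: Hom_def\<close>)

text \<open>One step of the saturation: parallel actions with the same label are made interchangeable.
  First a twin action is glued, for each related pair, onto the transitions shared by the pair; this is a
  pushout of a section of a trivial map. The twins are then given all transitions of the first action of
  their pair and, by a second pushout, identified with the second one.\<close>

lemma saturation_step:
  assumes X: "X \<in> Obj (systems b)"
  shows "\<exists>X1\<in>Obj (systems b). states X1 = states X \<and> actions X1 = actions X \<and> label X1 = label X \<and>
    transitions X \<subseteq> transitions X1 \<and>
    (\<forall>\<alpha> u v us \<beta>. (\<alpha>, u # us, \<beta>) \<in> transitions X \<and> rel b X u v \<longrightarrow> (\<alpha>, v # us, \<beta>) \<in> transitions X1) \<and>
    (\<forall>W. localizer U (systems b) (cofibrations b) W \<longrightarrow> inclusion X X1 \<in> W)"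
proof -
  have w: "weak_hdts \<Sigma> X" and small: "small (states X)" "small (actions X)"
    and sub: "states X \<subseteq> U" "actions X \<subseteq> U" and reg: "regular b X"
    using X by (auto simp: Obj_systems)
  note typed = transition_typed[OF w]
  have T: "mset_closed (transitions X)" "coherent (transitions X)"
    using w by (auto simp: weak_hdts_iff)
  define L where "L = actions X"
  have RL: "{(u, v). rel b X u v} \<subseteq> L \<times> L"
    by (auto simp: rel_def L_def)
  have "small {(u, v). rel b X u v}"
    using small_subset[OF small_Times[OF small(2,2)] RL[unfolded L_def]] .
  then obtain i :: "'u \<times> 'u \<Rightarrow> 'u" where i: "inj_on i {(u, v). rel b X u v}" "small (i ` {(u, v).
      rel b X u v})"
    using small_copy by blast
  \<comment> \<open>Related pairs are coded as elements of \<open>'u\<close>; \<open>lft\<close> and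
    \<open>rgt\<close> decode the two actions.\<close>
  define R where "R = i ` {(u, v). rel b X u v}"
  define lft rgt where "lft p = fst (inv_into {(u, v). rel b X u v} i p)"
    and "rgt p = snd (inv_into {(u, v). rel b X u v} i p)" for p
  have relR: "rel b X (lft p) (rgt p)" if "p \<in> R" for p
    using that i(1) by (auto simp: R_def lft_def rgt_def)
  have exR: "\<exists>p\<in>R. lft p = u \<and> rgt p = v" if "rel b X u v" for u v
    using that i(1) by (intro bexI[of _ "i (u, v)"]) (auto simp: R_def lft_def rgt_def)
  have "small ((UNIV :: bool set) \<times> R)"
    using i(2) by (intro small_Times) (auto simp: R_def intro: small_finite)
  then obtain c :: "bool \<times> 'u \<Rightarrow> 'u" where c: "inj_on c (UNIV \<times> R)" "c ` (UNIV \<times> R) \<subseteq> U"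
      "c ` (UNIV \<times> R) \<inter> L = {}" "small (c ` (UNIV \<times> R))"
    using fresh_copy[OF _ small(2)[folded L_def]] by blast
  \<comment> \<open>Two disjoint families of fresh names: \<open>d p\<close> is the action of the
    pair \<open>p\<close> in the gluing locus \<open>E\<close>, and \<open>e p\<close> is its
    twin.\<close>
  define d e where "d p = c (False, p)" and "e p = c (True, p)" for p
  have de: "d p = d p' \<longleftrightarrow> p = p'" "e p = e p' \<longleftrightarrow> p = p'" "d p \<noteq> e p'" "e p' \<noteq> d p"
    if "p \<in> R" "p' \<in> R" for p p'
    using that c(1) by (auto simp: d_def e_def inj_on_eq_iff)
  have dU: "d p \<notin> L" "e p \<notin> L" "d p \<in> U" "e p \<in> U" if "p \<in> R" for p
  proof -
    have "c (x, p) \<in> c ` (UNIV \<times> R)" for x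
      using that by simp
    then have "c (x, p) \<in> U" "c (x, p) \<notin> L" for x
      using c(2,3) by blast+
    then show "d p \<notin> L" "e p \<notin> L" "d p \<in> U" "e p \<in> U"
      by (simp_all add: d_def e_def)
  qed
  have smalls: "small (d ` R)" "small (e ` R)"
    using small_image i(2) by (auto simp: R_def)
  have subs: "d ` R \<subseteq> U" "e ` R \<subseteq> U"
    using de dU by auto
  define src where "src y = lft (inv_into R d y)" for y
  define src' where "src' y = (if y \<in> L then y else lft (inv_into R e y))" for y
  define tgt' where "tgt' y = (if y \<in> L then y else rgt (inv_into R e y))" for y
  have inj: "inj_on d R" "inj_on e R"
    using de dU by (auto simp: inj_on_def)
  have src: "src (d p) = lft p" if "p \<in> R" for p
    using that inj by (simp add: src_def)
  have src': "src' (e p) = lft p" "tgt' (e p) = rgt p" if "p \<in> R" for p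
    using that inj de dU by (simp_all add: src'_def tgt'_def)
  have src'L: "src' u = u" "tgt' u = u" if "u \<in> L" for u
    using that by (simp_all add: src'_def tgt'_def)
  have lab: "label X (lft p) = label X (rgt p)" "lft p \<in> L" "rgt p \<in> L" if "p \<in> R" for p
    using relR[OF that] by (auto simp: rel_def L_def)
  \<comment> \<open>The 1-transitions shared by the two actions of a pair, now carried by the new
    action \<open>k p\<close>. In the cubical case every pair has one, which keeps all actions used;
    in the weak case there may be none.\<close>
  define N where "N k = {(\<alpha>, [k p], \<beta>) | \<alpha> p \<beta>. p \<in> R \<and> (\<alpha>, [lft p], \<beta>) \<in> transitions X \<and> (\<alpha>, [rgt
      p], \<beta>) \<in> transitions X}"
    for k :: "'u \<Rightarrow> 'u"
  have NI: "(\<alpha>, [k p], \<beta>) \<in> N k"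
    if "p \<in> R" "(\<alpha>, [lft p], \<beta>) \<in> transitions X" "(\<alpha>, [rgt p], \<beta>) \<in> transitions X" for k \<alpha> p \<beta>
    using that unfolding N_def by blast
  have N_used: "\<not> b \<Longrightarrow> p \<in> R \<Longrightarrow> \<exists>\<alpha> \<beta>. (\<alpha>, [k p], \<beta>) \<in> N k" for p k
    using relR[of p] NI[of p] unfolding rel_def by metis
  define E where "E = \<lparr>states = states X, actions = d ` R, label = (\<lambda>y\<in>d ` R. label X (src y)),
      transitions = N d\<rparr>"
  have split_single: "splitting (N k)" "mset_closed (N k)" "coherent (N k)" for k
    by (rule length_one_closed; auto simp: N_def)+
  have E: "E \<in> Obj (systems b)"
  proof -
    have "weak_hdts \<Sigma> E"
      unfolding weak_hdts_iff
    proof (intro conjI)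
      show "label E \<in> actions E \<rightarrow>\<^sub>E \<Sigma>"
        using label_in[OF w] lab(2) src by (auto simp: E_def L_def)
      show "transitions E \<subseteq> well_typed (states E) (actions E)"
        using typed(1,2) by (auto simp: E_def N_def well_typed_def)
    qed (simp_all add: E_def split_single)
    moreover have "regular b E"
    proof (cases b)
      case False
      have "all_used E"
        unfolding all_used_def
      proof
        fix y assume "y \<in> actions E"
        then obtain p where "p \<in> R" "y = d p"
          by (auto simp: E_def)
        then show "\<exists>\<alpha> us \<beta>. (\<alpha>, us, \<beta>) \<in> transitions E \<and> y \<in> set us"
          using N_used[OF False, of p d] by (simp add: E_def) (meson list.set_intros(1))
      qed
      then show ?thesis
        by (simp add: regular_def E_def split_single)
    qed (simp add: regular_def)
    ultimately show ?thesis
      using small sub smalls subs by (simp add: Obj_systems E_def)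
  qed
  define r where "r y = (if y \<in> d ` R then y else d (inv_into R e y))" for y
  have r: "r (d p) = d p" "r (e p) = d p" if "p \<in> R" for p
  proof -
    have "e p \<notin> d ` R"
      using that de(4) by (metis imageE)
    then show "r (d p) = d p" "r (e p) = d p"
      using that inj by (simp_all add: r_def)
  qed
  \<comment> \<open>\<open>F\<close> adjoins \<open>e p\<close> as a clone of \<open>d p\<close>, so
    \<open>E\<close> includes into it as a section of a trivial map. Gluing \<open>F\<close> to
    \<open>X\<close> with \<open>d p\<close> sent to \<open>lft p\<close> adds a twin of
    \<open>lft p\<close> that is seen on shared transitions only.\<close>
  define F where "F = reindex E (d ` R \<union> e ` R) r"
  have rF: "r \<in> d ` R \<union> e ` R \<rightarrow> actions E" "\<And>u. u \<in> actions E \<Longrightarrow> r u = u" "actions E \<subseteq> d ` R \<union> e ` R"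
    using r by (auto simp: E_def)
  have F: "F \<in> Obj (systems b)"
    unfolding F_def using rF smalls subs by (intro reindex_Obj E) (auto intro: small_Un)
  have EF: "inclusion E F \<in> Hom (systems b) E F" "\<And>W. localizer U (systems b) (cofibrations b) W \<Longrightarrow>
      inclusion E F \<in> W"
    unfolding F_def
    using localizer_reindex_inclusion[OF _ E rF(1) _ small_Un[OF smalls] rF(3,2)] subs
        localizer_weak_equivalences
    by blast+
  have trF: "(\<alpha>, us, \<beta>) \<in> transitions F \<longleftrightarrow>
      (\<exists>p. p \<in> R \<and> (us = [d p] \<or> us = [e p]) \<and> (\<alpha>, [lft p], \<beta>) \<in> transitions X \<and> (\<alpha>, [rgt p], \<beta>) \<in>
          transitions X)" for \<alpha> us \<beta>
  proof
    assume "(\<alpha>, us, \<beta>) \<in> transitions F"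
    then have us: "(\<alpha>, map r us, \<beta>) \<in> N d" "set us \<subseteq> d ` R \<union> e ` R"
      by (auto simp: F_def E_def)
    then obtain p where p: "p \<in> R" "map r us = [d p]" "(\<alpha>, [lft p], \<beta>) \<in> transitions X" "(\<alpha>, [rgt
        p], \<beta>) \<in> transitions X"
      by (auto simp: N_def)
    then obtain y where y: "us = [y]" "r y = d p"
      by (auto simp: map_eq_Cons_conv)
    moreover obtain p' where "p' \<in> R" "y = d p' \<or> y = e p'"
      using us(2) y(1) by auto
    ultimately have "y = d p \<or> y = e p"
      using r p(1) de(1) by metis
    then show "\<exists>p. p \<in> R \<and> (us = [d p] \<or> us = [e p]) \<and> (\<alpha>, [lft p], \<beta>) \<in> transitions X \<and> (\<alpha>, [rgt
        p], \<beta>) \<in> transitions X"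
      using p y by blast
  next
    assume "\<exists>p. p \<in> R \<and> (us = [d p] \<or> us = [e p]) \<and> (\<alpha>, [lft p], \<beta>) \<in> transitions X \<and> (\<alpha>, [rgt p],
        \<beta>) \<in> transitions X"
    then obtain p where p: "p \<in> R" "us = [d p] \<or> us = [e p]" "(\<alpha>, [lft p], \<beta>) \<in> transitions X"
        "(\<alpha>, [rgt p], \<beta>) \<in> transitions X"
      by blast
    then have "map r us = [d p]"
      using r by auto
    then show "(\<alpha>, us, \<beta>) \<in> transitions F"
      using NI[OF p(1,3,4), of d] p(1,2) typed(1,2)[OF p(3)] by (auto simp: F_def E_def)
  qed
  have labF: "label F (d p) = label X (lft p)" "label F (e p) = label X (lft p)" if "p \<in> R" for p
    using that r src by (simp_all add: F_def E_def)
  \<comment> \<open>The first pushout written out: \<open>X\<close> with the twins and their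
    1-transitions.\<close>
  define Q where "Q = \<lparr>states = states X, actions = L \<union> e ` R, label = (\<lambda>y\<in>L \<union> e ` R. label X
      (src' y)), transitions = transitions X \<union> N e\<rparr>"
  have eL: "set us \<subseteq> L \<Longrightarrow> (\<alpha>, us, \<beta>) \<notin> N e" for \<alpha> us \<beta>
    using de dU by (auto simp: N_def)
  have Q: "Q \<in> Obj (systems b)"
  proof -
    have "coherent (transitions X \<union> N e)"
      unfolding coherent_def
    proof (intro allI impI, elim conjE)
      fix \<alpha> us vs ws \<beta> \<nu>1 \<nu>2
      assume a: "us \<noteq> []" "vs \<noteq> []" "ws \<noteq> []"
        "(\<alpha>, us @ vs @ ws, \<beta>) \<in> transitions X \<union> N e" "(\<alpha>, us, \<nu>1) \<in> transitions X \<union> N e"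
        "(\<nu>1, vs @ ws, \<beta>) \<in> transitions X \<union> N e"
        "(\<alpha>, us @ vs, \<nu>2) \<in> transitions X \<union> N e" "(\<nu>2, ws, \<beta>) \<in> transitions X \<union> N e"
      \<comment> \<open>Three nonempty parts exceed length one, so the long transition is one of
        \<open>X\<close>. Its actions are then old ones, which forces the other four transitions
        into \<open>X\<close> too.\<close>
      have long: "(\<alpha>, us @ vs @ ws, \<beta>) \<in> transitions X"
        using a(1-4) by (auto simp: N_def append_eq_Cons_conv)
      have "set us \<subseteq> L" "set vs \<subseteq> L" "set ws \<subseteq> L"
        using typed(4)[OF long] by (simp_all add: L_def)
      then have "(\<alpha>, us, \<nu>1) \<in> transitions X" "(\<nu>1, vs @ ws, \<beta>) \<in> transitions X"
        "(\<alpha>, us @ vs, \<nu>2) \<in> transitions X" "(\<nu>2, ws, \<beta>) \<in> transitions X"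
        using a(5-8) eL by auto
      then show "(\<nu>1, vs, \<nu>2) \<in> transitions X \<union> N e"
        using coherentD[OF T(2) a(1-3) long] by blast
    qed
    moreover have "mset_closed (transitions X \<union> N e)"
      using T(1) split_single(2)[of e] unfolding mset_closed_def by blast
    moreover have "transitions X \<union> N e \<subseteq> well_typed (states X) (L \<union> e ` R)"
      using w typed by (auto simp: weak_hdts_iff well_typed_def N_def L_def)
    moreover have "(\<lambda>y\<in>L \<union> e ` R. label X (src' y)) \<in> L \<union> e ` R \<rightarrow>\<^sub>E \<Sigma>"
      using label_in[OF w] src' src'L lab by (auto simp: L_def)
    ultimately have "weak_hdts \<Sigma> Q"
      by (simp add: weak_hdts_iff Q_def)
    moreover have "regular b Q"
    proof (cases b)
      case False
      have rX: "all_used X" "splitting (transitions X)"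
        using reg False by (auto simp: regular_def)
      have "splitting (transitions X \<union> N e)"
        using splitting_Union[of "{transitions X, N e}"] rX split_single(1) by auto
      moreover have "all_used Q"
        unfolding all_used_def
      proof
        fix y assume "y \<in> actions Q"
        then consider "y \<in> L" | p where "p \<in> R" "y = e p"
          by (auto simp: Q_def)
        then show "\<exists>\<alpha> us \<beta>. (\<alpha>, us, \<beta>) \<in> transitions Q \<and> y \<in> set us"
        proof cases
          case 1
          then show ?thesis
            using rX(1) unfolding all_used_def Q_def L_def by (simp, blast)
        next
          case 2
          then show ?thesis
            using N_used[OF False, of p e] by (simp add: Q_def) (meson list.set_intros(1))
        qed
      qed
      ultimately show ?thesis
        by (simp add: regular_def Q_def)
    qed (simp add: regular_def)
    ultimately show ?thesis
      using small sub smalls subs by (simp add: Obj_systems Q_def L_def small_Un)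
  qed
  have labQ: "label Q u = label X u" if "u \<in> L" for u
    using that src'L by (simp add: Q_def)
  have labQ': "label Q (e p) = label X (lft p)" if "p \<in> R" for p
    using that src' by (simp add: Q_def)
  have "premap E X (\<lambda>\<alpha>. \<alpha>) src"
    by (rule premapI) (use src lab in \<open>auto simp: E_def N_def L_def\<close>)
  note g = arrow_of_Hom[OF E X this]
  have XQ: "inclusion X Q \<in> Hom (systems b) X Q"
    using labQ by (intro inclusion_Hom X Q) (auto simp: Q_def L_def)
  have stEF: "states E = states X" "states F = states X" "states Q = states X" "actions Q = L \<union> e ` R"
    by (simp_all add: E_def F_def Q_def)
  define s where "s y = (if y \<in> d ` R then src y else y)" for y
  have s: "s (d p) = lft p" "s (e p) = e p" if "p \<in> R" for p
  proof -
    have "e p \<notin> d ` R"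
      using that de(4) by (metis imageE)
    then show "s (d p) = lft p" "s (e p) = e p"
      using that src by (simp_all add: s_def)
  qed
  have "premap F Q (\<lambda>\<alpha>. \<alpha>) s"
  proof (rule premapI)
    fix y assume "y \<in> actions F"
    then obtain p where p: "p \<in> R" "y = d p \<or> y = e p"
      by (auto simp: F_def)
    then show "s y \<in> actions Q" "label Q (s y) = label F y"
      using s lab labF labQ labQ' by (auto simp: stEF)
  next
    fix \<alpha> us \<beta> assume "(\<alpha>, us, \<beta>) \<in> transitions F"
    then show "(\<alpha>, map s us, \<beta>) \<in> transitions Q"
      using s unfolding trF by (auto simp: Q_def N_def)
  qed (simp add: F_def E_def Q_def)
  note g' = arrow_of_Hom[OF F Q this]
  have actF: "d p \<in> actions F" "e p \<in> actions F" "d p \<in> actions E" if "p \<in> R" for p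
    using that by (auto simp: F_def E_def)
  have po1: "is_pushout (systems b) (inclusion E F) (arrow_of E X (\<lambda>\<alpha>. \<alpha>) src) (inclusion X Q)
      (arrow_of F Q (\<lambda>\<alpha>. \<alpha>) s)"
  proof (rule is_pushoutI[OF EF(1) g XQ g'])
    show "arrow_comp (inclusion X Q) (arrow_of E X (\<lambda>\<alpha>. \<alpha>) src) = arrow_comp (arrow_of F Q (\<lambda>\<alpha>. \<alpha>)
        s) (inclusion E F)"
      by (rule arrow_eqI[OF arrow_comp_Hom[OF g XQ] arrow_comp_Hom[OF EF(1) g']])
        (use src s lab actF in \<open>auto simp: stEF E_def L_def\<close>)
  next
    fix Z a k assume a: "a \<in> Hom (systems b) X Z" and k: "k \<in> Hom (systems b) F Z"
      and sq: "arrow_comp a (arrow_of E X (\<lambda>\<alpha>. \<alpha>) src) = arrow_comp k (inclusion E F)"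
    note Da = Hom_D[OF a] and Dk = Hom_D[OF k]
    have k0: "on_states k \<alpha> = on_states a \<alpha>" if "\<alpha> \<in> states X" for \<alpha>
      using arg_cong[OF sq, of "\<lambda>f. on_states f \<alpha>"] that stEF by simp
    have k1: "on_actions k (d p) = on_actions a (lft p)" if "p \<in> R" for p
      using arg_cong[OF sq, of "\<lambda>f. on_actions f (d p)"] that actF src by simp
    define h1 where "h1 y = (if y \<in> L then on_actions a y else on_actions k y)" for y
    have h1L: "h1 y = on_actions a y" if "y \<in> L" for y
      using that by (simp add: h1_def)
    have h1e: "h1 (e p) = on_actions k (e p)" if "p \<in> R" for p
      using that de dU by (simp add: h1_def)
    have "premap Q Z (on_states a) h1"
    proof (rule premapI)
      fix y assume "y \<in> actions Q"
      then show "h1 y \<in> actions Z" "label Z (h1 y) = label Q y"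
        using premapD(2,3)[OF Da(5)] premapD(2,3)[OF Dk(5)] actF labF labQ labQ' h1L h1e
        by (auto simp: stEF L_def)
    next
      fix \<alpha> us \<beta> assume "(\<alpha>, us, \<beta>) \<in> transitions Q"
      then consider "(\<alpha>, us, \<beta>) \<in> transitions X" | "(\<alpha>, us, \<beta>) \<in> N e"
        by (auto simp: Q_def)
      then show "(on_states a \<alpha>, map h1 us, on_states a \<beta>) \<in> transitions Z"
      proof cases
        case 1
        have eq: "map h1 us = map (on_actions a) us"
          using typed(4)[OF 1] h1L by (auto simp: L_def)
        show ?thesis
          unfolding eq by (rule premapD(4)[OF Da(5) 1])
      next
        case 2
        then obtain p where p: "p \<in> R" "us = [e p]" "(\<alpha>, [lft p], \<beta>) \<in> transitions X" "(\<alpha>, [rgt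
            p], \<beta>) \<in> transitions X"
          by (auto simp: N_def)
        then have "(\<alpha>, [e p], \<beta>) \<in> transitions F"
          unfolding trF by blast
        from premapD(4)[OF Dk(5) this] show ?thesis
          using p h1e k0 typed(1,2)[OF p(3)] by simp
      qed
    qed (use premapD(1)[OF Da(5)] in \<open>simp add: stEF\<close>)
    note h = arrow_of_Hom[OF Q Da(2) this]
    have "arrow_comp (arrow_of Q Z (on_states a) h1) (inclusion X Q) = a"
      by (rule arrow_eqI[OF arrow_comp_Hom[OF XQ h] a]) (use h1L in \<open>simp_all add: stEF L_def\<close>)
    moreover have "arrow_comp (arrow_of Q Z (on_states a) h1) (arrow_of F Q (\<lambda>\<alpha>. \<alpha>) s) = k"
    proof (rule arrow_eqI[OF arrow_comp_Hom[OF g' h] k])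
      fix y assume y: "y \<in> actions F"
      then obtain p where p: "p \<in> R" "y = d p \<or> y = e p"
        by (auto simp: F_def)
      then show "on_actions (arrow_comp (arrow_of Q Z (on_states a) h1) (arrow_of F Q (\<lambda>\<alpha>. \<alpha>) s))
          y = on_actions k y"
        using y s h1L h1e k1 lab by (auto simp: stEF)
    qed (simp add: stEF k0)
    ultimately show "\<exists>h\<in>Hom (systems b) Q Z. arrow_comp h (inclusion X Q) = a \<and> arrow_comp h
        (arrow_of F Q (\<lambda>\<alpha>. \<alpha>) s) = k"
      using h by blast
  next
    fix Z h h' assume h: "h \<in> Hom (systems b) Q Z" "h' \<in> Hom (systems b) Q Z"
      "arrow_comp h (inclusion X Q) = arrow_comp h' (inclusion X Q)"
      "arrow_comp h (arrow_of F Q (\<lambda>\<alpha>. \<alpha>) s) = arrow_comp h' (arrow_of F Q (\<lambda>\<alpha>. \<alpha>) s)"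
    show "h = h'"
    proof (rule arrow_eqI[OF h(1,2)])
      show "on_states h \<alpha> = on_states h' \<alpha>" if "\<alpha> \<in> states Q" for \<alpha>
        using arg_cong[OF h(3), of "\<lambda>f. on_states f \<alpha>"] that by (simp add: stEF)
      fix y assume "y \<in> actions Q"
      then consider "y \<in> L" | p where "p \<in> R" "y = e p"
        by (auto simp: stEF)
      then show "on_actions h y = on_actions h' y"
      proof cases
        case 1
        then show ?thesis
          using arg_cong[OF h(3), of "\<lambda>f. on_actions f y"] by (simp add: L_def)
      next
        case 2
        then show ?thesis
          using arg_cong[OF h(4), of "\<lambda>f. on_actions f y"] actF s by simp
      qed
    qed
  qed
  \<comment> \<open>In \<open>P\<close> the twin \<open>e p\<close> is a full clone of
    \<open>lft p\<close>, with all of its transitions.\<close>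
  define P where "P = reindex X (L \<union> e ` R) src'"
  have sP: "src' \<in> L \<union> e ` R \<rightarrow> actions X" "L \<union> e ` R \<subseteq> U" "small (L \<union> e ` R)" "actions X \<subseteq> L \<union> e ` R"
    using src' src'L lab sub subs small smalls by (auto simp: L_def small_Un)
  have P: "P \<in> Obj (systems b)"
    unfolding P_def by (rule reindex_Obj[OF X sP(1-3)])
  have XP: "inclusion X P \<in> Hom (systems b) X P" "\<And>W. localizer U (systems b) (cofibrations b) W \<Longrightarrow>
      inclusion X P \<in> W"
    unfolding P_def
    using localizer_reindex_inclusion[OF _ X sP src'L(1)[unfolded L_def]] localizer_weak_equivalences
    by blast+
  have QP_sub: "transitions Q \<subseteq> transitions P"
  proof
    fix t assume "t \<in> transitions Q"
    then consider "t \<in> transitions X" | "t \<in> N e"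
      by (auto simp: Q_def)
    then show "t \<in> transitions P"
    proof cases
      case 1
      obtain \<alpha> us \<beta> where t: "t = (\<alpha>, us, \<beta>)"
        by (cases t)
      note tt = typed[OF 1[unfolded t]]
      have "map src' us = us"
        using tt(4) src'L by (intro map_idI) (auto simp: L_def)
      then show ?thesis
        using 1 tt by (auto simp: P_def t L_def)
    next
      case 2
      then show ?thesis
        using src' typed(1,2) by (auto simp: N_def P_def)
    qed
  qed
  have QP: "inclusion Q P \<in> Hom (systems b) Q P"
    by (rule inclusion_Hom[OF Q P _ _ _ QP_sub]) (auto simp: Q_def P_def)
  \<comment> \<open>The inclusion of \<open>X\<close> into \<open>Q\<close> is a pushout of a map of
    \<open>cofibrations b \<inter> W\<close>, and the inclusion into \<open>P\<close> is a section
    of a trivial map, so two-out-of-three gives the map in between.\<close>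
  have QP_W: "inclusion Q P \<in> W" if W: "localizer U (systems b) (cofibrations b) W" for W
  proof -
    have "inclusion E F \<in> cofibrations b \<inter> W"
      using EF W inclusion_cofibration by blast
    then have "inclusion X Q \<in> W"
      using po1 W unfolding localizer_def closed_under_pushout_def by blast
    moreover have "arrow_comp (inclusion Q P) (inclusion X Q) = inclusion X P"
      by (rule arrow_eqI[OF arrow_comp_Hom[OF XQ QP] XP(1)]) (auto simp: stEF L_def)
    ultimately show ?thesis
      using two_out_of_threeD(2)[OF localizer_two_out_of_three[OF W] XQ QP] XP(2)[OF W] by simp
  qed
  \<comment> \<open>Sending \<open>e p\<close> to \<open>rgt p\<close> hands every transition of
    \<open>lft p\<close> over to \<open>rgt p\<close>; closing under the axioms gives the second
    pushout.\<close>
  define T1 where "T1 = tmap (\<lambda>\<alpha>. \<alpha>) tgt' ` transitions P"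
  define X1 where "X1 = \<lparr>states = states X, actions = actions X, label = label X, transitions =
      coherent_closure T1\<rparr>"
  have XP_sub: "transitions X \<subseteq> transitions P"
    using QP_sub by (simp add: Q_def)
  have X1_sub: "transitions X \<subseteq> transitions X1"
  proof
    fix t assume t: "t \<in> transitions X"
    obtain \<alpha> us \<beta> where t': "t = (\<alpha>, us, \<beta>)"
      by (cases t)
    have "map tgt' us = us"
      using typed(4)[OF t[unfolded t']] src'L by (intro map_idI) (auto simp: L_def)
    then have "t \<in> T1"
      using t XP_sub unfolding T1_def t' by (intro image_eqI[of _ _ "(\<alpha>, us, \<beta>)"]) auto
    then show "t \<in> transitions X1"
      by (simp add: X1_def coherent_closure.base)
  qed
  have X1: "X1 \<in> Obj (systems b)"
  proof -
    have wP: "weak_hdts \<Sigma> P" and rP: "regular b P"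
      using P by (auto simp: Obj_systems)
    have "T1 \<subseteq> well_typed (states X) (actions X)"
      unfolding T1_def
    proof (rule tmap_well_typed)
      show "transitions P \<subseteq> well_typed (states P) (actions P)"
        using wP by (simp add: weak_hdts_iff)
      show "tgt' \<in> actions P \<rightarrow> actions X"
        using src' src'L lab by (auto simp: P_def L_def)
    qed (simp add: P_def)
    then have "weak_hdts \<Sigma> X1"
      using w coherent_closure_well_typed by (simp add: weak_hdts_iff X1_def
          mset_closed_coherent_closure coherent_coherent_closure)
    moreover have "regular b X1"
    proof (cases b)
      case False
      then have "splitting T1"
        using rP unfolding T1_def by (intro splitting_image) (simp add: regular_def)
      moreover have "all_used X1"
        using reg False X1_sub unfolding regular_def all_used_def by (simp add: X1_def) blast
      ultimately show ?thesis
        by (simp add: regular_def X1_def splitting_coherent_closure)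
    qed (simp add: regular_def)
    ultimately show ?thesis
      using small sub by (simp add: Obj_systems X1_def)
  qed
  have X1s: "states X1 = states X" "actions X1 = L" "label X1 = label X"
    by (simp_all add: X1_def L_def)
  have stP: "states P = states X" "actions P = L \<union> e ` R"
    by (simp_all add: P_def)
  have XX1: "inclusion X X1 \<in> Hom (systems b) X X1"
    by (rule inclusion_Hom[OF X X1 _ _ _ X1_sub]) (simp_all add: X1_def)
  \<comment> \<open>This is why \<open>Q\<close> stands between \<open>X\<close> and
    \<open>P\<close>: in \<open>Q\<close> the twin has only transitions which \<open>rgt p\<close>
    has as well, so sending it to \<open>rgt p\<close> is a map to \<open>X\<close>.\<close>
  have "premap Q X (\<lambda>\<alpha>. \<alpha>) tgt'"
  proof (rule premapI)
    fix y assume "y \<in> actions Q"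
    then show "tgt' y \<in> actions X" "label X (tgt' y) = label Q y"
      using src' src'L lab labQ labQ' by (auto simp: stEF L_def)
  next
    fix \<alpha> us \<beta> assume "(\<alpha>, us, \<beta>) \<in> transitions Q"
    then consider "(\<alpha>, us, \<beta>) \<in> transitions X" | "(\<alpha>, us, \<beta>) \<in> N e"
      by (auto simp: Q_def)
    then show "(\<alpha>, map tgt' us, \<beta>) \<in> transitions X"
    proof cases
      case 1
      have "map tgt' us = us"
        using typed(4)[OF 1] src'L by (intro map_idI) (auto simp: L_def)
      with 1 show ?thesis
        by simp
    next
      case 2
      then show ?thesis
        using src' by (auto simp: N_def)
    qed
  qed (simp add: stEF)
  note q = arrow_of_Hom[OF Q X this]
  have "premap P X1 (\<lambda>\<alpha>. \<alpha>) tgt'"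
  proof (rule premapI)
    fix y assume "y \<in> actions P"
    then show "tgt' y \<in> actions X1" "label X1 (tgt' y) = label P y"
      using src' src'L lab by (auto simp: X1s P_def)
  next
    fix \<alpha> us \<beta> assume "(\<alpha>, us, \<beta>) \<in> transitions P"
    then have "tmap (\<lambda>\<alpha>. \<alpha>) tgt' (\<alpha>, us, \<beta>) \<in> T1"
      unfolding T1_def by blast
    then show "(\<alpha>, map tgt' us, \<beta>) \<in> transitions X1"
      by (simp add: X1_def coherent_closure.base)
  qed (simp add: stP X1s)
  note q' = arrow_of_Hom[OF P X1 this]
  have po2: "is_pushout (systems b) (inclusion Q P) (arrow_of Q X (\<lambda>\<alpha>. \<alpha>) tgt') (inclusion X X1)
      (arrow_of P X1 (\<lambda>\<alpha>. \<alpha>) tgt')"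
  proof (rule is_pushoutI[OF QP q XX1 q'])
    show "arrow_comp (inclusion X X1) (arrow_of Q X (\<lambda>\<alpha>. \<alpha>) tgt') = arrow_comp (arrow_of P X1 (\<lambda>\<alpha>.
        \<alpha>) tgt') (inclusion Q P)"
      by (rule arrow_eqI[OF arrow_comp_Hom[OF q XX1] arrow_comp_Hom[OF QP q']])
        (use src' src'L lab in \<open>auto simp: stEF stP L_def\<close>)
  next
    fix Z a k assume a: "a \<in> Hom (systems b) X Z" and k: "k \<in> Hom (systems b) P Z"
      and sq: "arrow_comp a (arrow_of Q X (\<lambda>\<alpha>. \<alpha>) tgt') = arrow_comp k (inclusion Q P)"
    note Da = Hom_D[OF a] and Dk = Hom_D[OF k]
    have k0: "on_states k \<alpha> = on_states a \<alpha>" if "\<alpha> \<in> states X" for \<alpha>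
      using arg_cong[OF sq, of "\<lambda>f. on_states f \<alpha>"] that stEF by simp
    have k1: "on_actions a (tgt' y) = on_actions k y" if "y \<in> L \<union> e ` R" for y
      using arg_cong[OF sq, of "\<lambda>f. on_actions f y"] that stEF src' src'L lab by (auto simp: L_def)
    have "premap X1 Z (on_states a) (on_actions a)"
    proof (rule premapI)
      fix \<alpha> us \<beta> assume "(\<alpha>, us, \<beta>) \<in> transitions X1"
      then have t: "(\<alpha>, us, \<beta>) \<in> coherent_closure T1"
        by (simp add: X1_def)
      show "(on_states a \<alpha>, map (on_actions a) us, on_states a \<beta>) \<in> transitions Z"
      proof (rule premap_coherent_closure[OF _ _ _ t])
        fix \<alpha> vs \<beta> assume "(\<alpha>, vs, \<beta>) \<in> T1"
        then obtain ws where t: "(\<alpha>, ws, \<beta>) \<in> transitions P" "vs = map tgt' ws"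
          by (auto simp: T1_def)
        have ws: "\<alpha> \<in> states X" "\<beta> \<in> states X" "set ws \<subseteq> L \<union> e ` R"
          using t(1) by (auto simp: P_def)
        have eq: "map (on_actions a) vs = map (on_actions k) ws"
          using ws(3) k1 by (auto simp: t(2))
        show "(on_states a \<alpha>, map (on_actions a) vs, on_states a \<beta>) \<in> transitions Z"
          using premapD(4)[OF Dk(5) t(1)] k0 ws by (simp add: eq)
      qed (use Da(7) in \<open>auto simp: weak_hdts_iff\<close>)
    qed (use premapD[OF Da(5)] in \<open>simp_all add: X1s L_def\<close>)
    note h = arrow_of_Hom[OF X1 Da(2) this]
    have "arrow_comp (arrow_of X1 Z (on_states a) (on_actions a)) (inclusion X X1) = a"
      by (rule arrow_eqI[OF arrow_comp_Hom[OF XX1 h] a]) (simp_all add: X1s L_def)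
    moreover have "arrow_comp (arrow_of X1 Z (on_states a) (on_actions a)) (arrow_of P X1 (\<lambda>\<alpha>. \<alpha>)
        tgt') = k"
    proof (rule arrow_eqI[OF arrow_comp_Hom[OF q' h] k])
      fix y assume y: "y \<in> actions P"
      then have "tgt' y \<in> L"
        using src' src'L lab by (auto simp: stP)
      then show "on_actions (arrow_comp (arrow_of X1 Z (on_states a) (on_actions a)) (arrow_of P
          X1 (\<lambda>\<alpha>. \<alpha>) tgt')) y = on_actions k y"
        using y k1[of y] by (simp add: X1s stP)
    qed (simp add: X1s stP k0)
    ultimately show "\<exists>h\<in>Hom (systems b) X1 Z. arrow_comp h (inclusion X X1) = a \<and>
        arrow_comp h (arrow_of P X1 (\<lambda>\<alpha>. \<alpha>) tgt') = k"
      using h by blast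
  next
    fix Z h h' assume h: "h \<in> Hom (systems b) X1 Z" "h' \<in> Hom (systems b) X1 Z"
      "arrow_comp h (inclusion X X1) = arrow_comp h' (inclusion X X1)"
    show "h = h'"
    proof (rule arrow_eqI[OF h(1,2)])
      show "on_states h \<alpha> = on_states h' \<alpha>" if "\<alpha> \<in> states X1" for \<alpha>
        using arg_cong[OF h(3), of "\<lambda>f. on_states f \<alpha>"] that by (simp add: X1s)
      show "on_actions h y = on_actions h' y" if "y \<in> actions X1" for y
        using arg_cong[OF h(3), of "\<lambda>f. on_actions f y"] that by (simp add: X1s L_def)
    qed
  qed
  have "inclusion X X1 \<in> W" if W: "localizer U (systems b) (cofibrations b) W" for W
  proof -
    have "inclusion Q P \<in> cofibrations b \<inter> W"
      using QP QP_W[OF W] inclusion_cofibration by blast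
    then show ?thesis
      using po2 W unfolding localizer_def closed_under_pushout_def by blast
  qed
  moreover have "(\<alpha>, v # us, \<beta>) \<in> transitions X1" if t: "(\<alpha>, u # us, \<beta>) \<in> transitions X" and uv:
      "rel b X u v" for \<alpha> u v us \<beta>
  proof -
    obtain p where p: "p \<in> R" "lft p = u" "rgt p = v"
      using exR[OF uv] by blast
    have us: "map src' us = us" "map tgt' us = us" "set us \<subseteq> L"
      using typed(4)[OF t] src'L by (auto intro!: map_idI simp: L_def)
    \<comment> \<open>In \<open>P\<close> one occurrence of \<open>u\<close> may be traded for the
      twin while the rest of the list stays put; \<open>tgt'\<close> then turns the twin into
      \<open>v\<close>.\<close>
    have "(\<alpha>, e p # us, \<beta>) \<in> transitions P"
      using p us t typed(1,2)[OF t] src' by (simp add: P_def) blast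
    then have "tmap (\<lambda>\<alpha>. \<alpha>) tgt' (\<alpha>, e p # us, \<beta>) \<in> T1"
      unfolding T1_def by blast
    then show ?thesis
      using p us src' by (simp add: X1_def coherent_closure.base)
  qed
  ultimately show ?thesis
    using X1 X1_sub X1s by (intro bexI[of _ X1]) (auto simp: L_def)
qed

text \<open>States, actions and labels are constant along the chain, so a cocone is determined by
  its component at \<open>0\<close> and the union of the transitions is the colimit.\<close>

lemma omega_chain_composition:
  fixes X :: "nat \<Rightarrow> ('u, 'u, 'l) hdts"
  assumes X: "\<And>n. X n \<in> Obj (systems b)" "\<And>n. states (X n) = states (X 0)" "\<And>n. actions (X n) =
      actions (X 0)"
      "\<And>n. label (X n) = label (X 0)" "\<And>n. transitions (X n) \<subseteq> transitions (X (Suc n))"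
    and A: "\<And>n. inclusion (X n) (X (Suc n)) \<in> A" "closed_under_transfinite_composition U (systems b) A"
    and Y: "Y \<in> Obj (systems b)" "states Y = states (X 0)" "actions Y = actions (X 0)" "label Y =
        label (X 0)"
      "transitions Y = (\<Union>n. transitions (X n))"
  shows "inclusion (X 0) Y \<in> A"
proof -
  obtain e :: "nat \<Rightarrow> 'u" where e: "inj e" "range e \<subseteq> U" "small (range e)"
    using small_copy[OF small_nat] by blast
  let ?r = "omega_order e"
  have mono: "transitions (X m) \<subseteq> transitions (X n)" if "m \<le> n" for m n
    using lift_Suc_mono_le[of "\<lambda>n. transitions (X n)", OF X(5) that] .
  define D where "D = \<lparr>fobj = (\<lambda>i. X (inv e i)), fmap = (\<lambda>(i, j). inclusion (X (inv e i)) (X (inv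
      e j)))\<rparr>"
  have Dm: "inclusion (X m) (X n) \<in> Hom (systems b) (X m) (X n)" if "m \<le> n" for m n
    using that X(2,3,4)[of m] X(2,3,4)[of n] mono by (intro inclusion_Hom X) auto
  have dom: "states (X m) = states (X 0)" "actions (X m) = actions (X 0)" for m
    using X by auto
  have fun_D: "is_functor (order_category ?r) (systems b) D"
    unfolding is_functor_def
  proof (intro conjI ballI impI)
    fix i assume "i \<in> Obj (order_category ?r)"
    then obtain n where i: "i = e n"
      by (auto simp: order_category_def Field_omega_order)
    show "fobj D i \<in> Obj (systems b)"
      using X(1) by (simp add: D_def)
    show "fmap D (Ident (order_category ?r) i) = Ident (systems b) (fobj D i)"
      by (simp add: D_def order_category_def arrow_of_def arrow_ident_def)
  next
    fix f assume "f \<in> Arr (order_category ?r)"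
    then obtain m n where "f = (e m, e n)" "m \<le> n"
      by (auto simp: order_category_def omega_order_def)
    then show "fmap D f \<in> Hom (systems b) (fobj D (Dom (order_category ?r) f)) (fobj D (Cod
        (order_category ?r) f))"
      using Dm e(1) by (simp add: D_def order_category_def)
  next
    fix f g assume "f \<in> Arr (order_category ?r)" "g \<in> Arr (order_category ?r)"
      "Cod (order_category ?r) f = Dom (order_category ?r) g"
    then obtain m n k where fg: "f = (e m, e n)" "g = (e n, e k)" "m \<le> n" "n \<le> k"
      using e(1) by (auto simp: order_category_def omega_order_def inj_eq)
    have "inclusion (X m) (X k) = arrow_comp (inclusion (X n) (X k)) (inclusion (X m) (X n))"
      by (rule arrow_eqI[OF Dm arrow_comp_Hom[OF Dm[OF fg(3)] Dm[OF fg(4)]]])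
        (use fg dom[of m] dom[of n] in auto)
    then show "fmap D (Comp (order_category ?r) g f) = Comp (systems b) (fmap D g) (fmap D f)"
      using e(1) by (simp add: D_def order_category_def fg)
  qed
  define \<iota> where "\<iota> i = inclusion (X (inv e i)) Y" for i
  have \<iota>: "inclusion (X n) Y \<in> Hom (systems b) (X n) Y" for n
    using X(2,3,4)[of n] Y(5) by (intro inclusion_Hom X Y) (auto simp: Y)
  have "is_colimit (order_category ?r) (systems b) D Y \<iota>"
    unfolding is_colimit_def
  proof (intro conjI allI impI)
    show "is_cocone (order_category ?r) (systems b) D Y \<iota>"
      unfolding systems.cocone_order_category Field_omega_order
    proof (intro conjI ballI Y(1))
      show "\<iota> i \<in> Hom (systems b) (fobj D i) Y" for i
        using \<iota> by (simp add: D_def \<iota>_def)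
      fix p assume "p \<in> ?r"
      then obtain m n where p: "p = (e m, e n)" "m \<le> n"
        by (auto simp: omega_order_def)
      have "arrow_comp (inclusion (X n) Y) (inclusion (X m) (X n)) = inclusion (X m) Y"
        by (rule arrow_eqI[OF arrow_comp_Hom[OF Dm[OF p(2)] \<iota>] \<iota>]) (use dom[of m] dom[of n] in auto)
      then show "case p of (i, j) \<Rightarrow> Comp (systems b) (\<iota> j) (fmap D (i, j)) = \<iota> i"
        using e(1) by (simp add: p D_def \<iota>_def)
    qed
    fix Z \<kappa> assume "is_cocone (order_category ?r) (systems b) D Z \<kappa>"
    then have Z: "Z \<in> Obj (systems b)" and \<kappa>: "\<kappa> (e n) \<in> Hom (systems b) (X n) Z"
      and arr: "\<And>i j. (i, j) \<in> ?r \<Longrightarrow> arrow_comp (\<kappa> j) (fmap D (i, j)) = \<kappa> i" for n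
      using e(1) unfolding systems.cocone_order_category Field_omega_order by (auto simp: D_def)
    have \<kappa>c: "arrow_comp (\<kappa> (e n)) (inclusion (X m) (X n)) = \<kappa> (e m)" if "m \<le> n" for m n
      using arr[of "e m" "e n"] e(1) that by (simp add: D_def omega_order_iff)
    have k0: "on_states (\<kappa> (e n)) \<alpha> = on_states (\<kappa> (e 0)) \<alpha>" if "\<alpha> \<in> states (X 0)" for n \<alpha>
      using arg_cong[OF \<kappa>c[of 0 n], of "\<lambda>f. on_states f \<alpha>"] that by simp
    have k1: "on_actions (\<kappa> (e n)) u = on_actions (\<kappa> (e 0)) u" if "u \<in> actions (X 0)" for n u
      using arg_cong[OF \<kappa>c[of 0 n], of "\<lambda>f. on_actions f u"] that by simp
    note K = Hom_D[OF \<kappa>]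
    have "premap Y Z (on_states (\<kappa> (e 0))) (on_actions (\<kappa> (e 0)))"
    proof (rule premapI)
      fix \<alpha> us \<beta> assume "(\<alpha>, us, \<beta>) \<in> transitions Y"
      then obtain n where t: "(\<alpha>, us, \<beta>) \<in> transitions (X n)"
        using Y(5) by blast
      note tt = transition_typed[OF K(6) t]
      have eq: "map (on_actions (\<kappa> (e 0))) us = map (on_actions (\<kappa> (e n))) us"
        using tt(4) k1[of _ n] dom(2)[of n] by auto
      show "(on_states (\<kappa> (e 0)) \<alpha>, map (on_actions (\<kappa> (e 0))) us, on_states (\<kappa> (e 0)) \<beta>) \<in>
          transitions Z"
        unfolding eq using premapD(4)[OF K(5) t] k0[of _ n] tt(1,2) dom(1)[of n] by simp
    qed (use premapD[OF K(5)[of 0]] Y in auto)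
    note h = arrow_of_Hom[OF Y(1) Z this]
    let ?h = "arrow_of Y Z (on_states (\<kappa> (e 0))) (on_actions (\<kappa> (e 0)))"
    have hc: "arrow_comp ?h (inclusion (X n) Y) = \<kappa> (e n)" for n
      by (rule arrow_eqI[OF arrow_comp_Hom[OF \<iota> h] \<kappa>]) (use k0[of _ n] k1[of _ n] dom[of n] Y in auto)
    show "\<exists>!h. h \<in> Hom (systems b) Y Z \<and>
        (\<forall>j\<in>Obj (order_category ?r). Comp (systems b) h (\<iota> j) = \<kappa> j)"
    proof (rule ex1I[of _ ?h], intro conjI ballI h)
      fix j assume "j \<in> Obj (order_category ?r)"
      then obtain n where "j = e n"
        by (auto simp: order_category_def Field_omega_order)
      then show "Comp (systems b) ?h (\<iota> j) = \<kappa> j"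
        using hc e(1) by (simp add: \<iota>_def)
    next
      fix g assume g: "g \<in> Hom (systems b) Y Z \<and>
        (\<forall>j\<in>Obj (order_category ?r). Comp (systems b) g (\<iota> j) = \<kappa> j)"
      then have "Comp (systems b) g (\<iota> (e 0)) = \<kappa> (e 0)"
        by (simp add: order_category_def Field_omega_order)
      then have g0: "arrow_comp g (inclusion (X 0) Y) = \<kappa> (e 0)"
        using e(1) by (simp add: \<iota>_def)
      show "g = ?h"
      proof (rule arrow_eqI[OF _ h])
        show "g \<in> Hom (systems b) Y Z"
          using g by blast
        show "on_states g \<alpha> = on_states ?h \<alpha>" if "\<alpha> \<in> states Y" for \<alpha>
          using arg_cong[OF g0, of "\<lambda>f. on_states f \<alpha>"] that Y by simp
        show "on_actions g u = on_actions ?h u" if "u \<in> actions Y" for u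
          using arg_cong[OF g0, of "\<lambda>f. on_actions f u"] that Y by simp
      qed
    qed
  qed
  moreover have "is_least ?r (e 0)"
    using e(1) by (simp add: is_least_def Field_omega_order underS_omega_order)
  moreover have "fmap D (i, j) \<in> A" if ij: "is_succ ?r i j" for i j
  proof -
    obtain n where "i = e n" "j = e (Suc n)"
      using is_succ_omega_order[OF e(1) ij] .
    then show ?thesis
      using A(1) e(1) by (simp add: D_def)
  qed
  moreover have "Field ?r \<prec> U"
    using e(3) by (simp add: Field_omega_order)
  ultimately have "is_transfinite_composition U (systems b) A (\<iota> (e 0))"
    unfolding is_transfinite_composition_def
    using fun_D Well_order_omega_order[OF e(1)] not_is_limit_element_omega_order[OF e(1)]
    by (intro exI[of _ ?r] exI[of _ D] exI[of _ Y] exI[of _ \<iota>] exI[of _ "e 0"]) simp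
  then have "\<iota> (e 0) \<in> A"
    using A(2) by (simp add: closed_under_transfinite_composition_def)
  then show ?thesis
    using e(1) by (simp add: \<iota>_def)
qed

text \<open>One step adds transitions, and with them new instances of interchange and, in the
  cubical case, new related pairs. Countably many steps suffice, since every instance involves
  finitely many transitions and appears at a finite stage.\<close>

lemma saturation:
  assumes X: "X \<in> Obj (systems b)"
  shows "\<exists>Y\<in>Obj (systems b). states Y = states X \<and> actions Y = actions X \<and>
    transitions X \<subseteq> transitions Y \<and> label Y = label X \<and>
    (\<forall>\<alpha> u v us \<beta>. (\<alpha>, u # us, \<beta>) \<in> transitions Y \<and> rel b Y u v \<longrightarrow> (\<alpha>, v # us, \<beta>) \<in> transitions Y) \<and>
    (\<forall>W. localizer U (systems b) (cofibrations b) W \<longrightarrow> inclusion X Y \<in> W)"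
proof -
  define step where "step X X1 \<longleftrightarrow> X1 \<in> Obj (systems b) \<and> states X1 = states X \<and> actions X1 = actions X \<and>
    label X1 = label X \<and> transitions X \<subseteq> transitions X1 \<and>
    (\<forall>\<alpha> u v us \<beta>. (\<alpha>, u # us, \<beta>) \<in> transitions X \<and> rel b X u v \<longrightarrow> (\<alpha>, v # us, \<beta>) \<in> transitions X1) \<and>
    (\<forall>W. localizer U (systems b) (cofibrations b) W \<longrightarrow> inclusion X X1 \<in> W)" for X X1 :: "('u, 'u,
        'l) hdts"
  have step_ex: "\<exists>X1. step X X1" if "X \<in> Obj (systems b)" for X
    using saturation_step[OF that] unfolding step_def by blast
  define next_system where "next_system X = (SOME X1. step X X1)" for X
  have step_next: "step X (next_system X)" if "X \<in> Obj (systems b)" for X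
    unfolding next_system_def using someI_ex[OF step_ex[OF that]] .
  define S where "S n = (next_system ^^ n) X" for n
  have S_Obj: "S n \<in> Obj (systems b)" for n
    by (induction n) (use X step_next in \<open>auto simp: S_def step_def\<close>)
  have S_step: "step (S n) (S (Suc n))" for n
    using step_next[OF S_Obj[of n]] by (simp add: S_def)
  have same: "states (S n) = states X \<and> actions (S n) = actions X \<and> label (S n) = label X" for n
    by (induction n) (use S_step in \<open>auto simp: step_def S_def[of 0]\<close>)
  have S0: "S 0 = X"
    by (simp add: S_def)
  have mono: "transitions (S m) \<subseteq> transitions (S n)" if "m \<le> n" for m n
    by (rule lift_Suc_mono_le[of "\<lambda>n. transitions (S n)", OF _ that]) (use S_step in \<open>simp add:
        step_def\<close>)
  define T where "T = (\<Union>n. transitions (S n))"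
  have up: "t \<in> transitions (S n)" if "t \<in> transitions (S m)" "m \<le> n" for t m n
    using mono that by blast
  define Y where "Y = \<lparr>states = states X, actions = actions X, label = label X, transitions = T\<rparr>"
  have wS: "weak_hdts \<Sigma> (S n)" and regS: "regular b (S n)" for n
    using S_Obj[of n] by (auto simp: Obj_systems)
  have mT: "mset_closed T"
    using wS unfolding T_def mset_closed_def weak_hdts_iff by blast
  have "coherent T"
    unfolding coherent_def
  proof (intro allI impI, elim conjE)
    fix \<alpha> us vs ws \<beta> \<nu>1 \<nu>2
    assume ne: "us \<noteq> []" "vs \<noteq> []" "ws \<noteq> []"
      and "(\<alpha>, us @ vs @ ws, \<beta>) \<in> T" "(\<alpha>, us, \<nu>1) \<in> T" "(\<nu>1, vs @ ws, \<beta>) \<in> T"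
        "(\<alpha>, us @ vs, \<nu>2) \<in> T" "(\<nu>2, ws, \<beta>) \<in> T"
    then obtain n1 n2 n3 n4 n5 where n: "(\<alpha>, us @ vs @ ws, \<beta>) \<in> transitions (S n1)" "(\<alpha>, us, \<nu>1) \<in>
        transitions (S n2)"
      "(\<nu>1, vs @ ws, \<beta>) \<in> transitions (S n3)" "(\<alpha>, us @ vs, \<nu>2) \<in> transitions (S n4)" "(\<nu>2, ws, \<beta>)
          \<in> transitions (S n5)"
      unfolding T_def by blast
    define N where "N = n1 + n2 + n3 + n4 + n5"
    have "coherent (transitions (S N))"
      using wS by (simp add: weak_hdts_iff)
    then have "(\<nu>1, vs, \<nu>2) \<in> transitions (S N)"
      by (rule coherentD[OF _ ne])
        (use up[OF n(1), of N] up[OF n(2), of N] up[OF n(3), of N] up[OF n(4), of N] up[OF n(5),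
            of N] in \<open>simp_all add: N_def\<close>)
    then show "(\<nu>1, vs, \<nu>2) \<in> T"
      unfolding T_def by blast
  qed
  moreover have "T \<subseteq> well_typed (states X) (actions X)"
    using wS same unfolding T_def weak_hdts_iff by auto
  ultimately have wY: "weak_hdts \<Sigma> Y"
    using mT X by (simp add: Y_def weak_hdts_iff Obj_systems)
  have XT: "transitions X \<subseteq> T"
    unfolding T_def S0[symmetric] by blast
  have "regular b Y"
  proof (cases b)
    case False
    have "splitting T"
      unfolding T_def by (rule splitting_Union) (use regS False in \<open>auto simp: regular_def\<close>)
    moreover have "all_used Y"
      using regS[of 0] False XT unfolding S0 regular_def all_used_def by (simp add: Y_def) blast
    ultimately show ?thesis
      by (simp add: regular_def Y_def)
  qed (simp add: regular_def)
  then have Y: "Y \<in> Obj (systems b)"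
    using wY X by (simp add: Obj_systems Y_def)
  have sat: "(\<alpha>, v # us, \<beta>) \<in> transitions Y" if t: "(\<alpha>, u # us, \<beta>) \<in> transitions Y" and uv: "rel b
      Y u v" for \<alpha> u v us \<beta>
  proof -
    obtain m where m: "(\<alpha>, u # us, \<beta>) \<in> transitions (S m)"
      using t by (auto simp: Y_def T_def)
    obtain k where k: "rel b (S k) u v"
    proof (cases b)
      case True
      then show ?thesis
        using uv that[of 0] by (simp add: rel_def Y_def S0)
    next
      case False
      then obtain \<gamma> \<delta> where "(\<gamma>, [u], \<delta>) \<in> T" "(\<gamma>, [v], \<delta>) \<in> T"
        using uv by (auto simp: rel_def Y_def)
      then obtain k l where kl: "(\<gamma>, [u], \<delta>) \<in> transitions (S k)" "(\<gamma>, [v], \<delta>) \<in> transitions (S l)"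
        unfolding T_def by blast
      show ?thesis
        by (rule that[of "k + l"])
          (use up[OF kl(1), of "k + l"] up[OF kl(2), of "k + l"] uv same in \<open>auto simp: rel_def Y_def\<close>)
    qed
    \<comment> \<open>The transition is present from stage \<open>m\<close> on and the relation from
      stage \<open>k\<close> on; at \<open>m + k\<close> both are, and the next step performs the
      replacement.\<close>
    have "rel b (S (m + k)) u v"
      using k up[of _ k "m + k"] same by (fastforce simp: rel_def)
    then have "(\<alpha>, v # us, \<beta>) \<in> transitions (S (Suc (m + k)))"
      using S_step[of "m + k"] up[OF m, of "m + k"] unfolding step_def by auto
    then show ?thesis
      by (auto simp: Y_def T_def)
  qed
  have "inclusion X Y \<in> W" if W: "localizer U (systems b) (cofibrations b) W" for W
  proof -
    have "inclusion (S 0) Y \<in> cofibrations b \<inter> W"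
    proof (rule omega_chain_composition)
      show "closed_under_transfinite_composition U (systems b) (cofibrations b \<inter> W)"
        using W by (simp add: localizer_def)
      show "inclusion (S n) (S (Suc n)) \<in> cofibrations b \<inter> W" for n
      proof
        show "inclusion (S n) (S (Suc n)) \<in> W"
          using S_step[of n] W by (simp add: step_def)
        show "inclusion (S n) (S (Suc n)) \<in> cofibrations b"
          using mono[of n "Suc n"] same by (intro inclusion_cofibration inclusion_Hom S_Obj) auto
      qed
    qed (use S_Obj same mono Y in \<open>auto simp: Y_def T_def\<close>)
    then show ?thesis
      by (simp add: S0)
  qed
  then show ?thesis
    using sat XT Y by (intro bexI[of _ Y]) (auto simp: Y_def)
qed

text \<open>Saturation makes relatedness an equivalence relation under which transitions are
  invariant, so passing to representatives is a trivial map. That the states stay the same is used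
  by the second factorization.\<close>

lemma reflection:
  assumes X: "X \<in> Obj (systems b)"
  shows "\<exists>X'\<in>local_systems b. \<exists>r\<in>Hom (systems b) X X'. states X' = states X \<and>
    (\<forall>\<alpha>\<in>states X. on_states r \<alpha> = \<alpha>) \<and> (\<forall>W. localizer U (systems b) (cofibrations b) W \<longrightarrow> r \<in> W)"
proof -
  obtain Y where Y: "Y \<in> Obj (systems b)" "states Y = states X" "actions Y = actions X"
    "transitions X \<subseteq> transitions Y" "label Y = label X"
    and sat: "\<And>\<alpha> u v us \<beta>. (\<alpha>, u # us, \<beta>) \<in> transitions Y \<Longrightarrow> rel b Y u v \<Longrightarrow> (\<alpha>, v # us, \<beta>) \<in> transitions Y"
    and loc: "\<And>W. localizer U (systems b) (cofibrations b) W \<Longrightarrow> inclusion X Y \<in> W"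
    using saturation[OF X] by blast
  have w: "weak_hdts \<Sigma> Y" and regY: "regular b Y"
    using Y by (auto simp: Obj_systems)
  have closed: "mset_closed (transitions Y)" "coherent (transitions Y)"
    using w by (auto simp: weak_hdts_iff)
  have refl: "rel b Y u u" if u: "u \<in> actions Y" for u
  proof (cases b)
    case False
    then show ?thesis
      using regular_singleton[of Y u] u regY unfolding rel_def by metis
  qed (use u in \<open>simp add: rel_def\<close>)
  have sym: "rel b Y v u" if "rel b Y u v" for u v
    using that by (auto simp: rel_def)
  have trans: "rel b Y u v" if uxv: "rel b Y u x" "rel b Y x v" for u v x
  proof (cases b)
    case False
    obtain \<gamma> \<delta> where t: "(\<gamma>, [x], \<delta>) \<in> transitions Y" "(\<gamma>, [v], \<delta>) \<in> transitions Y"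
      using uxv(2) False by (auto simp: rel_def)
    \<comment> \<open>Saturation gives \<open>u\<close> the 1-transition shared by \<open>x\<close>
      and \<open>v\<close>; this is the witness required for transitivity.\<close>
    have "(\<gamma>, [u], \<delta>) \<in> transitions Y"
      by (rule sat[OF t(1) sym[OF uxv(1)]])
    then show ?thesis
      using t uxv by (auto simp: rel_def)
  qed (use uxv in \<open>auto simp: rel_def\<close>)
  define rep where "rep u = (SOME v. rel b Y u v)" for u
  have rep: "rel b Y u (rep u)" if "u \<in> actions Y" for u
    unfolding rep_def by (rule someI[of _ u]) (rule refl[OF that])
  have rep_eq: "rep u = rep v" if "rel b Y u v" for u v
  proof -
    have "rel b Y u = rel b Y v"
      using that sym trans by blast
    then show ?thesis
      by (simp add: rep_def)
  qed
  have rep_in: "rep u \<in> actions Y" "label Y (rep u) = label Y u" "rep (rep u) = rep u" if "u \<in>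
      actions Y" for u
    using rep[OF that] rep_eq[OF rep[OF that]] by (auto simp: rel_def)
  have rep_T: "(\<alpha>, map rep us, \<beta>) \<in> transitions Y \<longleftrightarrow> (\<alpha>, us, \<beta>) \<in> transitions Y" if us: "set us \<subseteq>
      actions Y" for \<alpha> us \<beta>
  proof -
    have "list_all2 (rel b Y) us (map rep us)" "list_all2 (rel b Y) (map rep us) us"
      using us rep sym by (auto simp: list_all2_conv_all_nth subset_iff)
    then show ?thesis
      using list_all2_saturated[OF closed(1), of "rel b Y"] sat by blast
  qed
  \<comment> \<open>The quotient is realised as the full subsystem on representatives, so that its
    actions still lie in \<open>U\<close>.\<close>
  define Z where "Z = \<lparr>states = states X, actions = rep ` actions Y, label = restrict (label X)
      (rep ` actions Y),
    transitions = transitions Y \<inter> well_typed (states X) (rep ` actions Y)\<rparr>"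
  have ZT: "(\<alpha>, us, \<beta>) \<in> transitions Z \<longleftrightarrow> (\<alpha>, us, \<beta>) \<in> transitions Y \<and> set us \<subseteq> rep ` actions Y"
      for \<alpha> us \<beta>
    using transition_typed[OF w, of \<alpha> us \<beta>] Y(2) by (auto simp: Z_def well_typed_def)
  have wZ: "weak_hdts \<Sigma> Z"
    unfolding weak_hdts_iff
  proof (intro conjI)
    show "label Z \<in> actions Z \<rightarrow>\<^sub>E \<Sigma>"
      using rep_in label_in[OF w] Y(5) by (auto simp: Z_def)
  qed (auto simp: Z_def closed intro!: mset_closed_Int coherent_Int well_typed_closed)
  have "premap Y Z (\<lambda>\<alpha>. \<alpha>) rep"
  proof (rule premapI)
    fix \<alpha> us \<beta> assume t: "(\<alpha>, us, \<beta>) \<in> transitions Y"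
    then show "(\<alpha>, map rep us, \<beta>) \<in> transitions Z"
      using rep_T transition_typed(4)[OF w t] by (auto simp: ZT)
  qed (use rep_in Y in \<open>auto simp: Z_def\<close>)
  note p = this
  have regZ: "regular b Z"
  proof (cases b)
    case False
    have rY: "all_used Y" "splitting (transitions Y)"
      using regY False by (auto simp: regular_def)
    have "splitting (transitions Z)"
      unfolding splitting_def
    proof (intro allI impI, elim conjE)
      fix \<alpha> us vs ws \<beta>
      assume t: "(\<alpha>, us, \<beta>) \<in> transitions Z" and ms: "mset us = mset vs + mset ws" and ne: "vs \<noteq>
          []" "ws \<noteq> []"
      have "set us = set vs \<union> set ws"
        using ms by (metis set_mset_mset set_mset_union)
      moreover obtain \<nu> where "(\<alpha>, vs, \<nu>) \<in> transitions Y" "(\<nu>, ws, \<beta>) \<in> transitions Y"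
        using splittingE[OF rY(2) _ ms ne] t ZT by blast
      ultimately show "\<exists>\<nu>. (\<alpha>, vs, \<nu>) \<in> transitions Z \<and> (\<nu>, ws, \<beta>) \<in> transitions Z"
        using t by (auto simp: ZT)
    qed
    moreover have "all_used Z"
      unfolding all_used_def
    proof
      fix x assume "x \<in> actions Z"
      then obtain u where u: "u \<in> actions Y" "x = rep u"
        by (auto simp: Z_def)
      then obtain \<alpha> us \<beta> where "(\<alpha>, us, \<beta>) \<in> transitions Y" "u \<in> set us"
        using rY(1) unfolding all_used_def by blast
      then have "(\<alpha>, map rep us, \<beta>) \<in> transitions Z" "x \<in> set (map rep us)"
        using premapD(4)[OF p] u(2) by auto
      then show "\<exists>\<alpha> us \<beta>. (\<alpha>, us, \<beta>) \<in> transitions Z \<and> x \<in> set us"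
        by blast
    qed
    ultimately show ?thesis
      by (simp add: regular_def)
  qed (simp add: regular_def)
  have "rep ` actions Y \<subseteq> actions X"
    using rep_in(1) Y(3) by auto
  then have Z: "Z \<in> Obj (systems b)"
    using wZ regZ X small_subset by (auto simp: Obj_systems Z_def)
  have "u = v" if uv: "rel b Z u v" for u v
  proof -
    obtain x y where "x \<in> actions Y" "u = rep x" "y \<in> actions Y" "v = rep y"
      using uv by (auto simp: rel_def Z_def)
    then have "rep u = u" "rep v = v" "u \<in> actions Y" "v \<in> actions Y"
      using rep_in by auto
    moreover from this have "rel b Y u v"
      using uv Y(5) by (auto simp: rel_def ZT) (auto simp: Z_def)
    ultimately show "u = v"
      using rep_eq by metis
  qed
  then have loc_Z: "Z \<in> local_systems b"
    using Z by (simp add: local_systems_def)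
  note q = arrow_of_Hom[OF Y(1) Z p]
  let ?q = "arrow_of Y Z (\<lambda>\<alpha>. \<alpha>) rep"
  have "?q \<in> trivial_maps b"
  proof (rule trivial_mapI[OF q])
    fix \<alpha> \<beta> us assume a: "\<alpha> \<in> states Y" "\<beta> \<in> states Y" "set us \<subseteq> actions Y"
      "(on_states ?q \<alpha>, map (on_actions ?q) us, on_states ?q \<beta>) \<in> transitions Z"
    have eq: "map (on_actions ?q) us = map rep us"
      using a(3) by auto
    show "(\<alpha>, us, \<beta>) \<in> transitions Y"
      using a(1,2) a(4)[unfolded eq] rep_T[OF a(3)] by (simp add: ZT)
  qed (use Y(2) in \<open>auto simp: Z_def bij_betw_def inj_on_def arrow_of_def image_iff\<close>)
  then have qW: "?q \<in> W" if "localizer U (systems b) (cofibrations b) W" for W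
    using localizer_trivial_maps[OF that] by blast
  have XY: "inclusion X Y \<in> Hom (systems b) X Y"
    by (rule inclusion_Hom[OF X Y(1)]) (use Y in auto)
  show ?thesis
  proof (intro bexI[of _ Z] bexI[of _ "arrow_comp ?q (inclusion X Y)"] conjI allI impI ballI loc_Z
      arrow_comp_Hom[OF XY q])
    show "arrow_comp ?q (inclusion X Y) \<in> W" if W: "localizer U (systems b) (cofibrations b) W" for W
      by (rule two_out_of_threeD(1)[OF localizer_two_out_of_three[OF W] XY q loc[OF W] qW[OF W]])
  qed (use Y in \<open>simp_all add: Z_def\<close>)
qed

section \<open>Minimality of the weak equivalences\<close>

lemma iso_localizer:
  assumes f: "f \<in> Hom (systems b) X Y" and g: "g \<in> Hom (systems b) Y X"
    and "arrow_comp g f = arrow_ident X" "arrow_comp f g = arrow_ident Y"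
  shows "f \<in> inj_class (systems b) (cofibrations b)"
  unfolding inj_class_def
proof (intro CollectI conjI ballI)
  show "f \<in> Arr (systems b)"
    by (rule systems.Hom_Arr[OF f])
  fix i assume i: "i \<in> cofibrations b"
  note iH = cofibrationD(1)[OF i]
  show "has_lifting (systems b) i f"
  proof (rule systems.has_liftingI[OF iH f], unfold systems_simps)
    fix u v assume u: "u \<in> Hom (systems b) (source i) X" and v: "v \<in> Hom (systems b) (target i) Y"
      and sq: "arrow_comp f u = arrow_comp v i"
    have "arrow_comp (arrow_comp g v) i = arrow_comp (arrow_comp g f) u"
      using systems.comp_assoc[OF iH v g] systems.comp_assoc[OF u f g] sq by simp
    then have "arrow_comp (arrow_comp g v) i = u"
      using assms(3) systems.ident_comp[OF u] by simp
    moreover have "arrow_comp f (arrow_comp g v) = v"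
      using systems.comp_assoc[OF v g f] assms(4) systems.ident_comp[OF v] by simp
    ultimately show "\<exists>h\<in>Hom (systems b) (target i) X. arrow_comp h i = u \<and> arrow_comp f h = v"
      using arrow_comp_Hom[OF v g] by blast
  qed
qed

lemma weak_equivalence_orthogonal:
  "f \<in> weak_equivalences b \<Longrightarrow> Z \<in> local_systems b \<Longrightarrow> systems.orthogonal b f Z"
  by (simp add: weak_equivalences_def systems.local_equivalences_def)

text \<open>Reflections lie in every localizer, so \<open>f\<close> may be replaced by a weak
  equivalence \<open>g\<close> between local systems. Such a map is an isomorphism, being orthogonal
  to its own source and target, and isomorphisms lift against everything.\<close>

lemma smallest_localizer_weak_equivalences:
  "smallest_localizer U (systems b) (cofibrations b) (weak_equivalences b)"
  unfolding smallest_localizer_def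
proof (intro conjI allI impI subsetI localizer_weak_equivalences)
  fix W f assume W: "localizer U (systems b) (cofibrations b) W" and f: "f \<in> weak_equivalences b"
  have "f \<in> Arr (systems b)"
    using f by (simp add: weak_equivalences_def systems.local_equivalences_def)
  then obtain X Y where fH: "f \<in> Hom (systems b) X Y"
    by (auto simp: Arr_systems)
  note X = Hom_D(1)[OF fH] and Y = Hom_D(2)[OF fH]
  note W_23 = two_out_of_threeD[OF localizer_two_out_of_three]
  obtain X' r where X': "X' \<in> local_systems b" and r: "r \<in> Hom (systems b) X X'"
    and rW: "\<And>W. localizer U (systems b) (cofibrations b) W \<Longrightarrow> r \<in> W"
    using reflection[OF X] by blast
  obtain Y' s where Y': "Y' \<in> local_systems b" and s: "s \<in> Hom (systems b) Y Y'"
    and sW: "\<And>W. localizer U (systems b) (cofibrations b) W \<Longrightarrow> s \<in> W"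
    using reflection[OF Y] by blast
  note we = localizer_weak_equivalences[of b]
  have sf: "arrow_comp s f \<in> Hom (systems b) X Y'"
    by (rule arrow_comp_Hom[OF fH s])
  obtain g where g: "g \<in> Hom (systems b) X' Y'" "arrow_comp g r = arrow_comp s f"
    using systems.orthogonalE[OF weak_equivalence_orthogonal[OF rW[OF we] Y'] r sf] by auto
  have "arrow_comp s f \<in> weak_equivalences b"
    by (rule W_23(1)[OF we fH s f sW[OF we]])
  then have g_we: "g \<in> weak_equivalences b"
    using W_23(2)[OF we r g(1) rW[OF we]] g(2) by simp
  note X'O = Hom_D(1)[OF g(1)] and Y'O = Hom_D(2)[OF g(1)]
  \<comment> \<open>Extending the identity of \<open>X'\<close> along \<open>g\<close> gives a left
    inverse.\<close>
  obtain h where h: "h \<in> Hom (systems b) Y' X'" "arrow_comp h g = arrow_ident X'"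
    using systems.orthogonalE[OF weak_equivalence_orthogonal[OF g_we X'] g(1) arrow_ident_Hom[OF
        X'O]] by auto
  \<comment> \<open>Both \<open>g h\<close> and the identity of \<open>Y'\<close> extend
    \<open>g\<close> along itself, so they agree.\<close>
  have "arrow_comp (arrow_comp g h) g = arrow_comp (arrow_ident Y') g"
    using systems.comp_assoc[OF g(1) h(1) g(1)] h(2) systems.comp_ident[OF g(1)]
        systems.ident_comp[OF g(1)] by simp
  then have gh: "arrow_comp g h = arrow_ident Y'"
    using systems.orthogonal_unique[OF weak_equivalence_orthogonal[OF g_we Y'] g(1)
        arrow_comp_Hom[OF h(1) g(1)]
        arrow_ident_Hom[OF Y'O]] by simp
  have "g \<in> W"
    using iso_localizer[OF g(1) h(1,2) gh] W unfolding localizer_def by blast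
  then have "arrow_comp s f \<in> W"
    using W_23(1)[OF W r g(1) rW[OF W]] g(2) by simp
  then show "f \<in> W"
    by (rule W_23(3)[OF W fH s sW[OF W]])
qed

section \<open>The model structures\<close>

definition core_if :: "bool \<Rightarrow> ('u, 'u, 'l) hdts \<Rightarrow> ('u, 'u, 'l) hdts" where
  "core_if b X = (if b then X else core_hdts X)"

lemma core_if:
  assumes "X \<in> Obj (systems True)"
  shows "core_if b X \<in> Obj (systems b)" "premap (core_if b X) X (\<lambda>\<alpha>. \<alpha>) (\<lambda>u. u)"
    "states (core_if b X) = states X"
    "Y \<in> Obj (systems b) \<Longrightarrow> premap Y X f0 f1 \<Longrightarrow> premap Y (core_if b X) f0 f1"
proof -
  show "core_if b X \<in> Obj (systems b)"
    using assms core_hdts_Obj(1) by (simp add: core_if_def)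
  show "premap (core_if b X) X (\<lambda>\<alpha>. \<alpha>) (\<lambda>u. u)"
    using premap_counit[OF assms] by (simp add: core_if_def premap_def)
  show "states (core_if b X) = states X"
    by (simp add: core_if_def)
  show "premap Y (core_if b X) f0 f1" if "Y \<in> Obj (systems b)" "premap Y X f0 f1"
    using that premap_core_hdts by (auto simp: core_if_def Obj_systems)
qed

text \<open>A map from \<open>Z\<close> to a local system is forced on states by its restriction to \<open>X\<close>, and on actions
  because its values are related to those of the extension along the reflection.\<close>

lemma intermediate_weak_equivalence:
  assumes i: "i \<in> Hom (systems b) X Z" and p: "p \<in> Hom (systems b) Z X'"
    and r: "arrow_comp p i \<in> weak_equivalences b"
    and st: "on_states i ` states X = states Z"
  shows "i \<in> weak_equivalences b"
  unfolding weak_equivalences_def systems.local_equivalences_def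
proof (intro CollectI conjI ballI systems.Hom_Arr[OF i])
  fix V assume V: "V \<in> local_systems b"
  then have VO: "V \<in> Obj (systems b)" and disc: "\<And>u v. rel b V u v \<Longrightarrow> u = v"
    by (auto simp: local_systems_def)
  note Di = Hom_D[OF i] and Dp = Hom_D[OF p]
  note o = weak_equivalence_orthogonal[OF r V] and pi = arrow_comp_Hom[OF i p]
  show "systems.orthogonal b i V"
  proof (rule systems.orthogonalI[OF i], unfold systems_simps)
    fix k assume "k \<in> Hom (systems b) X V"
    then obtain g where g: "g \<in> Hom (systems b) X' V" "arrow_comp g (arrow_comp p i) = k"
      using systems.orthogonalE[OF o pi] by auto
    then show "\<exists>h\<in>Hom (systems b) Z V. arrow_comp h i = k"
      using arrow_comp_Hom[OF p g(1)] systems.comp_assoc[OF i p g(1)] by auto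
  next
    fix h h' assume hh: "h \<in> Hom (systems b) Z V" "h' \<in> Hom (systems b) Z V" "arrow_comp h i =
        arrow_comp h' i"
    obtain g where g: "g \<in> Hom (systems b) X' V" "arrow_comp g (arrow_comp p i) = arrow_comp h i"
      using systems.orthogonalE[OF o pi arrow_comp_Hom[OF i hh(1)]] by auto
    \<comment> \<open>Every extension is compared with the one that factors through
      \<open>p\<close>; surjectivity of \<open>i\<close> on states settles the states.\<close>
    have eq: "l = arrow_comp g p" if l: "l \<in> Hom (systems b) Z V" and li: "arrow_comp l i =
        arrow_comp h i" for l
    proof (rule arrow_eqI[OF l arrow_comp_Hom[OF p g(1)]])
      note Dl = Hom_D[OF l] and Dg = Hom_D[OF g(1)]
      have s: "on_states l \<alpha> = on_states g (on_states p \<alpha>)" if "\<alpha> \<in> states Z" for \<alpha>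
      proof -
        obtain \<gamma> where "\<gamma> \<in> states X" "\<alpha> = on_states i \<gamma>"
          using st \<open>\<alpha> \<in> states Z\<close> by blast
        then show ?thesis
          using arg_cong[OF g(2)[folded li], of "\<lambda>f. on_states f \<gamma>"] Di(3) by simp
      qed
      then show "on_states l \<alpha> = on_states (arrow_comp g p) \<alpha>" if "\<alpha> \<in> states Z" for \<alpha>
        using that Dp(3) by simp
      fix u assume u: "u \<in> actions Z"
      \<comment> \<open>A 1-transition of \<open>u\<close> is sent by both maps to 1-transitions
        between the same states, as the maps agree on states.\<close>
      have "b \<or> (\<exists>\<alpha> \<beta>. (\<alpha>, [on_actions l u], \<beta>) \<in> transitions V \<and>
          (\<alpha>, [on_actions g (on_actions p u)], \<beta>) \<in> transitions V)"
      proof (cases b)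
        case False
        then obtain \<alpha> \<beta> where t: "(\<alpha>, [u], \<beta>) \<in> transitions Z"
          using regular_singleton[of Z u] u Dp(1) by (auto simp: Obj_systems)
        show ?thesis
          using premapD(4)[OF Dl(5) t] premapD(4)[OF Dg(5) premapD(4)[OF Dp(5) t]]
            s transition_typed(1,2)[OF Dp(6) t] by auto
      qed simp
      then have "rel b V (on_actions l u) (on_actions g (on_actions p u))"
        using premapD(2,3)[OF Dl(5) u] premapD(2,3)[OF Dp(5) u] premapD(2,3)[OF Dg(5)] by (simp
            add: rel_def)
      then show "on_actions l u = on_actions (arrow_comp g p) u"
        using disc u Dp(3) by simp
    qed
    show "h = h'"
      using eq[OF hh(1)] eq[OF hh(2)] hh(3) by simp
  qed
qed

text \<open>To lift a square from \<open>j\<close> to the second factor, first extend to a map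
  \<open>t\<close> into the local system \<open>X'\<close>, which orthogonality provides. As
  \<open>X'\<close> and the middle object have the same states, \<open>t\<close> dictates the lift
  on states. On actions the lift has to have prescribed values in \<open>X'\<close> and in
  \<open>Y\<close>, and the middle object contains an action for every admissible pair of
  values.\<close>

lemma has_factorizations_weak:
  "has_factorizations (systems b) (cofibrations b \<inter> weak_equivalences b)
     (inj_class (systems b) (cofibrations b \<inter> weak_equivalences b))"
  unfolding has_factorizations_def systems_simps
proof
  fix f assume "f \<in> Arr (systems b)"
  then have fA: "f \<in> Hom (systems b) (source f) (target f)"
    by (simp add: Arr_systems)
  define X Y where "X = source f" and "Y = target f"
  have f: "f \<in> Hom (systems b) X Y"
    using fA by (simp add: X_def Y_def)
  note D = Hom_D[OF f]
  note we = localizer_weak_equivalences[of b]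
  obtain X' r where X': "X' \<in> local_systems b" and r: "r \<in> Hom (systems b) X X'"
    and stX': "states X' = states X" and r0: "\<And>\<alpha>. \<alpha> \<in> states X \<Longrightarrow> on_states r \<alpha> = \<alpha>" and rW: "r \<in>
        weak_equivalences b"
    using reflection[OF D(1)] we by blast
  obtain Y' s where Y': "Y' \<in> local_systems b" and s: "s \<in> Hom (systems b) Y Y'"
    and s0: "\<And>\<alpha>. \<alpha> \<in> states Y \<Longrightarrow> on_states s \<alpha> = \<alpha>"
    using reflection[OF D(2)] by blast
  note Dr = Hom_D[OF r]
  obtain f' where f': "f' \<in> Hom (systems b) X' Y'" "arrow_comp f' r = arrow_comp s f"
    using systems.orthogonalE[OF weak_equivalence_orthogonal[OF rW Y'] r arrow_comp_Hom[OF f s]] by auto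
  have sub: "states X \<subseteq> U" "actions X \<subseteq> U" and small: "small (states X)" "small (actions X)"
      "small (actions X')" "small (actions Y)"
    using D(1,2) Dr(2) by (auto simp: Obj_systems)
  \<comment> \<open>All pairs of values with a common label: off the image of a cofibration a lift
    can then be prescribed freely. The code \<open>c\<close> keeps the pairs apart from
    \<open>actions X\<close>.\<close>
  let ?C = "{(w, v). w \<in> actions X' \<and> v \<in> actions Y \<and> label X' w = label Y v}"
  have smallC: "small ?C"
    by (rule small_subset[OF small_Times[OF small(3,4)]]) auto
  obtain c :: "'u \<times> 'u \<Rightarrow> 'u" where c: "inj_on c ?C" "c ` ?C \<subseteq> U" "c ` ?C \<inter> actions X = {}" "small
      (c ` ?C)"
    using fresh_copy[OF smallC small(2)] .
  define L where "L = actions X \<union> c ` ?C"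
  define p where "p u = (if u \<in> actions X then on_actions r u else fst (inv_into ?C c u))" for u
  define q where "q u = (if u \<in> actions X then on_actions f u else snd (inv_into ?C c u))" for u
  have pqX: "p u = on_actions r u" "q u = on_actions f u" if "u \<in> actions X" for u
    using that by (simp_all add: p_def q_def)
  have pqC: "p (c (w, v)) = w" "q (c (w, v)) = v" "c (w, v) \<in> L"
    if "w \<in> actions X'" "v \<in> actions Y" "label X' w = label Y v" for w v
  proof -
    have m: "(w, v) \<in> ?C"
      using that by simp
    then have "c (w, v) \<notin> actions X"
      using c(3) by blast
    moreover have "inv_into ?C c (c (w, v)) = (w, v)"
      by (rule inv_into_f_f[OF c(1) m])
    ultimately show "p (c (w, v)) = w" "q (c (w, v)) = v"
      by (simp_all add: p_def q_def)
    show "c (w, v) \<in> L"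
      using m by (auto simp: L_def)
  qed
  have L_cases: "u \<in> actions X \<or> (\<exists>w v. u = c (w, v) \<and> w \<in> actions X' \<and> v \<in> actions Y \<and> label X' w
      = label Y v)"
    if "u \<in> L" for u
    using that by (auto simp: L_def)
  have pq: "p u \<in> actions X'" "q u \<in> actions Y" "label X' (p u) = label Y (q u)" if "u \<in> L" for u
    using L_cases[OF that] pqX pqC premapD(2,3)[OF Dr(5)] premapD(2,3)[OF D(5)] by auto
  define T where "T = tmap (\<lambda>\<alpha>. \<alpha>) p -` transitions X' \<inter> (tmap (on_states f) q -` transitions Y \<inter>
      well_typed (states X) L)"
  define Z0 where "Z0 = \<lparr>states = states X, actions = L, label = (\<lambda>u\<in>L. label Y (q u)), transitions = T\<rparr>"
  have T_iff: "(\<alpha>, us, \<beta>) \<in> transitions Z0 \<longleftrightarrow> (\<alpha>, map p us, \<beta>) \<in> transitions X' \<and>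
      (on_states f \<alpha>, map q us, on_states f \<beta>) \<in> transitions Y \<and> set us \<subseteq> L" for \<alpha> us \<beta>
    using transition_typed[OF Dr(7), of \<alpha> "map p us" \<beta>] stX' by (auto simp: Z0_def T_def well_typed_def)
  have "weak_hdts \<Sigma> Z0"
    unfolding weak_hdts_iff
  proof (intro conjI)
    show "label Z0 \<in> actions Z0 \<rightarrow>\<^sub>E \<Sigma>"
      using pq(2) label_in[OF D(7)] by (auto simp: Z0_def)
  qed (use D(7) Dr(7) in \<open>auto simp: Z0_def T_def weak_hdts_iff intro!: mset_closed_Int coherent_Int
      mset_closed_vimage coherent_vimage well_typed_closed\<close>)
  then have Z0: "Z0 \<in> Obj (systems True)"
    using sub small c by (auto simp: Obj_systems Z0_def regular_def L_def intro: small_Un)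
  \<comment> \<open>In the cubical case \<open>Z0\<close> need not be cubical and is replaced by its
    coreflection, which has the same states and receives the same maps from cubical systems.\<close>
  define Z where "Z = core_if b Z0"
  note Z = core_if(1)[OF Z0, of b, folded Z_def] and Zp = core_if(2)[OF Z0, of b, folded Z_def]
    and Zs = core_if(3)[OF Z0, of b, folded Z_def] and Zu = core_if(4)[OF Z0, of _ b, folded Z_def]
  have stZ: "states Z = states X"
    by (simp add: Zs Z0_def)
  have "premap X Z0 (\<lambda>\<alpha>. \<alpha>) (\<lambda>u. u)"
  proof (rule premapI)
    fix \<alpha> us \<beta> assume t: "(\<alpha>, us, \<beta>) \<in> transitions X"
    note tt = transition_typed[OF D(6) t]
    have eq: "map p us = map (on_actions r) us" "map q us = map (on_actions f) us"
      using tt(4) pqX by auto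
    show "(\<alpha>, map (\<lambda>u. u) us, \<beta>) \<in> transitions Z0"
      using premapD(4)[OF D(5) t] premapD(4)[OF Dr(5) t] tt r0 by (auto simp: T_iff eq L_def)
  qed (use pqX premapD(3)[OF D(5)] in \<open>auto simp: Z0_def L_def\<close>)
  note i = arrow_of_Hom[OF D(1) Z Zu[OF D(1) this]]
  let ?i = "inclusion X Z"
  have "premap Z0 X' (\<lambda>\<alpha>. \<alpha>) p"
    by (rule premapI) (use pq stX' in \<open>auto simp: T_iff\<close>, auto simp: Z0_def pq)
  then have "premap Z X' (\<lambda>\<alpha>. \<alpha>) p"
    using premap_comp[OF Zp] by (simp add: comp_def)
  note pH = arrow_of_Hom[OF Z Dr(2) this]
  let ?p = "arrow_of Z X' (\<lambda>\<alpha>. \<alpha>) p"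
  have "premap Z0 Y (on_states f) q"
    by (rule premapI) (use pq premapD(1)[OF D(5)] in \<open>auto simp: T_iff\<close>, auto simp: Z0_def pq)
  then have "premap Z Y (on_states f) q"
    using premap_comp[OF Zp] by (simp add: comp_def)
  note qH = arrow_of_Hom[OF Z D(2) this]
  let ?q = "arrow_of Z Y (on_states f) q"
  have iZ: "u \<in> actions Z" if "u \<in> actions X" for u
    using premapD(2)[OF Hom_D(5)[OF i] that] that by simp
  have pi: "arrow_comp ?p ?i = r"
    by (rule arrow_eqI[OF arrow_comp_Hom[OF i pH] r]) (use r0 pqX iZ stZ in simp_all)
  have qi: "arrow_comp ?q ?i = f"
    by (rule arrow_eqI[OF arrow_comp_Hom[OF i qH] f]) (use pqX iZ stZ in simp_all)
  have i_we: "?i \<in> weak_equivalences b"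
    by (rule intermediate_weak_equivalence[OF i pH]) (use pi rW stZ in \<open>auto simp: arrow_of_def\<close>)
  have i_cof: "?i \<in> cofibrations b"
    by (rule inclusion_cofibration[OF i])
  \<comment> \<open>The two composites agree on \<open>X\<close>, and orthogonality of the inclusion
    to \<open>Y'\<close> extends the agreement to \<open>Z\<close>.\<close>
  have sq_Z: "arrow_comp f' ?p = arrow_comp s ?q"
  proof (rule systems.orthogonal_unique[OF weak_equivalence_orthogonal[OF i_we Y'] i
        arrow_comp_Hom[OF pH f'(1)] arrow_comp_Hom[OF qH s]])
    show "Comp (systems b) (arrow_comp f' ?p) ?i = Comp (systems b) (arrow_comp s ?q) ?i"
      using systems.comp_assoc[OF i pH f'(1)] systems.comp_assoc[OF i qH s] pi qi f'(2) by simp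
  qed
  have "?q \<in> inj_class (systems b) (cofibrations b \<inter> weak_equivalences b)"
    unfolding inj_class_def
  proof (intro CollectI conjI ballI systems.Hom_Arr[OF qH])
    fix j assume j: "j \<in> cofibrations b \<inter> weak_equivalences b"
    define A B where "A = source j" and "B = target j"
    have jH: "j \<in> Hom (systems b) A B" and inj: "inj_on (on_actions j) (actions A)"
      using cofibrationD j by (auto simp: A_def B_def)
    note Dj = Hom_D[OF jH]
    have j_we: "j \<in> weak_equivalences b"
      using j by blast
    show "has_lifting (systems b) j ?q"
    proof (rule systems.has_liftingI[OF jH qH], unfold systems_simps)
      fix u v assume u: "u \<in> Hom (systems b) A Z" and v: "v \<in> Hom (systems b) B Y"
        and sq: "arrow_comp ?q u = arrow_comp v j"
      note Du = Hom_D[OF u] and Dv = Hom_D[OF v]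
      obtain t where t: "t \<in> Hom (systems b) B X'" "arrow_comp t j = arrow_comp ?p u"
        using systems.orthogonalE[OF weak_equivalence_orthogonal[OF j_we X'] jH arrow_comp_Hom[OF
            u pH]] by auto
      note Dt = Hom_D[OF t(1)]
      \<comment> \<open>Nothing in the choice of \<open>t\<close> mentions \<open>v\<close>; the two
        are compatible because both sides extend the same map along the weak equivalence
        \<open>j\<close> into a local system.\<close>
      have eq: "arrow_comp f' t = arrow_comp s v"
      proof (rule systems.orthogonal_unique[OF weak_equivalence_orthogonal[OF j_we Y'] jH
            arrow_comp_Hom[OF t(1) f'(1)] arrow_comp_Hom[OF v s]])
        show "Comp (systems b) (arrow_comp f' t) j = Comp (systems b) (arrow_comp s v) j"
          using systems.comp_assoc[OF jH t(1) f'(1)] systems.comp_assoc[OF jH v s]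
            systems.comp_assoc[OF u pH f'(1)] systems.comp_assoc[OF u qH s] t(2) sq sq_Z by simp
      qed
      have f'0: "on_states f' \<alpha> = on_states f \<alpha>" if "\<alpha> \<in> states X" for \<alpha>
        using arg_cong[OF f'(2), of "\<lambda>g. on_states g \<alpha>"] that r0[OF that] Dr(3) D(3) s0
            premapD(1)[OF D(5) that] by simp
      \<comment> \<open>Reflections fix states, so the equation of maps to \<open>Y'\<close> becomes
        one between states of \<open>Y\<close>.\<close>
      have v0: "on_states f (on_states t \<beta>) = on_states v \<beta>" if "\<beta> \<in> states B" for \<beta>
        using arg_cong[OF eq, of "\<lambda>g. on_states g \<beta>"] that Dt(3) Dv(3) s0 premapD(1)[OF Dv(5) that]
          f'0 premapD(1)[OF Dt(5) that] stX' by simp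
      have uZ0: "on_actions u x \<in> L" "on_actions u x \<in> actions Z" if "x \<in> actions A" for x
        using premapD(2)[OF Zp premapD(2)[OF Du(5) that]] premapD(2)[OF Du(5) that] by (auto simp:
            Z0_def)
      have tj1: "on_actions t (on_actions j x) = p (on_actions u x)" if "x \<in> actions A" for x
        using arg_cong[OF t(2), of "\<lambda>g. on_actions g x"] that Dj(3) Du(3) uZ0 by simp
      have tj0: "on_states t (on_states j \<alpha>) = on_states u \<alpha>" if "\<alpha> \<in> states A" for \<alpha>
        using arg_cong[OF t(2), of "\<lambda>g. on_states g \<alpha>"] that Dj(3) Du(3) premapD(1)[OF Du(5) that]
            by simp
      have vj1: "on_actions v (on_actions j x) = q (on_actions u x)" if "x \<in> actions A" for x
        using arg_cong[OF sq, of "\<lambda>g. on_actions g x"] that Dj(3) Du(3) uZ0 by simp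
      \<comment> \<open>On the image of \<open>j\<close> the value comes from \<open>u\<close>; on
        any other action it is the adjoined action with components \<open>t\<close> and
        \<open>v\<close>.\<close>
      define h1 where "h1 y = (if y \<in> on_actions j ` actions A
        then on_actions u (inv_into (actions A) (on_actions j) y)
        else c (on_actions t y, on_actions v y))" for y
      have h1j: "h1 (on_actions j x) = on_actions u x" if "x \<in> actions A" for x
        using that inj by (simp add: h1_def)
      have h1: "h1 y \<in> L \<and> p (h1 y) = on_actions t y \<and> q (h1 y) = on_actions v y" if y: "y \<in>
          actions B" for y
      proof (cases "y \<in> on_actions j ` actions A")
        case True
        then show ?thesis
          using h1j uZ0 tj1 vj1 by auto
      next
        case False
        then show ?thesis
          using pqC[of "on_actions t y" "on_actions v y"] premapD(2,3)[OF Dt(5) y] premapD(2,3)[OF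
              Dv(5) y]
          by (simp add: h1_def)
      qed
      have "premap B Z0 (on_states t) h1"
      proof (rule premapI)
        show "on_states t \<beta> \<in> states Z0" if "\<beta> \<in> states B" for \<beta>
          using premapD(1)[OF Dt(5) that] stX' by (simp add: Z0_def)
        show "h1 y \<in> actions Z0" "label Z0 (h1 y) = label B y" if "y \<in> actions B" for y
          using h1[OF that] premapD(3)[OF Dv(5) that] by (auto simp: Z0_def)
        fix \<alpha> us \<beta> assume tr: "(\<alpha>, us, \<beta>) \<in> transitions B"
        note tt = transition_typed[OF Dv(6) tr]
        have m: "map p (map h1 us) = map (on_actions t) us" "map q (map h1 us) = map (on_actions v) us"
          using tt(4) h1 by auto
        have "set (map h1 us) \<subseteq> L"
          using tt(4) h1 by auto
        then show "(on_states t \<alpha>, map h1 us, on_states t \<beta>) \<in> transitions Z0"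
          unfolding T_iff m using premapD(4)[OF Dt(5) tr] premapD(4)[OF Dv(5) tr] v0 tt(1,2) by simp
      qed
      note h = arrow_of_Hom[OF Dv(1) Z Zu[OF Dv(1) this]]
      let ?h = "arrow_of B Z (on_states t) h1"
      have "arrow_comp ?h j = u"
        by (rule arrow_eqI[OF arrow_comp_Hom[OF jH h] u])
          (use Dj(3) premapD(1,2)[OF Dj(5)] tj0 h1j in simp_all)
      moreover have "arrow_comp ?q ?h = v"
      proof (rule arrow_eqI[OF arrow_comp_Hom[OF h qH] v])
        show "on_states (arrow_comp ?q ?h) \<beta> = on_states v \<beta>" if "\<beta> \<in> states B" for \<beta>
          using that v0 premapD(1)[OF Hom_D(5)[OF h] that] by simp
        show "on_actions (arrow_comp ?q ?h) y = on_actions v y" if "y \<in> actions B" for y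
          using that h1 premapD(2)[OF Hom_D(5)[OF h] that] by simp
      qed
      ultimately show "\<exists>h\<in>Hom (systems b) B Z. arrow_comp h j = u \<and> arrow_comp ?q h = v"
        using h by blast
    qed
  qed
  then show "\<exists>i\<in>cofibrations b \<inter> weak_equivalences b.
      \<exists>p\<in>inj_class (systems b) (cofibrations b \<inter> weak_equivalences b).
        source i = source f \<and> target i = source p \<and> target p = target f \<and> f = arrow_comp p i"
    using i_we i_cof qi by (intro bexI[of _ ?i] bexI[of _ ?q]) (auto simp: X_def Y_def)
qed

lemma left_determined_systems:
  "left_determined_model_structure U (systems b) (cofibrations b) (weak_equivalences b)
     (inj_class (systems b) (cofibrations b \<inter> weak_equivalences b))"
  unfolding left_determined_model_structure_def
proof (intro conjI smallest_localizer_weak_equivalences systems.model_structureI)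
  note we = localizer_weak_equivalences[of b, unfolded localizer_def]
  show "weak_equivalences b \<subseteq> Arr (systems b)" "two_out_of_three (systems b) (weak_equivalences b)"
    "inj_class (systems b) (cofibrations b) \<subseteq> weak_equivalences b"
    using we by blast+
  show "closed_under_retracts (systems b) (weak_equivalences b)"
    unfolding weak_equivalences_def by (rule systems.closed_under_retracts_local_equivalences)
  show "has_factorizations (systems b) (cofibrations b) (inj_class (systems b) (cofibrations b))"
    using has_factorizations_trivial[of b] trivial_maps_lifting[of b] unfolding
        has_factorizations_def by blast
qed (rule has_small_limits_systems has_small_colimits_systems cofibrations_Arr
    closed_under_retracts_cofibrations has_factorizations_weak)+

section \<open>Comparison of the two structures and cofibrancy\<close>

lemma weak_equivalences_False_True: "weak_equivalences False \<subseteq> weak_equivalences True"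
proof
  fix f assume f: "f \<in> weak_equivalences False"
  then have fA: "f \<in> Arr (systems False)"
    by (simp add: weak_equivalences_def systems.local_equivalences_def)
  then have fH: "f \<in> Hom (systems False) (source f) (target f)"
    by (simp add: Arr_systems)
  note fT = Hom_systems_mono[OF fH]
  interpret coreflection "systems True" "regular False" core_hdts counit
    by (rule coreflection_systems)
  have "systems.orthogonal True f Z" if Z: "Z \<in> local_systems True" for Z
  proof (rule orthogonal_coreflection[OF fT])
    have ZO: "Z \<in> Obj (systems True)" and disc: "\<And>u v. rel True Z u v \<Longrightarrow> u = v"
      using Z by (auto simp: local_systems_def)
    show "Z \<in> Obj (systems True)"
      by (rule ZO)
    show "regular False (source f)" "regular False (target f)"
      using Hom_D(1,2)[OF fH] by (auto simp: Obj_systems)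
    \<comment> \<open>In a local weak system equal labels already force equality, so the finer
      cubical relation on the core is trivial as well.\<close>
    have "u = v" if "rel False (core_hdts Z) u v" for u v
      using disc rel_premap[OF premap_counit[OF ZO] that] by (auto simp: rel_def)
    then have "core_hdts Z \<in> local_systems False"
      using core_hdts_Obj(1)[OF ZO] by (auto simp: local_systems_def)
    then show "cat.orthogonal (full_subcategory (systems True) (regular False)) f (core_hdts Z)"
      using weak_equivalence_orthogonal[OF f] by (simp add: systems_False[symmetric])
  qed
  then show "f \<in> weak_equivalences True"
    using systems.Hom_Arr[OF fT] by (auto simp: weak_equivalences_def systems.local_equivalences_def)
qed

text \<open>The empty system is initial, and a map out of it is vacuously injective on
  actions.\<close>

lemma cofibrant_systems:
  assumes X: "X \<in> Obj (systems b)"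
  shows "cofibrant (systems b) (cofibrations b) X"
proof -
  define I :: "('u, 'u, 'l) hdts" where
    "I = \<lparr>states = {}, actions = {}, label = (\<lambda>_\<in>{}. undefined), transitions = {}\<rparr>"
  have I: "I \<in> Obj (systems b)"
    by (auto simp: Obj_systems I_def weak_hdts_iff regular_def all_used_def splitting_def
        mset_closed_def coherent_def intro: small_finite)
  have H: "arrow_of I Y id id \<in> Hom (systems b) I Y" if "Y \<in> Obj (systems b)" for Y
    by (rule arrow_of_Hom[OF I that]) (simp add: premap_def I_def)
  have un: "f = arrow_of I Y id id" if "f \<in> Hom (systems b) I Y" for f Y
    by (rule arrow_eqI[OF that H[OF Hom_D(2)[OF that]]]) (simp_all add: I_def)
  have "is_initial (systems b) I"
    unfolding is_initial_def using I H un by blast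
  moreover have "arrow_of I X id id \<in> cofibrations b"
    by (rule cofibrationI[OF H[OF X]]) (simp add: I_def)
  ultimately show ?thesis
    unfolding cofibrant_def using H[OF X] by blast
qed

end

theorem corollary6p8:
  fixes U :: "'u set" and \<Sigma> :: "'l set"
  assumes "inaccessible U" and "\<Sigma> \<noteq> {}" and "\<Sigma> \<prec> U"
  shows "\<exists>We Fib We' Fib'.
    left_determined_model_structure U (CTS U \<Sigma>) (CTS_cof U \<Sigma>) We Fib \<and>
    left_determined_model_structure U (WHDTS U \<Sigma>) (WHDTS_cof U \<Sigma>) We' Fib' \<and>
    (\<exists>R \<phi>. quillen_adjunction (CTS U \<Sigma>) (CTS_cof U \<Sigma>) We
                              (WHDTS U \<Sigma>) (WHDTS_cof U \<Sigma>) We' inclusion_functor R \<phi>) \<and>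
    (\<forall>X\<in>Obj (CTS U \<Sigma>). cofibrant (CTS U \<Sigma>) (CTS_cof U \<Sigma>) X)"
proof -
  interpret hdts_universe U \<Sigma>
    using assms by unfold_locales
  interpret C: coreflection "systems True" "regular False" core_hdts counit
    by (rule coreflection_systems)
  have cof: "cofibrations False \<subseteq> cofibrations True"
    unfolding cofibrations_CTS[symmetric] cofibrations_WHDTS[symmetric] by (simp add: CTS_cof_def)
  have "quillen_adjunction (systems False) (cofibrations False) (weak_equivalences False)
      (systems True) (cofibrations True) (weak_equivalences True) inclusion_functor C.coreflector
          (\<lambda>X Y. C.adjunct)"
    unfolding quillen_adjunction_def
  proof (intro conjI)
    show "is_adjunction (systems False) (systems True) inclusion_functor C.coreflector (\<lambda>X Y. C.adjunct)"
      using C.is_adjunction_coreflector by (simp add: systems_False[symmetric])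
  qed (use cof weak_equivalences_False_True in \<open>auto simp: inclusion_functor_def\<close>)
  then show ?thesis
    unfolding CTS_eq cofibrations_CTS cofibrations_WHDTS systems_True[symmetric]
    using left_determined_systems cofibrant_systems by blast
qed

end
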